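(* Let $f:M^m\to Q_c^{m+1}$ be a complete noncompact (isometrically immersed) hypersurface in a space form $Q_c^{m+1}$ with $c\le0$. Let $A$ be the shape operator of $f$. Assume that, for some $1\le j\le m-1$, $$S_{j+1}=0\text{ on } M\quad\text{and}\quad S_j\text{ does not change sign on } M,$$ where $S_i=S_i(A)$. Then, for every $q\in M$, either $\operatorname{rk}(A(q))\le j-1$ or the rate of growth of $\int_M|S_j|$ is at least linear with respect to the geodesic balls $B_\mu(q)$ of $M$ centered at $q$, that is, $$\liminf_{\mu\to\infty}\frac1\mu\int_{B_\mu(q)}|S_j|>0.$$
   Context: $Q_c^{m+1}$ denotes the complete simply-connected Riemannian manifold of dimension $m+1$ and constant sectional curvature $c$. $M$ is connected and complete in the induced metric; the shape operator $A:TM\to TM$ is taken with respect to a globally defined unit normal field. $S_i(A)=\sum_{k_1<\dots<k_i}\lambda_{k_1}\cdots\lambda_{k_i}$ is the $i$-th elementary symmetric polynomial of the eigenvalues $\lambda_1,\dots,\lambda_m$ of $A$ (the principal curvatures). $\operatorname{rk}$ denotes rank. Integrals are with respect to the Riemannian measure of $M$. *)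

theory Defs
  imports "HOL-Analysis.Analysis"
begin

section \<open>Smooth maps and smooth manifolds\<close>

fun Ck_on :: "nat \<Rightarrow> 'a::euclidean_space set \<Rightarrow> ('a \<Rightarrow> 'b::real_normed_vector) \<Rightarrow> bool" where
  "Ck_on 0 U h \<longleftrightarrow> continuous_on U h"
| "Ck_on (Suc k) U h \<longleftrightarrow>
     (\<forall>u\<in>U. h differentiable at u) \<and> (\<forall>v. Ck_on k U (\<lambda>u. frechet_derivative h (at u) v))"

definition smooth_on :: "'a::euclidean_space set \<Rightarrow> ('a \<Rightarrow> 'b::real_normed_vector) \<Rightarrow> bool" where
  "smooth_on U h \<longleftrightarrow> (\<forall>k. Ck_on k U h)"

text \<open>The manifold is the whole type \<open>'p\<close>. A chart is given by its local parametrization: a pair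
  \<open>(V, x)\<close> where \<open>x\<close> maps the open set \<open>V\<close> homeomorphically onto an open set of \<open>'p\<close>. The values of
  \<open>x\<close> outside \<open>V\<close> are irrelevant.\<close>

type_synonym ('m, 'p) param = "(real^'m) set \<times> (real^'m \<Rightarrow> 'p)"

definition smooth_atlas :: "('m::finite, 'p::topological_space) param set \<Rightarrow> bool" where
  "smooth_atlas \<A> \<longleftrightarrow>
     (\<forall>(V, x)\<in>\<A>. open V \<and> open (x ` V) \<and> homeomorphism V (x ` V) x (inv_into V x)) \<and>
     (\<Union>(V, x)\<in>\<A>. x ` V) = UNIV \<and>
     (\<forall>(V, x)\<in>\<A>. \<forall>(W, y)\<in>\<A>. smooth_on (V \<inter> x -` (y ` W)) (inv_into W y \<circ> x))"

definition chart_at :: "('m::finite, 'p) param set \<Rightarrow> 'p \<Rightarrow> ('m, 'p) param" where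
  "chart_at \<A> p = (SOME (V, x). (V, x) \<in> \<A> \<and> p \<in> x ` V)"

text \<open>The tangent space at \<open>p\<close> is identified with \<open>real^'m\<close> by means of the chosen chart
  \<open>chart_at \<A> p\<close>; \<open>mdiff \<A> h p\<close> is the differential of \<open>h\<close> at \<open>p\<close> under this identification.
  Another choice of chart conjugates the endomorphisms of the tangent space by a linear
  isomorphism, so their rank and eigenvalues do not depend on it.\<close>

definition mdiff :: "('m::finite, 'p) param set \<Rightarrow> ('p \<Rightarrow> 'b::real_normed_vector) \<Rightarrow> 'p \<Rightarrow> real^'m \<Rightarrow> 'b"
  where "mdiff \<A> h p =
     (case chart_at \<A> p of (V, x) \<Rightarrow> frechet_derivative (h \<circ> x) (at (inv_into V x p)))"

section \<open>The space forms of nonpositive curvature\<close>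

text \<open>Standard models inside \<open>real^'n \<times> real\<close>, where \<open>CARD('n)\<close> is the dimension of the space form.
  For \<open>c = 0\<close> it is the Euclidean space \<open>real^'n \<times> {0}\<close>; for \<open>c < 0\<close> it is the upper sheet of the
  hyperboloid \<open>lorentz y y = 1 / c\<close>. In both cases the Riemannian metric is the restriction of
  \<open>lorentz\<close> to the tangent spaces.\<close>

definition lorentz :: "(real^'n) \<times> real \<Rightarrow> (real^'n::finite) \<times> real \<Rightarrow> real" where
  "lorentz y z = fst y \<bullet> fst z - snd y * snd z"

definition space_form :: "real \<Rightarrow> ((real^'n::finite) \<times> real) set" where
  "space_form c =
     (if c = 0 then {y. snd y = 0} else {y. lorentz y y = 1 / c \<and> snd y > 0})"

definition space_form_tangent ::
    "real \<Rightarrow> (real^'n) \<times> real \<Rightarrow> ((real^'n::finite) \<times> real) set" where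
  "space_form_tangent c y = (if c = 0 then {w. snd w = 0} else {w. lorentz w y = 0})"

text \<open>Levi-Civita covariant derivative in the space form of a tangent field \<open>\<xi>\<close> along \<open>f\<close>: the
  tangential part of the flat derivative of \<open>\<xi>\<close>. For \<open>c < 0\<close> the normal line of the hyperboloid at
  \<open>y\<close> is spanned by \<open>y\<close>, and \<open>lorentz y y = 1 / c\<close>, so the projection is
  \<open>w \<mapsto> w - c * lorentz w y *\<^sub>R y\<close>; for \<open>c = 0\<close> the correction vanishes.\<close>

definition space_form_covd ::
    "real \<Rightarrow> ('m::finite, 'p) param set \<Rightarrow> ('p \<Rightarrow> (real^'n::finite) \<times> real) \<Rightarrow>
     ('p \<Rightarrow> (real^'n) \<times> real) \<Rightarrow> 'p \<Rightarrow> real^'m \<Rightarrow> (real^'n) \<times> real" where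
  "space_form_covd c \<A> f \<xi> p v =
     mdiff \<A> \<xi> p v - (c * lorentz (mdiff \<A> \<xi> p v) (f p)) *\<^sub>R f p"

section \<open>Immersed hypersurfaces\<close>

text \<open>\<open>f\<close> is a smooth immersion into the space form and \<open>N\<close> a smooth global unit normal field
  along it. The manifold always carries the metric induced by \<open>f\<close>.\<close>

definition oriented_hypersurface ::
    "real \<Rightarrow> ('m::finite, 'p) param set \<Rightarrow> ('p \<Rightarrow> (real^'n::finite) \<times> real) \<Rightarrow>
     ('p \<Rightarrow> (real^'n) \<times> real) \<Rightarrow> bool" where
  "oriented_hypersurface c \<A> f N \<longleftrightarrow>
     CARD('n) = CARD('m) + 1 \<and>
     range f \<subseteq> space_form c \<and>
     (\<forall>(V, x)\<in>\<A>. smooth_on V (f \<circ> x) \<and> smooth_on V (N \<circ> x) \<and>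
        (\<forall>u\<in>V. inj (frechet_derivative (f \<circ> x) (at u)))) \<and>
     (\<forall>p. N p \<in> space_form_tangent c (f p) \<and> lorentz (N p) (N p) = 1 \<and>
        (\<forall>v. lorentz (N p) (mdiff \<A> f p v) = 0))"

definition shape_operator ::
    "real \<Rightarrow> ('m::finite, 'p) param set \<Rightarrow> ('p \<Rightarrow> (real^'n::finite) \<times> real) \<Rightarrow>
     ('p \<Rightarrow> (real^'n) \<times> real) \<Rightarrow> 'p \<Rightarrow> real^'m \<Rightarrow> real^'m" where
  "shape_operator c \<A> f N p v = (THE w. mdiff \<A> f p w = - space_form_covd c \<A> f N p v)"

text \<open>The eigenvalues listed with multiplicity: \<open>(l, k)\<close> is the \<open>k\<close>-th copy of the eigenvalue \<open>l\<close>.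
  Geometric multiplicities are meant, which for the (self-adjoint, hence diagonalizable) shape
  operator are the only ones.\<close>

definition eigenvalue_copies :: "(real^'m \<Rightarrow> real^'m::finite) \<Rightarrow> (real \<times> nat) set" where
  "eigenvalue_copies A = (SIGMA l:UNIV. {..<dim {v. A v = l *\<^sub>R v}})"

definition elem_sym :: "nat \<Rightarrow> (real^'m \<Rightarrow> real^'m::finite) \<Rightarrow> real" where
  "elem_sym i A = (\<Sum>K | K \<subseteq> eigenvalue_copies A \<and> card K = i. \<Prod>k\<in>K. fst k)"

section \<open>Riemannian distance and Riemannian measure of the induced metric\<close>

text \<open>The derivative of a curve may be unbounded near the finitely many exceptional parameters; the
  length, taken in \<open>ennreal\<close>, may then be infinite. This does not affect the infimum defining
  the distance.\<close>

definition piecewise_C1_curve :: "('m::finite, 'p::topological_space) param set \<Rightarrow> (real \<Rightarrow> 'p) \<Rightarrow> bool"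
  where "piecewise_C1_curve \<A> \<gamma> \<longleftrightarrow>
     continuous_on {0..1} \<gamma> \<and>
     (\<forall>(V, x)\<in>\<A>. \<forall>a b. 0 \<le> a \<and> a \<le> b \<and> b \<le> 1 \<and> \<gamma> ` {a..b} \<subseteq> x ` V \<longrightarrow>
        (inv_into V x \<circ> \<gamma>) piecewise_C1_differentiable_on {a..b})"

text \<open>In the induced metric the speed of \<open>\<gamma>\<close> is the speed of \<open>f \<circ> \<gamma>\<close> in the space form.\<close>

definition curve_length :: "('p \<Rightarrow> (real^'n::finite) \<times> real) \<Rightarrow> (real \<Rightarrow> 'p) \<Rightarrow> ennreal" where
  "curve_length f \<gamma> =
     (\<integral>\<^sup>+t\<in>{0..1}. ennreal (sqrt (lorentz (vector_derivative (f \<circ> \<gamma>) (at t))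
                                        (vector_derivative (f \<circ> \<gamma>) (at t)))) \<partial>lborel)"

definition riemannian_dist ::
    "('m::finite, 'p::topological_space) param set \<Rightarrow> ('p \<Rightarrow> (real^'n::finite) \<times> real) \<Rightarrow>
     'p \<Rightarrow> 'p \<Rightarrow> real" where
  "riemannian_dist \<A> f p q =
     enn2real (INF \<gamma>\<in>{\<gamma>. piecewise_C1_curve \<A> \<gamma> \<and> \<gamma> 0 = p \<and> \<gamma> 1 = q}. curve_length f \<gamma>)"

definition gram_matrix ::
    "('p \<Rightarrow> (real^'n::finite) \<times> real) \<Rightarrow> (real^'m::finite \<Rightarrow> 'p) \<Rightarrow> real^'m \<Rightarrow> real^'m^'m" where
  "gram_matrix f x u =
     (\<chi> i j. lorentz (frechet_derivative (f \<circ> x) (at u) (axis i 1))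
                    (frechet_derivative (f \<circ> x) (at u) (axis j 1)))"

text \<open>The Riemannian measure is the unique Borel measure that in each chart has density
  \<open>sqrt (det g)\<close> with respect to Lebesgue measure. (Uniqueness: countably many charts cover a
  second countable manifold; existence: the densities agree on overlaps by the change of variables
  formula.)\<close>

definition is_riemannian_measure ::
    "('m::finite, 'p::topological_space) param set \<Rightarrow> ('p \<Rightarrow> (real^'n::finite) \<times> real) \<Rightarrow>
     'p measure \<Rightarrow> bool" where
  "is_riemannian_measure \<A> f vol \<longleftrightarrow>
     sets vol = sets borel \<and>
     (\<forall>(V, x)\<in>\<A>. \<forall>B\<in>sets borel. B \<subseteq> x ` V \<longrightarrow>
        emeasure vol B = (\<integral>\<^sup>+u\<in>V \<inter> x -` B. ennreal (sqrt (det (gram_matrix f x u))) \<partial>lborel))"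

abbreviation geodesic_ball ::
    "('m::finite, 'p::topological_space) param set \<Rightarrow> ('p \<Rightarrow> (real^'n::finite) \<times> real) \<Rightarrow>
     'p \<Rightarrow> real \<Rightarrow> 'p set" where
  "geodesic_ball \<A> f \<equiv> Metric_space.mball UNIV (riemannian_dist \<A> f)"

end

theory Submission
  imports Defs "HOL-Computational_Algebra.Fundamental_Theorem_Algebra"
begin

text \<open>Newton's endomorphism \<open>P\<^sub>j = S\<^sub>j I - A P\<^sub>j\<^sub>-\<^sub>1\<close> is divergence free by the Codazzi equation, its
  trace is \<open>(m - j) S\<^sub>j\<close>, and it is semidefinite when \<open>S\<^sub>j\<^sub>+\<^sub>1 = 0\<close>. Let \<open>r\<close> be \<open>sqrt (1 + |y - f q|\<^sup>2)\<close>
  for \<open>c = 0\<close> and the logarithm of \<open>- lorentz y (f q)\<close> for \<open>c < 0\<close>: a function on the space form with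
  positive definite Hessian and bounded gradient. Since \<open>trace (A P\<^sub>j) = (j + 1) S\<^sub>j\<^sub>+\<^sub>1 = 0\<close>, the second
  fundamental form drops out of the divergence of \<open>X = P\<^sub>j \<nabla>r\<close>. Hence, up to the sign of \<open>S\<^sub>j\<close>, \<open>div X\<close>
  is bounded below by a positive function times \<open>|S\<^sub>j|\<close>, while \<open>|X|\<close> is at most a constant times \<open>|S\<^sub>j|\<close>.
  Integrating \<open>div X\<close> against \<open>max 0 (1 - d(q, p) / \<mu>)\<close>, which has compact support by Hopf--Rinow and
  Lipschitz constant \<open>1 / \<mu>\<close>, gives a positive lower bound, independent of \<open>\<mu>\<close>, on \<open>1 / \<mu>\<close> times the
  integral of \<open>|S\<^sub>j|\<close> over a ball of radius comparable to \<open>\<mu>\<close>, provided \<open>S\<^sub>j\<close> does not vanish at \<open>q\<close>. If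
  \<open>S\<^sub>j\<close> and \<open>S\<^sub>j\<^sub>+\<^sub>1\<close> both vanish at \<open>q\<close>, Newton's inequalities show that fewer than \<open>j\<close> principal
  curvatures are nonzero.\<close>

section \<open>Elementary symmetric functions and Newton endomorphisms\<close>

text \<open>The Codazzi equation is never written out. The partial derivatives of F + t N form a
  frame whose own derivatives are symmetric, being second derivatives; in this frame a tangent field
  obeys the classical divergence formula for every small t. Since det (1 - t A) (1 - t A)^-1 has the
  Newton endomorphisms as coefficients of (-t)^r, comparing powers of t gives the divergences of all
  P_r X at once. For c < 0 the map F + t N leaves the hyperboloid, which does no harm because only
  the flat ambient form enters. The distance from q is merely Lipschitz. Instead of integrating by
  parts, the support of the field is moved by u + \<epsilon> W u and variables are changed; this
  yields an inequality, which is all that the growth estimate asks for. The functions r are chosen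
  so that the ambient vector Z behind their gradients has a derivative that is a constant multiple
  of the differential of the immersion. The condition at q appears because the fixed lower bound for
  the integrated divergence comes from a neighbourhood of q alone.\<close>

definition lsym :: "nat \<Rightarrow> 'i set \<Rightarrow> ('i \<Rightarrow> real) \<Rightarrow> real" where
  "lsym k I l = (\<Sum>K | K \<subseteq> I \<and> card K = k. \<Prod>i\<in>K. l i)"

lemma lsym_0 [simp]: "finite I \<Longrightarrow> lsym 0 I l = 1"
proof -
  assume "finite I"
  then have "{K. K \<subseteq> I \<and> card K = 0} = {{}}"
    by (auto dest: finite_subset)
  then show ?thesis by (simp add: lsym_def)
qed

lemma lsym_Suc_insert:
  assumes "finite I" "i \<notin> I"
  shows "lsym (Suc k) (insert i I) l = lsym (Suc k) I l + l i * lsym k I l"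
proof -
  let ?A = "{K. K \<subseteq> I \<and> card K = Suc k}" and ?B = "{K. K \<subseteq> I \<and> card K = k}"
  have fin: "finite K" if "K \<subseteq> I" for K using that assms finite_subset by blast
  have eq: "{K. K \<subseteq> insert i I \<and> card K = Suc k} = ?A \<union> insert i ` ?B"
  proof (intro set_eqI iffI)
    fix K assume K: "K \<in> {K. K \<subseteq> insert i I \<and> card K = Suc k}"
    show "K \<in> ?A \<union> insert i ` ?B"
    proof (cases "i \<in> K")
      case True
      then have "K - {i} \<in> ?B" "K = insert i (K - {i})"
        using K assms(1) by (auto simp: card_Diff_singleton)
      then show ?thesis by blast
    qed (use K in auto)
  next
    fix K assume "K \<in> ?A \<union> insert i ` ?B"
    then show "K \<in> {K. K \<subseteq> insert i I \<and> card K = Suc k}"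
      using assms fin by (auto simp: card_insert_if subset_iff)
  qed
  have inj: "inj_on (insert i) ?B"
    using assms(2) by (intro inj_on_inverseI[of _ "\<lambda>K. K - {i}"]) auto
  have "lsym (Suc k) (insert i I) l = (\<Sum>K\<in>?A. \<Prod>i\<in>K. l i) + (\<Sum>K\<in>insert i ` ?B. \<Prod>i\<in>K. l i)"
    unfolding lsym_def eq by (rule sum.union_disjoint) (use assms in auto)
  also have "(\<Sum>K\<in>insert i ` ?B. \<Prod>i\<in>K. l i) = (\<Sum>K\<in>?B. \<Prod>i\<in>insert i K. l i)"
    by (subst sum.reindex[OF inj]) simp
  also have "\<dots> = (\<Sum>K\<in>?B. l i * (\<Prod>i\<in>K. l i))"
  proof (rule sum.cong)
    fix K assume "K \<in> ?B"
    then have "finite K" "i \<notin> K" using fin assms by auto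
    then show "(\<Prod>i\<in>insert i K. l i) = l i * (\<Prod>i\<in>K. l i)" by simp
  qed simp
  finally show ?thesis by (simp add: lsym_def sum_distrib_left)
qed

text \<open>The generating polynomial has only real roots, the source of Newton's inequalities. With
  factors 1 + l i x instead of x - l i, vanishing numbers lower the degree, so the degree counts the
  nonzero ones.\<close>

lemma coeff_prod_lsym:
  fixes l :: "'i \<Rightarrow> real"
  assumes "finite I" shows "coeff (\<Prod>i\<in>I. [:1, l i:]) k = lsym k I l"
  using assms
proof (induction I arbitrary: k rule: finite_induct)
  case empty
  show ?case
  proof (cases k)
    case (Suc n)
    then have "{K. K \<subseteq> ({} :: 'i set) \<and> card K = k} = {}" by auto
    then show ?thesis using Suc by (simp only: lsym_def sum.empty prod.empty) simp
  qed simp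
next
  case (insert i I)
  then show ?case
    by (cases k) (simp_all add: lsym_Suc_insert)
qed

section \<open>Real-rooted polynomials and Newton's inequalities\<close>

definition real_rooted :: "real poly \<Rightarrow> bool" where
  "real_rooted p \<longleftrightarrow> (\<exists>c as. p = smult c (\<Prod>a\<leftarrow>as. [:-a, 1:]))"

lemma real_rooted_prod:
  assumes "finite I" shows "real_rooted (\<Prod>i\<in>I. [:1, l i:])"
  using assms
proof (induction I rule: finite_induct)
  case empty
  show ?case unfolding real_rooted_def
    by (rule exI[of _ 1], rule exI[of _ "[]"]) simp
next
  case (insert i I)
  then obtain c as where c: "(\<Prod>i\<in>I. [:1, l i:]) = smult c (\<Prod>a\<leftarrow>as. [:-a, 1:])"
    by (auto simp: real_rooted_def)
  show ?case
  proof (cases "l i = 0")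
    case True
    then show ?thesis using insert c unfolding real_rooted_def by (auto simp: one_pCons[symmetric])
  next
    case False
    then have L: "[:1, l i:] = smult (l i) [:- (- (1 / l i)), 1:]" by simp
    then have "(\<Prod>i\<in>insert i I. [:1, l i:]) = smult (l i * c) (\<Prod>a\<leftarrow>(- (1 / l i)) # as. [:-a, 1:])"
      unfolding prod.insert[OF insert(1,2)] c L list.map prod_list.Cons
      by (simp only: mult_smult_left mult_smult_right smult_smult mult.commute)
    then show ?thesis unfolding real_rooted_def by blast
  qed
qed

text \<open>The logarithmic derivative is the sum of the 1 / (z - a), and each term has imaginary
  part of sign opposite to that of Im z. Off the real axis it therefore cannot vanish, which is
  Gauss-Lucas for real roots; multiplying by Im z treats both half planes at once.\<close>

lemma log_derivative_upper_half:
  assumes "Im z \<noteq> 0"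
  defines "P \<equiv> \<lambda>as. \<Prod>a\<leftarrow>as. [:- complex_of_real a, 1:]"
  shows "poly (P as) z \<noteq> 0 \<and> Im z * Im (poly (pderiv (P as)) z / poly (P as) z) \<le> 0 \<and>
    (as \<noteq> [] \<longrightarrow> Im z * Im (poly (pderiv (P as)) z / poly (P as) z) < 0)"
proof (induction as)
  case Nil
  show ?case by (simp add: P_def)
next
  case (Cons a as)
  have ne: "z - of_real a \<noteq> 0" using assms(1) by (auto simp: complex_eq_iff)
  have P: "P (a # as) = [:- complex_of_real a, 1:] * P as" by (simp add: P_def)
  have 1: "poly (P (a # as)) z = (z - of_real a) * poly (P as) z"
    unfolding P by (simp add: algebra_simps)
  have 2: "poly (pderiv (P (a # as))) z = poly (P as) z + (z - of_real a) * poly (pderiv (P as)) z"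
    unfolding P pderiv_mult by (simp add: pderiv_pCons algebra_simps)
  have "poly (pderiv (P (a # as))) z / poly (P (a # as)) z = 1 / (z - of_real a) + poly (pderiv (P as)) z / poly (P as) z"
    unfolding 1 2 using Cons ne by (simp add: field_simps)
  moreover have "Im z * Im (1 / (z - of_real a)) < 0"
  proof -
    have "Im (1 / (z - of_real a)) = - Im z / ((Re z - a)\<^sup>2 + (Im z)\<^sup>2)"
      by (simp add: Im_divide)
    moreover have "(Re z - a)\<^sup>2 + (Im z)\<^sup>2 > 0" using assms(1)
      by (simp add: add_nonneg_pos)
    moreover have "Im z * Im z > 0" using assms(1)
      by (metis linorder_neqE_linordered_idom mult_neg_neg mult_pos_pos)
    ultimately show ?thesis by (simp add: divide_neg_pos)
  qed
  ultimately show ?case using Cons 1 ne by (simp add: distrib_left) 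
qed

text \<open>The derivative splits over the complex numbers with real roots only; it remains to
  recognize its leading coefficient as real.\<close>

lemma real_rooted_pderiv:
  assumes "real_rooted p" shows "real_rooted (pderiv p)"
proof (cases "pderiv p = 0")
  case True
  \<comment> \<open>The zero polynomial counts as real-rooted through the scalar factor 0.\<close>
  then show ?thesis unfolding real_rooted_def
    by (intro exI[of _ 0]) simp
next
  case False
  obtain c as where p: "p = smult c (\<Prod>a\<leftarrow>as. [:-a, 1:])" using assms real_rooted_def by blast
  have ne: "c \<noteq> 0" "as \<noteq> []" using False p by (auto simp: pderiv_smult)
  define P where "P = (\<Prod>a\<leftarrow>as. [:- complex_of_real a, 1:])"
  define p' where "p' = pderiv (\<Prod>a\<leftarrow>as. [:-a, 1:])"
  have "poly (\<Prod>a\<leftarrow>as. [:- complex_of_real a, 1:]) (of_real x) = of_real (poly (\<Prod>a\<leftarrow>as. [:-a, 1:]) x)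
      \<and> poly (pderiv (\<Prod>a\<leftarrow>as. [:- complex_of_real a, 1:])) (of_real x) = of_real (poly (pderiv (\<Prod>a\<leftarrow>as. [:-a, 1:])) x)" for x
  proof (induction as)
    case (Cons a as)
    then show ?case by (simp add: pderiv_mult pderiv_pCons algebra_simps del: mult_pCons_left)
  qed simp
  then have ev: "poly (pderiv P) (of_real x) = of_real (poly p' x)" for x
    by (simp add: P_def p'_def)
  have roots: "Im z = 0" if "poly (pderiv P) z = 0" for z
    using log_derivative_upper_half[of z as] that ne by (fastforce simp: P_def)
  obtain r where r: "smult (lead_coeff (pderiv P)) (\<Prod>i<degree (pderiv P). [:-r i, 1:]) = pderiv P"
    using complex_poly_decompose' by blast
  define n where "n = degree (pderiv P)"
  define k where "k = lead_coeff (pderiv P)"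
  have rreal: "r i = of_real (Re (r i))" if "i < n" for i
  proof -
    have "poly (pderiv P) (r i) = 0"
      by (subst r[symmetric]) (use that in \<open>auto simp: poly_prod n_def\<close>)
    then show ?thesis using roots by (simp add: complex_eq_iff)
  qed
  define q where "q = (\<Prod>i<n. [:- Re (r i), 1:])"
  have key: "of_real (poly p' x) = k * of_real (poly q x)" for x
  proof -
    have "of_real (poly p' x) = k * (\<Prod>i<n. of_real x - r i)"
      unfolding ev[symmetric] by (subst r[symmetric]) (simp add: poly_prod n_def k_def)
    also have "(\<Prod>i<n. of_real x - r i) = of_real (poly q x)"
      unfolding q_def poly_prod of_real_prod
      by (rule prod.cong) (use rreal in \<open>auto simp: algebra_simps\<close>)
    finally show ?thesis .
  qed
  \<comment> \<open>Evaluation at a real point where the product of the linear factors is nonzero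
    exhibits the leading coefficient as a quotient of real numbers.\<close>
  have "q \<noteq> 0" unfolding q_def by auto
  then obtain x0 where x0: "poly q x0 \<noteq> 0"
    using poly_all_0_iff_0 by blast
  have "k = of_real (poly p' x0 / poly q x0)" using key[of x0] x0 by (simp add: field_simps)
  then obtain k' where k': "k = of_real k'" by blast
  have "poly p' x = poly (smult k' q) x" for x
    using key[of x] unfolding k' by (metis of_real_eq_iff of_real_mult poly_smult)
  then have "p' = smult k' q" by (simp add: poly_eq_poly_eq_iff[symmetric] fun_eq_iff)
  moreover have "q = (\<Prod>a\<leftarrow>map (\<lambda>i. Re (r i)) [0..<n]. [:-a, 1:])"
    unfolding q_def by (simp add: prod.distinct_set_conv_list[symmetric] o_def atLeast0LessThan flip: interv_sum_list_conv_sum_set_nat)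
  ultimately have "pderiv p = smult (c * k') (\<Prod>a\<leftarrow>map (\<lambda>i. Re (r i)) [0..<n]. [:-a, 1:])"
    by (simp add: p p'_def pderiv_smult)
  then show ?thesis unfolding real_rooted_def by blast
qed

lemma real_rooted_higher_pderiv: "real_rooted p \<Longrightarrow> real_rooted ((pderiv ^^ k) p)"
  by (induction k) (auto intro: real_rooted_pderiv)

text \<open>For p the product of the x - a, the expression p'^2 - p p'' is p^2 times the sum of the
  1 / (x - a)^2. The induction uses the division-free form: a new factor turns the old expression E
  into q^2 + (x - a)^2 E, with q the old product.\<close>

lemma laguerre_ineq_list:
  fixes x :: real
  defines "P \<equiv> \<lambda>as. \<Prod>a\<leftarrow>as. [:- a, 1:]"
  shows "poly (pderiv (P as)) x ^ 2 - poly (P as) x * poly (pderiv (pderiv (P as))) x \<ge> 0 \<and>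
    (as \<noteq> [] \<and> poly (P as) x \<noteq> 0 \<longrightarrow>
      poly (pderiv (P as)) x ^ 2 - poly (P as) x * poly (pderiv (pderiv (P as))) x > 0)"
proof (induction as)
  case (Cons a as)
  define q q1 q2 where "q = poly (P as) x" "q1 = poly (pderiv (P as)) x" "q2 = poly (pderiv (pderiv (P as))) x"
  note q = this
  have P: "P (a # as) = [:-a, 1:] * P as" by (simp add: P_def)
  have 0: "poly (P (a # as)) x = (x - a) * q" unfolding P q by (simp add: algebra_simps)
  have 1: "poly (pderiv (P (a # as))) x = q + (x - a) * q1"
    unfolding P q pderiv_mult by (simp add: pderiv_pCons algebra_simps)
  have 2: "poly (pderiv (pderiv (P (a # as)))) x = 2 * q1 + (x - a) * q2"
    unfolding P q pderiv_mult pderiv_add by (simp add: pderiv_pCons pderiv_mult pderiv_add algebra_simps)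
  have eq: "(q + (x - a) * q1)^2 - ((x - a) * q) * (2 * q1 + (x - a) * q2) = q^2 + (x - a)^2 * (q1^2 - q * q2)"
    by (simp add: power2_eq_square algebra_simps)
  have ge: "(x - a)^2 * (q1^2 - q * q2) \<ge> 0" using Cons by (simp add: q)
  show ?case unfolding 0 1 2 eq using ge by (auto intro!: add_pos_nonneg)
qed (simp add: P_def)

lemma laguerre_ineq:
  assumes "real_rooted p"
  shows "poly p x * poly (pderiv (pderiv p)) x \<le> poly (pderiv p) x ^ 2"
    and "poly (pderiv p) x = 0 \<Longrightarrow> poly (pderiv (pderiv p)) x = 0 \<Longrightarrow> poly p x \<noteq> 0 \<Longrightarrow> degree p = 0"
proof -
  obtain c as where p: "p = smult c (\<Prod>a\<leftarrow>as. [:-a, 1:])" using assms real_rooted_def by blast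
  let ?q = "\<Prod>a\<leftarrow>as. [:-a, 1:]"
  note L = laguerre_ineq_list[of as x]
  have "c^2 * (poly (pderiv ?q) x ^ 2 - poly ?q x * poly (pderiv (pderiv ?q)) x) \<ge> 0" using L by simp
  then show "poly p x * poly (pderiv (pderiv p)) x \<le> poly (pderiv p) x ^ 2"
    unfolding p by (simp add: pderiv_smult algebra_simps power2_eq_square)
  assume "poly (pderiv p) x = 0" "poly (pderiv (pderiv p)) x = 0" "poly p x \<noteq> 0"
  then have "as = []" using L unfolding p pderiv_smult by auto
  then show "degree p = 0" by (simp add: p)
qed

lemma lsym_pderiv:
  fixes l :: "'i \<Rightarrow> real"
  assumes "finite I"
  defines "p \<equiv> \<Prod>i\<in>I. [:1, l i:]"
  shows "poly ((pderiv ^^ k) p) 0 = fact k * lsym k I l"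
  using coeff_prod_lsym[OF assms(1), of l]
  by (simp add: poly_0_coeff_0 coeff_higher_pderiv pochhammer_fact p_def)

text \<open>Laguerre's inequality for the k-th derivative of the generating polynomial at 0: its
  value and its first two derivatives there are the coefficients k, k + 1, k + 2 up to
  factorials.\<close>

lemma lsym_newton:
  assumes "finite I"
  shows "lsym k I l * lsym (Suc (Suc k)) I l \<le> lsym (Suc k) I l ^ 2"
proof -
  define p where "p = (\<Prod>i\<in>I. [:1, l i:])"
  define a b c F where "a = lsym k I l" "b = lsym (Suc k) I l" "c = lsym (Suc (Suc k)) I l" "F = (fact k :: real)"
  note abc = this
  note D = lsym_pderiv[OF assms, of _ l, folded p_def]
  have F: "F > 0" by (simp add: abc)
  have e1: "(fact (Suc k) :: real) = (real k + 1) * F" by (simp add: abc(4))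
  have e2: "(fact (Suc (Suc k)) :: real) = (real k + 2) * ((real k + 1) * F)"
    unfolding fact_Suc[of "Suc k"] e1 by simp
  have "real_rooted ((pderiv ^^ k) p)" unfolding p_def
    by (intro real_rooted_higher_pderiv real_rooted_prod assms)
  from laguerre_ineq(1)[OF this, of 0]
  have "poly ((pderiv ^^ k) p) 0 * poly ((pderiv ^^ Suc (Suc k)) p) 0 \<le> poly ((pderiv ^^ Suc k) p) 0 ^ 2"
    by (simp only: funpow.simps o_apply)
  then have "F * a * (((real k + 2) * ((real k + 1) * F)) * c) \<le> (((real k + 1) * F) * b)^2"
    by (simp only: D e1 e2 abc(1-3) abc(4)[symmetric])
  then have "(F^2 * (real k + 1)) * ((real k + 2) * (a * c)) \<le> (F^2 * (real k + 1)) * ((real k + 1) * b^2)"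
    by (simp add: power2_eq_square mult_ac)
  then have "(real k + 2) * (a * c) \<le> (real k + 1) * b^2"
    by (rule mult_left_le_imp_le) (use F in simp)
  then have *: "(real k + 2) * (lsym k I l * lsym (Suc (Suc k)) I l) \<le> (real k + 1) * (lsym (Suc k) I l)^2"
    by (simp only: abc)
  \<comment> \<open>The factorials leave a sharper bound with factors k + 2 and k + 1. A product
    exceeding the square would be positive, and the larger factor would enlarge it further.\<close>
  show ?thesis
  proof (rule ccontr)
    assume "\<not> ?thesis"
    then have "(real k + 1) * (lsym (Suc k) I l)^2 < (real k + 2) * (lsym k I l * lsym (Suc (Suc k)) I l)"
      by (intro mult_strict_mono) (auto intro: less_le_trans[OF _ zero_le_power2])
    with * show False by simp
  qed
qed

text \<open>Descend until the preceding coefficient is nonzero: a derivative of the generating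
  polynomial is then nonzero at 0 while its next two derivatives vanish there. The strict case of
  Laguerre's inequality makes it constant, so the generating polynomial has degree below j, and this
  degree counts the nonzero numbers.\<close>

lemma lsym_consecutive_zeros:
  assumes "finite I" "lsym j I l = 0" "lsym (Suc j) I l = 0"
  shows "card {i\<in>I. l i \<noteq> 0} < j"
  using assms(2,3)
proof (induction j)
  case 0
  then show ?case using assms(1) by simp
next
  case (Suc k)
  show ?case
  proof (cases "lsym k I l = 0")
    case True
    then show ?thesis using Suc by simp
  next
    case False
    define p where "p = (\<Prod>i\<in>I. [:1, l i:])"
    note D = lsym_pderiv[OF assms(1), of _ l, folded p_def]
    have rr: "real_rooted ((pderiv ^^ k) p)" unfolding p_def
      by (intro real_rooted_higher_pderiv real_rooted_prod assms)
    have "degree ((pderiv ^^ k) p) = 0"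
    proof (rule laguerre_ineq(2)[OF rr, of 0])
      show "poly (pderiv ((pderiv ^^ k) p)) 0 = 0" using D[of "Suc k"] Suc.prems by simp
      show "poly (pderiv (pderiv ((pderiv ^^ k) p))) 0 = 0" using D[of "Suc (Suc k)"] Suc.prems by simp
      show "poly ((pderiv ^^ k) p) 0 \<noteq> 0" using D[of k] False by simp
    qed
    then have "degree p \<le> k" by (simp add: degree_higher_pderiv)
    moreover have "degree p = (\<Sum>i\<in>I. degree [:1, l i:])"
      unfolding p_def by (rule degree_prod_sum_eq) auto
    moreover have "\<dots> = (\<Sum>i\<in>I. if l i \<noteq> 0 then 1 else 0)"
      by (rule sum.cong) auto
    moreover have "\<dots> = card {i\<in>I. l i \<noteq> 0}" using sum.inter_filter[OF assms(1), of "\<lambda>_. 1::nat" "\<lambda>i. l i \<noteq> 0"] by simp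
    ultimately show ?thesis by simp
  qed
qed

text \<open>Euler's relation by double counting: every set of k + 1 indices is counted once for each
  of its elements.\<close>

lemma sum_lsym_remove:
  assumes "finite I"
  shows "(\<Sum>i\<in>I. l i * lsym k (I - {i}) l) = real (Suc k) * lsym (Suc k) I l"
proof -
  have L: "l i * lsym k (I - {i}) l = lsym (Suc k) I l - lsym (Suc k) (I - {i}) l" if "i \<in> I" for i
    using lsym_Suc_insert[of "I - {i}" i k l] that assms by (simp add: insert_absorb)
  have fin: "finite {K. K \<subseteq> I \<and> card K = Suc k}" using assms by simp
  have "(\<Sum>i\<in>I. l i * lsym k (I - {i}) l) = (\<Sum>i\<in>I. lsym (Suc k) I l - lsym (Suc k) (I - {i}) l)"
    by (rule sum.cong) (use L in auto)
  also have "\<dots> = (\<Sum>i\<in>I. \<Sum>K | K \<subseteq> I \<and> card K = Suc k. if i \<in> K then (\<Prod>i\<in>K. l i) else 0)"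
  proof (rule sum.cong)
    fix i assume "i \<in> I"
    have "{K. K \<subseteq> I - {i} \<and> card K = Suc k} = {K \<in> {K. K \<subseteq> I \<and> card K = Suc k}. i \<notin> K}" by auto
    then have "lsym (Suc k) (I - {i}) l = (\<Sum>K | K \<subseteq> I \<and> card K = Suc k. if i \<notin> K then (\<Prod>i\<in>K. l i) else 0)"
      unfolding lsym_def by (simp only: sum.inter_filter[OF fin])
    then show "lsym (Suc k) I l - lsym (Suc k) (I - {i}) l = (\<Sum>K | K \<subseteq> I \<and> card K = Suc k. if i \<in> K then (\<Prod>i\<in>K. l i) else 0)"
      by (simp only: lsym_def[of "Suc k" I l] sum_subtractf[symmetric]) (rule sum.cong; simp)
  qed simp
  also have "\<dots> = (\<Sum>K | K \<subseteq> I \<and> card K = Suc k. \<Sum>i\<in>I. if i \<in> K then (\<Prod>i\<in>K. l i) else 0)"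
    by (rule sum.swap)
  also have "\<dots> = (\<Sum>K | K \<subseteq> I \<and> card K = Suc k. real (Suc k) * (\<Prod>i\<in>K. l i))"
  proof (rule sum.cong)
    fix K assume "K \<in> {K. K \<subseteq> I \<and> card K = Suc k}"
    then have "I \<inter> K = K" "card K = Suc k" by auto
    have "(\<Sum>i\<in>I. if i \<in> K then (\<Prod>i\<in>K. l i) else 0) = (\<Sum>i\<in>I \<inter> K. \<Prod>i\<in>K. l i)"
      by (rule sum.inter_restrict[OF assms, symmetric])
    then show "(\<Sum>i\<in>I. if i \<in> K then (\<Prod>i\<in>K. l i) else 0) = real (Suc k) * (\<Prod>i\<in>K. l i)"
      using \<open>I \<inter> K = K\<close> \<open>card K = Suc k\<close> by simp
  qed simp
  finally show ?thesis by (simp add: lsym_def sum_distrib_left)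
qed

lemma lsym_remove:
  assumes "finite I" "i \<in> I"
  shows "lsym (Suc k) I l = lsym (Suc k) (I - {i}) l + l i * lsym k (I - {i}) l"
  using lsym_Suc_insert[of "I - {i}" i k l] assms by (simp add: insert_absorb)

lemma sum_lsym_removed:
  assumes "finite I"
  shows "(\<Sum>i\<in>I. lsym k (I - {i}) l) = (real (card I) - real k) * lsym k I l"
proof (cases k)
  case 0
  then show ?thesis using assms by simp
next
  case (Suc n)
  have "(\<Sum>i\<in>I. lsym k (I - {i}) l) = (\<Sum>i\<in>I. lsym k I l - l i * lsym n (I - {i}) l)"
  proof (rule sum.cong)
    fix i assume "i \<in> I"
    from lsym_remove[OF assms this, of n l] show "lsym k (I - {i}) l = lsym k I l - l i * lsym n (I - {i}) l"
      by (simp add: Suc)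
  qed simp
  also have "\<dots> = real (card I) * lsym k I l - real k * lsym k I l"
    using sum_lsym_remove[OF assms, of l n] Suc by (simp add: sum_subtractf)
  finally show ?thesis by (simp add: algebra_simps)
qed

text \<open>Newton's inequality for the remaining numbers makes the two products differ by a square.\<close>

lemma lsym_remove_same_sign:
  assumes "finite I" "i \<in> I" "lsym (Suc j) I l = 0" "j \<ge> 1"
  shows "lsym j (I - {i}) l * lsym j I l \<ge> 0"
proof -
  obtain k where j: "j = Suc k" using assms(4) by (cases j) auto
  let ?a = "\<lambda>k. lsym k (I - {i}) l"
  have 1: "?a (Suc j) = - l i * ?a j" using lsym_remove[OF assms(1,2), of j l] assms(3) by simp
  have 2: "lsym j I l = ?a j + l i * ?a k" using lsym_remove[OF assms(1,2), of k l] j by simp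
  have "?a k * ?a (Suc j) \<le> ?a j ^ 2" using lsym_newton[of "I - {i}" k l] assms j by simp
  then show ?thesis unfolding 1 2 by (simp add: power2_eq_square algebra_simps)
qed

lemma lsym_eq_0:
  assumes "finite I" "card {i\<in>I. l i \<noteq> 0} < j"
  shows "lsym j I l = 0"
  unfolding lsym_def
proof (rule sum.neutral, clarify)
  fix K assume K: "K \<subseteq> I" "j = card K"
  have "\<not> K \<subseteq> {i\<in>I. l i \<noteq> 0}"
  proof
    assume "K \<subseteq> {i\<in>I. l i \<noteq> 0}"
    then have "card K \<le> card {i\<in>I. l i \<noteq> 0}" using assms(1) by (intro card_mono) auto
    then show False using assms K by simp
  qed
  then obtain i where "i \<in> K" "l i = 0" using K by auto
  moreover have "finite K" using K assms(1) finite_subset by blast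
  ultimately show "(\<Prod>i\<in>K. l i) = 0" by (auto intro: prod_zero)
qed

text \<open>Semidefiniteness of the Newton endomorphism in terms of its eigenvalues
  \<open>lsym j (I - {i}) l\<close>. If \<open>lsym j I l\<close> vanishes, fewer than j numbers are
  nonzero and removing one keeps the symmetric function zero; otherwise the signs agree by the
  preceding product inequality.\<close>

lemma lsym_remove_nonneg:
  assumes I: "finite I" "i \<in> I" and z: "lsym (Suc j) I l = 0" and j: "j \<ge> 1"
    and s: "\<sigma> * lsym j I l \<ge> 0"
  shows "\<sigma> * lsym j (I - {i}) l \<ge> 0"
proof (cases "lsym j I l = 0")
  case True
  have "card {k\<in>I - {i}. l k \<noteq> 0} \<le> card {k\<in>I. l k \<noteq> 0}"
    using I by (intro card_mono) auto
  also have "\<dots> < j" by (rule lsym_consecutive_zeros[OF I(1) True z])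
  finally show ?thesis using lsym_eq_0[of "I - {i}" l j] I by simp
next
  case False
  have "lsym j (I - {i}) l * lsym j I l \<ge> 0" by (rule lsym_remove_same_sign[OF I z j])
  then have "(\<sigma> * lsym j I l) * (lsym j (I - {i}) l * lsym j I l) \<ge> 0" using s by (rule_tac mult_nonneg_nonneg)
  then have "(\<sigma> * lsym j (I - {i}) l) * (lsym j I l)^2 \<ge> 0" by (simp add: power2_eq_square mult_ac)
  then show ?thesis using False by (simp add: zero_le_mult_iff)
qed

lemma prod_one_plus_eq_sum_lsym:
  fixes l :: "'i \<Rightarrow> real"
  assumes "finite I" "card I \<le> n"
  shows "(\<Prod>i\<in>I. 1 + x * l i) = (\<Sum>r\<le>n. x^r * lsym r I l)"
proof -
  let ?p = "\<Prod>i\<in>I. [:1, l i:]"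
  have "degree ?p \<le> (\<Sum>i\<in>I. degree [:1, l i:])" 
    using degree_prod_sum_le[OF assms(1), of "\<lambda>i. [:1, l i:]"] by (simp add: o_def)
  also have "\<dots> \<le> (\<Sum>i\<in>I. 1)" by (rule sum_mono) auto
  finally have d: "degree ?p \<le> n" using assms(2) by simp
  have "(\<Prod>i\<in>I. 1 + x * l i) = poly ?p x" by (simp add: poly_prod)
  also have "\<dots> = (\<Sum>r\<le>degree ?p. coeff ?p r * x^r)" by (rule poly_altdef)
  also have "\<dots> = (\<Sum>r\<le>n. coeff ?p r * x^r)"
    by (rule sum.mono_neutral_left) (use d in \<open>auto simp: coeff_eq_0\<close>)
  finally show ?thesis by (simp add: coeff_prod_lsym[OF assms(1)] mult.commute)
qed

section \<open>Inner products and self-adjoint maps\<close>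

locale inner_form =
  fixes g :: "'a::euclidean_space \<Rightarrow> 'a \<Rightarrow> real"
  assumes bil: "bilinear g" and sym: "g v w = g w v" and pos: "v \<noteq> 0 \<Longrightarrow> g v v > 0"
begin

lemmas g_simps = bilinear_ladd[OF bil] bilinear_radd[OF bil] bilinear_lmul[OF bil] bilinear_rmul[OF bil]
  bilinear_lsub[OF bil] bilinear_rsub[OF bil] bilinear_lzero[OF bil] bilinear_rzero[OF bil]

lemma g_lsum: "g (sum h I) w = (\<Sum>i\<in>I. g (h i) w)"
  using bil linear_sum[of "\<lambda>x. g x w" h I] unfolding bilinear_def by simp

lemma g_rsum: "g w (sum h I) = (\<Sum>i\<in>I. g w (h i))"
  using bil linear_sum[of "g w" h I] unfolding bilinear_def by simp

text \<open>The Rayleigh quotient is homogeneous of degree 0, so its maximum may be sought on the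
  Euclidean unit sphere of the subspace, a compact set, although A is self-adjoint only for
  g.\<close>

lemma eigenvector_in_subspace:
  assumes A: "linear A" "\<And>v w. g (A v) w = g v (A w)"
    and S: "subspace S" "A ` S \<subseteq> S" "v0 \<in> S" "v0 \<noteq> 0"
  shows "\<exists>v\<in>S. \<exists>l. g v v = 1 \<and> A v = l *\<^sub>R v"
proof -
  let ?K = "S \<inter> sphere 0 1"
  have cg: "continuous_on UNIV (\<lambda>v. g (h v) (h' v))" if "linear h" "linear h'" for h h' :: "'a \<Rightarrow> 'a"
  proof -
    have "continuous_on UNIV h" "continuous_on UNIV h'"
      using that by (simp_all add: linear_continuous_on linear_conv_bounded_linear)
    then show ?thesis
      by (rule bounded_bilinear.continuous_on[OF bilinear_conv_bounded_bilinear[THEN iffD1, OF bil]])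
  qed
  have lid: "linear (\<lambda>v::'a. v)" by (simp add: linear_iff)
  have nz: "g v v \<noteq> 0" if "v \<in> ?K" for v
    using pos[of v] that by fastforce
  have "compact ?K" by (simp add: closed_Int_compact closed_subspace S(1))
  moreover have "v0 /\<^sub>R norm v0 \<in> ?K" using S by (simp add: subspace_scale)
  moreover have "continuous_on ?K (\<lambda>v. g (A v) v / g v v)"
    by (intro continuous_on_divide continuous_on_subset[OF cg[OF A(1) lid]] continuous_on_subset[OF cg[OF lid lid]])
       (use nz in auto)
  ultimately obtain u where u: "u \<in> ?K" and umax: "\<And>v. v \<in> ?K \<Longrightarrow> g (A v) v / g v v \<le> g (A u) u / g u u"
    using continuous_attains_sup[of ?K "\<lambda>v. g (A v) v / g v v"] by blast
  define M where "M = g (A u) u / g u u"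
  have un: "u \<noteq> 0" "u \<in> S" using u by auto
  have mx: "g (A v) v \<le> M * g v v" if "v \<in> S" for v
  proof (cases "v = 0")
    case False
    let ?v = "v /\<^sub>R norm v"
    have "?v \<in> ?K" using that False S(1) by (simp add: subspace_scale)
    from umax[OF this] have "g (A ?v) ?v / g ?v ?v \<le> M" by (simp add: M_def)
    moreover have "g (A ?v) ?v / g ?v ?v = g (A v) v / g v v"
      using False by (simp add: linear_cmul[OF A(1)] g_simps field_simps)
    ultimately have "g (A v) v / g v v \<le> M" by simp
    then show ?thesis using pos[OF False] by (simp add: pos_divide_le_eq)
  qed (simp add: g_simps)
  have orth: "g (A u - M *\<^sub>R u) w = 0" if w: "w \<in> S" for w
  proof (rule ccontr)
    define a where "a = g (A u - M *\<^sub>R u) w"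
    define b where "b = M * g w w - g (A w) w"
    assume "\<not> ?thesis"
    then have a0: "a \<noteq> 0" by (simp add: a_def)
    \<comment> \<open>By maximality the defect t^2 b - 2 t a along u + t w is nonnegative for all t.
      For b > 0 it is tested at its minimum t = a / b, for b = 0 at t = a; both force a = 0.\<close>
    have le: "2 * t * a \<le> t^2 * b" for t
    proof -
      have "u + t *\<^sub>R w \<in> S" using un w S(1) by (simp add: subspace_add subspace_scale)
      from mx[OF this]
      have "g (A u) u + t * g (A u) w + t * g (A w) u + t^2 * g (A w) w \<le> M * (g u u + t * g u w + t * g w u + t^2 * g w w)"
        by (simp add: linear_add[OF A(1)] linear_cmul[OF A(1)] g_simps power2_eq_square algebra_simps)
      moreover have "g (A u) u = M * g u u" using pos[OF un(1)] by (simp add: M_def)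
      moreover have "g (A w) u = g (A u) w" using A(2)[of w u] sym[of w "A u"] by simp
      ultimately show ?thesis using sym[of w u] by (simp add: a_def b_def g_simps algebra_simps)
    qed
    have b: "b \<ge> 0" using mx[OF w] by (simp add: b_def)
    show False
    proof (cases "b = 0")
      case True
      then show False using le[of a] a0 by (auto simp: mult_le_0_iff)
    next
      case False
      then have "b > 0" using b by simp
      have "2 * (a / b) * a \<le> (a / b)^2 * b" by (rule le)
      then have "2 * a^2 \<le> a^2" using \<open>b > 0\<close> by (simp add: field_simps power2_eq_square)
      then show False using a0 by simp
    qed
  qed
  have "A u - M *\<^sub>R u \<in> S" using S(1,2) un by (auto intro!: subspace_diff subspace_scale)
  from orth[OF this] have "A u - M *\<^sub>R u = 0"
    using pos[of "A u - M *\<^sub>R u"] by (cases "A u - M *\<^sub>R u = 0") (auto simp del: right_minus_eq)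
  then have eig: "A u = M *\<^sub>R u" by simp
  let ?v = "u /\<^sub>R sqrt (g u u)"
  have "g ?v ?v = 1" using pos[OF un(1)] by (simp add: g_simps field_simps)
  moreover have "A ?v = M *\<^sub>R ?v" by (simp add: linear_cmul[OF A(1)] eig)
  moreover have "?v \<in> S" using S(1) un by (simp add: subspace_scale)
  ultimately show ?thesis by blast
qed

text \<open>Stated for invariant subspaces so that the induction can pass to the g-orthogonal
  complement of an eigenvector, which A preserves by self-adjointness.\<close>

lemma spectral_subspace:
  assumes A: "linear A" "\<And>v w. g (A v) w = g v (A w)"
    and S: "subspace S" "A ` S \<subseteq> S"
  shows "\<exists>B\<subseteq>S. finite B \<and> (\<forall>v\<in>B. \<forall>w\<in>B. v \<noteq> w \<longrightarrow> g v w = 0) \<and> (\<forall>v\<in>B. g v v = 1 \<and> (\<exists>l. A v = l *\<^sub>R v)) \<and> span B = S"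
  using S
proof (induction "dim S" arbitrary: S rule: less_induct)
  case less
  show ?case
  proof (cases "S = {0}")
    case True
    then show ?thesis by (intro exI[of _ "{}"]) simp
  next
    case False
    then obtain v0 where "v0 \<in> S" "v0 \<noteq> 0" using less.prems subspace_0 by blast
    then obtain v l where v: "v \<in> S" "g v v = 1" "A v = l *\<^sub>R v"
      using eigenvector_in_subspace[OF A less.prems] by blast
    define S' where "S' = {w\<in>S. g v w = 0}"
    have sub: "subspace S'" using less.prems(1) unfolding S'_def
      by (auto simp: subspace_def g_simps)
    have inv: "A ` S' \<subseteq> S'" using less.prems(2) A(2)[of v] v by (auto simp: S'_def g_simps simp flip: A(2))
    have "v \<notin> S'" using v by (simp add: S'_def)
    then have "S' \<noteq> S" using v by blast
    moreover have "S' \<subseteq> S" by (auto simp: S'_def)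
    ultimately have "dim S' < dim S" using sub less.prems(1)
      by (metis dim_psubset psubsetI span_eq_iff)
    from less.hyps[OF this sub inv] obtain B where B: "B \<subseteq> S'" "finite B" "\<forall>v\<in>B. \<forall>w\<in>B. v \<noteq> w \<longrightarrow> g v w = 0"
        "\<forall>v\<in>B. g v v = 1 \<and> (\<exists>l. A v = l *\<^sub>R v)" "span B = S'" by blast
    have "S \<subseteq> span (insert v B)"
    proof
      fix w assume w: "w \<in> S"
      have "w - g v w *\<^sub>R v \<in> S'" using w v less.prems(1) by (auto simp: S'_def g_simps subspace_diff subspace_scale)
      then have "w - g v w *\<^sub>R v \<in> span (insert v B)" using B(5) span_mono[of B "insert v B"] by auto
      moreover have "g v w *\<^sub>R v \<in> span (insert v B)" by (simp add: span_base span_scale)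
      ultimately have "(w - g v w *\<^sub>R v) + g v w *\<^sub>R v \<in> span (insert v B)" by (rule span_add)
      then show "w \<in> span (insert v B)" by simp
    qed
    moreover have "span (insert v B) \<subseteq> S"
      by (rule span_minimal) (use B v S'_def less.prems in auto)
    ultimately have "span (insert v B) = S" by blast
    moreover have "g v w = 0" "g w v = 0" if "w \<in> B" for w
      using B(1) that sym[of w v] by (auto simp: S'_def)
    then have "\<forall>x\<in>insert v B. \<forall>w\<in>insert v B. x \<noteq> w \<longrightarrow> g x w = 0" using B(3) by blast
    moreover have "\<forall>x\<in>insert v B. g x x = 1 \<and> (\<exists>l. A x = l *\<^sub>R x)" using B(4) v by blast
    moreover have "insert v B \<subseteq> S" using B(1) v(1) by (auto simp: S'_def)
    ultimately show ?thesis using B(2) by (intro exI[of _ "insert v B"]) blast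
  qed
qed

end

section \<open>Newton endomorphisms in an orthonormal eigenbasis\<close>

locale eigenbasis = inner_form g for g :: "real^'m \<Rightarrow> real^'m::finite \<Rightarrow> real" +
  fixes A :: "real^'m^'m" and b :: "'m \<Rightarrow> real^'m" and l :: "'m \<Rightarrow> real"
  assumes on: "g (b i) (b k) = (if i = k then 1 else 0)"
    and eig: "A *v b i = l i *\<^sub>R b i"

lemma (in inner_form) eigenbasis_exists:
  fixes A :: "'a \<Rightarrow> 'a" and n :: "'i::finite itself"
  assumes A: "linear A" "\<And>v w. g (A v) w = g v (A w)" and d: "DIM('a) = CARD('i)"
  shows "\<exists>(b :: 'i \<Rightarrow> 'a) l. (\<forall>i k. g (b i) (b k) = (if i = k then 1 else 0)) \<and> (\<forall>i. A (b i) = l i *\<^sub>R b i)"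
proof -
  obtain B where B: "finite B" "\<forall>v\<in>B. \<forall>w\<in>B. v \<noteq> w \<longrightarrow> g v w = 0"
        "\<forall>v\<in>B. g v v = 1 \<and> (\<exists>l. A v = l *\<^sub>R v)" "span B = UNIV"
    using spectral_subspace[OF A, of UNIV] by auto
  have "independent B"
  proof (rule independent_if_scalars_zero[OF B(1)])
    fix f v assume s: "(\<Sum>x\<in>B. f x *\<^sub>R x) = 0" and v: "v \<in> B"
    have "0 = g (\<Sum>x\<in>B. f x *\<^sub>R x) v" unfolding s by (simp add: g_simps)
    also have "\<dots> = (\<Sum>x\<in>B. if x = v then f v else 0)"
      unfolding g_lsum by (rule sum.cong) (use B v in \<open>auto simp: g_simps\<close>)
    also have "\<dots> = f v" using B v by simp
    finally show "f v = 0" by simp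
  qed
  then have "card B = DIM('a)" using B(4) by (metis dim_UNIV dim_span_eq_card_independent)
  then obtain b where b: "bij_betw b (UNIV :: 'i set) B"
    using d B(1) by (metis finite_same_card_bij finite_class.finite_UNIV)
  then have bB: "b i \<in> B" for i by (auto simp: bij_betw_def)
  have inj: "b i = b k \<longleftrightarrow> i = k" for i k using b by (auto simp: bij_betw_def inj_on_def)
  have "\<forall>i. \<exists>l. A (b i) = l *\<^sub>R b i" using B(3) bB by blast
  then obtain l where "\<forall>i. A (b i) = l i *\<^sub>R b i" by metis
  moreover have "g (b i) (b k) = (if i = k then 1 else 0)" for i k
    using B(2,3) bB[of i] bB[of k] inj[of i k] by auto
  ultimately show ?thesis by blast
qed

text \<open>In the classical recursion P_{r+1} = S_{r+1} I - A P_r the coefficient S_{r+1} is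
  replaced by the trace of A P_r divided by r + 1. The entries are then polynomials in those of A,
  so differentiability and invariance under conjugation follow without eigenvalues.\<close>

primrec newton_tr :: "nat \<Rightarrow> real^'m^'m \<Rightarrow> real^'m^'m::finite" where
  "newton_tr 0 A = mat 1"
| "newton_tr (Suc r) A = (trace (A ** newton_tr r A) / real (Suc r)) *\<^sub>R mat 1 - A ** newton_tr r A"

lemma scaleR_matrix_vector: "(c *\<^sub>R (A :: real^'n^'m)) *v x = c *\<^sub>R (A *v x)"
  by (rule scaleR_matrix_vector_assoc[symmetric])

context eigenbasis begin

lemma expand: "v = (\<Sum>i\<in>UNIV. g v (b i) *\<^sub>R b i)"
proof -
  have inj: "inj b" using on by (metis injI zero_neq_one)
  have "independent (range b)"
  proof (rule independent_if_scalars_zero)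
    fix f x assume s: "(\<Sum>x\<in>range b. f x *\<^sub>R x) = 0" and "x \<in> range b"
    then obtain k where k: "x = b k" by blast
    have "(\<Sum>i\<in>UNIV. f (b i) *\<^sub>R b i) = 0" using s by (subst (asm) sum.reindex[OF inj]) simp
    then have "0 = g (\<Sum>i\<in>UNIV. f (b i) *\<^sub>R b i) (b k)" by (simp add: g_simps)
    also have "\<dots> = (\<Sum>i\<in>UNIV. if i = k then f (b k) else 0)"
      unfolding g_lsum by (rule sum.cong) (auto simp: g_simps on)
    finally show "f x = 0" by (simp add: k)
  qed simp
  then have "span (range b) = UNIV"
    by (metis card_image[OF inj] independent_card_le_dim dim_UNIV subset_UNIV DIM_cart DIM_real mult_1_right
        card_eq_dim finite_class.finite finite_imageI le_refl dim_subset_UNIV top.extremum_unique)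
  then have "v \<in> span (range b)" by simp
  then obtain f where "v = (\<Sum>x\<in>range b. f x *\<^sub>R x)" by (auto simp: span_finite)
  then have v: "v = (\<Sum>i\<in>UNIV. f (b i) *\<^sub>R b i)" by (simp add: sum.reindex[OF inj])
  have "g v (b k) = f (b k)" for k
  proof -
    have "g v (b k) = (\<Sum>i\<in>UNIV. if i = k then f (b k) else 0)"
      unfolding v g_lsum by (rule sum.cong) (auto simp: g_simps on)
    then show ?thesis by simp
  qed
  then show ?thesis using v by simp
qed

lemma parseval: "g v w = (\<Sum>i\<in>UNIV. g v (b i) * g w (b i))"
proof -
  have "g v w = g v (\<Sum>i\<in>UNIV. g w (b i) *\<^sub>R b i)" using expand[of w] by simp
  also have "\<dots> = (\<Sum>i\<in>UNIV. g v (b i) * g w (b i))" by (simp add: g_rsum g_simps mult.commute)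
  finally show ?thesis .
qed

lemma matrix_eqI: "(\<And>i. M *v b i = M' *v b i) \<Longrightarrow> M = M'"
proof -
  assume eq: "\<And>i. M *v b i = M' *v b i"
  have "M *v v = M' *v v" for v
    using eq by (subst (1 2) expand) (simp add: matrix_vector_mult_scaleR linear_sum[OF matrix_vector_mul_linear])
  then show "M = M'" by (simp add: matrix_eq)
qed

lemma trace_eigen: "trace M = (\<Sum>i\<in>UNIV. g (M *v b i) (b i))"
proof -
  have M: "M *v axis k 1 = (\<Sum>i\<in>UNIV. g (axis k 1) (b i) *\<^sub>R (M *v b i))" for k
    by (subst expand[of "axis k 1"]) (simp add: matrix_vector_mult_scaleR linear_sum[OF matrix_vector_mul_linear])
  have "trace M = (\<Sum>k\<in>UNIV. (M *v axis k 1) $ k)"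
    by (simp add: trace_def matrix_vector_mul_component axis_def inner_vec_def if_distrib cong: if_cong)
  also have "\<dots> = (\<Sum>k\<in>UNIV. \<Sum>i\<in>UNIV. g (axis k 1) (b i) * (M *v b i) $ k)"
    by (simp add: M)
  also have "\<dots> = (\<Sum>i\<in>UNIV. \<Sum>k\<in>UNIV. g (axis k 1) (b i) * (M *v b i) $ k)" by (rule sum.swap)
  also have "\<dots> = (\<Sum>i\<in>UNIV. g (\<Sum>k\<in>UNIV. (M *v b i) $ k *\<^sub>R axis k 1) (b i))"
    by (simp add: g_lsum g_simps mult.commute)
  also have "\<dots> = (\<Sum>i\<in>UNIV. g (M *v b i) (b i))"
    using basis_expansion[of "M *v b _"] by (simp add: scalar_mult_eq_scaleR)
  finally show ?thesis .
qed

text \<open>Proved jointly: the trace formula at r feeds the recursion at r + 1, and the eigenvalues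
  at r + 1 give the next trace by \<open>sum_lsym_remove\<close>.\<close>

lemma newton_tr_eigen: "newton_tr r A *v b i = lsym r (UNIV - {i}) l *\<^sub>R b i"
  and trace_newton: "trace (A ** newton_tr r A) = real (Suc r) * lsym (Suc r) UNIV l"
proof (induction r arbitrary: i)
  case 0
  {
    case 1
    show ?case by simp
  next
    case 2
    have "trace A = (\<Sum>i\<in>UNIV. l i * lsym 0 (UNIV - {i}) l)" by (simp add: trace_eigen eig g_simps on)
    then show ?case by (simp add: sum_lsym_remove[of UNIV l 0, simplified])
  }
next
  case (Suc r)
  have E: "newton_tr (Suc r) A *v b i = lsym (Suc r) (UNIV - {i}) l *\<^sub>R b i" for i
  proof -
    have e: "lsym (Suc r) UNIV l - l i * lsym r (UNIV - {i}) l = lsym (Suc r) (UNIV - {i}) l"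
      using lsym_remove[of UNIV i r l] by simp
    have "newton_tr (Suc r) A *v b i = lsym (Suc r) UNIV l *\<^sub>R b i - A *v (newton_tr r A *v b i)"
      by (simp add: Suc(2) matrix_vector_mult_diff_rdistrib scaleR_matrix_vector matrix_vector_mul_assoc del: of_nat_Suc)
    also have "\<dots> = lsym (Suc r) (UNIV - {i}) l *\<^sub>R b i"
      unfolding e[symmetric] by (simp add: Suc(1) matrix_vector_mult_scaleR eig algebra_simps)
    finally show ?thesis .
  qed
  { case 1 show ?case by (rule E) next
    case 2
    have "trace (A ** newton_tr (Suc r) A) = (\<Sum>i\<in>UNIV. l i * lsym (Suc r) (UNIV - {i}) l)"
      unfolding trace_eigen by (simp add: E matrix_vector_mul_assoc[symmetric] matrix_vector_mult_scaleR eig g_simps on mult.commute del: newton_tr.simps)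
    then show ?case by (simp add: sum_lsym_remove del: newton_tr.simps) }
qed

lemma trace_newton_tr: "trace (newton_tr r A) = (real CARD('m) - real r) * lsym r UNIV l"
  unfolding trace_eigen by (simp add: newton_tr_eigen g_simps on sum_lsym_removed)

lemma det_one_minus: "det (mat 1 - t *\<^sub>R A) = (\<Prod>i\<in>UNIV. 1 - t * l i)"
proof -
  define V :: "real^'m^'m" where "V = (\<chi> k i. b i $ k)"
  define D :: "real^'m^'m" where "D = (\<chi> k i. if k = i then 1 - t * l i else 0)"
  have Vb: "V *v axis i 1 = b i" for i
    by (simp add: V_def vec_eq_iff matrix_vector_mul_component axis_def inner_vec_def if_distrib cong: if_cong)
  have Da: "D *v axis i 1 = (1 - t * l i) *\<^sub>R axis i 1" for i
    unfolding matrix_vector_mult_basis by (simp add: D_def column_def vec_eq_iff axis_def)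
  have "((mat 1 - t *\<^sub>R A) ** V) *v axis i 1 = (V ** D) *v axis i 1" for i
    by (simp add: matrix_vector_mul_assoc[symmetric] Vb Da matrix_vector_mult_diff_rdistrib scaleR_matrix_vector eig matrix_vector_mult_scaleR algebra_simps)
  then have "(mat 1 - t *\<^sub>R A) ** V = V ** D"
    by (simp add: vec_eq_iff matrix_vector_mul_component axis_def inner_vec_def if_distrib cong: if_cong)
  then have "det (mat 1 - t *\<^sub>R A) * det V = det V * det D" by (metis det_mul)
  moreover have "det V \<noteq> 0"
  proof -
    have "surj ((*v) V)"
    proof (rule surjI)
      fix v show "V *v (\<chi> i. g v (b i)) = v"
        by (subst (2) expand[of v]) (simp add: V_def vec_eq_iff matrix_vector_mult_def mult.commute)
    qed
    then show ?thesis by (metis invertible_det_nz invertible_right_inverse matrix_right_invertible_surjective)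
  qed
  moreover have "det D = (\<Prod>i\<in>UNIV. 1 - t * l i)"
    by (subst det_diagonal) (auto simp: D_def)
  ultimately show ?thesis by simp
qed

text \<open>The sum is the adjugate of 1 - t A as a polynomial in t: on \<open>b i\<close> it acts
  as the product of the 1 - t l k over k different from i. This generating function allows all
  Newton endomorphisms to be differentiated together.\<close>

lemma newton_generating:
  assumes "CARD('m) \<le> n"
  shows "(mat 1 - t *\<^sub>R A) ** (\<Sum>r\<le>n. (-t)^r *\<^sub>R newton_tr r A) = det (mat 1 - t *\<^sub>R A) *\<^sub>R mat 1"
proof (rule matrix_eqI)
  fix i
  have s: "(\<Sum>r\<le>n. (-t)^r *\<^sub>R newton_tr r A) *v b i = (\<Sum>r\<le>n. (-t)^r * lsym r (UNIV - {i}) l) *\<^sub>R b i"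
  proof -
    have "(\<Sum>r\<in>F. (-t)^r *\<^sub>R newton_tr r A) *v b i = (\<Sum>r\<in>F. (-t)^r * lsym r (UNIV - {i}) l) *\<^sub>R b i" if "finite F" for F
      using that by (induction F) (auto simp: matrix_vector_mult_add_rdistrib scaleR_matrix_vector newton_tr_eigen scaleR_add_left)
    then show ?thesis by simp
  qed
  define c where "c = (\<Prod>k\<in>UNIV - {i}. 1 - t * l k)"
  have c: "(\<Sum>r\<le>n. (-t)^r * lsym r (UNIV - {i}) l) = c"
    using prod_one_plus_eq_sum_lsym[of "UNIV - {i}" n "-t" l] assms by (simp add: card_Diff_singleton_if c_def)
  have d: "det (mat 1 - t *\<^sub>R A) = (1 - t * l i) * c"
    unfolding det_one_minus c_def by (rule prod.remove) auto
  have "((mat 1 - t *\<^sub>R A) ** (\<Sum>r\<le>n. (-t)^r *\<^sub>R newton_tr r A)) *v b i = c *\<^sub>R (b i - t *\<^sub>R (l i *\<^sub>R b i))"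
    by (simp add: matrix_vector_mul_assoc[symmetric] s c matrix_vector_mult_scaleR matrix_vector_mult_diff_rdistrib
        scaleR_matrix_vector eig scaleR_right_diff_distrib)
  also have "\<dots> = ((1 - t * l i) * c) *\<^sub>R b i" by (simp add: algebra_simps)
  finally show "((mat 1 - t *\<^sub>R A) ** (\<Sum>r\<le>n. (-t)^r *\<^sub>R newton_tr r A)) *v b i = (det (mat 1 - t *\<^sub>R A) *\<^sub>R mat 1) *v b i"
    by (simp only: d scaleR_matrix_vector matrix_vector_mul_lid)
qed

lemma dim_eigenspace: "dim {v. A *v v = x *\<^sub>R v} = card {i. l i = x}"
proof -
  have inj: "inj b" using on by (metis injI zero_neq_one)
  have ind: "independent (b ` {i. l i = x})"
  proof (rule independent_if_scalars_zero)
    fix f v assume s: "(\<Sum>x\<in>b ` {i. l i = x}. f x *\<^sub>R x) = 0" and "v \<in> b ` {i. l i = x}"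
    then obtain k where k: "v = b k" "l k = x" by blast
    have "(\<Sum>i\<in>{i. l i = x}. f (b i) *\<^sub>R b i) = 0" using s by (subst (asm) sum.reindex) (use inj in \<open>auto intro: inj_on_subset\<close>)
    then have "0 = g (\<Sum>i\<in>{i. l i = x}. f (b i) *\<^sub>R b i) (b k)" by (simp add: g_simps)
    also have "\<dots> = (\<Sum>i\<in>{i. l i = x}. if i = k then f (b k) else 0)"
      unfolding g_lsum by (rule sum.cong) (auto simp: g_simps on)
    finally show "f v = 0" using k by simp
  qed simp
  have "{v. A *v v = x *\<^sub>R v} = span (b ` {i. l i = x})"
  proof (intro set_eqI iffI)
    fix v assume "v \<in> {v. A *v v = x *\<^sub>R v}"
    then have Av: "A *v v = x *\<^sub>R v" by simp
    have "g v (b i) = 0" if "l i \<noteq> x" for i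
    proof -
      have "A *v v = (\<Sum>k\<in>UNIV. g v (b k) *\<^sub>R (l k *\<^sub>R b k))"
        by (subst expand[of v]) (simp add: matrix_vector_mult_scaleR linear_sum[OF matrix_vector_mul_linear] eig)
      then have "g (A *v v) (b i) = (\<Sum>k\<in>UNIV. if k = i then g v (b i) * l i else 0)"
        by (simp add: g_lsum g_simps on if_distrib cong: if_cong)
      then have "x * g v (b i) = l i * g v (b i)" by (simp add: Av g_simps)
      then show ?thesis using that by simp
    qed
    then have "v = (\<Sum>i\<in>{i. l i = x}. g v (b i) *\<^sub>R b i)"
      by (subst expand[of v]) (rule sum.mono_neutral_right; auto)
    then show "v \<in> span (b ` {i. l i = x})"
      by (metis (mono_tags, lifting) imageI span_base span_scale span_sum)
  next
    fix v assume "v \<in> span (b ` {i. l i = x})"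
    then show "v \<in> {v. A *v v = x *\<^sub>R v}"
      by (induction rule: span_induct_alt) (auto simp: matrix_vector_right_distrib matrix_vector_mult_scaleR eig scaleR_add_right)
  qed
  then show ?thesis
    using dim_eq_card_independent[OF ind] card_image[OF inj_on_subset[OF inj, of "{i. l i = x}"]] by simp
qed

text \<open>Numbering, for each value x, the indices i with \<open>l i = x\<close> by 0, 1, ...
  identifies the index type with the eigenvalue copies, since the eigenspace dimension is the number
  of such indices.\<close>

lemma elem_sym_eq: "elem_sym i ((*v) A) = lsym i UNIV l"
proof -
  have "\<exists>h. bij_betw h {i. l i = x} {..<card {i. l i = x}}" for x
    using ex_bij_betw_finite_nat[of "{i. l i = x}"] by (simp add: atLeast0LessThan)
  then obtain h where h: "\<And>x. bij_betw (h x) {i. l i = x} {..<card {i. l i = x}}" by metis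
  define F where "F = (\<lambda>i. (l i, h (l i) i))"
  have inj: "inj F"
  proof (rule injI)
    fix i k assume "F i = F k"
    then have "l i = l k" "h (l i) i = h (l i) k" by (auto simp: F_def)
    then show "i = k" using h[of "l i"] by (auto simp: bij_betw_def inj_on_def)
  qed
  have rng: "range F = eigenvalue_copies ((*v) A)"
  proof (intro set_eqI iffI)
    fix y assume "y \<in> range F"
    then obtain i where i: "y = (l i, h (l i) i)" by (auto simp: F_def)
    have "h (l i) i \<in> {..<card {k. l k = l i}}" using h[of "l i"] by (auto simp: bij_betw_def)
    then show "y \<in> eigenvalue_copies ((*v) A)" by (simp add: i eigenvalue_copies_def dim_eigenspace)
  next
    fix y assume "y \<in> eigenvalue_copies ((*v) A)"
    then obtain x n where y: "y = (x, n)" "n < card {i. l i = x}"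
      by (auto simp: eigenvalue_copies_def dim_eigenspace)
    then have "n \<in> h x ` {i. l i = x}" using h[of x] by (auto simp: bij_betw_def)
    then show "y \<in> range F" by (auto simp: F_def y)
  qed
  have eq: "{K. K \<subseteq> eigenvalue_copies ((*v) A) \<and> card K = i} = image F ` {K. K \<subseteq> UNIV \<and> card K = i}"
  proof (intro set_eqI iffI)
    fix K assume K: "K \<in> {K. K \<subseteq> eigenvalue_copies ((*v) A) \<and> card K = i}"
    then have "K \<subseteq> range F" using rng by simp
    then have KF: "F ` (F -` K) = K" by blast
    have "card (F ` (F -` K)) = card (F -` K)" by (rule card_image[OF inj_on_subset[OF inj]]) simp
    then have "F -` K \<in> {K. K \<subseteq> UNIV \<and> card K = i}" using K unfolding KF by simp
    then have "F ` (F -` K) \<in> image F ` {K. K \<subseteq> UNIV \<and> card K = i}" by (rule imageI)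
    then show "K \<in> image F ` {K. K \<subseteq> UNIV \<and> card K = i}" unfolding KF .
  next
    fix K assume "K \<in> image F ` {K. K \<subseteq> UNIV \<and> card K = i}"
    then obtain J where "K = F ` J" "card J = i" by auto
    then show "K \<in> {K. K \<subseteq> eigenvalue_copies ((*v) A) \<and> card K = i}"
      unfolding rng[symmetric] using card_image[OF inj_on_subset[OF inj, of J]] by auto
  qed
  have inj2: "inj_on (image F) X" for X
    by (rule inj_onI) (simp only: inj_image_eq_iff[OF inj])
  have "elem_sym i ((*v) A) = (\<Sum>K | K \<subseteq> UNIV \<and> card K = i. \<Prod>k\<in>F ` K. fst k)"
    unfolding elem_sym_def eq by (subst sum.reindex[OF inj2]) (simp only: o_def)
  also have "\<dots> = lsym i UNIV l" unfolding lsym_def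
  proof (rule sum.cong)
    fix K :: "'m set"
    show "(\<Prod>k\<in>F ` K. fst k) = (\<Prod>i\<in>K. l i)"
      using prod.reindex[OF inj_on_subset[OF inj, of K], of fst] by (simp add: F_def o_def)
  qed simp
  finally show ?thesis .
qed

lemma rank_le: "dim (range ((*v) A)) \<le> card {i. l i \<noteq> 0}"
proof -
  have "range ((*v) A) \<subseteq> span (b ` {i. l i \<noteq> 0})"
  proof clarify
    fix v
    have "A *v v = (\<Sum>k\<in>UNIV. (g v (b k) * l k) *\<^sub>R b k)"
      by (subst expand[of v]) (simp add: matrix_vector_mult_scaleR linear_sum[OF matrix_vector_mul_linear] eig)
    also have "\<dots> = (\<Sum>k\<in>{i. l i \<noteq> 0}. (g v (b k) * l k) *\<^sub>R b k)" by (rule sum.mono_neutral_right) auto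
    also have "\<dots> \<in> span (b ` {i. l i \<noteq> 0})" by (intro span_sum span_scale span_base) auto
    finally show "A *v v \<in> span (b ` {i. l i \<noteq> 0})" .
  qed
  then have "dim (range ((*v) A)) \<le> card (b ` {i. l i \<noteq> 0})" by (intro dim_le_card) auto
  also have "\<dots> \<le> card {i. l i \<noteq> 0}" by (rule card_image_le) simp
  finally show ?thesis .
qed

text \<open>All eigenvalues p i of \<sigma> P are nonnegative, so each is at most their sum, the
  trace. This one comparison controls both the quadratic form and the length of P v by the trace, a
  multiple of |S_j|.\<close>

lemma newton_tr_semidefinite:
  assumes z: "lsym (Suc j) UNIV l = 0" and j: "j \<ge> 1" and s: "\<sigma> * lsym j UNIV l \<ge> 0" "\<bar>\<sigma>\<bar> = 1"
  defines "P \<equiv> newton_tr j A"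
  shows "0 \<le> \<sigma> * trace P" "\<sigma> * g (P *v v) v \<le> \<sigma> * trace P * g v v"
    and "g (P *v v) (P *v v) \<le> (\<sigma> * trace P)^2 * g v v"
proof -
  define p where "p i = \<sigma> * lsym j (UNIV - {i}) l" for i
  have p0: "p i \<ge> 0" for i unfolding p_def by (rule lsym_remove_nonneg[OF _ _ z j s(1)]) auto
  have tr: "\<sigma> * trace P = (\<Sum>i\<in>UNIV. p i)"
    by (simp add: P_def trace_eigen newton_tr_eigen g_simps on p_def sum_distrib_left)
  then show t0: "0 \<le> \<sigma> * trace P" using p0 by (simp add: sum_nonneg)
  have ple: "p i \<le> \<sigma> * trace P" for i unfolding tr by (rule member_le_sum) (use p0 in auto)
  have Pv: "P *v v = (\<Sum>i\<in>UNIV. (g v (b i) * lsym j (UNIV - {i}) l) *\<^sub>R b i)" for v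
    by (subst expand[of v]) (simp add: P_def matrix_vector_mult_scaleR linear_sum[OF matrix_vector_mul_linear] newton_tr_eigen)
  have c: "g (P *v v) (b i) = lsym j (UNIV - {i}) l * g v (b i)" for v i
    by (simp add: Pv g_lsum g_simps on if_distrib cong: if_cong)
  have "\<sigma> * g (P *v v) v = (\<Sum>i\<in>UNIV. p i * (g v (b i))^2)"
    by (subst parseval) (simp add: c p_def sum_distrib_left power2_eq_square mult_ac)
  also have "\<dots> \<le> (\<Sum>i\<in>UNIV. (\<sigma> * trace P) * (g v (b i))^2)"
    by (rule sum_mono) (simp add: mult_right_mono ple)
  also have "\<dots> = \<sigma> * trace P * g v v" by (subst (2) parseval) (simp add: sum_distrib_left power2_eq_square)
  finally show "\<sigma> * g (P *v v) v \<le> \<sigma> * trace P * g v v" .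
  have s2: "\<sigma> * \<sigma> = 1" using s(2) by (metis abs_mult_self_eq mult_1)
  have p2: "(p i)^2 = (lsym j (UNIV - {i}) l)^2" for i
  proof -
    have "(p i)^2 = (\<sigma> * \<sigma>) * (lsym j (UNIV - {i}) l)^2" by (simp only: p_def power2_eq_square mult_ac)
    then show ?thesis by (simp add: s2)
  qed
  have "g (P *v v) (P *v v) = (\<Sum>i\<in>UNIV. (p i)^2 * (g v (b i))^2)"
    by (subst parseval) (simp add: c p2, simp add: power2_eq_square mult_ac)
  also have "\<dots> \<le> (\<Sum>i\<in>UNIV. (\<sigma> * trace P)^2 * (g v (b i))^2)"
    by (intro sum_mono mult_right_mono power_mono ple p0) auto
  also have "\<dots> = (\<sigma> * trace P)^2 * g v v" by (subst (2) parseval) (simp add: sum_distrib_left power2_eq_square)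
  finally show "g (P *v v) (P *v v) \<le> (\<sigma> * trace P)^2 * g v v" .
qed

end

section \<open>Continuously differentiable maps\<close>

lemma has_derivative_det_mat_1:
  "(det has_derivative trace) (at (mat 1 :: real^'n^'n::finite))"
proof -
  let ?I = "mat 1 :: real^'n^'n"
  let ?d = "\<lambda>p H. of_int (sign p) * (\<Sum>i\<in>UNIV. H $ i $ p i * (\<Prod>j\<in>UNIV - {i}. ?I $ j $ p j))"
  have "((\<lambda>A::real^'n^'n. \<Sum>p\<in>{p. p permutes UNIV}. of_int (sign p) * (\<Prod>i\<in>UNIV. A $ i $ p i)) has_derivative
      (\<lambda>H. \<Sum>p\<in>{p. p permutes UNIV}. ?d p H)) (at ?I)"
    by (intro has_derivative_sum has_derivative_mult_right has_derivative_prod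
        bounded_linear_imp_has_derivative bounded_linear_compose[OF bounded_linear_vec_nth bounded_linear_vec_nth])
  moreover have "(\<Sum>p\<in>{p. p permutes UNIV}. ?d p H) = trace H" for H
  proof -
    \<comment> \<open>A permutation other than the identity moves at least two indices, so after one
      factor is deleted an off-diagonal entry of the unit matrix, a zero, remains.\<close>
    have z: "?d p H = 0" if p: "p permutes UNIV" "p \<noteq> id" for p
    proof -
      obtain k where k: "p k \<noteq> k" using p(2) by (auto simp: fun_eq_iff)
      have inj: "inj p" using p(1) permutes_inj by blast
      have pz: "(\<Prod>j\<in>UNIV - {i}. ?I $ j $ p j) = 0" for i
      proof -
        obtain j where "j \<noteq> i" "p j \<noteq> j"
          using k inj by (metis injD)
        then show ?thesis by (intro prod_zero bexI[of _ j]) (auto simp: mat_def)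
      qed
      show ?thesis unfolding pz by simp
    qed
    have "(\<Sum>p\<in>{p. p permutes UNIV}. ?d p H) = (\<Sum>p\<in>{id}. ?d p H)"
      by (rule sum.mono_neutral_right) (use z permutes_id in \<open>auto simp: finite_permutations\<close>)
    also have "\<dots> = trace H" by (simp add: trace_def mat_def)
    finally show ?thesis .
  qed
  then have "(\<lambda>H. \<Sum>p\<in>{p. p permutes UNIV}. ?d p H) = trace" by (rule ext)
  ultimately show ?thesis unfolding det_def[abs_def] by (simp only:)
qed

text \<open>Jacobi's formula, reduced to the unit matrix by det X = det G det (G^-1 X).\<close>

lemma has_derivative_det:
  fixes G Gi :: "real^'n^'n::finite"
  assumes "Gi ** G = mat 1"
  shows "(det has_derivative (\<lambda>H. det G * trace (Gi ** H))) (at G)"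
proof -
  have "G ** Gi = mat 1" using assms matrix_left_right_inverse by blast
  then have dd: "det G * det Gi = 1" by (metis det_I det_mul)
  have eq: "det X = det G * det (Gi ** X)" for X
    by (simp add: det_mul) (metis dd mult.assoc mult_1)
  have bl: "bounded_linear (\<lambda>X. Gi ** X)"
    by (rule linear_conv_bounded_linear[THEN iffD1], rule linearI)
       (auto simp: vec_eq_iff matrix_matrix_mult_def sum_distrib_left sum.distrib distrib_left mult_ac)
  have "((\<lambda>X. det (Gi ** X)) has_derivative (\<lambda>H. trace (Gi ** H))) (at G)"
    by (rule has_derivative_compose[OF bounded_linear_imp_has_derivative[OF bl]])
       (use has_derivative_det_mat_1 assms in simp)
  then have "((\<lambda>X. det G * det (Gi ** X)) has_derivative (\<lambda>H. det G * trace (Gi ** H))) (at G)"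
    by (rule has_derivative_mult_right)
  then show ?thesis by (simp add: eq[symmetric])
qed

text \<open>The quotient is the second difference over a parallelogram with sides s a and s b. The
  mean value theorem in direction a and then in direction b produces a nearby value of the mixed
  derivative, while the difference itself is symmetric in a and b.\<close>

lemma mixed_partials_aux:
  fixes h :: "'a::real_normed_vector \<Rightarrow> real"
  assumes "open U" "u \<in> U"
    and D: "\<And>v. v \<in> U \<Longrightarrow> (h has_derivative D v) (at v)"
    and Da: "\<And>v. v \<in> U \<Longrightarrow> ((\<lambda>v. D v a) has_derivative Da v) (at v)"
    and ca: "continuous_on U (\<lambda>v. Da v b)"
  shows "((\<lambda>s. (h (u + s *\<^sub>R a + s *\<^sub>R b) - h (u + s *\<^sub>R a) - h (u + s *\<^sub>R b) + h u) / s^2) \<longlongrightarrow> Da u b) (at_right 0)"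
proof (rule tendstoI)
  fix e :: real assume e: "e > 0"
  obtain r where r: "r > 0" "ball u r \<subseteq> U" using assms(1,2) openE by blast
  have "isCont (\<lambda>v. Da v b) u" using ca assms(1,2) by (simp add: continuous_on_eq_continuous_at)
  then obtain r' where r': "r' > 0" "\<And>v. dist v u < r' \<Longrightarrow> dist (Da v b) (Da u b) < e"
    using e unfolding continuous_at_eps_delta by (auto simp: dist_norm)
  define K where "K = norm a + norm b + 1"
  have K: "K > 0" by (simp add: K_def add_nonneg_pos)
  define d where "d = min r r' / K"
  have d: "d > 0" using r r' K by (simp add: d_def)
  have close: "dist (u + x *\<^sub>R a + y *\<^sub>R b) u < min r r'" if "0 \<le> x" "x < d" "0 \<le> y" "y < d" for x y
  proof -
    have "norm (x *\<^sub>R a + y *\<^sub>R b) \<le> x * norm a + y * norm b"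
      using norm_triangle_ineq[of "x *\<^sub>R a" "y *\<^sub>R b"] that by simp
    also have "\<dots> \<le> d * norm a + d * norm b" using that by (intro add_mono mult_right_mono) auto
    also have "\<dots> < d * K" using d by (simp add: K_def algebra_simps)
    also have "\<dots> = min r r'" using K by (simp add: d_def)
    finally show ?thesis by (simp add: dist_norm algebra_simps)
  qed
  have inU: "u + x *\<^sub>R a + y *\<^sub>R b \<in> U" if "0 \<le> x" "x < d" "0 \<le> y" "y < d" for x y
    using close[OF that] r(2) by (auto simp: dist_commute)
  have "dist ((h (u + s *\<^sub>R a + s *\<^sub>R b) - h (u + s *\<^sub>R a) - h (u + s *\<^sub>R b) + h u) / s^2) (Da u b) < e"
    if s: "0 < s" "s < d" for s
  proof -
    have inU0: "u + x *\<^sub>R a \<in> U" if "0 \<le> x" "x < d" for x using inU[of x 0] that d by simp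
    define g where "g x = h (u + x *\<^sub>R a + s *\<^sub>R b) - h (u + x *\<^sub>R a)" for x
    have "\<exists>\<xi>>0. \<xi> < s \<and> g s - g 0 = (s - 0) * (D (u + \<xi> *\<^sub>R a + s *\<^sub>R b) a - D (u + \<xi> *\<^sub>R a) a)"
    proof (rule MVT2[OF s(1)])
      fix x assume x: "0 \<le> x" "x \<le> s"
      have i1: "u + x *\<^sub>R a + s *\<^sub>R b \<in> U" and i2: "u + x *\<^sub>R a \<in> U"
        using inU[of x s] inU0[of x] x s by auto
      have "((\<lambda>x. u + x *\<^sub>R a + s *\<^sub>R b) has_derivative (\<lambda>t. t *\<^sub>R a)) (at x)"
        by (auto intro!: derivative_eq_intros)
      from has_derivative_compose[OF this D[OF i1]]
      have 1: "((\<lambda>x. h (u + x *\<^sub>R a + s *\<^sub>R b)) has_derivative (\<lambda>t. D (u + x *\<^sub>R a + s *\<^sub>R b) (t *\<^sub>R a))) (at x)" .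
      have "((\<lambda>x. u + x *\<^sub>R a) has_derivative (\<lambda>t. t *\<^sub>R a)) (at x)"
        by (auto intro!: derivative_eq_intros)
      from has_derivative_compose[OF this D[OF i2]]
      have 2: "((\<lambda>x. h (u + x *\<^sub>R a)) has_derivative (\<lambda>t. D (u + x *\<^sub>R a) (t *\<^sub>R a))) (at x)" .
      have "D (u + x *\<^sub>R a + s *\<^sub>R b) (t *\<^sub>R a) = t * D (u + x *\<^sub>R a + s *\<^sub>R b) a"
        "D (u + x *\<^sub>R a) (t *\<^sub>R a) = t * D (u + x *\<^sub>R a) a" for t
        using linear_cmul[OF has_derivative_linear[OF D[OF i1]]] linear_cmul[OF has_derivative_linear[OF D[OF i2]]] by auto
      then show "(g has_real_derivative D (u + x *\<^sub>R a + s *\<^sub>R b) a - D (u + x *\<^sub>R a) a) (at x)"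
        unfolding has_field_derivative_def g_def
        by (intro has_derivative_eq_rhs[OF has_derivative_diff[OF 1 2]]) (simp add: fun_eq_iff algebra_simps)
    qed
    then obtain \<xi> where \<xi>: "0 < \<xi>" "\<xi> < s" "g s - g 0 = s * (D (u + \<xi> *\<^sub>R a + s *\<^sub>R b) a - D (u + \<xi> *\<^sub>R a) a)" by auto
    have "\<exists>\<eta>>0. \<eta> < s \<and> D (u + \<xi> *\<^sub>R a + s *\<^sub>R b) a - D (u + \<xi> *\<^sub>R a + 0 *\<^sub>R b) a = (s - 0) * Da (u + \<xi> *\<^sub>R a + \<eta> *\<^sub>R b) b"
    proof (rule MVT2[OF s(1)])
      fix y assume y: "0 \<le> y" "y \<le> s"
      have i: "u + \<xi> *\<^sub>R a + y *\<^sub>R b \<in> U" using inU[of \<xi> y] y s \<xi> by auto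
      have "((\<lambda>y. u + \<xi> *\<^sub>R a + y *\<^sub>R b) has_derivative (\<lambda>t. t *\<^sub>R b)) (at y)"
        by (auto intro!: derivative_eq_intros)
      from has_derivative_compose[OF this Da[OF i]]
      have 3: "((\<lambda>y. D (u + \<xi> *\<^sub>R a + y *\<^sub>R b) a) has_derivative (\<lambda>t. Da (u + \<xi> *\<^sub>R a + y *\<^sub>R b) (t *\<^sub>R b))) (at y)" .
      show "((\<lambda>y. D (u + \<xi> *\<^sub>R a + y *\<^sub>R b) a) has_real_derivative Da (u + \<xi> *\<^sub>R a + y *\<^sub>R b) b) (at y)"
        unfolding has_field_derivative_def
        by (intro has_derivative_eq_rhs[OF 3]) (simp add: fun_eq_iff linear_cmul[OF has_derivative_linear[OF Da[OF i]]])
    qed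
    then obtain \<eta> where \<eta>: "0 < \<eta>" "\<eta> < s" "D (u + \<xi> *\<^sub>R a + s *\<^sub>R b) a - D (u + \<xi> *\<^sub>R a) a = s * Da (u + \<xi> *\<^sub>R a + \<eta> *\<^sub>R b) b" by auto
    have "h (u + s *\<^sub>R a + s *\<^sub>R b) - h (u + s *\<^sub>R a) - h (u + s *\<^sub>R b) + h u = g s - g 0"
      by (simp add: g_def)
    also have "\<dots> = s^2 * Da (u + \<xi> *\<^sub>R a + \<eta> *\<^sub>R b) b" unfolding \<xi>(3) \<eta>(3) by (simp add: power2_eq_square)
    finally have "(h (u + s *\<^sub>R a + s *\<^sub>R b) - h (u + s *\<^sub>R a) - h (u + s *\<^sub>R b) + h u) / s^2 = Da (u + \<xi> *\<^sub>R a + \<eta> *\<^sub>R b) b"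
      using s by simp
    then show ?thesis using r'(2) close[of \<xi> \<eta>] \<xi> \<eta> s by simp
  qed
  then show "\<forall>\<^sub>F s in at_right 0. dist ((h (u + s *\<^sub>R a + s *\<^sub>R b) - h (u + s *\<^sub>R a) - h (u + s *\<^sub>R b) + h u) / s^2) (Da u b) < e"
    unfolding eventually_at_right_field using d by blast
qed

lemma mixed_partials_real:
  fixes h :: "'a::real_normed_vector \<Rightarrow> real"
  assumes "open U" "u \<in> U"
    and D: "\<And>v. v \<in> U \<Longrightarrow> (h has_derivative D v) (at v)"
    and Da: "\<And>v. v \<in> U \<Longrightarrow> ((\<lambda>v. D v a) has_derivative Da v) (at v)"
    and Db: "\<And>v. v \<in> U \<Longrightarrow> ((\<lambda>v. D v b) has_derivative Db v) (at v)"
    and "continuous_on U (\<lambda>v. Da v b)" "continuous_on U (\<lambda>v. Db v a)"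
  shows "Da u b = Db u a"
proof -
  have 1: "((\<lambda>s. (h (u + s *\<^sub>R a + s *\<^sub>R b) - h (u + s *\<^sub>R a) - h (u + s *\<^sub>R b) + h u) / s^2) \<longlongrightarrow> Da u b) (at_right 0)"
    by (rule mixed_partials_aux[where D = D and Da = Da]) (use assms in auto)
  have "((\<lambda>s. (h (u + s *\<^sub>R b + s *\<^sub>R a) - h (u + s *\<^sub>R b) - h (u + s *\<^sub>R a) + h u) / s^2) \<longlongrightarrow> Db u a) (at_right 0)"
    by (rule mixed_partials_aux[where D = D and Da = Db]) (use assms in auto)
  then have 2: "((\<lambda>s. (h (u + s *\<^sub>R a + s *\<^sub>R b) - h (u + s *\<^sub>R a) - h (u + s *\<^sub>R b) + h u) / s^2) \<longlongrightarrow> Db u a) (at_right 0)"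
    by (simp add: algebra_simps)
  show ?thesis using tendsto_unique[OF _ 1 2] by simp
qed

lemma Ck_on_2_symmetric:
  fixes h :: "'a::euclidean_space \<Rightarrow> 'b::euclidean_space"
  assumes "open U" "u \<in> U" "Ck_on (Suc (Suc 0)) U h"
  shows "frechet_derivative (\<lambda>v. frechet_derivative h (at v) a) (at u) b = frechet_derivative (\<lambda>v. frechet_derivative h (at v) b) (at u) a"
proof (rule euclidean_eqI)
  fix e :: 'b assume "e \<in> Basis"
  have D: "(h has_derivative frechet_derivative h (at v)) (at v)" if "v \<in> U" for v
    using assms(3) that by (simp add: frechet_derivative_works)
  have DD: "((\<lambda>v. frechet_derivative h (at v) c) has_derivative frechet_derivative (\<lambda>v. frechet_derivative h (at v) c) (at v)) (at v)" if "v \<in> U" for v c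
    using assms(3) that by (simp add: frechet_derivative_works)
  have C: "continuous_on U (\<lambda>v. frechet_derivative (\<lambda>v. frechet_derivative h (at v) c) (at v) d)" for c d
    using assms(3) by simp
  show "frechet_derivative (\<lambda>v. frechet_derivative h (at v) a) (at u) b \<bullet> e = frechet_derivative (\<lambda>v. frechet_derivative h (at v) b) (at u) a \<bullet> e"
    by (rule mixed_partials_real[OF assms(1,2), where h = "\<lambda>v. h v \<bullet> e" and D = "\<lambda>v w. frechet_derivative h (at v) w \<bullet> e"
          and Da = "\<lambda>v w. frechet_derivative (\<lambda>v. frechet_derivative h (at v) a) (at v) w \<bullet> e"
          and Db = "\<lambda>v w. frechet_derivative (\<lambda>v. frechet_derivative h (at v) b) (at v) w \<bullet> e"])
       (intro has_derivative_inner_left D DD continuous_intros C | assumption)+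
qed

section \<open>Calculus of maps with continuous first derivatives\<close>

definition C1_on :: "'a::euclidean_space set \<Rightarrow> ('a \<Rightarrow> 'b::real_normed_vector) \<Rightarrow> bool" where
  "C1_on V h \<longleftrightarrow> (\<forall>u\<in>V. h differentiable at u) \<and> (\<forall>v. continuous_on V (\<lambda>u. frechet_derivative h (at u) v))"

lemma C1_onI:
  assumes "\<And>u. u \<in> V \<Longrightarrow> (h has_derivative h' u) (at u)" "\<And>v. continuous_on V (\<lambda>u. h' u v)"
  shows "C1_on V h"
proof -
  have "frechet_derivative h (at u) = h' u" if "u \<in> V" for u
    using frechet_derivative_at[OF assms(1)[OF that]] by simp
  then have "continuous_on V (\<lambda>u. frechet_derivative h (at u) v)" for v
    using assms(2)[of v] by (subst continuous_on_cong[where g = "\<lambda>u. h' u v"]) auto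
  then show ?thesis unfolding C1_on_def differentiable_def using assms(1) by blast
qed

lemma C1_onD:
  assumes "C1_on V h"
  shows "u \<in> V \<Longrightarrow> (h has_derivative frechet_derivative h (at u)) (at u)"
    and "continuous_on V (\<lambda>u. frechet_derivative h (at u) v)"
    and "u \<in> V \<Longrightarrow> h differentiable at u"
  using assms by (auto simp: C1_on_def frechet_derivative_works)

lemma C1_on_continuous: "C1_on V h \<Longrightarrow> continuous_on V h"
  by (meson C1_onD(3) continuous_at_imp_continuous_on differentiable_imp_continuous_within)

lemma C1_on_subset: "C1_on V h \<Longrightarrow> W \<subseteq> V \<Longrightarrow> C1_on W h"
  unfolding C1_on_def by (meson continuous_on_subset subsetD)

lemma C1_on_cong:
  assumes "open V" "\<And>u. u \<in> V \<Longrightarrow> h u = k u" "C1_on V k" shows "C1_on V h"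
proof (rule C1_onI)
  fix u assume u: "u \<in> V"
  show "(h has_derivative frechet_derivative k (at u)) (at u)"
    by (rule has_derivative_transform_within_open[OF C1_onD(1)[OF assms(3) u] assms(1) u]) (use assms(2) in simp)
qed (rule C1_onD(2)[OF assms(3)])

lemma smooth_on_C1: "smooth_on V h \<Longrightarrow> C1_on V h"
  unfolding smooth_on_def C1_on_def by (drule spec[of _ "Suc 0"]) simp

lemma smooth_on_C1_derivative: "smooth_on V h \<Longrightarrow> C1_on V (\<lambda>u. frechet_derivative h (at u) v)"
  unfolding smooth_on_def C1_on_def by (drule spec[of _ "Suc (Suc 0)"]) simp

lemma C1_on_const: "C1_on V (\<lambda>_. c)"
  by (rule C1_onI[where h' = "\<lambda>_ _. 0"]) auto

lemma C1_on_id: "C1_on V (\<lambda>u. u)"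
  by (rule C1_onI[where h' = "\<lambda>_ v. v"]) auto

lemma C1_on_bounded_linear:
  assumes "bounded_linear L" "C1_on V h" shows "C1_on V (\<lambda>u. L (h u))"
  by (rule C1_onI[where h' = "\<lambda>u v. L (frechet_derivative h (at u) v)"])
     (auto intro!: bounded_linear.has_derivative[OF assms(1)] bounded_linear.continuous_on[OF assms(1)] C1_onD[OF assms(2)])

lemma C1_on_bounded_bilinear:
  assumes "bounded_bilinear B" "C1_on V h" "C1_on V k" shows "C1_on V (\<lambda>u. B (h u) (k u))"
  by (rule C1_onI[where h' = "\<lambda>u v. B (h u) (frechet_derivative k (at u) v) + B (frechet_derivative h (at u) v) (k u)"])
     (intro bounded_bilinear.FDERIV[OF assms(1)] bounded_bilinear.continuous_on[OF assms(1)] continuous_on_add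
       C1_onD[OF assms(2)] C1_onD[OF assms(3)] C1_on_continuous[OF assms(2)] C1_on_continuous[OF assms(3)] | assumption)+

lemma C1_on_add: "C1_on V h \<Longrightarrow> C1_on V k \<Longrightarrow> C1_on V (\<lambda>u. h u + k u)"
  by (rule C1_onI[where h' = "\<lambda>u v. frechet_derivative h (at u) v + frechet_derivative k (at u) v"])
     (auto intro!: derivative_intros continuous_intros dest: C1_onD)

lemma C1_on_minus: "C1_on V h \<Longrightarrow> C1_on V (\<lambda>u. - h u)"
  by (rule C1_on_bounded_linear[OF bounded_linear_minus[OF bounded_linear_ident]])

lemma C1_on_diff: "C1_on V h \<Longrightarrow> C1_on V k \<Longrightarrow> C1_on V (\<lambda>u. h u - k u)"
  using C1_on_add[of V h "\<lambda>u. - k u"] C1_on_minus[of V k] by simp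

lemma C1_on_sum:
  assumes "\<And>i. i \<in> I \<Longrightarrow> C1_on V (h i)" shows "C1_on V (\<lambda>u. \<Sum>i\<in>I. h i u)"
proof (cases "finite I")
  case True
  then show ?thesis using assms
    by (induction I) (auto intro: C1_on_const C1_on_add)
qed (auto intro: C1_on_const)

lemmas C1_on_mult = C1_on_bounded_bilinear[OF bounded_bilinear_mult]
lemmas C1_on_scaleR = C1_on_bounded_bilinear[OF bounded_bilinear_scaleR]
lemmas C1_on_inner = C1_on_bounded_bilinear[OF bounded_bilinear_inner]

lemma C1_on_prod:
  fixes h :: "'i \<Rightarrow> 'a::euclidean_space \<Rightarrow> real"
  assumes "\<And>i. i \<in> I \<Longrightarrow> C1_on V (h i)" shows "C1_on V (\<lambda>u. \<Prod>i\<in>I. h i u)"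
proof (cases "finite I")
  case True
  then show ?thesis using assms
    by (induction I) (auto intro: C1_on_const C1_on_mult)
qed (auto intro: C1_on_const)

lemma C1_on_real_compose:
  fixes h :: "'a::euclidean_space \<Rightarrow> real"
  assumes "C1_on V h" "\<And>u. u \<in> V \<Longrightarrow> h u \<in> S" "\<And>x. x \<in> S \<Longrightarrow> (F has_real_derivative F' x) (at x)" "continuous_on S F'"
  shows "C1_on V (\<lambda>u. F (h u))"
proof (rule C1_onI[where h' = "\<lambda>u v. F' (h u) * frechet_derivative h (at u) v"])
  fix u assume u: "u \<in> V"
  show "((\<lambda>u. F (h u)) has_derivative (\<lambda>v. F' (h u) * frechet_derivative h (at u) v)) (at u)"
    using has_derivative_compose[OF C1_onD(1)[OF assms(1) u] assms(3)[OF assms(2)[OF u], unfolded has_field_derivative_def]] .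
next
  fix v
  have "continuous_on V (\<lambda>u. F' (h u))"
    by (rule continuous_on_compose2[OF assms(4) C1_on_continuous[OF assms(1)]]) (use assms(2) in auto)
  then show "continuous_on V (\<lambda>u. F' (h u) * frechet_derivative h (at u) v)"
    by (intro continuous_intros C1_onD(2)[OF assms(1)])
qed

lemma C1_on_inverse:
  fixes h :: "'a::euclidean_space \<Rightarrow> real"
  assumes "C1_on V h" "\<And>u. u \<in> V \<Longrightarrow> h u \<noteq> 0" shows "C1_on V (\<lambda>u. inverse (h u))"
  by (rule C1_on_real_compose[OF assms(1), where S = "- {0}" and F' = "\<lambda>x. - inverse (x * x)"])
     (use assms(2) in \<open>auto intro!: derivative_eq_intros continuous_intros simp: power2_eq_square\<close>)

lemma C1_on_divide:
  fixes h k :: "'a::euclidean_space \<Rightarrow> real"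
  assumes "C1_on V h" "C1_on V k" "\<And>u. u \<in> V \<Longrightarrow> k u \<noteq> 0" shows "C1_on V (\<lambda>u. h u / k u)"
  unfolding divide_inverse by (intro C1_on_mult C1_on_inverse assms)

lemma C1_on_sqrt:
  fixes h :: "'a::euclidean_space \<Rightarrow> real"
  assumes "C1_on V h" "\<And>u. u \<in> V \<Longrightarrow> h u > 0" shows "C1_on V (\<lambda>u. sqrt (h u))"
  by (rule C1_on_real_compose[OF assms(1), where S = "{0<..}" and F' = "\<lambda>x. inverse (sqrt x) / 2"])
     (use assms(2) in \<open>auto intro!: derivative_eq_intros continuous_intros\<close>)

lemma C1_on_vec_lambda:
  fixes h :: "'i::finite \<Rightarrow> 'a::euclidean_space \<Rightarrow> 'b::euclidean_space"
  assumes "\<And>i. C1_on V (h i)" shows "C1_on V (\<lambda>u. \<chi> i. h i u)"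
proof (rule C1_onI[where h' = "\<lambda>u v. \<chi> i. frechet_derivative (h i) (at u) v"])
  fix u assume u: "u \<in> V"
  show "((\<lambda>u. \<chi> i. h i u) has_derivative (\<lambda>v. \<chi> i. frechet_derivative (h i) (at u) v)) (at u)"
  proof -
    have b: "bounded_linear (\<lambda>x::'b. axis i x :: 'b^'i)" for i
      by (rule linear_conv_bounded_linear[THEN iffD1], rule linearI) (auto simp: axis_def vec_eq_iff)
    have e: "(\<chi> i. k i) = (\<Sum>i\<in>UNIV. axis i (k i))" for k :: "'i \<Rightarrow> 'b"
      by (simp add: vec_eq_iff axis_def if_distrib cong: if_cong)
    show ?thesis unfolding e
      by (intro has_derivative_sum bounded_linear.has_derivative[OF b] C1_onD(1)[OF assms u])
  qed
qed (intro continuous_on_vec_lambda C1_onD(2)[OF assms])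

lemma C1_on_vec_nth: "C1_on V h \<Longrightarrow> C1_on V (\<lambda>u. h u $ i)"
  by (rule C1_on_bounded_linear[OF bounded_linear_vec_nth])

lemma C1_on_det:
  fixes M :: "'a::euclidean_space \<Rightarrow> real^'n^'n::finite"
  assumes "C1_on V M" shows "C1_on V (\<lambda>u. det (M u))"
  unfolding det_def by (intro C1_on_sum C1_on_mult C1_on_const C1_on_prod C1_on_vec_nth assms)

lemma C1_on_trace:
  fixes M :: "'a::euclidean_space \<Rightarrow> real^'n^'n::finite"
  assumes "C1_on V M" shows "C1_on V (\<lambda>u. trace (M u))"
  unfolding trace_def by (intro C1_on_sum C1_on_vec_nth assms)

lemma C1_on_matrix_mult:
  fixes M M' :: "'a::euclidean_space \<Rightarrow> real^'n^'n::finite"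
  assumes "C1_on V M" "C1_on V M'" shows "C1_on V (\<lambda>u. M u ** M' u)"
  unfolding matrix_matrix_mult_def by (intro C1_on_vec_lambda C1_on_sum C1_on_mult C1_on_vec_nth assms)

lemma C1_on_matrix_vector_mult:
  fixes M :: "'a::euclidean_space \<Rightarrow> real^'n^'n::finite"
  assumes "C1_on V M" "C1_on V h" shows "C1_on V (\<lambda>u. M u *v h u)"
  unfolding matrix_vector_mult_def by (intro C1_on_vec_lambda C1_on_sum C1_on_mult C1_on_vec_nth assms)

text \<open>Cramer's rule makes the solution rational in the data. The shape operator and the
  tangential part of an ambient field are characterized only by linear equations, and obtain their
  differentiability in this way.\<close>

lemma C1_on_linear_solve:
  fixes M :: "'a::euclidean_space \<Rightarrow> real^'n^'n::finite"
  assumes "C1_on V M" "C1_on V h" "\<And>u. u \<in> V \<Longrightarrow> det (M u) \<noteq> 0" "open V" "\<And>u. u \<in> V \<Longrightarrow> M u *v z u = h u"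
  shows "C1_on V z"
proof (rule C1_on_cong[OF assms(4)])
  show "z u = (\<chi> k. det (\<chi> i j. if j = k then h u $ i else M u $ i $ j) / det (M u))" if "u \<in> V" for u
    using cramer[OF assms(3)[OF that], of "z u" "h u"] assms(5)[OF that] by simp
  have "C1_on V (\<lambda>u. if j = k then h u $ i else M u $ i $ j)" for i j k
    by (cases "j = k") (auto intro!: C1_on_vec_nth assms)
  then show "C1_on V (\<lambda>u. \<chi> k. det (\<chi> i j. if j = k then h u $ i else M u $ i $ j) / det (M u))"
    by (intro C1_on_vec_lambda C1_on_divide C1_on_det assms) 
qed

lemma C1_on_compose:
  fixes h :: "'a::euclidean_space \<Rightarrow> 'b::euclidean_space"
  assumes h: "C1_on V h" and k: "C1_on W k" and "h ` V \<subseteq> W"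
  shows "C1_on V (\<lambda>u. k (h u))"
proof (rule C1_onI[where h' = "\<lambda>u v. frechet_derivative k (at (h u)) (frechet_derivative h (at u) v)"])
  fix u assume u: "u \<in> V"
  show "((\<lambda>u. k (h u)) has_derivative (\<lambda>v. frechet_derivative k (at (h u)) (frechet_derivative h (at u) v))) (at u)"
    by (rule has_derivative_compose[OF C1_onD(1)[OF h u] C1_onD(1)[OF k]]) (use assms u in auto)
next
  fix v
  have lin: "linear (frechet_derivative k (at (h u)))" if "u \<in> V" for u
    using C1_onD(1)[OF k] assms(3) that has_derivative_linear by blast
  have c: "continuous_on V (\<lambda>u. frechet_derivative k (at (h u)) b)" for b
    by (rule continuous_on_compose2[OF C1_onD(2)[OF k] C1_on_continuous[OF h] assms(3)])
  have "continuous_on V (\<lambda>u. \<Sum>b\<in>Basis. (frechet_derivative h (at u) v \<bullet> b) *\<^sub>R frechet_derivative k (at (h u)) b)"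
    by (intro continuous_intros c C1_onD(2)[OF h])
  moreover have "(\<Sum>b\<in>Basis. (frechet_derivative h (at u) v \<bullet> b) *\<^sub>R frechet_derivative k (at (h u)) b)
      = frechet_derivative k (at (h u)) (frechet_derivative h (at u) v)" if "u \<in> V" for u
  proof -
    have "frechet_derivative k (at (h u)) (frechet_derivative h (at u) v)
        = frechet_derivative k (at (h u)) (\<Sum>b\<in>Basis. (frechet_derivative h (at u) v \<bullet> b) *\<^sub>R b)"
      by (simp add: euclidean_representation)
    then show ?thesis by (simp only: linear_sum[OF lin[OF that]] linear_cmul[OF lin[OF that]])
  qed
  ultimately show "continuous_on V (\<lambda>u. frechet_derivative k (at (h u)) (frechet_derivative h (at u) v))"
    by (rule continuous_on_eq)
qed

section \<open>Testing a divergence with a Lipschitz function\<close>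

lemma absolutely_integrable_compact:
  fixes f :: "'a::euclidean_space \<Rightarrow> 'b::euclidean_space"
  assumes "compact K" "continuous_on K f"
  shows "f absolutely_integrable_on K"
proof -
  have "integrable lborel (\<lambda>x. indicator K x *\<^sub>R f x)"
    by (rule borel_integrable_compact[OF assms])
  then have "integrable lebesgue (\<lambda>x. indicator K x *\<^sub>R f x)"
    by (subst integrable_completion) auto
  then show ?thesis by (simp add: set_integrable_def)
qed

lemma integrable_on_compact:
  fixes f :: "'a::euclidean_space \<Rightarrow> 'b::euclidean_space"
  assumes "compact K" "continuous_on K f"
  shows "f integrable_on K"
  using absolutely_integrable_compact[OF assms] set_lebesgue_integral_eq_integral(1) by blast

text \<open>A preimage of y is a fixed point of the contraction x \<mapsto> y - W x.\<close>

lemma surj_id_plus_contraction: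
  fixes W :: "'a::banach \<Rightarrow> 'a"
  assumes "0 \<le> c" "c < 1" "\<And>x y. norm (W x - W y) \<le> c * norm (x - y)"
  shows "inj (\<lambda>x. x + W x)" "surj (\<lambda>x. x + W x)"
proof -
  show "inj (\<lambda>x. x + W x)"
  proof (rule injI, rule ccontr)
    fix x y assume "x + W x = y + W y" "x \<noteq> y"
    then have "x - y = W y - W x" by (simp add: algebra_simps)
    then have "norm (x - y) \<le> c * norm (x - y)" using assms(3)[of y x] by (simp add: norm_minus_commute)
    moreover have "c * norm (x - y) < 1 * norm (x - y)"
      using \<open>x \<noteq> y\<close> assms(2) by (intro mult_strict_right_mono) auto
    ultimately show False by simp
  qed
  show "surj (\<lambda>x. x + W x)"
    unfolding surj_def
  proof
    fix y
    have "\<exists>!x. y - W x = x"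
      by (rule banach_fix_type[OF assms(1,2)]) (use assms(3) in \<open>auto simp: dist_norm norm_minus_commute\<close>)
    then obtain x where "y - W x = x" by blast
    then show "\<exists>x. y = x + W x" by (metis diff_add_cancel)
  qed
qed

lemma change_of_variables_self_map:
  fixes \<phi> :: "real^'m::{finite,wellorder} \<Rightarrow> real" and T :: "real^'m::_ \<Rightarrow> real^'m::_"
  assumes K: "compact K" "inj_on T K" "T ` K = K"
    and d: "\<And>u. u \<in> K \<Longrightarrow> (T has_derivative T' u) (at u)"
    and \<phi>: "continuous_on K \<phi>"
  shows "(\<lambda>u. \<bar>det (matrix (T' u))\<bar> * \<phi> (T u)) integrable_on K"
    and "integral K (\<lambda>u. \<bar>det (matrix (T' u))\<bar> * \<phi> (T u)) = integral K \<phi>"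
proof -
  \<comment> \<open>The transformation formula applies to vector-valued integrands, so the real
    function is carried through real^1 and back.\<close>
  let ?f = "\<lambda>u. vec (\<phi> u) :: real^1"
  let ?h = "\<lambda>u. \<bar>det (matrix (T' u))\<bar> *\<^sub>R ?f (T u)"
  have cf: "continuous_on K ?f" unfolding vec_def by (intro continuous_on_vec_lambda \<phi>)
  have 1: "?h absolutely_integrable_on K \<and> integral K ?h = integral K ?f"
    using has_absolute_integral_change_of_variables_compact[OF K(1) has_derivative_at_withinI[OF d] K(2), of ?f "integral K ?f"]
      absolutely_integrable_compact[OF K(1) cf] unfolding K(3) by blast
  then have i: "?h integrable_on K" using set_lebesgue_integral_eq_integral(1) by blast
  have e: "(\<lambda>u. \<bar>det (matrix (T' u))\<bar> * \<phi> (T u)) = (\<lambda>v. v $ 1) \<circ> ?h" "\<phi> = (\<lambda>v. v $ 1) \<circ> ?f"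
    by (auto simp: fun_eq_iff)
  show "(\<lambda>u. \<bar>det (matrix (T' u))\<bar> * \<phi> (T u)) integrable_on K"
    unfolding e(1) by (rule integrable_linear[OF i bounded_linear_vec_nth])
  have "integral K ((\<lambda>v. v $ 1) \<circ> ?h) = integral K ?h $ 1"
    by (rule integral_linear[OF i bounded_linear_vec_nth])
  moreover have "integral K ((\<lambda>v. v $ 1) \<circ> ?f) = integral K ?f $ 1"
    by (rule integral_linear[OF integrable_on_compact[OF K(1) cf] bounded_linear_vec_nth])
  ultimately show "integral K (\<lambda>u. \<bar>det (matrix (T' u))\<bar> * \<phi> (T u)) = integral K \<phi>"
    using 1 unfolding e[symmetric] by simp
qed

lemma compact_bound:
  fixes f :: "'a::topological_space \<Rightarrow> 'b::real_normed_vector"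
  assumes "compact K" "continuous_on K f"
  obtains B where "B \<ge> 0" "\<And>u. u \<in> K \<Longrightarrow> norm (f u) \<le> B"
proof -
  have "bounded (f ` K)" using assms by (simp add: compact_continuous_image compact_imp_bounded)
  then obtain B where "\<forall>x\<in>f ` K. norm x \<le> B" unfolding bounded_iff by blast
  then show ?thesis by (intro that[of "max B 0"]) (auto simp: le_max_iff_disj)
qed

text \<open>The map \<open>u \<mapsto> u + \<epsilon> W u\<close> permutes \<open>K\<close> and has Jacobian \<open>1 + \<epsilon> div W + o(\<epsilon>)\<close>, so that the
  transformation formula moves the derivative from \<open>W\<close> to the merely Lipschitz function \<open>\<phi>\<close>.\<close>

lemma integral_lipschitz_mult_divergence_wellorder:
  fixes W :: "real^'m::{finite,wellorder} \<Rightarrow> real^'m::_" and \<phi> :: "real^'m::_ \<Rightarrow> real"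
  assumes K: "compact K" and supp: "\<And>u. u \<notin> K \<Longrightarrow> W u = 0"
    and W: "\<And>u. (W has_derivative DW u) (at u)" "\<And>v. continuous_on UNIV (\<lambda>u. DW u v)"
    and \<phi>: "continuous_on K \<phi>"
    and n: "\<And>u h s. s \<ge> 0 \<Longrightarrow> n u (s *\<^sub>R h) = s * n u h" "\<And>u h. n u h \<ge> 0" "continuous_on K (\<lambda>u. n u (W u))"
    and ell: "Lp \<ge> 0"
    and lip: "\<And>e. e > 0 \<Longrightarrow> \<exists>d>0. \<forall>u\<in>K. \<forall>h. norm h < d \<and> u + h \<in> K \<longrightarrow> \<bar>\<phi> (u + h) - \<phi> u\<bar> \<le> Lp * (n u h + e * norm h)"
  shows "\<bar>integral K (\<lambda>u. \<phi> u * trace (matrix (DW u)))\<bar> \<le> Lp * integral K (\<lambda>u. n u (W u))"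
proof -
  define D where "D u = matrix (DW u)" for u
  have lin: "linear (DW u)" for u using W(1) has_derivative_linear by blast
  have Dcont: "continuous_on S D" for S
    unfolding D_def matrix_def
    by (intro continuous_on_vec_lambda continuous_on_subset[OF continuous_on_component[OF W(2)]]) auto
  have dtr: "continuous_on S (\<lambda>u. trace (D u))" for S
    unfolding trace_def by (intro continuous_intros Dcont)
  obtain B where B: "B \<ge> 0" "\<And>u. u \<in> K \<Longrightarrow> \<bar>\<phi> u\<bar> \<le> B" using compact_bound[OF K \<phi>] by (metis real_norm_def)
  obtain C where C: "C \<ge> 0" "\<And>u. u \<in> K \<Longrightarrow> norm (D u) \<le> C" using compact_bound[OF K Dcont] by metis
  obtain Ct where Ct: "Ct \<ge> 0" "\<And>u. u \<in> K \<Longrightarrow> \<bar>trace (D u)\<bar> \<le> Ct" using compact_bound[OF K dtr] by (metis real_norm_def)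
  have Wcont: "continuous_on S W" for S
    using W(1) by (meson continuous_at_imp_continuous_on has_derivative_continuous)
  obtain Wb where Wb: "Wb \<ge> 0" "\<And>u. u \<in> K \<Longrightarrow> norm (W u) \<le> Wb" using compact_bound[OF K Wcont] by metis
  have DW: "DW u h = D u *v h" for u h unfolding D_def using fun_cong[OF matrix_vector_mul(2)[OF lin[of u]], of h] by simp
  have D0: "D u = 0" if "u \<notin> K" for u
  proof -
    have "open (- K)" using K compact_imp_closed by blast
    have "(W has_derivative (\<lambda>_. 0)) (at u)"
      by (rule has_derivative_transform_within_open[OF has_derivative_const[of 0] \<open>open (- K)\<close>])
         (use that supp in auto)
    then have "DW u = (\<lambda>_. 0)" using has_derivative_unique[OF W(1)] by blast
    then show ?thesis by (simp add: D_def matrix_def vec_eq_iff)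
  qed
  \<comment> \<open>The derivative vanishes off K, so its bound on K holds everywhere and W is
    Lipschitz on the whole space.\<close>
  obtain L where L: "L \<ge> 0" "\<And>u v. norm (W u - W v) \<le> L * norm (u - v)"
  proof -
    define L where "L = of_nat CARD('m::_) * C"
    have onL: "onorm (DW u) \<le> L" for u
    proof (rule onorm_le)
      fix h
      have "norm (DW u h) \<le> norm (\<Sum>i\<in>UNIV. h $ i *\<^sub>R column i (D u))"
        unfolding DW by (simp add: matrix_mult_sum scalar_mult_eq_scaleR)
      also have "\<dots> \<le> (\<Sum>i\<in>UNIV. norm (h $ i *\<^sub>R column i (D u)))" by (rule norm_sum)
      also have "\<dots> \<le> (\<Sum>i\<in>(UNIV::'m::_ set). norm h * C)"
      proof (rule sum_mono)
        fix i :: "'m::_"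
        have "norm (column i (D u)) \<le> norm (D u)"
        proof -
          have "norm (column i (D u)) \<le> L2_set (\<lambda>k. norm (D u $ k)) UNIV"
            unfolding norm_vec_def[of "column i (D u)"]
            by (intro L2_set_mono) (auto simp: column_def intro: component_le_norm_cart)
          then show ?thesis by (simp add: norm_vec_def)
        qed
        also have "\<dots> \<le> C" using C D0[of u] by (cases "u \<in> K") auto
        finally show "norm (h $ i *\<^sub>R column i (D u)) \<le> norm h * C"
          using component_le_norm_cart[of h i] C by (auto intro!: mult_mono)
      qed
      finally show "norm (DW u h) \<le> L * norm h" by (simp add: L_def mult.commute mult.left_commute)
    qed
    have "norm (W u - W v) \<le> L * norm (u - v)" for u v
      by (rule differentiable_bound[of UNIV W DW]) (use W(1) onL in auto)
    moreover have "L \<ge> 0" using C by (simp add: L_def)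
    ultimately show ?thesis using that by blast
  qed
  define V where "V = integral K (\<lambda>u. 1::real)"
  define J where "J = integral K (\<lambda>u. n u (W u))"
  define I where "I = integral K (\<lambda>u. \<phi> u * trace (D u))"
  have V: "V \<ge> 0" unfolding V_def by (rule integral_nonneg[OF integrable_on_compact[OF K continuous_on_const]]) simp
  have J: "J \<ge> 0" unfolding J_def by (rule integral_nonneg[OF integrable_on_compact[OF K n(3)]]) (rule n(2))
  have main: "\<bar>I\<bar> \<le> \<eta> * B * C * V + Lp * (1 + \<eta>) * (J + \<eta> * Wb * V)" if \<eta>: "0 < \<eta>" "\<eta> \<le> 1" for \<eta>
  proof -
    obtain \<delta> where \<delta>: "\<delta> > 0" "\<And>H::real^'m::_^'m::_. norm H < \<delta> \<Longrightarrow> \<bar>det (mat 1 + H) - 1 - trace H\<bar> \<le> \<eta> * norm H"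
    proof -
      have "\<forall>e>0. \<exists>d>0. \<forall>Y::real^'m::_^'m::_. norm (Y - mat 1) < d \<longrightarrow> norm (det Y - det (mat 1 :: real^'m::_^'m::_) - trace (Y - mat 1)) \<le> e * norm (Y - mat 1)"
        using has_derivative_det_mat_1 unfolding has_derivative_at_alt by blast
      then obtain \<delta> where "\<delta> > 0" and \<delta>: "\<forall>Y::real^'m::_^'m::_. norm (Y - mat 1) < \<delta> \<longrightarrow> norm (det Y - det (mat 1 :: real^'m::_^'m::_) - trace (Y - mat 1)) \<le> \<eta> * norm (Y - mat 1)"
        using \<eta>(1) by blast
      have H: "\<bar>det (mat 1 + H) - 1 - trace H\<bar> \<le> \<eta> * norm H" if "norm H < \<delta>" for H :: "real^'m::_^'m::_"
        using \<delta>[rule_format, of "mat 1 + H"] that by simp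
      show ?thesis by (rule that[OF \<open>\<delta> > 0\<close> H])
    qed
    obtain d where d: "d > 0" "\<And>u h. u \<in> K \<Longrightarrow> norm h < d \<Longrightarrow> u + h \<in> K \<Longrightarrow> \<bar>\<phi> (u + h) - \<phi> u\<bar> \<le> Lp * (n u h + \<eta> * norm h)"
      using lip[OF \<eta>(1)] by blast
    \<comment> \<open>M dominates all constants, so a single step size \<epsilon> makes T injective
      (through L), keeps the Jacobian within reach of the determinant expansion (C), keeps
      displacements below d (Wb), and keeps the determinant between 0 and 1 + \<eta> (Ct +
      C).\<close>
    define M where "M = L + C + Wb + Ct + 1"
    have M: "M > 0" "L \<le> M" "C \<le> M" "Wb \<le> M" "Ct + C \<le> M"
      using L C Wb Ct by (auto simp: M_def)
    define \<epsilon> where "\<epsilon> = min (min \<delta> d) \<eta> / (2 * M)"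
    have \<epsilon>: "\<epsilon> > 0" using \<delta> d \<eta> M by (simp add: \<epsilon>_def)
    have small: "\<epsilon> * x < min (min \<delta> d) \<eta>" if "x \<le> M" for x
    proof -
      have "\<epsilon> * x \<le> \<epsilon> * M" using that \<epsilon> by simp
      also have "\<epsilon> * M = min (min \<delta> d) \<eta> / 2" using M by (simp add: \<epsilon>_def)
      also have "\<dots> < min (min \<delta> d) \<eta>"
      proof -
        have "r / 2 < r" if "r > 0" for r :: real using that by simp
        then show ?thesis using \<delta>(1) d(1) \<eta>(1) by (metis min_less_iff_conj)
      qed
      finally show ?thesis .
    qed
    define T where "T u = u + \<epsilon> *\<^sub>R W u" for u
    have "norm (\<epsilon> *\<^sub>R W x - \<epsilon> *\<^sub>R W y) \<le> (\<epsilon> * L) * norm (x - y)" for x y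
      using L(2)[of x y] \<epsilon> by (simp add: scaleR_diff_right[symmetric] mult.assoc)
    moreover have "0 \<le> \<epsilon> * L" "\<epsilon> * L < 1" using \<epsilon> L small[OF M(2)] \<eta> by auto
    ultimately have injT: "inj T" and surjT: "surj T"
      using surj_id_plus_contraction[of "\<epsilon> * L" "\<lambda>u. \<epsilon> *\<^sub>R W u"] unfolding T_def[abs_def] by auto
    have Tout: "T u = u" if "u \<notin> K" for u using supp[OF that] by (simp add: T_def)
    \<comment> \<open>T is the identity off K, so a point of K sent outside would have the same
      image as its image point.\<close>
    have TK: "T u \<in> K" if "u \<in> K" for u
    proof (rule ccontr)
      assume "T u \<notin> K"
      then have "T (T u) = T u" by (rule Tout)
      then have "T u = u" using injT by (simp add: inj_def)
      then show False using that \<open>T u \<notin> K\<close> by simp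
    qed
    have TKK: "T ` K = K"
    proof (intro equalityI subsetI)
      fix y assume y: "y \<in> K"
      obtain x where x: "y = T x" using surjT by blast
      have "x \<in> K" using Tout[of x] x y by (cases "x \<in> K") auto
      then show "y \<in> T ` K" using x by blast
    qed (use TK in auto)
    have dT: "(T has_derivative (\<lambda>h. h + \<epsilon> *\<^sub>R DW u h)) (at u)" for u
      unfolding T_def[abs_def] by (intro derivative_intros W(1))
    define q where "q u = \<bar>det (mat 1 + \<epsilon> *\<^sub>R D u)\<bar>" for u
    have mT: "matrix (\<lambda>h. h + \<epsilon> *\<^sub>R DW u h) = mat 1 + \<epsilon> *\<^sub>R D u" for u
      by (auto simp: matrix_def D_def vec_eq_iff mat_def axis_def)
    note cv = change_of_variables_self_map[OF K inj_on_subset[OF injT subset_UNIV] TKK dT \<phi>, unfolded mT, folded q_def]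
    have qb: "\<bar>q u - 1 - \<epsilon> * trace (D u)\<bar> \<le> \<eta> * \<epsilon> * C" "q u \<le> 1 + \<eta>" if u: "u \<in> K" for u
    proof -
      have nD: "norm (\<epsilon> *\<^sub>R D u) \<le> \<epsilon> * C" using C(2)[OF u] \<epsilon> by simp
      have tr: "trace (\<epsilon> *\<^sub>R D u) = \<epsilon> * trace (D u)" by (simp add: trace_def sum_distrib_left)
      have "norm (\<epsilon> *\<^sub>R D u) < \<delta>" using nD small[OF M(3)] by simp
      from \<delta>(2)[OF this] have 1: "\<bar>det (mat 1 + \<epsilon> *\<^sub>R D u) - 1 - \<epsilon> * trace (D u)\<bar> \<le> \<eta> * norm (\<epsilon> *\<^sub>R D u)"
        unfolding tr .
      also have "\<dots> \<le> \<eta> * (\<epsilon> * C)" by (rule mult_left_mono[OF nD]) (use \<eta> in simp)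
      finally have 2: "\<bar>det (mat 1 + \<epsilon> *\<^sub>R D u) - 1 - \<epsilon> * trace (D u)\<bar> \<le> \<eta> * \<epsilon> * C" by (simp add: mult.assoc)
      have 3: "\<bar>\<epsilon> * trace (D u)\<bar> \<le> \<epsilon> * Ct" using Ct(2)[OF u] \<epsilon> by (simp add: abs_mult)
      have 4: "\<eta> * \<epsilon> * C \<le> \<epsilon> * C" using \<eta> \<epsilon> C(1) by (simp add: mult_left_le_one_le mult_right_mono)
      have 5: "\<epsilon> * Ct + \<epsilon> * C < \<eta>" using small[OF M(5)] by (simp add: distrib_left)
      have "det (mat 1 + \<epsilon> *\<^sub>R D u) > 0" using 2 3 4 5 \<eta> by linarith
      then have q: "q u = det (mat 1 + \<epsilon> *\<^sub>R D u)" by (simp add: q_def)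
      show "\<bar>q u - 1 - \<epsilon> * trace (D u)\<bar> \<le> \<eta> * \<epsilon> * C" using 2 by (simp add: q)
      show "q u \<le> 1 + \<eta>" using 2 3 4 5 unfolding q by linarith
    qed
    have qc: "continuous_on K q"
      unfolding q_def det_def by (intro continuous_intros Dcont)
    have Tc: "continuous_on K T" unfolding T_def[abs_def] by (intro continuous_intros Wcont)
    have \<phi>T: "continuous_on K (\<lambda>u. \<phi> (T u))"
      by (rule continuous_on_compose2[OF \<phi> Tc]) (use TK in auto)
    have int: "h integrable_on K" if "continuous_on K h" for h :: "real^'m::_ \<Rightarrow> real" by (rule integrable_on_compact[OF K that])
    \<comment> \<open>The change of variables rewrites the integral of \<phi> as that of q times
      \<phi> composed with T. The divergence hidden in q - 1 is thereby exchanged for the increment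
      \<phi> - \<phi> T, which the Lipschitz condition controls.\<close>
    have "integral K (\<lambda>u. \<phi> u * (q u - 1)) = integral K (\<lambda>u. \<phi> u * q u) - integral K \<phi>"
      by (subst integral_diff[symmetric]) (auto intro!: int continuous_intros qc \<phi> simp: algebra_simps)
    also have "\<dots> = integral K (\<lambda>u. \<phi> u * q u) - integral K (\<lambda>u. q u * \<phi> (T u))" by (simp only: cv(2))
    also have "\<dots> = integral K (\<lambda>u. (\<phi> u - \<phi> (T u)) * q u)"
      by (subst integral_diff[symmetric]) (auto intro!: int continuous_intros qc \<phi> \<phi>T simp: algebra_simps)
    finally have eq: "integral K (\<lambda>u. \<phi> u * (q u - 1)) = integral K (\<lambda>u. (\<phi> u - \<phi> (T u)) * q u)" .
    have "norm (integral K (\<lambda>u. (\<phi> u - \<phi> (T u)) * q u)) \<le> integral K (\<lambda>u. (Lp * (\<epsilon> * (n u (W u) + \<eta> * Wb))) * (1 + \<eta>))"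
    proof (rule integral_norm_bound_integral)
      show "(\<lambda>u. (\<phi> u - \<phi> (T u)) * q u) integrable_on K" by (intro int continuous_intros qc \<phi> \<phi>T)
      show "(\<lambda>u. (Lp * (\<epsilon> * (n u (W u) + \<eta> * Wb))) * (1 + \<eta>)) integrable_on K" by (intro int continuous_intros n(3))
      fix u assume u: "u \<in> K"
      have "norm (\<epsilon> *\<^sub>R W u) \<le> \<epsilon> * Wb" using Wb(2)[OF u] \<epsilon> by simp
      then have "norm (\<epsilon> *\<^sub>R W u) < d" using small[OF M(4)] by simp
      from d(2)[OF u this] TK[OF u]
      have "\<bar>\<phi> (T u) - \<phi> u\<bar> \<le> Lp * (n u (\<epsilon> *\<^sub>R W u) + \<eta> * norm (\<epsilon> *\<^sub>R W u))" by (simp add: T_def)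
      also have "\<dots> \<le> Lp * (\<epsilon> * (n u (W u) + \<eta> * Wb))"
      proof (rule mult_left_mono[OF _ ell])
        have "\<eta> * norm (\<epsilon> *\<^sub>R W u) \<le> \<eta> * (\<epsilon> * Wb)" by (rule mult_left_mono) (use \<open>norm (\<epsilon> *\<^sub>R W u) \<le> \<epsilon> * Wb\<close> \<eta> in auto)
        then show "n u (\<epsilon> *\<^sub>R W u) + \<eta> * norm (\<epsilon> *\<^sub>R W u) \<le> \<epsilon> * (n u (W u) + \<eta> * Wb)"
          using n(1)[of \<epsilon> u "W u"] \<epsilon> by (simp add: algebra_simps)
      qed
      finally have "\<bar>\<phi> u - \<phi> (T u)\<bar> \<le> Lp * (\<epsilon> * (n u (W u) + \<eta> * Wb))" by (simp add: abs_minus_commute)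
      then have "\<bar>\<phi> u - \<phi> (T u)\<bar> * q u \<le> (Lp * (\<epsilon> * (n u (W u) + \<eta> * Wb))) * (1 + \<eta>)"
        using qb(2)[OF u] by (intro mult_mono) (auto simp: q_def)
      then show "norm ((\<phi> u - \<phi> (T u)) * q u) \<le> (Lp * (\<epsilon> * (n u (W u) + \<eta> * Wb))) * (1 + \<eta>)"
        by (simp add: abs_mult q_def)
    qed
    also have "integral K (\<lambda>u. (Lp * (\<epsilon> * (n u (W u) + \<eta> * Wb))) * (1 + \<eta>)) = \<epsilon> * (Lp * (1 + \<eta>) * (J + \<eta> * Wb * V))"
    proof -
      have "integral K (\<lambda>u. n u (W u) + \<eta> * Wb) = J + \<eta> * Wb * V"
      proof -
        have "integral K (\<lambda>u. \<eta> * Wb) = \<eta> * Wb * V"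
          using integral_mult_right[of K "\<eta> * Wb" "\<lambda>_. 1"] by (simp add: V_def)
        then show ?thesis unfolding J_def
          by (subst integral_add) (auto intro!: int n(3))
      qed
      then have "integral K (\<lambda>u. (\<epsilon> * Lp * (1 + \<eta>)) * (n u (W u) + \<eta> * Wb)) = (\<epsilon> * Lp * (1 + \<eta>)) * (J + \<eta> * Wb * V)"
        by (subst integral_mult_right) simp
      then show ?thesis by (simp only: mult_ac)
    qed
    finally have b1: "\<bar>integral K (\<lambda>u. \<phi> u * (q u - 1))\<bar> \<le> \<epsilon> * (Lp * (1 + \<eta>) * (J + \<eta> * Wb * V))"
      unfolding eq by simp
    have "norm (integral K (\<lambda>u. \<phi> u * (q u - 1 - \<epsilon> * trace (D u)))) \<le> integral K (\<lambda>u. (\<epsilon> * (\<eta> * B * C)) * 1)"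
    proof (rule integral_norm_bound_integral)
      show "(\<lambda>u. \<phi> u * (q u - 1 - \<epsilon> * trace (D u))) integrable_on K" by (intro int continuous_intros qc \<phi> dtr)
      show "(\<lambda>u. (\<epsilon> * (\<eta> * B * C)) * 1) integrable_on K" by (intro int continuous_intros)
      fix u assume u: "u \<in> K"
      have "\<bar>\<phi> u\<bar> * \<bar>q u - 1 - \<epsilon> * trace (D u)\<bar> \<le> B * (\<eta> * \<epsilon> * C)"
        by (intro mult_mono B(2) qb u B(1)) auto
      then show "norm (\<phi> u * (q u - 1 - \<epsilon> * trace (D u))) \<le> (\<epsilon> * (\<eta> * B * C)) * 1"
        by (simp add: abs_mult mult_ac)
    qed
    also have "\<dots> = \<epsilon> * (\<eta> * B * C * V)" by (subst integral_mult_right) (simp add: V_def mult_ac)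
    finally have b2: "\<bar>integral K (\<lambda>u. \<phi> u * (q u - 1 - \<epsilon> * trace (D u)))\<bar> \<le> \<epsilon> * (\<eta> * B * C * V)" by simp
    have "integral K (\<lambda>u. \<phi> u * (q u - 1 - \<epsilon> * trace (D u))) = integral K (\<lambda>u. \<phi> u * (q u - 1) - \<epsilon> * (\<phi> u * trace (D u)))"
      by (rule arg_cong[where f = "integral K"]) (simp add: fun_eq_iff algebra_simps)
    also have "\<dots> = integral K (\<lambda>u. \<phi> u * (q u - 1)) - integral K (\<lambda>u. \<epsilon> * (\<phi> u * trace (D u)))"
      by (rule integral_diff) (intro int continuous_intros qc \<phi> dtr)+
    also have "integral K (\<lambda>u. \<epsilon> * (\<phi> u * trace (D u))) = \<epsilon> * I" unfolding I_def by (rule integral_mult_right)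
    finally have "\<bar>\<epsilon> * I\<bar> \<le> \<epsilon> * (\<eta> * B * C * V) + \<epsilon> * (Lp * (1 + \<eta>) * (J + \<eta> * Wb * V))"
      using b1 b2 by linarith
    then have "\<epsilon> * \<bar>I\<bar> \<le> \<epsilon> * (\<eta> * B * C * V + Lp * (1 + \<eta>) * (J + \<eta> * Wb * V))"
      using \<epsilon> by (simp add: abs_mult distrib_left)
    then show ?thesis using \<epsilon> by (rule mult_left_le_imp_le)
  qed
  have "\<bar>I\<bar> \<le> Lp * J"
  proof (rule field_le_epsilon)
    fix e :: real assume e: "e > 0"
    \<comment> \<open>Q collects the coefficients of the errors of order \<eta>, with 1 + \<eta>
      estimated by 2 and a summand 1 for positivity.\<close>
    define Q where "Q = B * C * V + Lp * (J + 2 * Wb * V) + 1"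
    have Q: "Q > 0" using B C V J Wb ell by (simp add: Q_def add_nonneg_pos)
    define \<eta> where "\<eta> = min 1 (e / Q)"
    have \<eta>: "0 < \<eta>" "\<eta> \<le> 1" using e Q by (auto simp: \<eta>_def)
    have "\<bar>I\<bar> \<le> \<eta> * B * C * V + Lp * (1 + \<eta>) * (J + \<eta> * Wb * V)" by (rule main[OF \<eta>])
    also have "\<dots> = Lp * J + \<eta> * (B * C * V + Lp * (J + (1 + \<eta>) * (Wb * V)))" by (simp add: algebra_simps)
    also have "\<dots> \<le> Lp * J + \<eta> * Q"
    proof -
      have "(1 + \<eta>) * (Wb * V) \<le> 2 * (Wb * V)" using \<eta> Wb(1) V by (intro mult_right_mono) auto
      then have "Lp * (J + (1 + \<eta>) * (Wb * V)) \<le> Lp * (J + 2 * Wb * V)" by (intro mult_left_mono ell) simp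
      then have "B * C * V + Lp * (J + (1 + \<eta>) * (Wb * V)) \<le> Q" unfolding Q_def by linarith
      then show ?thesis using \<eta> by simp
    qed
    also have "\<eta> * Q \<le> e"
    proof -
      have "\<eta> * Q \<le> e / Q * Q" using Q by (intro mult_right_mono) (auto simp: \<eta>_def)
      then show ?thesis using Q by simp
    qed
    finally show "\<bar>I\<bar> \<le> Lp * J + e" by simp
  qed
  then show ?thesis by (simp add: I_def J_def D_def)
qed

text \<open>The transformation formula of the library requires a wellordered index type; a copy of the
  index type carries such an order.\<close>

typedef 'a wo = "UNIV :: 'a set" morphisms un_wo mk_wo by simp

lemma bij_un_wo: "bij un_wo"
  by (metis UNIV_I bij_iff mk_wo_inverse un_wo_inverse)

instance wo :: (finite) finite
  by standard (metis bij_un_wo bij_betw_finite finite_class.finite_UNIV)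

definition wo_code :: "'a wo \<Rightarrow> nat" where
  "wo_code x = (SOME f :: 'a \<Rightarrow> nat. inj f) (un_wo x)"

lemma inj_wo_code: "inj (wo_code :: 'a::finite wo \<Rightarrow> nat)"
proof -
  have "\<exists>f :: 'a \<Rightarrow> nat. inj f"
    using finite_imp_inj_to_nat_seg[OF finite_class.finite_UNIV] by blast
  then have "inj (SOME f :: 'a \<Rightarrow> nat. inj f)" by (rule someI_ex)
  then show ?thesis unfolding wo_code_def[abs_def]
    by (metis bij_is_inj bij_un_wo inj_compose[unfolded comp_def])
qed

instantiation wo :: (finite) wellorder
begin

definition less_eq_wo :: "'a wo \<Rightarrow> 'a wo \<Rightarrow> bool" where "less_eq_wo x y \<longleftrightarrow> wo_code x \<le> wo_code y"
definition less_wo :: "'a wo \<Rightarrow> 'a wo \<Rightarrow> bool" where "less_wo x y \<longleftrightarrow> wo_code x < wo_code y"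

instance
proof
  fix x y z :: "'a wo" and P
  show "x < y \<longleftrightarrow> x \<le> y \<and> \<not> y \<le> x" by (auto simp: less_eq_wo_def less_wo_def)
  show "x \<le> x" by (simp add: less_eq_wo_def)
  show "x \<le> y \<Longrightarrow> y \<le> z \<Longrightarrow> x \<le> z" by (simp add: less_eq_wo_def)
  show "x \<le> y \<Longrightarrow> y \<le> x \<Longrightarrow> x = y" by (rule injD[OF inj_wo_code]) (simp add: less_eq_wo_def)
  show "x \<le> y \<or> y \<le> x" by (auto simp: less_eq_wo_def)
  assume step: "\<And>x :: 'a wo. (\<And>y. y < x \<Longrightarrow> P y) \<Longrightarrow> P x"
  show "P x"
    by (induction "wo_code x" arbitrary: x rule: less_induct) (auto intro: step simp: less_wo_def)
qed

end

definition reindex :: "('j \<Rightarrow> 'i) \<Rightarrow> real^'i \<Rightarrow> real^'j" where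
  "reindex \<sigma> u = (\<chi> j. u $ \<sigma> j)"

lemma linear_reindex: "linear (reindex \<sigma>)"
  by (rule linearI) (auto simp: reindex_def vec_eq_iff)

lemma bounded_linear_reindex: "bounded_linear (reindex \<sigma> :: real^'i::finite \<Rightarrow> real^'j::finite)"
  using linear_reindex linear_conv_bounded_linear by blast

lemma norm_reindex:
  fixes \<sigma> :: "'j::finite \<Rightarrow> 'i::finite"
  assumes "bij \<sigma>" shows "norm (reindex \<sigma> u) = norm u"
  unfolding norm_vec_def L2_set_def reindex_def
  using sum.reindex_bij_betw[OF assms, of "\<lambda>i. (norm (u $ i))\<^sup>2"] by simp

lemma reindex_inv:
  assumes "bij \<sigma>"
  shows "reindex (inv \<sigma>) (reindex \<sigma> u) = u" "reindex \<sigma> (reindex (inv \<sigma>) v) = v"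
  using assms by (auto simp: reindex_def vec_eq_iff bij_is_surj surj_f_inv_f bij_is_inj)

lemma trace_reindex:
  fixes \<sigma> :: "'j::finite \<Rightarrow> 'i::finite"
  assumes "bij \<sigma>"
  shows "trace (matrix (\<lambda>h. reindex \<sigma> (D (reindex (inv \<sigma>) h)))) = trace (matrix D)"
proof -
  have ax: "reindex (inv \<sigma>) (axis j 1) = axis (\<sigma> j) 1" for j
    by (simp add: reindex_def axis_def vec_eq_iff) (metis assms bij_inv_eq_iff)
  have "trace (matrix (\<lambda>h. reindex \<sigma> (D (reindex (inv \<sigma>) h)))) = (\<Sum>j\<in>UNIV. D (axis (\<sigma> j) 1) $ \<sigma> j)"
    unfolding trace_def matrix_def by (simp add: ax) (simp add: reindex_def)
  also have "\<dots> = trace (matrix D)"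
    unfolding trace_def matrix_def using sum.reindex_bij_betw[OF assms, of "\<lambda>i. D (axis i 1) $ i"] by simp
  finally show ?thesis .
qed

text \<open>It suffices to compare volumes of boxes, whose side lengths are only permuted.\<close>

lemma lborel_reindex:
  fixes \<sigma> :: "'j::finite \<Rightarrow> 'i::finite"
  assumes "bij \<sigma>"
  shows "distr lborel borel (reindex \<sigma>) = lborel"
proof (rule lborel_eqI[symmetric])
  have m: "reindex \<sigma> \<in> borel_measurable lborel"
    using borel_measurable_continuous_onI[OF linear_continuous_on[OF bounded_linear_reindex]] by simp
  show "sets (distr lborel borel (reindex \<sigma>)) = sets borel" by simp
  fix l u :: "real^'j"
  assume le: "\<And>b. b \<in> Basis \<Longrightarrow> l \<bullet> b \<le> u \<bullet> b"
  let ?l = "reindex (inv \<sigma>) l" and ?u = "reindex (inv \<sigma>) u"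
  have lec: "l $ j \<le> u $ j" for j using le[of "axis j 1"] by (simp add: inner_axis)
  have eq: "reindex \<sigma> -` box l u = box ?l ?u"
  proof (rule set_eqI)
    fix v :: "real^'i"
    have "v \<in> reindex \<sigma> -` box l u \<longleftrightarrow> (\<forall>j. l $ j < v $ \<sigma> j \<and> v $ \<sigma> j < u $ j)"
      by (simp add: mem_box_cart reindex_def)
    also have "\<dots> \<longleftrightarrow> (\<forall>i. l $ inv \<sigma> i < v $ i \<and> v $ i < u $ inv \<sigma> i)"
      using assms by (metis bij_inv_eq_iff)
    finally show "v \<in> reindex \<sigma> -` box l u \<longleftrightarrow> v \<in> box ?l ?u" by (simp add: mem_box_cart reindex_def)
  qed
  have pb: "(\<Prod>b\<in>Basis. (x :: real^'k::finite) \<bullet> b) = (\<Prod>k\<in>UNIV. x $ k)" for x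
  proof -
    have B: "(Basis :: (real^'k) set) = range (\<lambda>k. axis k 1)" by (auto simp: Basis_vec_def)
    have "inj (\<lambda>k::'k. axis k (1::real))" by (auto simp: inj_def axis_eq_axis)
    then show ?thesis unfolding B by (simp add: prod.reindex inner_axis)
  qed
  have "emeasure (distr lborel borel (reindex \<sigma>)) (box l u) = emeasure lborel (box ?l ?u)"
    using m by (simp add: emeasure_distr eq)
  also have "\<dots> = (\<Prod>b\<in>Basis. (?u - ?l) \<bullet> b)"
    using lec by (subst emeasure_lborel_box) (auto simp: Basis_vec_def inner_axis reindex_def)
  also have "\<dots> = (\<Prod>i\<in>UNIV. (u - l) $ inv \<sigma> i)" unfolding pb by (simp add: reindex_def)
  also have "\<dots> = (\<Prod>j\<in>UNIV. (u - l) $ j)"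
    by (rule arg_cong[where f = ennreal]) (rule prod.reindex_bij_betw[OF bij_betw_inv_into[OF assms]])
  finally show "emeasure (distr lborel borel (reindex \<sigma>)) (box l u) = (\<Prod>b\<in>Basis. (u - l) \<bullet> b)"
    unfolding pb .
qed

lemma integral_compact_lborel:
  fixes f :: "'a::euclidean_space \<Rightarrow> real"
  assumes "compact K" "continuous_on K f"
  shows "integrable lborel (\<lambda>u. indicator K u * f u)" "integral K f = (\<integral>u. indicator K u * f u \<partial>lborel)"
proof -
  show i: "integrable lborel (\<lambda>u. indicator K u * f u)"
    using borel_integrable_compact[OF assms] by simp
  then have "set_integrable lborel K f" by (simp add: set_integrable_def)
  from set_borel_integral_eq_integral(2)[OF this] show "integral K f = (\<integral>u. indicator K u * f u \<partial>lborel)"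
    by (simp add: set_lebesgue_integral_def)
qed

text \<open>\<open>n\<close> stands for the norm of a metric depending on the point, and
  \<open>lip\<close> is a Lipschitz condition to first order: e * norm h absorbs the variation of
  that norm between u and u + h. Relabelling coordinates preserves Lebesgue measure, the Euclidean
  norm and the trace, which removes the order on the index type.\<close>

theorem integral_lipschitz_mult_divergence:
  fixes W :: "real^'m::finite \<Rightarrow> real^'m" and \<phi> :: "real^'m \<Rightarrow> real"
  assumes K: "compact K" and supp: "\<And>u. u \<notin> K \<Longrightarrow> W u = 0"
    and W: "\<And>u. (W has_derivative DW u) (at u)" "\<And>v. continuous_on UNIV (\<lambda>u. DW u v)"
    and \<phi>: "continuous_on K \<phi>"
    and n: "\<And>u h s. s \<ge> 0 \<Longrightarrow> n u (s *\<^sub>R h) = s * n u h" "\<And>u h. n u h \<ge> 0" "continuous_on K (\<lambda>u. n u (W u))"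
    and Lp: "Lp \<ge> 0"
    and lip: "\<And>e. e > 0 \<Longrightarrow> \<exists>d>0. \<forall>u\<in>K. \<forall>h. norm h < d \<and> u + h \<in> K \<longrightarrow> \<bar>\<phi> (u + h) - \<phi> u\<bar> \<le> Lp * (n u h + e * norm h)"
  shows "\<bar>\<integral>u. indicator K u * (\<phi> u * trace (matrix (DW u))) \<partial>lborel\<bar> \<le> Lp * (\<integral>u. indicator K u * n u (W u) \<partial>lborel)"
proof -
  let ?i = "reindex un_wo :: real^'m \<Rightarrow> real^'m wo" and ?k = "reindex (inv un_wo) :: real^'m wo \<Rightarrow> real^'m"
  note inv = reindex_inv[OF bij_un_wo]
  note bi = bounded_linear_reindex[of "un_wo :: 'm wo \<Rightarrow> 'm"] and bk = bounded_linear_reindex[of "inv un_wo :: 'm \<Rightarrow> 'm wo"]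
  have nk: "norm (?k v) = norm v" for v using norm_reindex[OF bij_imp_bij_inv[OF bij_un_wo]] .
  have K': "compact (?i ` K)" by (intro compact_continuous_image K linear_continuous_on bi)
  have mem: "v \<in> ?i ` K \<longleftrightarrow> ?k v \<in> K" for v
    using inv(2)[of v, symmetric] by (auto simp: inv(1) intro: image_eqI[where x = "?k v"])
  have ck: "continuous_on S ?k" for S by (rule linear_continuous_on[OF bk])
  have ckK: "?k ` (?i ` K) \<subseteq> K" by (auto simp: inv)
  have add: "?k (u + h) = ?k u + ?k h" for u h using linear_add[OF linear_reindex] .
  have sc: "?k (s *\<^sub>R h) = s *\<^sub>R ?k h" for s h using linear_cmul[OF linear_reindex] .
  define W' DW' \<phi>' n' where "W' v = ?i (W (?k v))" and "DW' v h = ?i (DW (?k v) (?k h))"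
    and "\<phi>' v = \<phi> (?k v)" and "n' v h = n (?k v) (?k h)" for v h
  have main: "\<bar>integral (?i ` K) (\<lambda>u. \<phi>' u * trace (matrix (DW' u)))\<bar> \<le> Lp * integral (?i ` K) (\<lambda>u. n' u (W' u))"
  proof (rule integral_lipschitz_mult_divergence_wellorder[OF K'])
    show "W' u = 0" if "u \<notin> ?i ` K" for u using supp[of "?k u"] that linear_0[OF linear_reindex] by (simp add: W'_def mem)
    show "(W' has_derivative DW' u) (at u)" for u
    proof -
      have "((\<lambda>v. W (?k v)) has_derivative (\<lambda>h. DW (?k u) (?k h))) (at u)"
        by (rule has_derivative_compose[OF bounded_linear_imp_has_derivative[OF bk] W(1)])
      from bounded_linear.has_derivative[OF bi this] show ?thesis
        unfolding W'_def[abs_def] DW'_def[abs_def] .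
    qed
    show "continuous_on UNIV (\<lambda>u. DW' u v)" for v unfolding DW'_def
      by (intro bounded_linear.continuous_on[OF bi] continuous_on_compose2[OF W(2) ck]) auto
    show "continuous_on (?i ` K) \<phi>'" unfolding \<phi>'_def[abs_def] by (rule continuous_on_compose2[OF \<phi> ck ckK])
    show "n' u (s *\<^sub>R h) = s * n' u h" if "s \<ge> 0" for u h s using n(1)[OF that] by (simp add: n'_def sc)
    show "n' u h \<ge> 0" for u h by (simp add: n'_def n(2))
    show "continuous_on (?i ` K) (\<lambda>u. n' u (W' u))" unfolding n'_def W'_def inv
      by (rule continuous_on_compose2[OF n(3) ck ckK])
    show "Lp \<ge> 0" by (rule Lp)
    fix e :: real assume "e > 0"
    from lip[OF this] obtain d where "d > 0" and d: "\<forall>u\<in>K. \<forall>h. norm h < d \<and> u + h \<in> K \<longrightarrow> \<bar>\<phi> (u + h) - \<phi> u\<bar> \<le> Lp * (n u h + e * norm h)" by blast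
    have "\<forall>u\<in>?i ` K. \<forall>h. norm h < d \<and> u + h \<in> ?i ` K \<longrightarrow> \<bar>\<phi>' (u + h) - \<phi>' u\<bar> \<le> Lp * (n' u h + e * norm h)"
    proof (intro ballI allI impI)
      fix u h assume "u \<in> ?i ` K" "norm h < d \<and> u + h \<in> ?i ` K"
      then show "\<bar>\<phi>' (u + h) - \<phi>' u\<bar> \<le> Lp * (n' u h + e * norm h)"
        using d[rule_format, of "?k u" "?k h"] by (simp only: mem add nk \<phi>'_def n'_def)
    qed
    then show "\<exists>d>0. \<forall>u\<in>?i ` K. \<forall>h. norm h < d \<and> u + h \<in> ?i ` K \<longrightarrow> \<bar>\<phi>' (u + h) - \<phi>' u\<bar> \<le> Lp * (n' u h + e * norm h)"
      using \<open>d > 0\<close> by blast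
  qed
  have transfer: "integral (?i ` K) (\<lambda>v. f (?k v)) = (\<integral>u. indicator K u * f u \<partial>lborel)" if f: "continuous_on K f" for f :: "real^'m \<Rightarrow> real"
  proof -
    have cf: "continuous_on (?i ` K) (\<lambda>v. f (?k v))" by (rule continuous_on_compose2[OF f ck ckK])
    note I = integral_compact_lborel[OF K' cf]
    have m: "?i \<in> measurable lborel borel"
      using borel_measurable_continuous_onI[OF linear_continuous_on[OF bi]] by simp
    have "(\<integral>v. indicator (?i ` K) v * f (?k v) \<partial>lborel) = (\<integral>v. indicator (?i ` K) v * f (?k v) \<partial>distr lborel borel ?i)"
      by (simp only: lborel_reindex[OF bij_un_wo])
    also have "\<dots> = (\<integral>u. indicator (?i ` K) (?i u) * f (?k (?i u)) \<partial>lborel)"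
      by (rule integral_distr[OF m]) (use I(1) in \<open>simp add: borel_measurable_integrable[of lborel, simplified]\<close>)
    also have "\<dots> = (\<integral>u. indicator K u * f u \<partial>lborel)"
      by (rule Bochner_Integration.integral_cong) (simp_all add: inv indicator_def mem)
    finally show ?thesis using I(2) by simp
  qed
  have tr: "trace (matrix (DW' u)) = trace (matrix (DW (?k u)))" for u
    unfolding DW'_def[abs_def] by (rule trace_reindex[OF bij_un_wo])
  have "continuous_on K (\<lambda>u. trace (matrix (DW u)))"
    unfolding trace_def matrix_def
    by (simp, intro continuous_on_sum continuous_on_component continuous_on_subset[OF W(2)]) auto
  then have 1: "integral (?i ` K) (\<lambda>u. \<phi>' u * trace (matrix (DW' u))) = (\<integral>u. indicator K u * (\<phi> u * trace (matrix (DW u))) \<partial>lborel)"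
    unfolding tr \<phi>'_def by (intro transfer[of "\<lambda>u. \<phi> u * trace (matrix (DW u))"] continuous_intros \<phi>)
  have 2: "integral (?i ` K) (\<lambda>u. n' u (W' u)) = (\<integral>u. indicator K u * n u (W u) \<partial>lborel)"
    unfolding n'_def W'_def inv by (rule transfer[OF n(3)])
  show ?thesis using main unfolding 1 2 .
qed

section \<open>Compactness of closed balls in complete length spaces\<close>

theorem (in Metric_space) hopf_rinow:
  assumes complete: "mcomplete"
    and loc: "\<And>x. x \<in> M \<Longrightarrow> \<exists>r>0. compactin mtopology (mcball x r)"
    and len: "\<And>x y s e. x \<in> M \<Longrightarrow> y \<in> M \<Longrightarrow> 0 \<le> s \<Longrightarrow> s \<le> d x y \<Longrightarrow> e > 0 \<Longrightarrow>
        \<exists>z\<in>M. d x z \<le> s \<and> d z y < d x y - s + e"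
    and x: "x \<in> M"
  shows "compactin mtopology (mcball x r)"
proof (rule ccontr)
  assume nc: "\<not> compactin mtopology (mcball x r)"
  \<comment> \<open>Let R be the supremum of the radii with compact ball. The length property makes
    the R-ball totally bounded, hence compact by completeness; finitely many compact balls covering
    its surroundings then reach beyond R.\<close>
  define A where "A = {r. 0 \<le> r \<and> compactin mtopology (mcball x r)}"
  have sub: "compactin mtopology (mcball x r')" if "compactin mtopology (mcball x r'')" "r' \<le> r''" for r' r''
    using closed_compactin[OF that(1) _ closedin_mcball] mcball_subset_concentric[OF that(2)] by blast
  have ub: "a \<le> r" if "a \<in> A" for a
    using sub[of a r] nc that by (force simp: A_def)
  then have bdd: "bdd_above A" by (auto simp: bdd_above_def)
  obtain r0 where "r0 > 0" "compactin mtopology (mcball x r0)" using loc[OF x] by blast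
  then have r0: "r0 \<in> A" by (simp add: A_def)
  define R where "R = Sup A"
  have R0: "R > 0" using cSup_upper[OF r0 bdd] \<open>r0 > 0\<close> by (simp add: R_def)
  have less: "compactin mtopology (mcball x s)" if sR: "s < R" for s
  proof -
    have "A \<noteq> {}" using r0 by blast
    then obtain a where "a \<in> A" "s < a" using sR less_cSup_iff[of A s] bdd unfolding R_def by blast
    then show ?thesis using sub[of a s] by (auto simp: A_def)
  qed
  have tb: "mtotally_bounded (mcball x R)"
    unfolding mtotally_bounded_def
  proof (intro allI impI)
    fix \<epsilon> :: real assume e: "\<epsilon> > 0"
    \<comment> \<open>Every point of the R-ball is within \<epsilon> / 2 of the s-ball: \<epsilon> /
      4 pays for the smaller radius and \<epsilon> / 4 for the slack in the length property.\<close>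
    define s where "s = max 0 (R - \<epsilon> / 4)"
    have s: "0 \<le> s" "s < R" "R - \<epsilon> / 4 \<le> s" using R0 e by (auto simp: s_def)
    have "mtotally_bounded (mcball x s)" using less[OF s(2)] by (rule compactin_imp_mtotally_bounded)
    then obtain K where K: "finite K" "K \<subseteq> mcball x s" "mcball x s \<subseteq> (\<Union>k\<in>K. mball k (\<epsilon> / 2))"
      using e unfolding mtotally_bounded_def by (metis half_gt_zero)
    have "mcball x R \<subseteq> (\<Union>k\<in>K. mball k \<epsilon>)"
    proof
      fix y assume y: "y \<in> mcball x R"
      then have yM: "y \<in> M" "d x y \<le> R" by auto
      obtain z where z: "z \<in> M" "d x z \<le> s" "d z y < \<epsilon> / 2"
      proof (cases "d x y \<le> s")
        case True
        then show ?thesis using that[of y] yM e by simp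
      next
        case False
        then obtain z where "z \<in> M" "d x z \<le> s" "d z y < d x y - s + \<epsilon> / 4"
          using len[OF x yM(1) s(1), of "\<epsilon> / 4"] e by auto
        then show ?thesis using that[of z] yM s(3) by auto
      qed
      then have "z \<in> mcball x s" using x by simp
      then obtain k where k: "k \<in> K" "k \<in> M" "d k z < \<epsilon> / 2" using K(3) by auto
      have "d k y \<le> d k z + d z y" by (rule triangle[OF k(2) z(1) yM(1)])
      then have "d k y < \<epsilon>" using k z by linarith
      then show "y \<in> (\<Union>k\<in>K. mball k \<epsilon>)" using k yM by auto
    qed
    moreover have "K \<subseteq> mcball x R" using K(2) mcball_subset_concentric[of s R x] s by auto
    ultimately show "\<exists>K. finite K \<and> K \<subseteq> mcball x R \<and> mcball x R \<subseteq> (\<Union>x\<in>K. mball x \<epsilon>)" using K(1) by blast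
  qed
  have compR: "compactin mtopology (mcball x R)"
    using mtotally_bounded_eq_compact_closure_of[OF complete] tb closure_of_closedin[OF closedin_mcball[of x R]]
    by (metis)
  have "\<forall>y\<in>M. \<exists>r>0. compactin mtopology (mcball y r)" using loc by blast
  then obtain \<rho> where \<rho>: "\<And>y. y \<in> M \<Longrightarrow> \<rho> y > 0" "\<And>y. y \<in> M \<Longrightarrow> compactin mtopology (mcball y (\<rho> y))" by metis
  let ?U = "(\<lambda>y. mball y (\<rho> y / 2)) ` mcball x R"
  have "mcball x R \<subseteq> \<Union>?U" using \<rho>(1) by auto
  moreover have "\<And>U. U \<in> ?U \<Longrightarrow> openin mtopology U" by auto
  ultimately obtain \<F> where "finite \<F>" "\<F> \<subseteq> ?U" and cov: "mcball x R \<subseteq> \<Union>\<F>"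
    using compactinD[OF compR] by meson
  then obtain Y where Y: "finite Y" "Y \<subseteq> mcball x R" "\<F> = (\<lambda>y. mball y (\<rho> y / 2)) ` Y"
    by (meson finite_subset_image)
  \<comment> \<open>A point at distance at most R + \<delta> is within 2 \<delta> \<le> \<rho> y / 2
    of a point of the R-ball that is itself within \<rho> y / 2 of y. The inserted 1 keeps the
    minimum meaningful should Y be empty.\<close>
  define \<delta> where "\<delta> = Min (insert 1 ((\<lambda>y. \<rho> y / 4) ` Y))"
  have d0: "\<delta> > 0" unfolding \<delta>_def using Y \<rho>(1) by (subst Min_gr_iff) auto
  have dle: "\<delta> \<le> \<rho> y / 4" if "y \<in> Y" for y unfolding \<delta>_def using Y that by (intro Min_le) auto
  have "mcball x (R + \<delta>) \<subseteq> (\<Union>y\<in>Y. mcball y (\<rho> y))"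
  proof
    fix w assume "w \<in> mcball x (R + \<delta>)"
    then have w: "w \<in> M" "d x w \<le> R + \<delta>" by auto
    obtain z where z: "z \<in> M" "d x z \<le> R" "d z w < 2 * \<delta>"
    proof (cases "d x w \<le> R")
      case True
      then show ?thesis using that[of w] w d0 by simp
    next
      case False
      then obtain z where "z \<in> M" "d x z \<le> R" "d z w < d x w - R + \<delta>"
        using len[OF x w(1), of R \<delta>] d0 R0 by auto
      then show ?thesis using that[of z] w by auto
    qed
    then have "z \<in> \<Union>\<F>" using cov x by auto
    then obtain y where y: "y \<in> Y" "y \<in> M" "d y z < \<rho> y / 2" unfolding Y(3) by auto
    have "d y w \<le> d y z + d z w" by (rule triangle[OF y(2) z(1) w(1)])
    then have "d y w \<le> \<rho> y" using y z dle[OF y(1)] by linarith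
    then show "w \<in> (\<Union>y\<in>Y. mcball y (\<rho> y))" using y w by auto
  qed
  moreover have "compactin mtopology (\<Union>y\<in>Y. mcball y (\<rho> y))"
    by (rule compactin_Union) (use Y \<rho>(2) in auto)
  ultimately have "compactin mtopology (mcball x (R + \<delta>))"
    using closed_compactin closedin_mcball by blast
  then have "R + \<delta> \<in> A" using R0 d0 by (simp add: A_def)
  then have "R + \<delta> \<le> R" unfolding R_def by (rule cSup_upper[OF _ bdd])
  then show False using d0 by simp
qed

section \<open>The divergence of a Newton field in a chart\<close>

lemma bounded_bilinear_lorentz: "bounded_bilinear (lorentz :: (real^'n::finite) \<times> real \<Rightarrow> _)"
  unfolding bilinear_conv_bounded_bilinear[symmetric] bilinear_def
  by (auto intro!: linearI simp: lorentz_def inner_add_left inner_add_right algebra_simps)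

interpretation lorentz: bounded_bilinear "lorentz :: (real^'n::finite) \<times> real \<Rightarrow> _"
  by (rule bounded_bilinear_lorentz)

lemma lorentz_commute: "lorentz v w = lorentz w v"
  by (simp add: lorentz_def inner_commute)

lemma polynomial_coeffs_eq:
  fixes a b :: "nat \<Rightarrow> real"
  assumes "\<delta> > 0" "\<And>t. \<bar>t\<bar> < \<delta> \<Longrightarrow> (\<Sum>r\<le>n. (-t)^r * a r) = (\<Sum>r\<le>n. (-t)^r * b r)" and "r \<le> n"
  shows "a r = b r"
proof -
  define p where "p = (\<Sum>r\<le>n. monom (a r - b r) r)"
  have ev: "poly p x = (\<Sum>r\<le>n. x^r * a r) - (\<Sum>r\<le>n. x^r * b r)" for x
    unfolding p_def poly_sum sum_subtractf[symmetric]
    by (rule sum.cong) (auto simp: poly_monom algebra_simps)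
  have "{-\<delta><..<\<delta>} \<subseteq> {x. poly p x = 0}"
  proof
    fix x assume "x \<in> {-\<delta><..<\<delta>}"
    then have "\<bar>- x\<bar> < \<delta>" by auto
    from assms(2)[OF this] show "x \<in> {x. poly p x = 0}" by (simp add: ev)
  qed
  moreover have "infinite {-\<delta><..<\<delta>}" using assms(1) by (simp add: infinite_Ioo)
  ultimately have "p = 0" using poly_roots_finite[of p] finite_subset by blast
  then have "coeff p r = 0" by simp
  moreover have "coeff p r = a r - b r" using assms(3) by (simp add: p_def coeff_sum)
  ultimately show ?thesis by simp
qed

definition gram :: "('m::finite \<Rightarrow> (real^'n::finite) \<times> real) \<Rightarrow> real^'m^'m" where
  "gram E = (\<chi> i k. lorentz (E i) (E k))"

lemma trace_transpose: "trace (transpose A) = trace A"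
  by (simp add: trace_def transpose_def)

lemma has_derivative_vec_lambda:
  fixes h :: "'i::finite \<Rightarrow> 'a::real_normed_vector \<Rightarrow> 'b::euclidean_space"
  assumes "\<And>i. (h i has_derivative h' i) F"
  shows "((\<lambda>u. \<chi> i. h i u) has_derivative (\<lambda>v. \<chi> i. h' i v)) F"
proof -
  have b: "bounded_linear (\<lambda>x::'b. axis i x :: 'b^'i)" for i
    by (rule linear_conv_bounded_linear[THEN iffD1], rule linearI) (auto simp: axis_def vec_eq_iff)
  have e: "(\<chi> i. k i) = (\<Sum>i\<in>UNIV. axis i (k i))" for k :: "'i \<Rightarrow> 'b"
    by (simp add: vec_eq_iff axis_def if_distrib cong: if_cong)
  show ?thesis unfolding e
    by (intro has_derivative_sum bounded_linear.has_derivative[OF b] assms)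
qed

text \<open>The classical formula for the divergence of the tangent field \<open>X = \<Sum>i. s i E i\<close>, in the form
  \<open>(1 / \<surd>det \<Gamma>) \<Sum>k. \<partial>k (\<surd>det \<Gamma> s k) = tr (\<Gamma>\<inverse> (\<langle>E l, \<partial>k X\<rangle>))\<close>.\<close>

lemma divergence_tangent_field:
  fixes E :: "'m::finite \<Rightarrow> real^'m \<Rightarrow> (real^'n::finite) \<times> real" and s :: "real^'m \<Rightarrow> real^'m"
  assumes E: "\<And>i. (E i has_derivative E' i) (at u)"
    and sym: "\<And>i k. E' i (axis k 1) = E' k (axis i 1)"
    and s: "(s has_derivative s') (at u)"
    and pos: "det (gram (\<lambda>i. E i u)) > 0"
    and inv: "Gi ** gram (\<lambda>i. E i u) = mat 1"
    and X: "((\<lambda>v. \<Sum>i\<in>UNIV. s v $ i *\<^sub>R E i v) has_derivative X') (at u)"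
  shows "\<exists>Y'. ((\<lambda>v. sqrt (det (gram (\<lambda>i. E i v))) *\<^sub>R s v) has_derivative Y') (at u) \<and>
     trace (matrix Y') = sqrt (det (gram (\<lambda>i. E i u))) * trace (Gi ** (\<chi> l k. lorentz (E l u) (X' (axis k 1))))"
proof -
  define G where "G v = gram (\<lambda>i. E i v)" for v
  define dG where "dG h = (\<chi> i k. lorentz (E i u) (E' k h) + lorentz (E' i h) (E k u))" for h
  define P where "P n = (\<chi> l k. lorentz (E l u) (E' k (axis n 1)))" for n
  have posG: "det (G u) > 0" and invG: "Gi ** G u = mat 1" using pos inv by (auto simp: G_def)
  have symG: "transpose (G u) = G u" by (simp add: G_def gram_def transpose_def vec_eq_iff lorentz_commute)
  have "G u ** Gi = mat 1" using invG matrix_left_right_inverse by blast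
  then have "transpose Gi ** G u = mat 1"
    using matrix_transpose_mul[of "G u" Gi] symG by (simp add: transpose_mat)
  then have symGi: "transpose Gi = Gi" using \<open>G u ** Gi = mat 1\<close>
    by (metis matrix_mul_assoc matrix_mul_lid matrix_mul_rid)
  have Gd: "(G has_derivative dG) (at u)"
    unfolding G_def[abs_def] gram_def dG_def[abs_def]
    by (intro has_derivative_vec_lambda lorentz.FDERIV E)
  have dGP: "dG (axis n 1) = P n + transpose (P n)" for n
    by (simp add: dG_def P_def transpose_def vec_eq_iff lorentz_commute)
  have dd: "((\<lambda>v. det (G v)) has_derivative (\<lambda>h. det (G u) * trace (Gi ** dG h))) (at u)"
    by (rule has_derivative_compose[OF Gd has_derivative_det[OF invG]])
  define H where "H v = sqrt (det (G v))" for v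
  have H0: "H u > 0" using posG by (simp add: H_def)
  have HH: "H u * H u = det (G u)" using posG by (simp add: H_def)
  define H' where "H' h = det (G u) * trace (Gi ** dG h) * (inverse (sqrt (det (G u))) / 2)" for h
  have dH: "(H has_derivative H') (at u)"
    unfolding H_def[abs_def] H'_def[abs_def] by (rule has_derivative_real_sqrt[OF posG dd, THEN has_derivative_eq_rhs]) (simp add: field_simps)
  \<comment> \<open>The derivative of the Gram matrix is P n plus its transpose. Both have the same
    trace against the symmetric inverse, and the resulting factor 2 cancels the 1/2 from the square
    root.\<close>
  have trP: "trace (Gi ** transpose (P n)) = trace (Gi ** P n)" for n
  proof -
    have "trace (Gi ** transpose (P n)) = trace (transpose (Gi ** transpose (P n)))" by (simp only: trace_transpose)
    also have "\<dots> = trace (P n ** Gi)" by (simp only: matrix_transpose_mul transpose_transpose symGi)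
    finally show ?thesis by (simp only: trace_mul_sym[of "P n" Gi])
  qed
  have H'n: "H' (axis n 1) = H u * trace (Gi ** P n)" for n
  proof -
    have "H' (axis n 1) = H u * H u * (2 * trace (Gi ** P n)) * (inverse (H u) / 2)"
      unfolding H'_def dGP HH H_def[symmetric] by (simp add: matrix_add_ldistrib trace_add trP)
    then show ?thesis using H0 by simp
  qed
  let ?Y' = "\<lambda>h. H u *\<^sub>R s' h + H' h *\<^sub>R s u"
  have Y: "((\<lambda>v. H v *\<^sub>R s v) has_derivative ?Y') (at u)"
    by (rule has_derivative_scaleR[OF dH s])
  have trY: "trace (matrix ?Y') = H u * ((\<Sum>n\<in>UNIV. s' (axis n 1) $ n) + (\<Sum>n\<in>UNIV. s u $ n * trace (Gi ** P n)))"
    unfolding trace_def[of "matrix ?Y'"] unfolding matrix_def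
    by (simp add: H'n sum.distrib distrib_left sum_distrib_left mult_ac)
  define Xm where "Xm = (\<chi> l k. lorentz (E l u) (X' (axis k 1)))"
  have X'eq: "X' = (\<lambda>h. \<Sum>i\<in>UNIV. s u $ i *\<^sub>R E' i h + s' h $ i *\<^sub>R E i u)"
  proof (rule has_derivative_unique[OF X])
    show "((\<lambda>v. \<Sum>i\<in>UNIV. s v $ i *\<^sub>R E i v) has_derivative (\<lambda>h. \<Sum>i\<in>UNIV. s u $ i *\<^sub>R E' i h + s' h $ i *\<^sub>R E i u)) (at u)"
      by (intro has_derivative_sum has_derivative_scaleR E bounded_linear.has_derivative[OF bounded_linear_vec_nth s])
  qed
  \<comment> \<open>Symmetry of the derivatives of E exchanges i and k, so the matrices coming from
    X' are the same P i that occur in the derivative of the volume density.\<close>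
  have Xm: "Xm $ l $ k = (\<Sum>i\<in>UNIV. s u $ i * P i $ l $ k) + (\<Sum>i\<in>UNIV. G u $ l $ i * s' (axis k 1) $ i)" for l k
    unfolding Xm_def X'eq
    by (simp add: lorentz.sum_right lorentz.add_right lorentz.scaleR_right P_def sym[of _ k] G_def gram_def sum.distrib mult.commute)
  have "Gi ** Xm = (\<Sum>i\<in>UNIV. s u $ i *\<^sub>R (Gi ** P i)) + (\<chi> n k. s' (axis k 1) $ n)"
  proof -
    have "Xm = (\<Sum>i\<in>UNIV. s u $ i *\<^sub>R P i) + G u ** (\<chi> n k. s' (axis k 1) $ n)"
      by (simp add: vec_eq_iff Xm matrix_matrix_mult_def)
    moreover have "Gi ** (\<Sum>i\<in>I. s u $ i *\<^sub>R P i) = (\<Sum>i\<in>I. s u $ i *\<^sub>R (Gi ** P i))" for I :: "'m set"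
      by (rule linear_sum[THEN trans, of "\<lambda>X. Gi ** X"])
         (auto intro!: linearI simp: vec_eq_iff matrix_matrix_mult_def sum_distrib_left sum.distrib distrib_left mult_ac)
    ultimately show ?thesis by (simp add: matrix_add_ldistrib matrix_mul_assoc invG)
  qed
  then have "trace (Gi ** Xm) = (\<Sum>i\<in>UNIV. s u $ i * trace (Gi ** P i)) + (\<Sum>n\<in>UNIV. s' (axis n 1) $ n)"
    by (simp add: trace_def sum.distrib sum_distrib_left) (rule sum.swap)
  then have "trace (matrix ?Y') = H u * trace (Gi ** Xm)" unfolding trY by simp
  then show ?thesis using Y unfolding H_def G_def Xm_def by blast
qed


section \<open>Immersed patches and the divergence of Newton fields\<close>

locale immersed_patch =
  fixes V :: "(real^'m::finite) set" and F N :: "real^'m \<Rightarrow> (real^'n::finite) \<times> real"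
    and A :: "real^'m \<Rightarrow> real^'m^'m" and T S :: "real^'m \<Rightarrow> real^'m \<Rightarrow> (real^'n) \<times> real"
  defines "T \<equiv> \<lambda>u. frechet_derivative F (at u)" and "S \<equiv> \<lambda>u. frechet_derivative N (at u)"
  assumes V: "open V" and F: "smooth_on V F" and N: "smooth_on V N"
    and pos: "\<And>u v. u \<in> V \<Longrightarrow> v \<noteq> 0 \<Longrightarrow> lorentz (T u v) (T u v) > 0"
    and NT: "\<And>u v. u \<in> V \<Longrightarrow> lorentz (N u) (T u v) = 0"
    and weingarten: "\<And>u v. u \<in> V \<Longrightarrow> S u v = - T u (A u *v v)"
begin

lemma T: "u \<in> V \<Longrightarrow> (F has_derivative T u) (at u)"
  unfolding T_def by (rule C1_onD(1)[OF smooth_on_C1[OF F]])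

lemma S: "u \<in> V \<Longrightarrow> (N has_derivative S u) (at u)"
  unfolding S_def by (rule C1_onD(1)[OF smooth_on_C1[OF N]])

lemma linear_T: "u \<in> V \<Longrightarrow> linear (T u)" and linear_S: "u \<in> V \<Longrightarrow> linear (S u)"
  using T S has_derivative_linear by blast+

lemma C1_T: "C1_on V (\<lambda>u. T u v)" and C1_S: "C1_on V (\<lambda>u. S u v)"
  unfolding T_def S_def by (rule smooth_on_C1_derivative F N)+

definition g :: "real^'m \<Rightarrow> real^'m \<Rightarrow> real^'m \<Rightarrow> real" where
  "g u v w = lorentz (T u v) (T u w)"

lemma inner_g: assumes u: "u \<in> V" shows "inner_form (g u)"
proof
  show "bilinear (g u)" unfolding bilinear_def g_def
    using linear_add[OF linear_T[OF u]] linear_cmul[OF linear_T[OF u]]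
    by (auto intro!: linearI simp: lorentz.add_left lorentz.add_right lorentz.scaleR_left lorentz.scaleR_right)
qed (use pos[OF u] in \<open>auto simp: g_def lorentz_commute\<close>)

text \<open>Differentiating <N, T w> = 0 expresses both sides through the second derivative of F,
  which is symmetric.\<close>

lemma second_form_sym:
  assumes u: "u \<in> V" shows "lorentz (S u v) (T u w) = lorentz (S u w) (T u v)"
proof -
  have D: "((\<lambda>u. T u w) has_derivative frechet_derivative (\<lambda>u. T u w) (at u)) (at u)" for w
    by (rule C1_onD(1)[OF C1_T u])
  have key: "lorentz (S u v) (T u w) = - lorentz (N u) (frechet_derivative (\<lambda>u. T u w) (at u) v)" for v w
  proof -
    have "((\<lambda>u. lorentz (N u) (T u w)) has_derivative
        (\<lambda>h. lorentz (N u) (frechet_derivative (\<lambda>u. T u w) (at u) h) + lorentz (S u h) (T u w))) (at u)"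
      by (rule lorentz.FDERIV[OF S[OF u] D])
    moreover have "((\<lambda>u. lorentz (N u) (T u w)) has_derivative (\<lambda>h. 0)) (at u)"
      by (rule has_derivative_transform_within_open[OF has_derivative_const V u]) (use NT in auto)
    ultimately have "(\<lambda>h. lorentz (N u) (frechet_derivative (\<lambda>u. T u w) (at u) h) + lorentz (S u h) (T u w)) = (\<lambda>h. 0)"
      by (rule has_derivative_unique)
    from fun_cong[OF this, of v] show ?thesis by simp
  qed
  have "Ck_on (Suc (Suc 0)) V F" using F unfolding smooth_on_def by blast
  from Ck_on_2_symmetric[OF V u this, of w v]
  have "frechet_derivative (\<lambda>u. T u w) (at u) v = frechet_derivative (\<lambda>u. T u v) (at u) w" unfolding T_def .
  then show ?thesis unfolding key by simp
qed

lemma A_selfadjoint: "u \<in> V \<Longrightarrow> g u (A u *v v) w = g u v (A u *v w)"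
  using second_form_sym[of u v w] weingarten[of u] lorentz_commute[of "T u (A u *v w)" "T u v"]
  by (simp add: g_def lorentz.minus_left)

lemma eigenbasis_at: assumes u: "u \<in> V" obtains b l where "eigenbasis (g u) (A u) b l"
proof -
  interpret inner_form "g u" by (rule inner_g[OF u])
  obtain b :: "'m \<Rightarrow> real^'m" and l where "\<forall>i k. g u (b i) (b k) = (if i = k then 1 else 0)" "\<forall>i. A u *v b i = l i *\<^sub>R b i"
    using eigenbasis_exists[where 'i = 'm and A = "(*v) (A u)"] A_selfadjoint[OF u] by auto
  then have "eigenbasis (g u) (A u) b l" by unfold_locales auto
  then show ?thesis by (rule that)
qed

definition G :: "real^'m \<Rightarrow> real^'m^'m" where "G u = gram (\<lambda>i. T u (axis i 1))"

lemma T_expand: assumes u: "u \<in> V" shows "T u v = (\<Sum>i\<in>UNIV. v $ i *\<^sub>R T u (axis i 1))"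
proof -
  have "T u v = T u (\<Sum>i\<in>UNIV. v $ i *\<^sub>R axis i 1)" using basis_expansion[of v] by (simp add: scalar_mult_eq_scaleR)
  then show ?thesis by (simp only: linear_sum[OF linear_T[OF u]] linear_cmul[OF linear_T[OF u]])
qed

lemma g_G: assumes u: "u \<in> V" shows "g u v w = v \<bullet> (G u *v w)"
  unfolding g_def T_expand[OF u, of v] T_expand[OF u, of w]
  by (simp add: lorentz.sum_left lorentz.sum_right lorentz.scaleR_left lorentz.scaleR_right inner_vec_def
      matrix_vector_mult_def G_def gram_def sum_distrib_left mult_ac) (rule sum.swap)

lemma det_G: assumes u: "u \<in> V" shows "det (G u) > 0"
proof -
  obtain b l where "eigenbasis (g u) (A u) b l" using eigenbasis_at[OF u] .
  then interpret eigenbasis "g u" "A u" b l .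
  define B :: "real^'m^'m" where "B = (\<chi> k i. b i $ k)"
  have "(transpose B ** (G u ** B)) $ i $ k = g u (b i) (b k)" for i k
    unfolding g_G[OF u] by (simp add: matrix_matrix_mult_def transpose_def B_def inner_vec_def matrix_vector_mult_def)
  then have "transpose B ** (G u ** B) = mat 1" by (simp add: vec_eq_iff on mat_def)
  then have "det (transpose B ** (G u ** B)) = 1" by simp
  then have "(det B)^2 * det (G u) = 1" by (simp add: det_mul power2_eq_square mult_ac)
  then show ?thesis by (metis zero_less_mult_pos zero_less_one zero_less_power2 mult_zero_left power_zero_numeral zero_neq_one)
qed

lemma C1_G: "C1_on V G"
  unfolding G_def[abs_def] gram_def
  by (intro C1_on_vec_lambda C1_on_bounded_bilinear[OF bounded_bilinear_lorentz] C1_T)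

lemma solve_tangent:
  assumes u: "u \<in> V" and "\<And>i. lorentz (T u (axis i 1)) X = lorentz (T u (axis i 1)) (T u z)"
  shows "G u *v z = (\<chi> i. lorentz (T u (axis i 1)) X)"
  unfolding assms(2) T_expand[OF u, of z]
  by (simp add: vec_eq_iff matrix_vector_mult_def G_def gram_def lorentz.sum_right lorentz.scaleR_right mult.commute)

text \<open>A is given only through the Weingarten equation; pairing that equation with the
  coordinate vectors gives, for each column, a linear system with invertible matrix G.\<close>

lemma C1_A: "C1_on V A"
proof -
  have "C1_on V (\<lambda>u. column k (A u))" for k
  proof (rule C1_on_linear_solve[OF C1_G])
    show "C1_on V (\<lambda>u. \<chi> i. lorentz (T u (axis i 1)) (- S u (axis k 1)))"
      by (intro C1_on_vec_lambda C1_on_bounded_bilinear[OF bounded_bilinear_lorentz] C1_T C1_on_minus C1_S)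
    show "G u *v column k (A u) = (\<chi> i. lorentz (T u (axis i 1)) (- S u (axis k 1)))" if u: "u \<in> V" for u
      by (rule solve_tangent[OF u]) (simp add: weingarten[OF u] matrix_vector_mult_basis)
  qed (use det_G V in force)+
  then have "C1_on V (\<lambda>u. \<chi> i k. column k (A u) $ i)"
    by (intro C1_on_vec_lambda C1_on_vec_nth)
  then show ?thesis by (simp add: column_def)
qed

lemma C1_newton: "C1_on V (\<lambda>u. newton_tr r (A u))"
proof (induction r)
  case (Suc r)
  have "C1_on V (\<lambda>u. (trace (A u ** newton_tr r (A u)) / real (Suc r)) *\<^sub>R (mat 1 :: real^'m^'m) - A u ** newton_tr r (A u))"
    by (intro C1_on_diff C1_on_scaleR C1_on_divide C1_on_trace C1_on_matrix_mult C1_A Suc C1_on_const) simp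
  then show ?case by simp
qed (simp add: C1_on_const)


text \<open>Z is an ambient vector with derivative a T along F, e a second normal field, and z the
  tangential part of Z in coordinates. For small t the field T z is expanded in the frame of
  derivatives of F + t N, with coefficients s = (1 - t A)^-1 z. The volume factor of this frame is
  det (1 - t A) times that of F, so volume times s is the sum of the (-t)^r Y r. Its divergence is
  given by \<open>divergence_tangent_field\<close>, and equality of polynomials near t = 0 separates
  the terms.\<close>

theorem newton_divergence:
  fixes Z e :: "real^'m \<Rightarrow> (real^'n) \<times> real" and \<zeta> a :: "real^'m \<Rightarrow> real" and \<beta> :: real and z :: "real^'m \<Rightarrow> real^'m"
  defines "Y \<equiv> \<lambda>r u. sqrt (det (G u)) *\<^sub>R (newton_tr r (A u) *v z u)"
  assumes Z: "\<And>u. u \<in> V \<Longrightarrow> (Z has_derivative (\<lambda>h. a u *\<^sub>R T u h)) (at u)" "continuous_on V a"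
    and e: "\<And>u. u \<in> V \<Longrightarrow> (e has_derivative (\<lambda>h. \<beta> *\<^sub>R T u h)) (at u)"
    and eT: "\<And>u v. u \<in> V \<Longrightarrow> lorentz (e u) (T u v) = 0"
    and \<zeta>: "C1_on V \<zeta>"
    and z: "\<And>u. u \<in> V \<Longrightarrow> T u (z u) = Z u - lorentz (Z u) (N u) *\<^sub>R N u - \<zeta> u *\<^sub>R e u"
  shows C1_newton_field: "C1_on V (Y r)" and C1_tangent_part: "C1_on V z"
    and "u \<in> V \<Longrightarrow> trace (matrix (frechet_derivative (Y r) (at u))) =
      sqrt (det (G u)) * ((a u - \<zeta> u * \<beta>) * trace (newton_tr r (A u)) + lorentz (Z u) (N u) * trace (A u ** newton_tr r (A u)))"
proof -
  have CZ: "C1_on V Z"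
    by (rule C1_onI[OF Z(1)]) (auto intro!: continuous_intros Z(2) C1_on_continuous[OF C1_T])
  have Tz: "lorentz (T u v) (T u (z u)) = lorentz (T u v) (Z u)" if u: "u \<in> V" for u v
    using NT[OF u, of v] eT[OF u, of v]
    by (simp add: z[OF u] lorentz.diff_right lorentz.scaleR_right lorentz_commute[of "T u v"])
  show Cz: "C1_on V z"
  proof (rule C1_on_linear_solve[OF C1_G])
    show "C1_on V (\<lambda>u. \<chi> i. lorentz (T u (axis i 1)) (Z u))"
      by (intro C1_on_vec_lambda C1_on_bounded_bilinear[OF bounded_bilinear_lorentz] C1_T CZ)
    show "G u *v z u = (\<chi> i. lorentz (T u (axis i 1)) (Z u))" if u: "u \<in> V" for u
      by (rule solve_tangent[OF u]) (simp add: Tz[OF u])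
  qed (use det_G V in force)+
  have CY: "C1_on V (Y r)" for r unfolding Y_def
    by (intro C1_on_scaleR C1_on_sqrt C1_on_det C1_G det_G C1_on_matrix_vector_mult C1_newton Cz)
  show "C1_on V (Y r)" by (rule CY)
  assume u: "u \<in> V"
  \<comment> \<open>At least CARD('m) for the generating identity, and at least r so that the
    coefficient of index r occurs.\<close>
  define n where "n = max r CARD('m)"
  define M where "M t u = mat 1 - t *\<^sub>R A u" for t u
  define Q where "Q t u = (\<Sum>r\<le>n. (-t)^r *\<^sub>R newton_tr r (A u))" for t u
  have MQ: "M t u ** Q t u = det (M t u) *\<^sub>R mat 1" if u: "u \<in> V" for t u
  proof -
    obtain b l where "eigenbasis (g u) (A u) b l" using eigenbasis_at[OF u] .
    then interpret eigenbasis "g u" "A u" b l .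
    show ?thesis unfolding M_def Q_def by (rule newton_generating) (simp add: n_def)
  qed
  \<comment> \<open>Positivity near t = 0 makes the shifted frame a basis and spares an absolute
    value in the square root of (det M)^2.\<close>
  have "isCont (\<lambda>t. det (M t u)) 0" unfolding M_def det_def by (intro continuous_intros)
  moreover have "det (M 0 u) = 1" by (simp add: M_def)
  ultimately have "\<forall>\<^sub>F t in at 0. det (M t u) > 0"
    by (metis isCont_def order_tendstoD(1) zero_less_one)
  then obtain \<delta> where \<delta>: "\<delta> > 0" "\<And>t. t \<noteq> 0 \<Longrightarrow> \<bar>t\<bar> < \<delta> \<Longrightarrow> det (M t u) > 0"
    unfolding eventually_at by (auto simp: dist_real_def)
  then have Mpos: "det (M t u) > 0" if "\<bar>t\<bar> < \<delta>" for t
    using that \<open>det (M 0 u) = 1\<close> by (cases "t = 0") auto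
  define R where "R r = sqrt (det (G u)) * ((a u - \<zeta> u * \<beta>) * trace (newton_tr r (A u)) + lorentz (Z u) (N u) * trace (A u ** newton_tr r (A u)))" for r
  define dY where "dY r = frechet_derivative (Y r) (at u)" for r
  have dY: "(Y r has_derivative dY r) (at u)" for r unfolding dY_def by (rule C1_onD(1)[OF CY u])
  have "(\<Sum>r\<le>n. (-t)^r * trace (matrix (dY r))) = (\<Sum>r\<le>n. (-t)^r * R r)" if t: "\<bar>t\<bar> < \<delta>" for t
  proof -
    define V' where "V' = {v\<in>V. det (M t v) > 0}"
    have CM: "C1_on V (M t)" unfolding M_def by (intro C1_on_diff C1_on_scaleR C1_on_const C1_A)
    have V': "open V'"
    proof -
      have "V' = V \<inter> (\<lambda>v. det (M t v)) -` {0<..}" by (auto simp: V'_def)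
      then show ?thesis using continuous_open_preimage[OF C1_on_continuous[OF C1_on_det[OF CM]] V open_greaterThan] by simp
    qed
    have uV': "u \<in> V'" using u Mpos[OF t] by (simp add: V'_def)
    define E where "E i v = T v (axis i 1) + t *\<^sub>R S v (axis i 1)" for i v
    define E' where "E' i = (\<lambda>h. frechet_derivative (\<lambda>v. T v (axis i 1)) (at u) h + t *\<^sub>R frechet_derivative (\<lambda>v. S v (axis i 1)) (at u) h)" for i
    have dE: "(E i has_derivative E' i) (at u)" for i
      unfolding E_def[abs_def] E'_def
      by (intro derivative_intros C1_onD(1)[OF C1_T u] C1_onD(1)[OF C1_S u])
    \<comment> \<open>This is where the Codazzi equation is hidden: besides those of F, the second
      derivatives of N are symmetric.\<close>
    have symE: "E' i (axis k 1) = E' k (axis i 1)" for i k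
    proof -
      have "Ck_on (Suc (Suc 0)) V F" "Ck_on (Suc (Suc 0)) V N" using F N unfolding smooth_on_def by blast+
      from this[THEN Ck_on_2_symmetric[OF V u], of "axis i 1" "axis k 1"]
      show ?thesis unfolding E'_def T_def S_def by simp
    qed
    have EM: "E i v = T v (M t v *v axis i 1)" if v: "v \<in> V" for i v
      by (simp add: E_def weingarten[OF v] M_def matrix_vector_mult_diff_rdistrib scaleR_matrix_vector
          linear_diff[OF linear_T[OF v]] linear_cmul[OF linear_T[OF v]])
    have sumE: "(\<Sum>i\<in>UNIV. x $ i *\<^sub>R E i v) = T v (M t v *v x)" if v: "v \<in> V" for v x
    proof -
      have "M t v *v x = M t v *v (\<Sum>i\<in>UNIV. x $ i *\<^sub>R axis i 1)" using basis_expansion[of x] by (simp add: scalar_mult_eq_scaleR)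
      also have "\<dots> = (\<Sum>i\<in>UNIV. x $ i *\<^sub>R (M t v *v axis i 1))"
        by (simp add: linear_sum[OF matrix_vector_mul_linear] matrix_vector_mult_scaleR)
      finally show ?thesis
        by (simp only: EM[OF v] linear_sum[OF linear_T[OF v]] linear_cmul[OF linear_T[OF v]])
    qed
    have gE: "lorentz (E i v) (T v (B *v axis k 1)) = (transpose (M t v) ** (G v ** B)) $ i $ k" if v: "v \<in> V" for i k v B
      unfolding EM[OF v] g_def[symmetric] g_G[OF v] matrix_vector_mul_assoc matrix_vector_mult_basis
      by (simp add: inner_vec_def column_def matrix_matrix_mult_def transpose_def matrix_vector_mult_def)
    have gramE: "gram (\<lambda>i. E i v) = transpose (M t v) ** (G v ** M t v)" if v: "v \<in> V" for v
      by (simp add: gram_def vec_eq_iff gE[OF v, symmetric] EM[OF v, symmetric])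
    have sqE: "sqrt (det (gram (\<lambda>i. E i v))) = det (M t v) * sqrt (det (G v))" if v: "v \<in> V'" for v
    proof -
      have "v \<in> V" "det (M t v) > 0" using v by (auto simp: V'_def)
      then have "det (gram (\<lambda>i. E i v)) = (det (M t v))^2 * det (G v)"
        by (simp add: gramE det_mul power2_eq_square mult_ac)
      then show ?thesis using \<open>det (M t v) > 0\<close> by (simp add: real_sqrt_mult)
    qed
    define s where "s v = inverse (det (M t v)) *\<^sub>R (Q t v *v z v)" for v
    have CQ: "C1_on V (Q t)" unfolding Q_def by (intro C1_on_sum C1_on_scaleR C1_on_const C1_newton)
    have subV: "V' \<subseteq> V" by (auto simp: V'_def)
    have "C1_on V' s" unfolding s_def
      by (intro C1_on_scaleR C1_on_inverse C1_on_det C1_on_matrix_vector_mult C1_on_subset[OF CM subV]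
          C1_on_subset[OF CQ subV] C1_on_subset[OF Cz subV]) (auto simp: V'_def)
    then have ds: "(s has_derivative frechet_derivative s (at u)) (at u)" using uV' by (rule C1_onD(1))
    have Ms: "M t v *v s v = z v" if v: "v \<in> V'" for v
    proof -
      have "v \<in> V" "det (M t v) \<noteq> 0" using v by (auto simp: V'_def)
      then show ?thesis
        by (simp add: s_def matrix_vector_mult_scaleR matrix_vector_mul_assoc MQ scaleR_matrix_vector)
    qed
    define c where "c = lorentz (Z u) (N u)"
    define \<zeta>' where "\<zeta>' = frechet_derivative \<zeta> (at u)"
    have d\<zeta>: "(\<zeta> has_derivative \<zeta>') (at u)" unfolding \<zeta>'_def by (rule C1_onD(1)[OF \<zeta> u])
    define X' where "X' h = a u *\<^sub>R T u h - (c *\<^sub>R S u h + (lorentz (Z u) (S u h) + lorentz (a u *\<^sub>R T u h) (N u)) *\<^sub>R N u)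
        - (\<zeta> u *\<^sub>R (\<beta> *\<^sub>R T u h) + \<zeta>' h *\<^sub>R e u)" for h
    have dX0: "((\<lambda>v. Z v - lorentz (Z v) (N v) *\<^sub>R N v - \<zeta> v *\<^sub>R e v) has_derivative X') (at u)"
      unfolding X'_def[abs_def] c_def
      by (intro has_derivative_diff has_derivative_scaleR lorentz.FDERIV Z(1)[OF u] S[OF u] d\<zeta> e[OF u])
    have dX: "((\<lambda>v. \<Sum>i\<in>UNIV. s v $ i *\<^sub>R E i v) has_derivative X') (at u)"
      by (rule has_derivative_transform_within_open[OF dX0 V' uV']) (use subV in \<open>auto simp: sumE Ms z\<close>)
    have detpos: "det (gram (\<lambda>i. E i u)) > 0"
    proof -
      have "det (gram (\<lambda>i. E i u)) = (det (M t u))^2 * det (G u)"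
        by (simp add: gramE[OF u] det_mul power2_eq_square mult_ac)
      then show ?thesis using Mpos[OF t] det_G[OF u] by simp
    qed
    then obtain Gi where Gi: "Gi ** gram (\<lambda>i. E i u) = mat 1"
      by (metis invertible_def invertible_det_nz less_irrefl)
    obtain Y' where Y': "((\<lambda>v. sqrt (det (gram (\<lambda>i. E i v))) *\<^sub>R s v) has_derivative Y') (at u)"
      and trY': "trace (matrix Y') = sqrt (det (gram (\<lambda>i. E i u))) * trace (Gi ** (\<chi> l k. lorentz (E l u) (X' (axis k 1))))"
      using divergence_tangent_field[OF dE symE ds detpos Gi dX] by blast
    \<comment> \<open>The frame is orthogonal to N and e, so the derivatives of their coefficients
      drop out. There remain a - \<zeta> \<beta> times the metric and, from the derivative of N, the
      normal component c times the second fundamental form.\<close>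
    have Xm: "(\<chi> l k. lorentz (E l u) (X' (axis k 1))) = (a u - \<zeta> u * \<beta>) *\<^sub>R (transpose (M t u) ** G u) + c *\<^sub>R ((transpose (M t u) ** G u) ** A u)"
    proof -
      have EN: "lorentz (E l u) (N u) = 0" "lorentz (E l u) (e u) = 0" for l
        using NT[OF u] eT[OF u] by (simp_all add: EM[OF u] lorentz_commute[of "T u _"])
      have 1: "lorentz (E l u) (T u (axis k 1)) = (transpose (M t u) ** G u) $ l $ k" for l k
        using gE[OF u, of l "mat 1" k] by simp
      have 2: "lorentz (E l u) (T u (A u *v axis k 1)) = ((transpose (M t u) ** G u) ** A u) $ l $ k" for l k
        using gE[OF u, of l "A u" k] by (simp add: matrix_mul_assoc)
      show ?thesis
        by (simp add: vec_eq_iff X'_def lorentz.diff_right lorentz.add_right lorentz.scaleR_right lorentz.minus_right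
            EN weingarten[OF u] 1 2 algebra_simps)
    qed
    \<comment> \<open>The Gram matrix of the frame is M^T G M, so this product is the inverse of M,
      which the generating identity writes as Q / det M.\<close>
    have GiM: "Gi ** (transpose (M t u) ** G u) = inverse (det (M t u)) *\<^sub>R Q t u"
    proof -
      let ?K = "Gi ** (transpose (M t u) ** G u)" and ?R = "inverse (det (M t u)) *\<^sub>R Q t u"
      have KM: "?K ** M t u = mat 1" using Gi by (simp add: gramE[OF u] matrix_mul_assoc)
      have MR: "M t u ** ?R = mat 1"
      proof -
        have "M t u ** ?R = inverse (det (M t u)) *\<^sub>R (M t u ** Q t u)"
          by (simp add: vec_eq_iff matrix_matrix_mult_def sum_distrib_left mult_ac)
        then show ?thesis using Mpos[OF t] by (simp add: MQ[OF u])
      qed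
      have "?K = ?K ** (M t u ** ?R)" by (simp add: MR)
      also have "\<dots> = (?K ** M t u) ** ?R" by (simp only: matrix_mul_assoc)
      finally show ?thesis by (simp add: KM)
    qed
    have trsc: "trace (x *\<^sub>R B) = x * trace B" for x and B :: "real^'m^'m" by (simp add: trace_def sum_distrib_left)
    have scm: "B ** (x *\<^sub>R C) = x *\<^sub>R (B ** C)" "(x *\<^sub>R B) ** C = x *\<^sub>R (B ** C)" for x and B C :: "real^'m^'m"
      by (simp_all add: vec_eq_iff matrix_matrix_mult_def sum_distrib_left mult_ac)
    have "trace (Gi ** (\<chi> l k. lorentz (E l u) (X' (axis k 1)))) = inverse (det (M t u)) * ((a u - \<zeta> u * \<beta>) * trace (Q t u) + c * trace (A u ** Q t u))"
    proof -
      have "Gi ** ((transpose (M t u) ** G u) ** A u) = (inverse (det (M t u)) *\<^sub>R Q t u) ** A u"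
        using arg_cong[OF GiM, of "\<lambda>X. X ** A u"] by (simp only: matrix_mul_assoc)
      then show ?thesis
        unfolding Xm matrix_add_ldistrib scm GiM trace_add trsc by (simp add: trsc trace_mul_sym[of "Q t u"] algebra_simps)
    qed
    then have "trace (matrix Y') = sqrt (det (G u)) * ((a u - \<zeta> u * \<beta>) * trace (Q t u) + c * trace (A u ** Q t u))"
      unfolding trY' sqE[OF uV'] using Mpos[OF t] by simp
    also have "\<dots> = (\<Sum>r\<le>n. (-t)^r * R r)"
    proof -
      have tz: "trace (0 :: real^'m^'m) = 0" "A u ** (0 :: real^'m^'m) = 0"
        by (simp_all add: trace_def vec_eq_iff matrix_matrix_mult_def)
      have "trace (\<Sum>r\<in>I. (-t)^r *\<^sub>R newton_tr r (A u)) = (\<Sum>r\<in>I. (-t)^r * trace (newton_tr r (A u)))"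
        "trace (A u ** (\<Sum>r\<in>I. (-t)^r *\<^sub>R newton_tr r (A u))) = (\<Sum>r\<in>I. (-t)^r * trace (A u ** newton_tr r (A u)))" if "finite I" for I
        using that by (induction I) (auto simp: trace_add trsc scm matrix_add_ldistrib tz)
      from this[of "{..n}"] show ?thesis
        by (simp add: Q_def R_def c_def sum_distrib_left sum.distrib[symmetric] algebra_simps)
    qed
    finally have tr1: "trace (matrix Y') = (\<Sum>r\<le>n. (-t)^r * R r)" .
    \<comment> \<open>The factor det M of the volume cancels the inverse determinant in s, which
      leaves a polynomial in t.\<close>
    have "((\<lambda>v. \<Sum>r\<le>n. (-t)^r *\<^sub>R Y r v) has_derivative Y') (at u)"
    proof (rule has_derivative_transform_within_open[OF Y' V' uV'])
      fix v assume v: "v \<in> V'"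
      then have Mv: "det (M t v) \<noteq> 0" by (simp add: V'_def)
      have "sqrt (det (gram (\<lambda>i. E i v))) *\<^sub>R s v = sqrt (det (G v)) *\<^sub>R (Q t v *v z v)"
        using Mv by (simp add: sqE[OF v] s_def)
      also have "Q t v *v z v = (\<Sum>r\<le>n. (-t)^r *\<^sub>R (newton_tr r (A v) *v z v))"
      proof -
        have "(\<Sum>r\<in>I. (-t)^r *\<^sub>R newton_tr r (A v)) *v z v = (\<Sum>r\<in>I. (-t)^r *\<^sub>R (newton_tr r (A v) *v z v))" if "finite I" for I
          using that by (induction I) (auto simp: matrix_vector_mult_add_rdistrib scaleR_matrix_vector)
        then show ?thesis by (simp add: Q_def)
      qed
      finally show "sqrt (det (gram (\<lambda>i. E i v))) *\<^sub>R s v = (\<Sum>r\<le>n. (-t)^r *\<^sub>R Y r v)"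
        by (simp add: Y_def scaleR_sum_right mult.commute)
    qed
    moreover have "((\<lambda>v. \<Sum>r\<le>n. (-t)^r *\<^sub>R Y r v) has_derivative (\<lambda>h. \<Sum>r\<le>n. (-t)^r *\<^sub>R dY r h)) (at u)"
      by (intro has_derivative_sum has_derivative_scaleR_right dY)
    ultimately have "Y' = (\<lambda>h. \<Sum>r\<le>n. (-t)^r *\<^sub>R dY r h)" by (rule has_derivative_unique)
    then have "trace (matrix Y') = (\<Sum>r\<le>n. (-t)^r * trace (matrix (dY r)))"
      by (simp add: trace_def matrix_def sum_distrib_left) (rule sum.swap)
    then show ?thesis using tr1 by simp
  qed
  from polynomial_coeffs_eq[OF \<delta>(1) this, of r]
  have "trace (matrix (dY r)) = R r" by (simp add: n_def)
  then show "trace (matrix (frechet_derivative (Y r) (at u))) =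
      sqrt (det (G u)) * ((a u - \<zeta> u * \<beta>) * trace (newton_tr r (A u)) + lorentz (Z u) (N u) * trace (A u ** newton_tr r (A u)))"
    by (simp add: dY_def R_def)
qed

end

section \<open>Piecewise continuously differentiable curves and arc length\<close>

lemma piecewise_C1_cong:
  assumes "h piecewise_C1_differentiable_on {a..b::real}" "\<And>t. t \<in> {a..b} \<Longrightarrow> k t = h t"
  shows "k piecewise_C1_differentiable_on {a..b}"
proof -
  obtain S D where S: "finite S" "\<And>t. t \<in> {a..b} - S \<Longrightarrow> (h has_vector_derivative D t) (at t)" "continuous_on ({a..b} - S) D"
    using assms(1) unfolding piecewise_C1_differentiable_on_def C1_differentiable_on_def by blast
  \<comment> \<open>The endpoints join the exceptional set: derivatives are two-sided, and beyond
    the interval k may differ from h.\<close>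
  have "(k has_vector_derivative D t) (at t)" if t: "t \<in> {a..b} - (S \<union> {a, b})" for t
  proof (rule has_vector_derivative_transform_within_open[of h _ _ "{a<..<b}"])
    show "(h has_vector_derivative D t) (at t)" using S(2) t by auto
  qed (use t assms(2) in auto)
  moreover have "continuous_on ({a..b} - (S \<union> {a, b})) D" by (rule continuous_on_subset[OF S(3)]) auto
  ultimately have "k C1_differentiable_on ({a..b} - (S \<union> {a, b}))" unfolding C1_differentiable_on_def by blast
  moreover have "continuous_on {a..b} k"
  proof (rule continuous_on_eq)
    show "continuous_on {a..b} h" using assms(1) by (simp add: piecewise_C1_differentiable_on_def)
  qed (use assms(2) in simp)
  moreover have "finite (S \<union> {a, b})" using S(1) by simp
  ultimately show ?thesis unfolding piecewise_C1_differentiable_on_def by blast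
qed

lemma C1_on_has_vector_derivative_compose:
  assumes "C1_on V h" "\<beta> t \<in> V" "(\<beta> has_vector_derivative D) (at t)"
  shows "((h \<circ> \<beta>) has_vector_derivative frechet_derivative h (at (\<beta> t)) D) (at t)"
proof -
  have hd: "(h has_derivative frechet_derivative h (at (\<beta> t))) (at (\<beta> t))" by (rule C1_onD(1)[OF assms(1,2)])
  have "((\<lambda>s. h (\<beta> s)) has_derivative (\<lambda>s. frechet_derivative h (at (\<beta> t)) (s *\<^sub>R D))) (at t)"
    by (rule has_derivative_compose[OF assms(3)[unfolded has_vector_derivative_def] hd])
  then show ?thesis
    unfolding has_vector_derivative_def o_def using linear_cmul[OF has_derivative_linear[OF hd]] by simp
qed

lemma piecewise_C1_compose_C1_on:
  fixes h :: "'a::euclidean_space \<Rightarrow> 'b::real_normed_vector"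
  assumes h: "C1_on V h" and \<beta>: "\<beta> piecewise_C1_differentiable_on {a..b}" "\<beta> ` {a..b} \<subseteq> V"
  shows "(h \<circ> \<beta>) piecewise_C1_differentiable_on {a..b}"
proof -
  obtain S D where S: "finite S" "\<And>t. t \<in> {a..b} - S \<Longrightarrow> (\<beta> has_vector_derivative D t) (at t)" "continuous_on ({a..b} - S) D"
    and c: "continuous_on {a..b} \<beta>"
    using \<beta>(1) unfolding piecewise_C1_differentiable_on_def C1_differentiable_on_def by blast
  let ?D = "\<lambda>t. frechet_derivative h (at (\<beta> t)) (D t)"
  have lin: "linear (frechet_derivative h (at (\<beta> t)))" if "t \<in> {a..b}" for t
    using C1_onD(1)[OF h] \<beta>(2) that has_derivative_linear by blast
  have 1: "((h \<circ> \<beta>) has_vector_derivative ?D t) (at t)" if "t \<in> {a..b} - S" for t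
    by (rule C1_on_has_vector_derivative_compose[OF h _ S(2)[OF that]]) (use that \<beta>(2) in auto)
  have c1: "continuous_on ({a..b} - S) (\<lambda>t. frechet_derivative h (at (\<beta> t)) w)" for w
    by (rule continuous_on_compose2[OF C1_onD(2)[OF h] continuous_on_subset[OF c]]) (use \<beta>(2) in auto)
  have "continuous_on ({a..b} - S) (\<lambda>t. \<Sum>b\<in>Basis. (D t \<bullet> b) *\<^sub>R frechet_derivative h (at (\<beta> t)) b)"
    by (intro continuous_intros c1 S(3))
  moreover have "(\<Sum>b\<in>Basis. (D t \<bullet> b) *\<^sub>R frechet_derivative h (at (\<beta> t)) b) = ?D t" if "t \<in> {a..b} - S" for t
  proof -
    have l: "linear (frechet_derivative h (at (\<beta> t)))" using lin that by blast
    have "?D t = frechet_derivative h (at (\<beta> t)) (\<Sum>b\<in>Basis. (D t \<bullet> b) *\<^sub>R b)" by (simp add: euclidean_representation)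
    then show ?thesis by (simp only: linear_sum[OF l] linear_cmul[OF l])
  qed
  ultimately have "continuous_on ({a..b} - S) ?D" by (rule continuous_on_eq)
  then have "(h \<circ> \<beta>) C1_differentiable_on ({a..b} - S)"
    unfolding C1_differentiable_on_def by (intro exI[of _ ?D] conjI ballI 1)
  moreover have "continuous_on {a..b} (h \<circ> \<beta>)"
    unfolding o_def by (rule continuous_on_compose2[OF C1_on_continuous[OF h] c \<beta>(2)])
  ultimately show ?thesis unfolding piecewise_C1_differentiable_on_def using S(1) by blast
qed

lemma piecewise_C1_exceptional:
  fixes h :: "real \<Rightarrow> 'b::real_normed_vector"
  assumes "h piecewise_C1_differentiable_on {a..b}"
  obtains S where "finite S" "\<And>t. t \<in> {a..b} - S \<Longrightarrow> h differentiable at t"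
    "continuous_on ({a..b} - S) (\<lambda>t. vector_derivative h (at t))"
  using assms unfolding piecewise_C1_differentiable_on_def C1_differentiable_on_eq by blast

lemma AE_not_in_finite: "finite S \<Longrightarrow> AE t in (lborel :: real measure). t \<notin> S"
  by (rule AE_not_in) (rule finite_imp_null_set_lborel)

lemma measurable_piecewise_speed:
  fixes k :: "real \<Rightarrow> real"
  assumes "finite S" "continuous_on ({a..b} - S) k"
  shows "(\<lambda>t. indicator ({a..b} - S) t * k t) \<in> borel_measurable borel"
proof -
  have "(\<lambda>t. indicator ({a..b} - S) t *\<^sub>R k t) \<in> borel_measurable borel"
  proof (rule borel_measurable_continuous_on_indicator[OF _ assms(2)])
    have "S \<in> sets borel" using assms(1) by (simp add: finite_imp_closed)
    then show "{a..b} - S \<in> sets borel" by simp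
  qed
  then show ?thesis by simp
qed

lemma nn_integral_drop_finite:
  fixes k :: "real \<Rightarrow> real"
  assumes "finite S"
  shows "(\<integral>\<^sup>+t\<in>{a..b}. ennreal (k t) \<partial>lborel) = (\<integral>\<^sup>+t. ennreal (indicator ({a..b} - S) t * k t) \<partial>lborel)"
  by (rule nn_integral_cong_AE) (use AE_not_in_finite[OF assms] in eventually_elim, auto simp: indicator_def)

text \<open>The speed may be unbounded near exceptional parameters. If its integral is infinite
  there is nothing to show; otherwise the speed is integrable and the fundamental theorem with
  finitely many exceptions applies.\<close>

lemma norm_increment_le_nn_integral:
  fixes \<beta> :: "real \<Rightarrow> 'a::euclidean_space"
  assumes "a \<le> b" "\<beta> piecewise_C1_differentiable_on {a..b}"
  shows "ennreal (norm (\<beta> b - \<beta> a)) \<le> (\<integral>\<^sup>+t\<in>{a..b}. ennreal (norm (vector_derivative \<beta> (at t))) \<partial>lborel)"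
proof -
  obtain S where S: "finite S" "\<And>t. t \<in> {a..b} - S \<Longrightarrow> \<beta> differentiable at t"
    "continuous_on ({a..b} - S) (\<lambda>t. vector_derivative \<beta> (at t))"
    using piecewise_C1_exceptional[OF assms(2)] by blast
  let ?k = "\<lambda>t. indicator ({a..b} - S) t * norm (vector_derivative \<beta> (at t))"
  have m: "?k \<in> borel_measurable borel"
    by (rule measurable_piecewise_speed[OF S(1)]) (intro continuous_intros S(3))
  note eq = nn_integral_drop_finite[OF S(1), where a = a and b = b and k = "\<lambda>t. norm (vector_derivative \<beta> (at t))"]
  show ?thesis
  proof (cases "(\<integral>\<^sup>+t. ennreal (?k t) \<partial>lborel) = \<infinity>")
    case False
    then obtain r where r: "r \<ge> 0" "(\<integral>\<^sup>+t. ennreal (?k t) \<partial>lborel) = ennreal r"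
      by (metis enn2real_nonneg ennreal_enn2real infinity_ennreal_def less_top)
    have "(?k has_integral r) UNIV"
      by (rule nn_integral_has_integral[OF m _ r(2) r(1)]) simp
    moreover have "(\<lambda>t. if t \<in> {a..b} then ?k t else 0) = ?k" by (auto simp: indicator_def)
    ultimately have "(?k has_integral r) {a..b}"
      by (subst has_integral_restrict_UNIV[symmetric]) (simp only:)
    then have I: "((\<lambda>t. norm (vector_derivative \<beta> (at t))) has_integral r) {a..b}"
      by (rule has_integral_spike_finite[OF S(1), rotated]) (auto simp: indicator_def)
    have J: "((\<lambda>t. vector_derivative \<beta> (at t)) has_integral (\<beta> b - \<beta> a)) {a..b}"
    proof (rule fundamental_theorem_of_calculus_interior_strong[OF S(1) assms(1)])
      show "continuous_on {a..b} \<beta>" using assms(2) by (simp add: piecewise_C1_differentiable_on_def)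
      show "(\<beta> has_vector_derivative vector_derivative \<beta> (at t)) (at t)" if "t \<in> {a<..<b} - S" for t
        using S(2)[of t] that by (simp add: vector_derivative_works)
    qed
    have "norm (integral {a..b} (\<lambda>t. vector_derivative \<beta> (at t))) \<le> integral {a..b} (\<lambda>t. norm (vector_derivative \<beta> (at t)))"
      by (rule integral_norm_bound_integral) (use I J in \<open>auto intro: has_integral_integrable\<close>)
    then have "norm (\<beta> b - \<beta> a) \<le> r" using I J by (simp add: integral_unique)
    then show ?thesis unfolding eq r(2) using r(1) by (simp add: ennreal_leI)
  qed (simp add: eq)
qed

definition speed :: "(real \<Rightarrow> (real^'n::finite) \<times> real) \<Rightarrow> real \<Rightarrow> real" where
  "speed c t = sqrt (lorentz (vector_derivative c (at t)) (vector_derivative c (at t)))"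

definition arclength :: "(real \<Rightarrow> (real^'n::finite) \<times> real) \<Rightarrow> real \<Rightarrow> real \<Rightarrow> ennreal" where
  "arclength c a b = (\<integral>\<^sup>+t\<in>{a..b}. ennreal (speed c t) \<partial>lborel)"

lemma continuous_on_speed:
  assumes "continuous_on S (\<lambda>t. vector_derivative c (at t))" shows "continuous_on S (speed c)"
  unfolding speed_def by (intro continuous_intros lorentz.continuous_on assms)

lemma arclength_split:
  assumes "c piecewise_C1_differentiable_on {a..b}" "a \<le> m" "m \<le> b"
  shows "arclength c a b = arclength c a m + arclength c m b"
proof -
  obtain S where S: "finite S" "continuous_on ({a..b} - S) (\<lambda>t. vector_derivative c (at t))"
    using piecewise_C1_exceptional[OF assms(1)] by blast
  have cs: "continuous_on ({a..b} - S) (speed c)" by (rule continuous_on_speed[OF S(2)])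
  let ?S = "insert m S"
  have f: "finite ?S" using S by simp
  let ?k = "\<lambda>a b t. indicator ({a..b} - ?S) t * speed c t"
  have m: "?k a m \<in> borel_measurable borel" "?k m b \<in> borel_measurable borel"
    by (rule measurable_piecewise_speed[OF f], rule continuous_on_subset[OF cs], use assms in auto)+
  have "arclength c a b = (\<integral>\<^sup>+t. ennreal (?k a m t) + ennreal (?k m b t) \<partial>lborel)"
    unfolding arclength_def nn_integral_drop_finite[OF f]
    by (rule nn_integral_cong) (use assms in \<open>auto simp: indicator_def\<close>)
  also have "\<dots> = (\<integral>\<^sup>+t. ennreal (?k a m t) \<partial>lborel) + (\<integral>\<^sup>+t. ennreal (?k m b t) \<partial>lborel)"
    by (rule nn_integral_add) (use m in auto)
  finally show ?thesis by (simp add: arclength_def nn_integral_drop_finite[OF f])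
qed

lemma arclength_cong:
  assumes "\<And>t. t \<in> {a<..<b} \<Longrightarrow> c t = c' t"
  shows "arclength c a b = arclength c' a b"
proof -
  have "speed c t = speed c' t" if t: "t \<in> {a<..<b}" for t
  proof -
    have ev: "\<forall>\<^sub>F s in nhds t. c s = c' s"
      using assms t by (auto intro!: eventually_nhds_in_open[THEN eventually_mono, of "{a<..<b}"])
    have "vector_derivative c (at t) = vector_derivative c' (at t)"
      by (rule vector_derivative_cong_eq) (use ev assms[OF t] in \<open>auto simp: eventually_nhds_conv_at\<close>)
    then show ?thesis by (simp add: speed_def)
  qed
  then show ?thesis
    unfolding arclength_def nn_integral_drop_finite[of "{a, b}", simplified]
    by (intro nn_integral_cong) (auto simp: indicator_def)
qed

text \<open>Negative m is included, so that reversing curves can give the symmetry of the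
  distance.\<close>

lemma arclength_affine:
  assumes c: "c piecewise_C1_differentiable_on {a..b}" and m: "m \<noteq> 0" "(\<lambda>t. m * t + k) ` {p..q} = {a..b}"
  shows "arclength (c \<circ> (\<lambda>t. m * t + k)) p q = arclength c a b"
proof -
  obtain S where S: "finite S" "\<And>t. t \<in> {a..b} - S \<Longrightarrow> c differentiable at t" "continuous_on ({a..b} - S) (\<lambda>t. vector_derivative c (at t))"
    using piecewise_C1_exceptional[OF c] by blast
  let ?\<sigma> = "\<lambda>t. m * t + k"
  have mem: "t \<in> {p..q} \<longleftrightarrow> ?\<sigma> t \<in> {a..b}" for t
  proof
    assume "?\<sigma> t \<in> {a..b}"
    then have "?\<sigma> t \<in> ?\<sigma> ` {p..q}" using m(2) by simp
    then show "t \<in> {p..q}" using m(1) by auto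
  qed (metis imageI m(2))
  define S' where "S' = ?\<sigma> -` S"
  have S': "finite S'" unfolding S'_def by (rule finite_vimageI[OF S(1)]) (use m(1) in \<open>auto simp: inj_def\<close>)
  have sp: "speed (c \<circ> ?\<sigma>) t = \<bar>m\<bar> * speed c (?\<sigma> t)" if "t \<in> {p..q} - S'" for t
  proof -
    have "?\<sigma> t \<in> {a..b} - S" using that mem by (auto simp: S'_def)
    then have "(c has_vector_derivative vector_derivative c (at (?\<sigma> t))) (at (?\<sigma> t))"
      using S(2) by (simp add: vector_derivative_works)
    moreover have "(?\<sigma> has_vector_derivative m) (at t)"
      unfolding has_vector_derivative_def by (auto intro!: derivative_eq_intros simp: mult.commute)
    ultimately have "((c \<circ> ?\<sigma>) has_vector_derivative m *\<^sub>R vector_derivative c (at (?\<sigma> t))) (at t)"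
      by (rule vector_diff_chain_at[rotated])
    then have "vector_derivative (c \<circ> ?\<sigma>) (at t) = m *\<^sub>R vector_derivative c (at (?\<sigma> t))"
      by (rule vector_derivative_at)
    then show ?thesis
      by (simp add: speed_def lorentz.scaleR_left lorentz.scaleR_right real_sqrt_mult mult.assoc[symmetric])
  qed
  let ?g = "\<lambda>t. indicator ({a..b} - S) t * speed c t"
  have mg: "?g \<in> borel_measurable borel"
    by (rule measurable_piecewise_speed[OF S(1) continuous_on_speed[OF S(3)]])
  have "arclength c a b = (\<integral>\<^sup>+t. ennreal (?g t) \<partial>lborel)"
    unfolding arclength_def by (rule nn_integral_drop_finite[OF S(1)])
  also have "\<dots> = ennreal \<bar>m\<bar> * (\<integral>\<^sup>+t. ennreal (?g (k + m * t)) \<partial>lborel)"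
    by (rule nn_integral_real_affine) (use m mg in auto)
  also have "\<dots> = (\<integral>\<^sup>+t. ennreal \<bar>m\<bar> * ennreal (?g (k + m * t)) \<partial>lborel)"
    by (rule nn_integral_cmult[symmetric]) (use mg in measurable)
  also have "\<dots> = (\<integral>\<^sup>+t. ennreal (indicator ({p..q} - S') t * speed (c \<circ> ?\<sigma>) t) \<partial>lborel)"
  proof (rule nn_integral_cong)
    fix t
    have "indicator ({a..b} - S) (k + m * t) = (indicator ({p..q} - S') t :: real)"
      using mem[of t] by (auto simp: indicator_def S'_def add.commute)
    then show "ennreal \<bar>m\<bar> * ennreal (?g (k + m * t)) = ennreal (indicator ({p..q} - S') t * speed (c \<circ> ?\<sigma>) t)"
      using sp[of t] by (cases "t \<in> {p..q} - S'") (auto simp: ennreal_mult[symmetric] add.commute ennreal_mult')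
  qed
  also have "\<dots> = arclength (c \<circ> ?\<sigma>) p q"
    unfolding arclength_def by (rule nn_integral_drop_finite[OF S', symmetric])
  finally show ?thesis ..
qed

section \<open>The Riemannian distance of a hypersurface\<close>

text \<open>The normal direction of the space form in the ambient space: the last unit vector in the
  flat model, the point itself on the hyperboloid. Both are timelike for \<open>lorentz\<close>, so
  the two models share their linear algebra.\<close>

definition radial :: "real \<Rightarrow> (real^'n) \<times> real \<Rightarrow> (real^'n::finite) \<times> real" where
  "radial c y = (if c = 0 then (0, 1) else y)"

lemma space_form_tangent_iff: "w \<in> space_form_tangent c y \<longleftrightarrow> lorentz (radial c y) w = 0"
  by (auto simp: space_form_tangent_def radial_def lorentz_def inner_commute algebra_simps)

lemma lorentz_radial:
  assumes "c \<le> 0" "y \<in> space_form c" shows "lorentz (radial c y) (radial c y) < 0"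
proof (cases "c = 0")
  case False
  then have "1 / c < 0" using assms(1) by (simp add: divide_less_0_iff)
  then show ?thesis using assms(2) False by (simp add: space_form_def radial_def)
qed (simp add: radial_def lorentz_def)

text \<open>The complement of a timelike vector is spacelike, by Cauchy-Schwarz in the first factor.
  This is why the induced metric is Riemannian.\<close>

lemma lorentz_pos_on_tangent:
  assumes "c \<le> 0" "y \<in> space_form c" "lorentz (radial c y) w = 0" "w \<noteq> 0"
  shows "lorentz w w > 0"
proof -
  obtain b r where w: "w = (b, r)" by force
  show ?thesis
  proof (cases "c = 0")
    case True
    then have "r = 0" using assms(3) by (simp add: radial_def lorentz_def w)
    then show ?thesis using assms(4) by (simp add: w lorentz_def zero_prod_def)
  next
    case False
    obtain a s where y: "y = (a, s)" by force
    have ys: "a \<bullet> a - s * s = 1 / c" "s > 0" using assms(2) False by (auto simp: space_form_def lorentz_def y)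
    then have "a \<bullet> a < s * s" using assms(1) False by (smt (verit) divide_neg_pos divide_pos_neg zero_less_one)
    then have na: "norm a < s" using ys(2) by (metis abs_of_pos norm_eq_sqrt_inner real_sqrt_abs2 real_sqrt_less_iff)
    have ab: "a \<bullet> b = s * r" using assms(3) False by (simp add: radial_def lorentz_def w y)
    show ?thesis
    proof (cases "b = 0")
      case True
      then have "r = 0" using ab ys(2) by simp
      then show ?thesis using True assms(4) w by (simp add: zero_prod_def)
    next
      case False
      have "s * \<bar>r\<bar> = \<bar>a \<bullet> b\<bar>" using ab ys(2) by (simp add: abs_mult)
      also have "\<dots> \<le> norm a * norm b" by (rule Cauchy_Schwarz_ineq2)
      also have "\<dots> < s * norm b" using na False by simp
      finally have "\<bar>r\<bar> < norm b" using ys(2) by simp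
      then have "r * r < norm b * norm b" by (metis abs_ge_zero abs_mult_self_eq mult_strict_mono' )
      then show ?thesis by (simp add: w lorentz_def power2_norm_eq_inner[symmetric] power2_eq_square)
    qed
  qed
qed

lemma derivative_of_constant:
  assumes "(h has_derivative h') (at u)" "\<And>w. h w = k" shows "h' v = 0"
proof -
  have "h = (\<lambda>_. k)" using assms(2) by auto
  then have "(h has_derivative (\<lambda>_. 0)) (at u)" by simp
  then have "h' = (\<lambda>_. 0)" by (rule has_derivative_unique[OF assms(1)])
  then show ?thesis by simp
qed

section \<open>Charts of a hypersurface and lengths of tangent vectors\<close>

locale hypersurface =
  fixes c :: real and \<A> :: "('m::finite, 'p::t2_space) param set"
    and f N :: "'p \<Rightarrow> (real^'n::finite) \<times> real"
  assumes c0: "c \<le> 0" and atlas: "smooth_atlas \<A>" and hyp: "oriented_hypersurface c \<A> f N"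
    and conn: "connected (UNIV :: 'p set)"
begin

lemma chart:
  assumes "(V, x) \<in> \<A>"
  shows "open V" "open (x ` V)" "homeomorphism V (x ` V) x (inv_into V x)"
    "continuous_on V x" "continuous_on (x ` V) (inv_into V x)"
    "u \<in> V \<Longrightarrow> inv_into V x (x u) = u"
  using atlas assms unfolding smooth_atlas_def homeomorphism_def by fastforce+

lemma chart_open_image:
  assumes "(V, x) \<in> \<A>" "open U" "U \<subseteq> V" shows "open (x ` U)"
proof -
  have "x ` U = x ` V \<inter> inv_into V x -` U"
    using assms(3) chart(6)[OF assms(1)] by (auto simp: image_iff)
  then show ?thesis using continuous_open_preimage[OF chart(5)[OF assms(1)] chart(2)[OF assms(1)] assms(2)] by simp
qed

lemma chart_cover: obtains V x where "(V, x) \<in> \<A>" "p \<in> x ` V"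
  using atlas unfolding smooth_atlas_def by blast

lemma chart_at:
  obtains V x where "chart_at \<A> p = (V, x)" "(V, x) \<in> \<A>" "p \<in> x ` V"
proof -
  obtain V x where "(V, x) \<in> \<A>" "p \<in> x ` V" by (rule chart_cover)
  then have "\<exists>z. (case z of (V, x) \<Rightarrow> (V, x) \<in> \<A> \<and> p \<in> x ` V)" by blast
  from someI_ex[OF this] have "case chart_at \<A> p of (V, x) \<Rightarrow> (V, x) \<in> \<A> \<and> p \<in> x ` V"
    unfolding chart_at_def .
  then show ?thesis using that by (cases "chart_at \<A> p") auto
qed

lemma smooth: "(V, x) \<in> \<A> \<Longrightarrow> smooth_on V (f \<circ> x)" "(V, x) \<in> \<A> \<Longrightarrow> smooth_on V (N \<circ> x)"
  and immersion: "(V, x) \<in> \<A> \<Longrightarrow> u \<in> V \<Longrightarrow> inj (frechet_derivative (f \<circ> x) (at u))"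
  using hyp unfolding oriented_hypersurface_def by fastforce+

definition dom :: "(real^'m) set \<Rightarrow> (real^'m \<Rightarrow> 'p) \<Rightarrow> (real^'m) set \<Rightarrow> (real^'m \<Rightarrow> 'p) \<Rightarrow> (real^'m) set" where
  "dom V x W y = V \<inter> x -` (y ` W)"

lemma open_dom: "(V, x) \<in> \<A> \<Longrightarrow> (W, y) \<in> \<A> \<Longrightarrow> open (dom V x W y)"
  unfolding dom_def by (intro continuous_open_preimage chart)

lemma C1_transition:
  assumes "(V, x) \<in> \<A>" "(W, y) \<in> \<A>" shows "C1_on (dom V x W y) (inv_into W y \<circ> x)"
  using atlas assms unfolding smooth_atlas_def dom_def by (intro smooth_on_C1) blast

lemma derivative_transition:
  fixes h :: "'p \<Rightarrow> 'b::real_normed_vector"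
  assumes x: "(V, x) \<in> \<A>" and y: "(W, y) \<in> \<A>" and u: "u \<in> V" "x u \<in> y ` W"
    and h: "(h \<circ> y) differentiable at (inv_into W y (x u))"
  defines "\<tau> \<equiv> frechet_derivative (inv_into W y \<circ> x) (at u)"
  shows "linear \<tau>" "((h \<circ> x) has_derivative (\<lambda>v. frechet_derivative (h \<circ> y) (at (inv_into W y (x u))) (\<tau> v))) (at u)"
proof -
  have uO: "u \<in> dom V x W y" using u by (simp add: dom_def)
  note d = C1_onD(1)[OF C1_transition[OF x y] uO]
  then show "linear \<tau>" unfolding \<tau>_def by (rule has_derivative_linear)
  have "((\<lambda>w. (h \<circ> y) ((inv_into W y \<circ> x) w)) has_derivative (\<lambda>v. frechet_derivative (h \<circ> y) (at (inv_into W y (x u))) (\<tau> v))) (at u)"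
  proof -
    have e: "(inv_into W y \<circ> x) u = inv_into W y (x u)" by simp
    have "(h \<circ> y has_derivative frechet_derivative (h \<circ> y) (at (inv_into W y (x u)))) (at ((inv_into W y \<circ> x) u))"
      unfolding e using h by (simp only: frechet_derivative_works)
    then show ?thesis unfolding \<tau>_def by (rule has_derivative_compose[OF d])
  qed
  then show "((h \<circ> x) has_derivative (\<lambda>v. frechet_derivative (h \<circ> y) (at (inv_into W y (x u))) (\<tau> v))) (at u)"
    by (rule has_derivative_transform_within_open[OF _ open_dom[OF x y] uO])
       (auto simp: dom_def f_inv_into_f)
qed

text \<open>The differential of the change from x to the chart selected at \<open>x u\<close>. It
  carries coordinate vectors of x to the identification of the tangent space behind
  \<open>mdiff\<close>, so pointwise notions can be computed in any chart.\<close>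

definition tr :: "(real^'m \<Rightarrow> 'p) \<Rightarrow> real^'m \<Rightarrow> real^'m \<Rightarrow> real^'m" where
  "tr x u = (case chart_at \<A> (x u) of (W, y) \<Rightarrow> frechet_derivative (inv_into W y \<circ> x) (at u))"

lemma mdiff_tr:
  fixes h :: "'p \<Rightarrow> 'b::real_normed_vector"
  assumes x: "(V, x) \<in> \<A>" "u \<in> V" and h: "\<And>W y w. (W, y) \<in> \<A> \<Longrightarrow> w \<in> W \<Longrightarrow> (h \<circ> y) differentiable at w"
  shows "linear (tr x u)" "((h \<circ> x) has_derivative (\<lambda>v. mdiff \<A> h (x u) (tr x u v))) (at u)"
    "frechet_derivative (h \<circ> x) (at u) v = mdiff \<A> h (x u) (tr x u v)"
proof -
  obtain W y where y: "chart_at \<A> (x u) = (W, y)" "(W, y) \<in> \<A>" "x u \<in> y ` W" by (rule chart_at)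
  have "inv_into W y (x u) \<in> W" using y(3) by (rule inv_into_into)
  note d = derivative_transition[OF x(1) y(2) x(2) y(3) h[OF y(2) this]]
  show "linear (tr x u)" using d(1) by (simp add: tr_def y)
  show *: "((h \<circ> x) has_derivative (\<lambda>v. mdiff \<A> h (x u) (tr x u v))) (at u)"
    using d(2) by (simp add: tr_def mdiff_def y)
  show "frechet_derivative (h \<circ> x) (at u) v = mdiff \<A> h (x u) (tr x u v)"
    using frechet_derivative_at[OF *] by metis
qed

abbreviation "T x u \<equiv> frechet_derivative (f \<circ> x) (at u)"

lemma T_tr: "(V, x) \<in> \<A> \<Longrightarrow> u \<in> V \<Longrightarrow> T x u v = mdiff \<A> f (x u) (tr x u v)"
  and S_tr: "(V, x) \<in> \<A> \<Longrightarrow> u \<in> V \<Longrightarrow> frechet_derivative (N \<circ> x) (at u) v = mdiff \<A> N (x u) (tr x u v)"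
  by (rule mdiff_tr(3); use smooth smooth_on_C1 C1_onD(3) in blast)+

lemma linear_tr: "(V, x) \<in> \<A> \<Longrightarrow> u \<in> V \<Longrightarrow> linear (tr x u)"
  by (rule mdiff_tr(1)[where h = f]; use smooth smooth_on_C1 C1_onD(3) in blast)

lemma T: "(V, x) \<in> \<A> \<Longrightarrow> u \<in> V \<Longrightarrow> ((f \<circ> x) has_derivative T x u) (at u)"
  by (rule C1_onD(1)[OF smooth_on_C1[OF smooth(1)]])

lemma linear_T: "(V, x) \<in> \<A> \<Longrightarrow> u \<in> V \<Longrightarrow> linear (T x u)"
  using T has_derivative_linear by blast

lemma inj_tr: "(V, x) \<in> \<A> \<Longrightarrow> u \<in> V \<Longrightarrow> inj (tr x u)"
  using immersion[of V x u] by (auto simp: inj_def T_tr)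

lemma N_normal: "lorentz (N p) (N p) = 1" "lorentz (N p) (mdiff \<A> f p v) = 0" "lorentz (radial c (f p)) (N p) = 0"
  using hyp unfolding oriented_hypersurface_def space_form_tangent_iff by blast+

lemma NT: "(V, x) \<in> \<A> \<Longrightarrow> u \<in> V \<Longrightarrow> lorentz (N (x u)) (T x u v) = 0"
  by (simp add: T_tr N_normal)

lemma f_space: "f p \<in> space_form c"
  using hyp unfolding oriented_hypersurface_def by blast

lemma radial_T:
  assumes x: "(V, x) \<in> \<A>" and u: "u \<in> V" shows "lorentz (radial c (f (x u))) (T x u v) = 0"
proof (cases "c = 0")
  case True
  have "((\<lambda>u. snd ((f \<circ> x) u)) has_derivative (\<lambda>v. snd (T x u v))) (at u)"
    by (rule has_derivative_snd[OF T[OF x u]])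
  then have "snd (T x u v) = 0"
    by (rule derivative_of_constant[where k = 0]) (use f_space True in \<open>simp add: space_form_def\<close>)
  then show ?thesis using True by (simp add: radial_def lorentz_def)
next
  case False
  have "((\<lambda>u. lorentz ((f \<circ> x) u) ((f \<circ> x) u)) has_derivative (\<lambda>v. lorentz ((f \<circ> x) u) (T x u v) + lorentz (T x u v) ((f \<circ> x) u))) (at u)"
    by (rule lorentz.FDERIV[OF T[OF x u] T[OF x u]])
  then have "lorentz ((f \<circ> x) u) (T x u v) + lorentz (T x u v) ((f \<circ> x) u) = 0"
    by (rule derivative_of_constant[where k = "1 / c"]) (use f_space False in \<open>simp add: space_form_def\<close>)
  then show ?thesis using False by (simp add: radial_def lorentz_commute[of "T x u v"])
qed

lemma T_pos: "(V, x) \<in> \<A> \<Longrightarrow> u \<in> V \<Longrightarrow> v \<noteq> 0 \<Longrightarrow> lorentz (T x u v) (T x u v) > 0"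
proof (rule lorentz_pos_on_tangent[OF c0 f_space radial_T])
  assume a: "(V, x) \<in> \<A>" "u \<in> V" "v \<noteq> 0"
  then show "T x u v \<noteq> 0"
    using immersion[OF a(1,2)] linear_0[OF linear_T[OF a(1,2)]] by (metis injD)
qed

definition gn :: "(real^'m \<Rightarrow> 'p) \<Rightarrow> real^'m \<Rightarrow> real^'m \<Rightarrow> real" where
  "gn x u v = sqrt (lorentz (T x u v) (T x u v))"

lemma gn_scale: "(V, x) \<in> \<A> \<Longrightarrow> u \<in> V \<Longrightarrow> gn x u (s *\<^sub>R v) = \<bar>s\<bar> * gn x u v"
  by (simp add: gn_def linear_cmul[OF linear_T] lorentz.scaleR_left lorentz.scaleR_right real_sqrt_mult mult.assoc[symmetric])

lemma gn_pos: "(V, x) \<in> \<A> \<Longrightarrow> u \<in> V \<Longrightarrow> v \<noteq> 0 \<Longrightarrow> gn x u v > 0"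
  by (simp add: gn_def T_pos)

lemma gn_nonneg: "(V, x) \<in> \<A> \<Longrightarrow> u \<in> V \<Longrightarrow> gn x u v \<ge> 0"
  using gn_pos[of V x u v] linear_0[OF linear_T[of V x u]] by (cases "v = 0") (auto simp: gn_def lorentz.zero_left)

lemma continuous_T:
  assumes x: "(V, x) \<in> \<A>" shows "continuous_on (V \<times> UNIV) (\<lambda>(u, v). T x u v)"
proof -
  have c: "continuous_on (V \<times> UNIV) (\<lambda>z. T x (fst z) b)" for b
    by (rule continuous_on_compose2[OF C1_onD(2)[OF smooth_on_C1[OF smooth(1)[OF x]]]])
       (auto intro!: continuous_intros)
  have "continuous_on (V \<times> UNIV) (\<lambda>z. \<Sum>b\<in>Basis. (snd z \<bullet> b) *\<^sub>R T x (fst z) b)"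
    by (intro continuous_intros c)
  moreover have "(\<Sum>b\<in>Basis. (snd z \<bullet> b) *\<^sub>R T x (fst z) b) = (case z of (u, v) \<Rightarrow> T x u v)" if z: "z \<in> V \<times> UNIV" for z
  proof -
    have l: "linear (T x (fst z))" using linear_T[OF x] z by auto
    have "T x (fst z) (snd z) = T x (fst z) (\<Sum>b\<in>Basis. (snd z \<bullet> b) *\<^sub>R b)" by (simp add: euclidean_representation)
    then show ?thesis by (simp add: linear_sum[OF l] linear_cmul[OF l] case_prod_beta)
  qed
  ultimately show ?thesis by (rule continuous_on_eq)
qed

lemma continuous_gn:
  assumes x: "(V, x) \<in> \<A>" shows "continuous_on (V \<times> UNIV) (\<lambda>(u, v). gn x u v)"
  using continuous_T[OF x] unfolding gn_def case_prod_beta by (intro continuous_intros lorentz.continuous_on)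

text \<open>By homogeneity it suffices to minimize over K times the unit sphere, a compact set on
  which the norm is positive.\<close>

lemma gn_lower:
  assumes x: "(V, x) \<in> \<A>" and K: "compact K" "K \<subseteq> V"
  obtains k where "k > 0" "\<And>u v. u \<in> K \<Longrightarrow> k * norm v \<le> gn x u v"
proof -
  let ?C = "K \<times> sphere (0::real^'m) 1"
  have cc: "compact ?C" by (intro compact_Times K compact_sphere)
  have cg: "continuous_on ?C (\<lambda>(u, v). gn x u v)" by (rule continuous_on_subset[OF continuous_gn[OF x]]) (use K in auto)
  obtain k where k: "k > 0" "\<And>u v. u \<in> K \<Longrightarrow> norm v = 1 \<Longrightarrow> k \<le> gn x u v"
  proof (cases "?C = {}")
    case True
    then show ?thesis by (intro that[of 1]) auto
  next
    case False
    then obtain z where z: "z \<in> ?C" "\<And>w. w \<in> ?C \<Longrightarrow> (case z of (u, v) \<Rightarrow> gn x u v) \<le> (case w of (u, v) \<Rightarrow> gn x u v)"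
      using continuous_attains_inf[OF cc _ cg] by blast
    obtain a b where ab: "z = (a, b)" by force
    have "gn x a b > 0" by (rule gn_pos[OF x]) (use z(1) K ab in auto)
    then show ?thesis using z(2) ab by (intro that[of "gn x a b"]) auto
  qed
  have "k * norm v \<le> gn x u v" if u: "u \<in> K" for u v
  proof (cases "v = 0")
    case True
    then show ?thesis using gn_nonneg[OF x, of u v] u K by auto
  next
    case False
    have uV: "u \<in> V" using u K by auto
    have "k \<le> gn x u ((1 / norm v) *\<^sub>R v)" by (rule k(2)[OF u]) (use False in simp)
    also have "\<dots> = gn x u v / norm v" using gn_scale[OF x uV, of "1 / norm v" v] by simp
    finally show ?thesis using False by (simp add: pos_le_divide_eq)
  qed
  then show ?thesis using that k(1) by blast
qed

text \<open>Uniform continuity on K times the unit sphere, extended to all vectors by homogeneity;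
  it supplies the error term e * norm h of the first-order Lipschitz condition.\<close>

lemma gn_uniform:
  assumes x: "(V, x) \<in> \<A>" and K: "compact K" "K \<subseteq> V" and e: "e > 0"
  obtains d where "d > 0" "\<And>u w v. u \<in> K \<Longrightarrow> w \<in> K \<Longrightarrow> dist u w < d \<Longrightarrow> gn x w v \<le> gn x u v + e * norm v"
proof -
  let ?C = "K \<times> sphere (0::real^'m) 1"
  have cg: "continuous_on ?C (\<lambda>(u, v). gn x u v)" by (rule continuous_on_subset[OF continuous_gn[OF x]]) (use K in auto)
  have "uniformly_continuous_on ?C (\<lambda>(u, v). gn x u v)"
    by (rule compact_uniformly_continuous[OF cg]) (intro compact_Times K compact_sphere)
  then obtain d where d: "d > 0" "\<And>z w. z \<in> ?C \<Longrightarrow> w \<in> ?C \<Longrightarrow> dist w z < d \<Longrightarrow> dist (case w of (u, v) \<Rightarrow> gn x u v) (case z of (u, v) \<Rightarrow> gn x u v) < e"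
    using e unfolding uniformly_continuous_on_def by metis
  have "gn x w v \<le> gn x u v + e * norm v" if u: "u \<in> K" "w \<in> K" "dist u w < d" for u w v
  proof (cases "v = 0")
    case True
    then show ?thesis using linear_0[OF linear_T[OF x]] u K by (auto simp: gn_def subset_iff)
  next
    case False
    let ?v = "(1 / norm v) *\<^sub>R v"
    have uV: "u \<in> V" "w \<in> V" using u K by auto
    have "dist (gn x w ?v) (gn x u ?v) < e"
      using d(2)[of "(u, ?v)" "(w, ?v)"] u False by (simp add: dist_Pair_Pair dist_commute)
    then have "gn x w ?v < gn x u ?v + e" by (simp add: dist_real_def)
    moreover have "gn x w ?v = gn x w v / norm v" "gn x u ?v = gn x u v / norm v"
      using gn_scale[OF x uV(1), of "1 / norm v" v] gn_scale[OF x uV(2), of "1 / norm v" v] by auto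
    ultimately have "gn x w v / norm v < gn x u v / norm v + e" by simp
    then have "gn x w v < (gn x u v / norm v + e) * norm v" using False by (simp add: pos_divide_less_eq)
    then show ?thesis using False by (simp add: distrib_right)
  qed
  then show ?thesis using that d(1) by blast
qed

end

section \<open>Curves and the length distance\<close>

context hypersurface begin

text \<open>The curves of \<open>piecewise_C1_curve\<close> over arbitrary parameter intervals,
  since restriction and concatenation lead out of the unit interval.\<close>

definition admissible :: "(real \<Rightarrow> 'p) \<Rightarrow> real \<Rightarrow> real \<Rightarrow> bool" where
  "admissible \<gamma> a b \<longleftrightarrow> continuous_on {a..b} \<gamma> \<and>
     (\<forall>(V, x)\<in>\<A>. \<forall>p q. a \<le> p \<and> p \<le> q \<and> q \<le> b \<and> \<gamma> ` {p..q} \<subseteq> x ` V \<longrightarrow>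
        (inv_into V x \<circ> \<gamma>) piecewise_C1_differentiable_on {p..q})"

lemma admissible_01: "admissible \<gamma> 0 1 \<longleftrightarrow> piecewise_C1_curve \<A> \<gamma>"
  unfolding admissible_def piecewise_C1_curve_def ..

lemma admissible_cont: "admissible \<gamma> a b \<Longrightarrow> continuous_on {a..b} \<gamma>"
  by (simp add: admissible_def)

lemma admissible_chart:
  assumes "admissible \<gamma> a b" "(V, x) \<in> \<A>" "a \<le> p" "p \<le> q" "q \<le> b" "\<gamma> ` {p..q} \<subseteq> x ` V"
  shows "(inv_into V x \<circ> \<gamma>) piecewise_C1_differentiable_on {p..q}"
proof -
  have "\<forall>(V, x)\<in>\<A>. \<forall>p q. a \<le> p \<and> p \<le> q \<and> q \<le> b \<and> \<gamma> ` {p..q} \<subseteq> x ` V \<longrightarrow>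
        (inv_into V x \<circ> \<gamma>) piecewise_C1_differentiable_on {p..q}"
    using assms(1) by (simp add: admissible_def)
  from bspec[OF this assms(2)] show ?thesis using assms(3-6) by simp
qed

lemma admissibleI:
  assumes "continuous_on {a..b} \<gamma>"
    "\<And>V x p q. (V, x) \<in> \<A> \<Longrightarrow> a \<le> p \<Longrightarrow> p \<le> q \<Longrightarrow> q \<le> b \<Longrightarrow> \<gamma> ` {p..q} \<subseteq> x ` V \<Longrightarrow>
        (inv_into V x \<circ> \<gamma>) piecewise_C1_differentiable_on {p..q}"
  shows "admissible \<gamma> a b"
  using assms unfolding admissible_def by auto

lemma admissible_sub: "admissible \<gamma> a b \<Longrightarrow> a \<le> p \<Longrightarrow> q \<le> b \<Longrightarrow> admissible \<gamma> p q"
  by (rule admissibleI) (auto intro!: admissible_chart[of \<gamma> a b] elim!: continuous_on_subset[OF admissible_cont])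

text \<open>Bisection of the interval: near each parameter the curve stays in one chart, where f is
  smooth in coordinates, and the property passes to a union of two adjacent intervals.\<close>

lemma admissible_image_C1:
  assumes \<gamma>: "admissible \<gamma> a b" and "a \<le> b"
  shows "(f \<circ> \<gamma>) piecewise_C1_differentiable_on {a..b}"
proof -
  let ?P = "\<lambda>p q. a \<le> p \<and> p \<le> q \<and> q \<le> b \<longrightarrow> (f \<circ> \<gamma>) piecewise_C1_differentiable_on {p..q}"
  have "?P a b"
  proof (induction rule: Bolzano[OF assms(2), of ?P])
    case (1 p q r)
    have eq: "(\<lambda>t. if t \<le> q then (f \<circ> \<gamma>) t else (f \<circ> \<gamma>) t) = f \<circ> \<gamma>" by auto
    show ?case
      using piecewise_C1_differentiable_cases[of "f \<circ> \<gamma>" p q "f \<circ> \<gamma>" r] 1 unfolding eq by auto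
  next
    case (2 t)
    obtain V x where x: "(V, x) \<in> \<A>" "\<gamma> t \<in> x ` V" by (rule chart_cover)
    have "\<exists>d>0. \<forall>s\<in>{a..b}. dist s t < d \<longrightarrow> \<gamma> s \<in> x ` V"
    proof -
      have "openin (top_of_set {a..b}) ({a..b} \<inter> \<gamma> -` (x ` V))"
        by (rule continuous_openin_preimage_gen[OF admissible_cont[OF \<gamma>] chart(2)[OF x(1)]])
      then show ?thesis unfolding openin_euclidean_subtopology_iff using 2 x(2) by fastforce
    qed
    then obtain d where d: "d > 0" "\<And>s. s \<in> {a..b} \<Longrightarrow> dist s t < d \<Longrightarrow> \<gamma> s \<in> x ` V" by blast
    have "?P p q" if pq: "p \<le> t" "t \<le> q" "q - p < d" for p q
    proof (intro impI, elim conjE)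
      assume ab: "a \<le> p" "p \<le> q" "q \<le> b"
      have sub: "\<gamma> ` {p..q} \<subseteq> x ` V" using d(2) ab pq by (auto simp: dist_real_def)
      let ?\<beta> = "inv_into V x \<circ> \<gamma>"
      have \<beta>: "?\<beta> piecewise_C1_differentiable_on {p..q}" by (rule admissible_chart[OF \<gamma> x(1) ab sub])
      have "?\<beta> ` {p..q} \<subseteq> V" using sub by (auto simp: subset_iff intro!: inv_into_into)
      from piecewise_C1_compose_C1_on[OF smooth_on_C1[OF smooth(1)[OF x(1)]] \<beta> this]
      show "(f \<circ> \<gamma>) piecewise_C1_differentiable_on {p..q}"
        by (rule piecewise_C1_cong) (use sub in \<open>auto simp: image_subset_iff f_inv_into_f\<close>)
    qed
    then show ?case using d(1) by blast
  qed
  then show ?thesis using assms(2) by simp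
qed

lemma admissible_affine:
  assumes \<gamma>: "admissible \<gamma> a b" and m: "(\<lambda>t. m * t + k) ` {p..q} = {a..b}" "m \<noteq> 0"
  shows "admissible (\<lambda>t. \<gamma> (m * t + k)) p q"
proof (rule admissibleI)
  show "continuous_on {p..q} (\<lambda>t. \<gamma> (m * t + k))"
    by (rule continuous_on_compose2[OF admissible_cont[OF \<gamma>]]) (use m in \<open>auto intro!: continuous_intros\<close>)
  fix V x p' q' assume x: "(V, x) \<in> \<A>" and pq: "p \<le> p'" "p' \<le> q'" "q' \<le> q" "(\<lambda>t. \<gamma> (m * t + k)) ` {p'..q'} \<subseteq> x ` V"
  have mem: "m * t + k \<in> {a..b}" if "t \<in> {p..q}" for t using m(1) that by blast
  obtain a' b' where ab: "(\<lambda>t. m * t + k) ` {p'..q'} = {a'..b'}" "a' \<le> b'" "a' \<in> (\<lambda>t. m * t + k) ` {p'..q'}" "b' \<in> (\<lambda>t. m * t + k) ` {p'..q'}"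
  proof (cases "m > 0")
    case True
    have "(\<lambda>t. m * t + k) ` {p'..q'} = {m * p' + k..m * q' + k}"
      using image_affinity_atLeastAtMost[of m k p' q'] True pq by auto
    then show ?thesis using that True pq by (auto simp: mult_left_mono)
  next
    case False
    have "(\<lambda>t. m * t + k) ` {p'..q'} = {m * q' + k..m * p' + k}"
      using image_affinity_atLeastAtMost[of m k p' q'] False pq m(2) by auto
    then show ?thesis using that[of "m * q' + k" "m * p' + k"] False pq by (auto simp: mult_left_mono_neg)
  qed
  have "a \<le> a'" "b' \<le> b" using ab(3,4) mem pq by fastforce+
  moreover have "\<gamma> ` {a'..b'} \<subseteq> x ` V" using pq(4) unfolding ab(1)[symmetric] by auto
  ultimately have "(inv_into V x \<circ> \<gamma>) piecewise_C1_differentiable_on {a'..b'}"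
    using admissible_chart[OF \<gamma> x _ ab(2)] by blast
  then have "(inv_into V x \<circ> \<gamma>) piecewise_C1_differentiable_on ((\<lambda>t. m * t + k) ` {p'..q'})" by (simp only: ab(1))
  from piecewise_C1_differentiable_affine[OF this]
  show "(inv_into V x \<circ> (\<lambda>t. \<gamma> (m * t + k))) piecewise_C1_differentiable_on {p'..q'}" by (simp add: o_def)
qed

lemma admissible_join:
  assumes \<gamma>: "admissible \<gamma>1 a m" "admissible \<gamma>2 m b" and m: "a \<le> m" "m \<le> b" "\<gamma>1 m = \<gamma>2 m"
  shows "admissible (\<lambda>t. if t \<le> m then \<gamma>1 t else \<gamma>2 t) a b"
proof (rule admissibleI)
  let ?\<gamma> = "\<lambda>t. if t \<le> m then \<gamma>1 t else \<gamma>2 t"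
  have "continuous_on ({a..m} \<union> {m..b}) ?\<gamma>"
    by (rule continuous_on_cases) (use \<gamma> m in \<open>auto intro: admissible_cont\<close>)
  then show "continuous_on {a..b} ?\<gamma>" using m by (simp add: ivl_disj_un_two_touch)
  fix V x p q assume x: "(V, x) \<in> \<A>" and pq: "a \<le> p" "p \<le> q" "q \<le> b" "?\<gamma> ` {p..q} \<subseteq> x ` V"
  consider "q \<le> m" | "m \<le> p" | "p \<le> m" "m \<le> q" using pq by linarith
  then show "(inv_into V x \<circ> ?\<gamma>) piecewise_C1_differentiable_on {p..q}"
  proof cases
    case 1
    have "(inv_into V x \<circ> \<gamma>1) piecewise_C1_differentiable_on {p..q}"
      by (rule admissible_chart[OF \<gamma>(1) x]) (use pq 1 in \<open>force split: if_splits\<close>)+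
    then show ?thesis by (rule piecewise_C1_cong) (use 1 in auto)
  next
    case 2
    have e: "?\<gamma> t = \<gamma>2 t" if "t \<in> {p..q}" for t using that 2 m(3) by (cases "t = m") auto
    have "(inv_into V x \<circ> \<gamma>2) piecewise_C1_differentiable_on {p..q}"
      by (rule admissible_chart[OF \<gamma>(2) x 2 pq(2,3)]) (use pq(4) e in \<open>auto simp: image_subset_iff\<close>)
    then show ?thesis by (rule piecewise_C1_cong) (use e in simp)
  next
    case 3
    have e: "?\<gamma> t = \<gamma>2 t" if "t \<in> {m..q}" for t using that m(3) by (cases "t = m") auto
    have 1: "(inv_into V x \<circ> \<gamma>1) piecewise_C1_differentiable_on {p..m}"
      by (rule admissible_chart[OF \<gamma>(1) x pq(1) 3(1)]) (use pq(4) 3 in \<open>auto simp: image_subset_iff\<close>)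
    have 2: "(inv_into V x \<circ> \<gamma>2) piecewise_C1_differentiable_on {m..q}"
    proof (rule admissible_chart[OF \<gamma>(2) x order_refl 3(2) pq(3)])
      have "\<gamma>2 t \<in> x ` V" if "t \<in> {m..q}" for t
      proof -
        have "?\<gamma> t \<in> x ` V" by (rule subsetD[OF pq(4)], rule imageI) (use that 3 in auto)
        then show ?thesis by (simp only: e[OF that])
      qed
      then show "\<gamma>2 ` {m..q} \<subseteq> x ` V" by blast
    qed
    have "(\<lambda>t. if t \<le> m then (inv_into V x \<circ> \<gamma>1) t else (inv_into V x \<circ> \<gamma>2) t) piecewise_C1_differentiable_on {p..q}"
      by (rule piecewise_C1_differentiable_cases[OF 1 2 3]) (simp add: m(3))
    then show ?thesis by (rule piecewise_C1_cong) auto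
  qed
qed

text \<open>\<open>riemannian_dist\<close> turns an infinite infimum into 0, so the argument works
  with the extended value until \<open>D_finite\<close> excludes infinity.\<close>

definition D :: "'p \<Rightarrow> 'p \<Rightarrow> ennreal" where
  "D p q = (INF \<gamma>\<in>{\<gamma>. piecewise_C1_curve \<A> \<gamma> \<and> \<gamma> 0 = p \<and> \<gamma> 1 = q}. curve_length f \<gamma>)"

lemma curve_length_eq: "curve_length f \<gamma> = arclength (f \<circ> \<gamma>) 0 1"
  by (simp add: curve_length_def arclength_def speed_def)

lemma D_le_arclength:
  assumes \<gamma>: "admissible \<gamma> a b" and ab: "a < b"
  shows "D (\<gamma> a) (\<gamma> b) \<le> arclength (f \<circ> \<gamma>) a b" "D (\<gamma> b) (\<gamma> a) \<le> arclength (f \<circ> \<gamma>) a b"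
proof -
  note fc = admissible_image_C1[OF \<gamma> less_imp_le[OF ab]]
  have im: "(\<lambda>t. (b - a) * t + a) ` {0..1} = {a..b}" "(\<lambda>t. (a - b) * t + b) ` {0..1} = {a..b}"
    using image_affinity_atLeastAtMost[of "b - a" a 0 "1::real"] image_affinity_atLeastAtMost[of "a - b" b 0 "1::real"] ab by auto
  have 1: "arclength (f \<circ> (\<lambda>t. \<gamma> ((b - a) * t + a))) 0 1 = arclength (f \<circ> \<gamma>) a b"
    using arclength_affine[OF fc _ im(1)] ab by (simp add: o_def)
  have 2: "arclength (f \<circ> (\<lambda>t. \<gamma> ((a - b) * t + b))) 0 1 = arclength (f \<circ> \<gamma>) a b"
    using arclength_affine[OF fc _ im(2)] ab by (simp add: o_def)
  have adm: "admissible (\<lambda>t. \<gamma> ((b - a) * t + a)) 0 1" "admissible (\<lambda>t. \<gamma> ((a - b) * t + b)) 0 1"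
    using admissible_affine[OF \<gamma> im(1)] admissible_affine[OF \<gamma> im(2)] ab by auto
  have "D (\<gamma> a) (\<gamma> b) \<le> curve_length f (\<lambda>t. \<gamma> ((b - a) * t + a))" unfolding D_def
    by (rule INF_lower) (use adm(1) in \<open>simp add: admissible_01\<close>)
  then show "D (\<gamma> a) (\<gamma> b) \<le> arclength (f \<circ> \<gamma>) a b" unfolding curve_length_eq 1 .
  have "D (\<gamma> b) (\<gamma> a) \<le> curve_length f (\<lambda>t. \<gamma> ((a - b) * t + b))" unfolding D_def
    by (rule INF_lower) (use adm(2) in \<open>simp add: admissible_01\<close>)
  then show "D (\<gamma> b) (\<gamma> a) \<le> arclength (f \<circ> \<gamma>) a b" unfolding curve_length_eq 2 .
qed

lemma D_approx:
  assumes "D p q < z" obtains \<gamma> where "admissible \<gamma> 0 1" "\<gamma> 0 = p" "\<gamma> 1 = q" "arclength (f \<circ> \<gamma>) 0 1 < z"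
  using assms unfolding D_def INF_less_iff curve_length_eq admissible_01[symmetric] by blast

lemma D_sym_le: "D p q \<le> D q p"
proof (rule ccontr)
  assume "\<not> D p q \<le> D q p"
  then obtain \<gamma> where "admissible \<gamma> 0 1" "\<gamma> 0 = q" "\<gamma> 1 = p" "arclength (f \<circ> \<gamma>) 0 1 < D p q"
    using D_approx[of q p "D p q"] by (metis not_le)
  then show False using D_le_arclength(2)[of \<gamma> 0 1] by simp
qed

lemma D_sym: "D p q = D q p"
  by (intro antisym D_sym_le)

lemma ennreal_less_add: "x < top \<Longrightarrow> 0 < e \<Longrightarrow> x < x + ennreal e"
  by (cases x) (auto simp: ennreal_plus[symmetric] ennreal_less_iff simp del: ennreal_plus)

lemma D_triangle: "D p r \<le> D p q + D q r"
proof (rule ennreal_le_epsilon)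
  fix e :: real assume e: "D p q + D q r < top" "0 < e"
  have lt: "D p q < D p q + ennreal (e / 2)" "D q r < D q r + ennreal (e / 2)"
    using e by (auto intro!: ennreal_less_add)
  obtain \<gamma>1 where 1: "admissible \<gamma>1 0 1" "\<gamma>1 0 = p" "\<gamma>1 1 = q" "arclength (f \<circ> \<gamma>1) 0 1 < D p q + ennreal (e / 2)"
    by (rule D_approx[OF lt(1)])
  obtain \<gamma>2 where 2: "admissible \<gamma>2 0 1" "\<gamma>2 0 = q" "\<gamma>2 1 = r" "arclength (f \<circ> \<gamma>2) 0 1 < D q r + ennreal (e / 2)"
    by (rule D_approx[OF lt(2)])
  have im: "(\<lambda>t. 1 * t + (-1)) ` {1..2} = {0..1::real}"
    using image_affinity_atLeastAtMost[of 1 "-1" 1 "2::real"] by simp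
  define \<gamma>2' where "\<gamma>2' t = \<gamma>2 (1 * t + (-1))" for t
  have a2: "admissible \<gamma>2' 1 2" unfolding \<gamma>2'_def[abs_def] by (rule admissible_affine[OF 2(1) im]) simp
  define \<gamma> where "\<gamma> t = (if t \<le> 1 then \<gamma>1 t else \<gamma>2' t)" for t
  have adm: "admissible \<gamma> 0 2" unfolding \<gamma>_def[abs_def]
    by (rule admissible_join[OF 1(1) a2]) (auto simp: 1 2 \<gamma>2'_def)
  have "D (\<gamma> 0) (\<gamma> 2) \<le> arclength (f \<circ> \<gamma>) 0 2" by (rule D_le_arclength[OF adm]) simp
  then have "D p r \<le> arclength (f \<circ> \<gamma>) 0 2" by (simp add: \<gamma>_def \<gamma>2'_def 1 2)
  also have "\<dots> = arclength (f \<circ> \<gamma>) 0 1 + arclength (f \<circ> \<gamma>) 1 2"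
    by (rule arclength_split[OF admissible_image_C1[OF adm]]) auto
  also have "arclength (f \<circ> \<gamma>) 0 1 = arclength (f \<circ> \<gamma>1) 0 1" by (rule arclength_cong) (simp add: \<gamma>_def)
  also have "arclength (f \<circ> \<gamma>) 1 2 = arclength (f \<circ> \<gamma>2 \<circ> (\<lambda>t. 1 * t + (-1))) 1 2"
    by (rule arclength_cong) (simp add: \<gamma>_def \<gamma>2'_def)
  also have "\<dots> = arclength (f \<circ> \<gamma>2) 0 1"
    by (rule arclength_affine[OF admissible_image_C1[OF 2(1)] _ im]) auto
  also have "arclength (f \<circ> \<gamma>1) 0 1 + arclength (f \<circ> \<gamma>2) 0 1 \<le> (D p q + ennreal (e / 2)) + (D q r + ennreal (e / 2))"
    by (intro add_mono less_imp_le 1 2)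
  also have "\<dots> = (D p q + D q r) + (ennreal (e / 2) + ennreal (e / 2))" by (simp only: add_ac)
  also have "ennreal (e / 2) + ennreal (e / 2) = ennreal e"
    using e(2) by (subst ennreal_plus[symmetric]) auto
  finally show "D p r \<le> D p q + D q r + ennreal e" .
qed

lemma D_self: "D p p = 0"
proof -
  have "admissible (\<lambda>_. p) 0 1"
    by (rule admissibleI) (auto simp: o_def intro: piecewise_C1_differentiable_const)
  from D_le_arclength(1)[OF this] have "D p p \<le> arclength (\<lambda>_. f p) 0 1" by (simp add: o_def)
  also have "\<dots> = 0" by (simp add: arclength_def speed_def vector_derivative_const_at lorentz.zero_left)
  finally show ?thesis by simp
qed

lemma D_segment:
  assumes x: "(V, x) \<in> \<A>" and seg: "closed_segment u (u + h) \<subseteq> V"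
    and B: "\<And>t. t \<in> {0..1} \<Longrightarrow> gn x (u + t *\<^sub>R h) h \<le> B"
  shows "D (x u) (x (u + h)) \<le> ennreal B"
proof -
  define \<beta> where "\<beta> t = u + t *\<^sub>R h" for t
  have \<beta>V: "\<beta> t \<in> V" if "t \<in> {0..1}" for t
  proof -
    have "\<beta> t = (1 - t) *\<^sub>R u + t *\<^sub>R (u + h)" by (simp add: \<beta>_def algebra_simps)
    then have "\<beta> t \<in> closed_segment u (u + h)" using that by (auto simp: closed_segment_def)
    then show ?thesis using seg by blast
  qed
  have d\<beta>: "(\<beta> has_vector_derivative h) (at t)" for t
    unfolding \<beta>_def[abs_def] has_vector_derivative_def by (auto intro!: derivative_eq_intros)
  have "\<beta> C1_differentiable_on {a..b}" for a b
    unfolding C1_differentiable_on_def by (intro exI[of _ "\<lambda>_. h"]) (auto intro: d\<beta>)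
  then have C\<beta>: "\<beta> piecewise_C1_differentiable_on {a..b}" for a b by (rule C1_differentiable_imp_piecewise)
  have c\<beta>: "continuous_on S \<beta>" for S unfolding \<beta>_def[abs_def] by (intro continuous_intros)
  have "admissible (x \<circ> \<beta>) 0 1"
  proof (rule admissibleI)
    show "continuous_on {0..1} (x \<circ> \<beta>)" unfolding o_def
      by (rule continuous_on_compose2[OF chart(4)[OF x] c\<beta>]) (use \<beta>V in auto)
    fix W y p q assume y: "(W, y) \<in> \<A>" and pq: "0 \<le> p" "p \<le> q" "q \<le> 1" "(x \<circ> \<beta>) ` {p..q} \<subseteq> y ` W"
    have "\<beta> ` {p..q} \<subseteq> dom V x W y" using pq \<beta>V by (auto simp: dom_def)
    from piecewise_C1_compose_C1_on[OF C1_transition[OF x y] C\<beta> this]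
    show "(inv_into W y \<circ> (x \<circ> \<beta>)) piecewise_C1_differentiable_on {p..q}" by (simp only: o_assoc)
  qed
  from D_le_arclength(1)[OF this] have "D (x u) (x (u + h)) \<le> arclength (f \<circ> x \<circ> \<beta>) 0 1"
    by (simp add: \<beta>_def o_assoc)
  also have "\<dots> \<le> (\<integral>\<^sup>+t\<in>{0..1::real}. ennreal B \<partial>lborel)"
    unfolding arclength_def
  proof (rule nn_integral_mono)
    fix t :: real
    show "ennreal (speed (f \<circ> x \<circ> \<beta>) t) * indicator {0..1} t \<le> ennreal B * indicator {0..1} t"
    proof (cases "t \<in> {0..1}")
      case True
      have "((f \<circ> x) \<circ> \<beta> has_vector_derivative T x (\<beta> t) h) (at t)"
        by (rule C1_on_has_vector_derivative_compose[OF smooth_on_C1[OF smooth(1)[OF x]] \<beta>V[OF True] d\<beta>])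
      then have "speed (f \<circ> x \<circ> \<beta>) t = gn x (\<beta> t) h"
        by (simp only: speed_def gn_def vector_derivative_at)
      then have "ennreal (speed (f \<circ> x \<circ> \<beta>) t) \<le> ennreal B"
        using B[OF True] by (simp add: \<beta>_def ennreal_leI)
      then show ?thesis by (rule mult_right_mono) simp
    qed simp
  qed
  also have "\<dots> = ennreal B" by (simp add: nn_integral_cmult)
  finally show ?thesis .
qed

lemma arclength_chart_lower:
  assumes x: "(V, x) \<in> \<A>" and \<beta>: "\<beta> piecewise_C1_differentiable_on {0..b}" "\<beta> ` {0..b} \<subseteq> K" "K \<subseteq> V" "0 \<le> b"
    and k: "k \<ge> 0" "\<And>u v. u \<in> K \<Longrightarrow> k * norm v \<le> gn x u v"
  shows "ennreal (k * norm (\<beta> b - \<beta> 0)) \<le> arclength ((f \<circ> x) \<circ> \<beta>) 0 b"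
proof -
  obtain S where S: "finite S" "\<And>t. t \<in> {0..b} - S \<Longrightarrow> \<beta> differentiable at t"
    "continuous_on ({0..b} - S) (\<lambda>t. vector_derivative \<beta> (at t))"
    using piecewise_C1_exceptional[OF \<beta>(1)] by blast
  let ?k = "\<lambda>t. indicator ({0..b} - S) t * norm (vector_derivative \<beta> (at t))"
  have m: "?k \<in> borel_measurable borel"
    by (rule measurable_piecewise_speed[OF S(1)]) (intro continuous_intros S(3))
  have "ennreal (k * norm (\<beta> b - \<beta> 0)) = ennreal k * ennreal (norm (\<beta> b - \<beta> 0))"
    using k(1) by (simp add: ennreal_mult')
  also have "\<dots> \<le> ennreal k * (\<integral>\<^sup>+t\<in>{0..b}. ennreal (norm (vector_derivative \<beta> (at t))) \<partial>lborel)"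
    by (intro mult_left_mono norm_increment_le_nn_integral \<beta>) simp
  also have "\<dots> = (\<integral>\<^sup>+t. ennreal k * ennreal (?k t) \<partial>lborel)"
    unfolding nn_integral_drop_finite[OF S(1)] by (rule nn_integral_cmult[symmetric]) (use m in simp)
  also have "\<dots> \<le> (\<integral>\<^sup>+t. ennreal (indicator ({0..b} - S) t * speed ((f \<circ> x) \<circ> \<beta>) t) \<partial>lborel)"
  proof (rule nn_integral_mono)
    fix t :: real
    show "ennreal k * ennreal (?k t) \<le> ennreal (indicator ({0..b} - S) t * speed ((f \<circ> x) \<circ> \<beta>) t)"
    proof (cases "t \<in> {0..b} - S")
      case True
      have \<beta>t: "\<beta> t \<in> K" using True \<beta>(2) by auto
      have "(\<beta> has_vector_derivative vector_derivative \<beta> (at t)) (at t)"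
        using S(2)[OF True] by (simp add: vector_derivative_works)
      then have "((f \<circ> x) \<circ> \<beta> has_vector_derivative T x (\<beta> t) (vector_derivative \<beta> (at t))) (at t)"
        by (rule C1_on_has_vector_derivative_compose[OF smooth_on_C1[OF smooth(1)[OF x]], rotated]) (use \<beta>t \<beta>(3) in auto)
      then have "speed ((f \<circ> x) \<circ> \<beta>) t = gn x (\<beta> t) (vector_derivative \<beta> (at t))"
        by (simp only: speed_def gn_def vector_derivative_at)
      then show ?thesis using k(2)[OF \<beta>t] True k(1) by (simp add: ennreal_mult'[symmetric] ennreal_leI)
    qed simp
  qed
  also have "\<dots> = arclength ((f \<circ> x) \<circ> \<beta>) 0 b"
    unfolding arclength_def nn_integral_drop_finite[OF S(1)] ..
  finally show ?thesis .
qed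

text \<open>A curve to a point outside the coordinate ball is followed up to its first exit. Until
  then it stays in the compact ball, where the metric dominates k times the Euclidean norm, and it
  has moved a coordinate distance of at least r.\<close>

lemma D_exit:
  assumes x: "(V, x) \<in> \<A>" and r: "cball u r \<subseteq> V" "r > 0"
    and k: "k \<ge> 0" "\<And>w v. w \<in> cball u r \<Longrightarrow> k * norm v \<le> gn x w v"
    and q: "q \<notin> x ` ball u r"
  shows "ennreal (k * r) \<le> D (x u) q"
proof (rule ccontr)
  assume "\<not> ennreal (k * r) \<le> D (x u) q"
  then have "D (x u) q < ennreal (k * r)" by simp
  then obtain \<gamma> where \<gamma>: "admissible \<gamma> 0 1" "\<gamma> 0 = x u" "\<gamma> 1 = q" "arclength (f \<circ> \<gamma>) 0 1 < ennreal (k * r)"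
    by (rule D_approx)
  note cont = admissible_cont[OF \<gamma>(1)]
  have uV: "u \<in> V" using r by auto
  have ballV: "ball u r \<subseteq> V" using r by auto
  define C where "C = {0..1} \<inter> \<gamma> -` (- (x ` ball u r))"
  have "closed C" unfolding C_def
    by (rule continuous_closed_preimage[OF cont]) (auto intro: chart_open_image[OF x _ ballV] simp: closed_Compl)
  moreover have "1 \<in> C" using \<gamma>(3) q by (simp add: C_def)
  moreover have bdd: "bdd_below C" unfolding C_def by (intro bdd_belowI[of _ 0]) auto
  ultimately have "Inf C \<in> C" by (intro closed_contains_Inf) auto
  define b where "b = Inf C"
  have b: "b \<in> {0..1}" "\<gamma> b \<notin> x ` ball u r" using \<open>Inf C \<in> C\<close> by (auto simp: C_def b_def)
  have before: "\<gamma> t \<in> x ` ball u r" if "0 \<le> t" "t < b" for t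
  proof (rule ccontr)
    assume "\<gamma> t \<notin> x ` ball u r"
    then have "t \<in> C" using that b by (auto simp: C_def)
    then have "b \<le> t" unfolding b_def by (rule cInf_lower[OF _ bdd])
    then show False using that by simp
  qed
  have b0: "b > 0" using b r \<gamma>(2) by (cases "b = 0") auto
  have "compact (x ` cball u r)" by (rule compact_continuous_image[OF continuous_on_subset[OF chart(4)[OF x] r(1)] compact_cball])
  then have cl: "closed (x ` cball u r)" by (rule compact_imp_closed)
  \<comment> \<open>The exit point lies in the image of the closed ball by continuity, since that
    image is compact and so closed in a Hausdorff space.\<close>
  have "\<gamma> ` closure {0..<b} \<subseteq> x ` cball u r"
  proof (rule image_closure_subset[OF _ cl])
    show "continuous_on (closure {0..<b}) \<gamma>" using b b0 by (intro continuous_on_subset[OF cont]) auto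
    show "\<gamma> ` {0..<b} \<subseteq> x ` cball u r" using before by fastforce
  qed
  then have sub: "\<gamma> ` {0..b} \<subseteq> x ` cball u r" using b0 by simp
  then have subV: "\<gamma> ` {0..b} \<subseteq> x ` V" using r(1) by blast
  let ?\<beta> = "inv_into V x \<circ> \<gamma>"
  have \<beta>: "?\<beta> piecewise_C1_differentiable_on {0..b}"
    by (rule admissible_chart[OF \<gamma>(1) x _ _ _ subV]) (use b in auto)
  have \<beta>K: "?\<beta> t \<in> cball u r" if t: "t \<in> {0..b}" for t
  proof -
    obtain w where "w \<in> cball u r" "\<gamma> t = x w" using sub t by blast
    then show ?thesis using chart(6)[OF x, of w] r(1) by auto
  qed
  have xb: "x (?\<beta> t) = \<gamma> t" if "t \<in> {0..b}" for t
  proof -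
    have "\<gamma> t \<in> x ` V" using subV that by blast
    then show ?thesis by (simp add: f_inv_into_f)
  qed
  have "?\<beta> b \<notin> ball u r" using b xb[of b] b0 by (metis atLeastAtMost_iff imageI less_imp_le order_refl)
  then have "norm (?\<beta> b - ?\<beta> 0) \<ge> r"
    using chart(6)[OF x uV] \<gamma>(2) by (simp add: dist_norm norm_minus_commute)
  then have "ennreal (k * r) \<le> ennreal (k * norm (?\<beta> b - ?\<beta> 0))" using k(1) by (intro ennreal_leI mult_left_mono) auto
  also have "\<dots> \<le> arclength ((f \<circ> x) \<circ> ?\<beta>) 0 b"
    by (rule arclength_chart_lower[OF x \<beta> _ r(1) less_imp_le[OF b0] k]) (use \<beta>K in auto)
  also have "\<dots> = arclength (f \<circ> \<gamma>) 0 b" by (rule arclength_cong) (use xb in auto)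
  also have "\<dots> \<le> arclength (f \<circ> \<gamma>) 0 1"
    using arclength_split[OF admissible_image_C1[OF \<gamma>(1)], of b] b by simp
  finally show False using \<gamma>(4) by simp
qed

text \<open>The coordinate segment is a competitor whose length is nearly the norm of h at u. It may
  leave K, so norms are compared on a compact neighbourhood of K inside V.\<close>

lemma D_local:
  assumes x: "(V, x) \<in> \<A>" and K: "compact K" "K \<subseteq> V" and e: "e > 0"
  obtains d where "d > 0" "\<And>u h. u \<in> K \<Longrightarrow> norm h < d \<Longrightarrow> u + h \<in> V \<and> D (x u) (x (u + h)) \<le> ennreal (gn x u h + e * norm h)"
proof (cases "K = {}")
  case True
  then show ?thesis by (intro that[of 1]) auto
next
  case False
  obtain d0 where d0: "d0 > 0" "{w. infdist w K \<le> d0} \<subseteq> V"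
    using compact_in_open_separated[OF False K(1) chart(1)[OF x] K(2)] by blast
  let ?K = "{w. infdist w K \<le> d0}"
  have cK: "compact ?K" by (rule compact_infdist_le[OF False K(1) d0(1)])
  obtain d1 where d1: "d1 > 0" "\<And>u w v. u \<in> ?K \<Longrightarrow> w \<in> ?K \<Longrightarrow> dist u w < d1 \<Longrightarrow> gn x w v \<le> gn x u v + e * norm v"
    by (rule gn_uniform[OF x cK d0(2) e]) blast
  have "u + h \<in> V \<and> D (x u) (x (u + h)) \<le> ennreal (gn x u h + e * norm h)" if u: "u \<in> K" and h: "norm h < min d0 d1" for u h
  proof -
    have in': "u + t *\<^sub>R h \<in> ?K" and ds: "dist u (u + t *\<^sub>R h) < d1" if t: "t \<in> {0..1}" for t
    proof -
      have "norm (t *\<^sub>R h) \<le> 1 * norm h" unfolding norm_scaleR by (rule mult_right_mono) (use t in auto)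
      then have n: "norm (t *\<^sub>R h) < d0" "norm (t *\<^sub>R h) < d1" using h by auto
      have "infdist (u + t *\<^sub>R h) K \<le> dist (u + t *\<^sub>R h) u" by (rule infdist_le[OF u])
      then show "u + t *\<^sub>R h \<in> ?K" using n(1) by (simp add: dist_norm)
      show "dist u (u + t *\<^sub>R h) < d1" using n(2) by (simp add: dist_norm)
    qed
    have seg: "closed_segment u (u + h) \<subseteq> V"
    proof
      fix w assume "w \<in> closed_segment u (u + h)"
      then obtain t where "t \<in> {0..1}" "w = (1 - t) *\<^sub>R u + t *\<^sub>R (u + h)" by (auto simp: closed_segment_def)
      then show "w \<in> V" using in'[of t] d0(2) by (auto simp: algebra_simps)
    qed
    have "D (x u) (x (u + h)) \<le> ennreal (gn x u h + e * norm h)"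
      by (rule D_segment[OF x seg], rule d1(2)) (use in'[of 0] in' ds in auto)
    then show ?thesis using seg by auto
  qed
  moreover have "min d0 d1 > 0" using d0 d1 by simp
  ultimately show ?thesis using that by blast
qed

lemma D_near:
  assumes x: "(V, x) \<in> \<A>" "u \<in> V" and e: "e > 0"
  obtains d where "d > 0" "ball u d \<subseteq> V" "\<And>w. w \<in> ball u d \<Longrightarrow> D (x u) (x w) < ennreal e"
proof -
  obtain d where d: "d > 0" "\<And>h. norm h < d \<Longrightarrow> u + h \<in> V \<and> D (x u) (x (u + h)) \<le> ennreal (gn x u h + 1 * norm h)"
    by (rule D_local[OF x(1), of "{u}" 1]) (use x in auto)
  have "continuous_on UNIV (\<lambda>h. gn x u h + 1 * norm h)"
  proof -
    have "continuous_on UNIV (\<lambda>h::real^'m. (u, h))" by (intro continuous_intros)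
    from continuous_on_compose2[OF continuous_gn[OF x(1)] this] have "continuous_on UNIV (gn x u)"
      using x(2) by auto
    then show ?thesis by (intro continuous_intros)
  qed
  then have "isCont (\<lambda>h. gn x u h + 1 * norm h) 0" by (simp add: continuous_on_eq_continuous_at)
  moreover have "gn x u 0 + 1 * norm (0::real^'m) = 0"
    using linear_0[OF linear_T[OF x]] by (simp add: gn_def lorentz.zero_left)
  ultimately obtain d' where d': "d' > 0" "\<And>h. norm h < d' \<Longrightarrow> \<bar>gn x u h + 1 * norm h\<bar> < e"
    using e unfolding continuous_at_eps_delta by (auto simp: dist_norm)
  show ?thesis
  proof (rule that[of "min d d'"])
    show "min d d' > 0" using d d' by simp
    have w: "w = u + (w - u)" "norm (w - u) < d" "norm (w - u) < d'" if "w \<in> ball u (min d d')" for w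
      using that by (auto simp: dist_norm norm_minus_commute)
    show "ball u (min d d') \<subseteq> V" using d(2) w by (metis subsetI)
    fix w assume "w \<in> ball u (min d d')"
    note w = w[OF this]
    have "D (x u) (x w) \<le> ennreal (gn x u (w - u) + 1 * norm (w - u))" using d(2)[OF w(2)] by simp
    also have "\<dots> < ennreal e" using d'(2)[OF w(3)] e by (intro ennreal_lessI) auto
    finally show "D (x u) (x w) < ennreal e" .
  qed
qed

text \<open>Small balls of the length distance lie in compact coordinate balls, as
  \<open>D_exit\<close> shows. This one fact yields separation of points, an inclusion of topologies
  and local compactness.\<close>

lemma D_lower:
  assumes x: "(V, x) \<in> \<A>" "u \<in> V" and U: "open U" "x u \<in> U"
  obtains e K where "e > 0" "compact K" "K \<subseteq> U" "\<And>q. D (x u) q < ennreal e \<Longrightarrow> q \<in> K"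
proof -
  have "open (V \<inter> x -` U)" by (intro continuous_open_preimage chart[OF x(1)] U)
  then obtain r where r: "r > 0" "cball u r \<subseteq> V \<inter> x -` U" using x(2) U(2) open_contains_cball by blast
  then have rV: "cball u r \<subseteq> V" by blast
  obtain k where k: "k > 0" "\<And>w v. w \<in> cball u r \<Longrightarrow> k * norm v \<le> gn x w v"
    by (rule gn_lower[OF x(1) compact_cball rV]) blast
  show ?thesis
  proof (rule that[of "k * r" "x ` cball u r"])
    show "k * r > 0" using k r by simp
    show "compact (x ` cball u r)" by (rule compact_continuous_image[OF continuous_on_subset[OF chart(4)[OF x(1)] rV] compact_cball])
    show "x ` cball u r \<subseteq> U" using r(2) by blast
    fix q assume q: "D (x u) q < ennreal (k * r)"
    have "q \<in> x ` ball u r"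
    proof (rule ccontr)
      assume "q \<notin> x ` ball u r"
      from D_exit[OF x(1) rV r(1) less_imp_le[OF k(1)] k(2) this] q show False by simp
    qed
    then show "q \<in> x ` cball u r" by (auto simp: image_iff intro: bexI less_imp_le)
  qed
qed

text \<open>Finite distance is an equivalence relation with open classes, so connectedness leaves a
  single class.\<close>

lemma D_finite: "D p q < top"
proof (rule connected_equivalence_relation[OF conn, of p q "\<lambda>p q. D p q < top"])
  show "D q p < top" if "D p q < top" for p q using that by (simp add: D_sym)
  show "D p r < top" if "D p q < top" "D q r < top" for p q r
    using D_triangle[of p r q] that by (meson ennreal_add_less_top le_less_trans)
  fix p
  obtain V x where x: "(V, x) \<in> \<A>" "p \<in> x ` V" by (rule chart_cover)
  then obtain u where u: "u \<in> V" "p = x u" by blast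
  obtain d where d: "d > 0" "ball u d \<subseteq> V" "\<And>w. w \<in> ball u d \<Longrightarrow> D (x u) (x w) < ennreal 1"
    by (rule D_near[OF x(1) u(1), of 1]) auto
  have "open (x ` ball u d)" by (rule chart_open_image[OF x(1) _ d(2)]) simp
  moreover have "p \<in> x ` ball u d" using u d by auto
  moreover have "\<forall>q\<in>x ` ball u d. D p q < top"
  proof clarify
    fix w assume "w \<in> ball u d"
    then have "D p (x w) < ennreal 1" using d(3) u(2) by simp
    also have "\<dots> < top" by simp
    finally show "D p (x w) < top" .
  qed
  ultimately show "\<exists>T. openin (top_of_set UNIV) T \<and> p \<in> T \<and> (\<forall>q\<in>T. D p q < top)"
    unfolding subtopology_UNIV open_openin[symmetric] by (intro exI[of _ "x ` ball u d"] conjI)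
qed simp_all

section \<open>The Riemannian distance as a metric\<close>

abbreviation dd :: "'p \<Rightarrow> 'p \<Rightarrow> real" where "dd \<equiv> riemannian_dist \<A> f"

lemma dd_D: "ennreal (dd p q) = D p q"
  using D_finite[of p q] unfolding riemannian_dist_def D_def by simp

lemma dd_nonneg: "dd p q \<ge> 0"
  by (simp add: riemannian_dist_def)

lemma dd_less: "dd p q < e \<longleftrightarrow> D p q < ennreal e"
  unfolding dd_D[symmetric] using dd_nonneg[of p q] by (simp add: ennreal_less_iff)

lemma dd_le: "e \<ge> 0 \<Longrightarrow> dd p q \<le> e \<longleftrightarrow> D p q \<le> ennreal e"
  unfolding dd_D[symmetric] by simp

lemma dd_metric: "Metric_space UNIV dd"
proof
  fix p q r
  show "0 \<le> dd p q" by (rule dd_nonneg)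
  show "dd p q = dd q p" using D_sym[of p q] by (simp add: dd_D[symmetric] dd_nonneg)
  show "dd p r \<le> dd p q + dd q r"
    using D_triangle[of p r q] by (simp add: dd_D[symmetric] ennreal_plus[symmetric] dd_nonneg del: ennreal_plus)
  show "dd p q = 0 \<longleftrightarrow> p = q"
  proof
    assume 0: "dd p q = 0"
    show "p = q"
    proof (rule ccontr)
      assume "p \<noteq> q"
      obtain V x where x: "(V, x) \<in> \<A>" "p \<in> x ` V" by (rule chart_cover)
      then obtain u where u: "u \<in> V" "p = x u" by blast
      have "open (- {q})" "x u \<in> - {q}" using \<open>p \<noteq> q\<close> u by auto
      then obtain e K where "e > 0" "compact K" "K \<subseteq> - {q}" and eK: "\<And>q. D (x u) q < ennreal e \<Longrightarrow> q \<in> K"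
        by (rule D_lower[OF x(1) u(1)]) blast
      have "q \<in> K" by (rule eK) (use dd_less[of p q e] 0 u \<open>e > 0\<close> in simp)
      then show False using \<open>K \<subseteq> - {q}\<close> by blast
    qed
  next
    assume "p = q"
    then show "dd p q = 0" using D_self[of p] dd_D[of p p] by (simp add: dd_nonneg)
  qed
qed

sublocale dd: Metric_space UNIV dd
  by (rule dd_metric)

lemma dd_open: "open {q. dd p q < r}"
proof (rule Topological_Spaces.openI)
  fix q assume q: "q \<in> {q. dd p q < r}"
  obtain V x where x: "(V, x) \<in> \<A>" "q \<in> x ` V" by (rule chart_cover)
  then obtain u where u: "u \<in> V" "q = x u" by blast
  have "r - dd p q > 0" using q by simp
  then obtain d where d: "d > 0" "ball u d \<subseteq> V" "\<And>w. w \<in> ball u d \<Longrightarrow> D (x u) (x w) < ennreal (r - dd p q)"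
    by (rule D_near[OF x(1) u(1)]) blast
  have "x ` ball u d \<subseteq> {q. dd p q < r}"
  proof
    fix z assume "z \<in> x ` ball u d"
    then have "dd q z < r - dd p q" using d(3) u by (auto simp: dd_less)
    then show "z \<in> {q. dd p q < r}" using dd.triangle[of p q z] by simp
  qed
  moreover have "open (x ` ball u d)" by (rule chart_open_image[OF x(1) _ d(2)]) simp
  moreover have "q \<in> x ` ball u d" using u d by auto
  ultimately show "\<exists>T. open T \<and> q \<in> T \<and> T \<subseteq> {q. dd p q < r}" by blast
qed

lemma dd_small_nbhd:
  assumes "open U" "p \<in> U"
  obtains e K where "e > 0" "compact K" "K \<subseteq> U" "\<And>q. dd p q < e \<Longrightarrow> q \<in> K"
proof -
  obtain V x where x: "(V, x) \<in> \<A>" "p \<in> x ` V" by (rule chart_cover)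
  then obtain u where u: "u \<in> V" "p = x u" by blast
  have "x u \<in> U" using assms(2) u(2) by simp
  then obtain e K where "e > 0" "compact K" "K \<subseteq> U" and eK: "\<And>q. D (x u) q < ennreal e \<Longrightarrow> q \<in> K"
    by (rule D_lower[OF x(1) u(1) assms(1)]) blast
  then show ?thesis by (intro that[of e K]) (simp_all add: dd_less u(2))
qed

lemma dd_topology: "dd.mtopology = euclidean"
proof (rule topology_eq[THEN iffD2], intro allI)
  fix U :: "'p set"
  show "openin dd.mtopology U \<longleftrightarrow> openin euclidean U"
  proof
    assume o: "openin dd.mtopology U"
    have "open U"
    proof (rule Topological_Spaces.openI)
      fix p assume "p \<in> U"
      then obtain r where "r > 0" "dd.mball p r \<subseteq> U" using o unfolding dd.openin_mtopology by blast
      then show "\<exists>T. open T \<and> p \<in> T \<and> T \<subseteq> U"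
        using dd_open[of p r] by (intro exI[of _ "{q. dd p q < r}"]) auto
    qed
    then show "openin euclidean U" unfolding open_openin[symmetric] .
  next
    assume "openin euclidean U"
    then have o: "open U" unfolding open_openin[symmetric] .
    show "openin dd.mtopology U" unfolding dd.openin_mtopology
    proof (intro conjI allI impI)
      fix p assume "p \<in> U"
      then obtain e K where "e > 0" "compact K" "K \<subseteq> U" and eK: "\<And>q. dd p q < e \<Longrightarrow> q \<in> K"
        by (rule dd_small_nbhd[OF o]) blast
      then show "\<exists>r>0. dd.mball p r \<subseteq> U" by (intro exI[of _ e]) auto
    qed simp
  qed
qed

lemma dd_continuous: "continuous_on UNIV (\<lambda>q. dd p q)"
proof (rule continuous_at_imp_continuous_on, intro ballI)
  fix q
  show "isCont (\<lambda>q. dd p q) q" unfolding isCont_def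
  proof (rule tendstoI)
    fix e :: real assume "e > 0"
    have "dist (dd p z) (dd p q) < e" if "z \<in> {z. dd q z < e}" for z
      using dd.triangle[of p q z] dd.triangle[of p z q] dd.commute[of z q] that by (auto simp: dist_real_def)
    then show "\<forall>\<^sub>F z in at q. dist (dd p z) (dd p q) < e"
      unfolding eventually_at_topological
      using dd_open[of q e] \<open>e > 0\<close> by (intro exI[of _ "{z. dd q z < e}"]) auto
  qed
qed

text \<open>Along an almost shortest curve the distance from p takes the value s by continuity, and
  the lengths of the two arcs at such a point add up to the total. This is the length property that
  \<open>hopf_rinow\<close> asks for.\<close>

lemma dd_length_property:
  assumes s: "0 \<le> s" "s \<le> dd p q" and e: "e > 0"
  shows "\<exists>z. dd p z \<le> s \<and> dd z q < dd p q - s + e"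
proof -
  have "dd p q < dd p q + e" using e by simp
  then have "D p q < ennreal (dd p q + e)" by (simp only: dd_less)
  then obtain \<gamma> where \<gamma>: "admissible \<gamma> 0 1" "\<gamma> 0 = p" "\<gamma> 1 = q" "arclength (f \<circ> \<gamma>) 0 1 < ennreal (dd p q + e)"
    by (rule D_approx)
  have cont: "continuous_on {0..1} (\<lambda>t. dd p (\<gamma> t))"
    by (rule continuous_on_compose2[OF dd_continuous admissible_cont[OF \<gamma>(1)]]) simp
  have "\<exists>t\<ge>0. t \<le> 1 \<and> dd p (\<gamma> t) = s"
    by (rule IVT'[OF _ _ _ cont]) (use s \<gamma> dd.mdist_zero[of p] in auto)
  then obtain t where t: "0 \<le> t" "t \<le> 1" "dd p (\<gamma> t) = s" by blast
  let ?z = "\<gamma> t"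
  have L1: "D p ?z \<le> arclength (f \<circ> \<gamma>) 0 t"
  proof (cases "t = 0")
    case True then show ?thesis by (simp add: D_self \<gamma>(2))
  next
    case False
    then have "0 < t" using t by simp
    have "admissible \<gamma> 0 t" by (rule admissible_sub[OF \<gamma>(1)]) (use t in auto)
    from D_le_arclength(1)[OF this \<open>0 < t\<close>] show ?thesis by (simp add: \<gamma>(2))
  qed
  have L2: "D ?z q \<le> arclength (f \<circ> \<gamma>) t 1"
  proof (cases "t = 1")
    case True then show ?thesis by (simp add: D_self \<gamma>(3))
  next
    case False
    then have "t < 1" using t by simp
    have "admissible \<gamma> t 1" by (rule admissible_sub[OF \<gamma>(1)]) (use t in auto)
    from D_le_arclength(1)[OF this \<open>t < 1\<close>] show ?thesis by (simp add: \<gamma>(3))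
  qed
  have "D p ?z + D ?z q \<le> arclength (f \<circ> \<gamma>) 0 1"
    using add_mono[OF L1 L2] arclength_split[OF admissible_image_C1[OF \<gamma>(1)], of t] t by simp
  also have "\<dots> < ennreal (dd p q + e)" by (rule \<gamma>(4))
  finally have "ennreal (dd p ?z + dd ?z q) < ennreal (dd p q + e)"
    by (simp add: dd_D[symmetric] ennreal_plus[symmetric] dd_nonneg del: ennreal_plus)
  then have "dd p ?z + dd ?z q < dd p q + e" 
    by (subst (asm) ennreal_less_iff) (simp_all add: dd_nonneg)
  then have "dd ?z q < dd p q - s + e" using t(3) by simp
  then show ?thesis using t(3) by (intro exI[of _ ?z]) simp
qed

lemma closed_ball_compact:
  assumes "dd.mcomplete" shows "compact {z. dd p z \<le> r}"
proof -
  have "compactin dd.mtopology (dd.mcball p r)"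
  proof (rule dd.hopf_rinow[OF assms])
    fix z :: 'p
    have "open (UNIV :: 'p set)" "z \<in> UNIV" by auto
    then obtain e K where eK: "e > 0" "compact K" "K \<subseteq> UNIV" "\<And>q. dd z q < e \<Longrightarrow> q \<in> K"
      by (rule dd_small_nbhd) blast
    have cK: "compactin dd.mtopology K" using eK(2) by (simp add: dd_topology)
    have "dd.mcball z (e / 2) \<subseteq> K" using eK(1,4) by auto
    then have "compactin dd.mtopology (dd.mcball z (e / 2))"
      by (rule closed_compactin[OF cK _ dd.closedin_mcball])
    then show "\<exists>r>0. compactin dd.mtopology (dd.mcball z r)" using eK(1) by (intro exI[of _ "e / 2"]) simp
  next
    fix x y :: 'p and s e :: real
    assume "0 \<le> s" "s \<le> dd x y" "e > 0"
    then show "\<exists>z\<in>UNIV. dd x z \<le> s \<and> dd z y < dd x y - s + e" using dd_length_property by simp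
  qed simp
  moreover have "dd.mcball p r = {z. dd p z \<le> r}" by auto
  ultimately show ?thesis by (simp add: dd_topology)
qed

text \<open>The triangle inequality turns the first-order bound on short distances into Lipschitz
  constant 1, measured in the induced norm, for the distance from q.\<close>

lemma dd_chart_lipschitz:
  assumes x: "(V, x) \<in> \<A>" and K: "compact K" "K \<subseteq> V" and e: "e > 0"
  shows "\<exists>d>0. \<forall>u\<in>K. \<forall>h. norm h < d \<and> u + h \<in> K \<longrightarrow> \<bar>dd q (x (u + h)) - dd q (x u)\<bar> \<le> gn x u h + e * norm h"
proof -
  obtain d where d: "d > 0" "\<And>u h. u \<in> K \<Longrightarrow> norm h < d \<Longrightarrow> u + h \<in> V \<and> D (x u) (x (u + h)) \<le> ennreal (gn x u h + e * norm h)"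
    by (rule D_local[OF x K e]) blast
  have "\<bar>dd q (x (u + h)) - dd q (x u)\<bar> \<le> gn x u h + e * norm h" if u: "u \<in> K" "norm h < d" for u h
  proof -
    have "u \<in> V" using u K by auto
    then have "0 \<le> gn x u h + e * norm h" using gn_nonneg[OF x] e by (simp add: add_nonneg_nonneg)
    then have "dd (x u) (x (u + h)) \<le> gn x u h + e * norm h" using d(2)[OF u] by (simp add: dd_le)
    moreover have "\<bar>dd q (x (u + h)) - dd q (x u)\<bar> \<le> dd (x u) (x (u + h))"
      using dd.triangle[of q "x u" "x (u + h)"] dd.triangle[of q "x (u + h)" "x u"] dd.commute[of "x u" "x (u + h)"] by simp
    ultimately show ?thesis by simp
  qed
  then show ?thesis using d(1) by blast
qed

end

section \<open>The shape operator\<close>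

lemma trace_similar:
  fixes P Pi X Y :: "real^'m^'m::finite"
  assumes "P ** X = Y ** P" "P ** Pi = mat 1" "Pi ** P = mat 1"
  shows "trace X = trace Y"
proof -
  have "Y = (Y ** P) ** Pi" using assms(2) by (simp add: matrix_mul_assoc[symmetric])
  then have "trace Y = trace (Pi ** (P ** X))" using trace_mul_sym[of "P ** X" Pi] assms(1) by simp
  then show ?thesis using assms(3) by (simp add: matrix_mul_assoc)
qed

lemma matrix_scaleR_mult:
  fixes A B :: "real^'m^'m::finite"
  shows "A ** (k *\<^sub>R B) = k *\<^sub>R (A ** B)" "(k *\<^sub>R A) ** B = k *\<^sub>R (A ** B)"
  by (simp_all add: vec_eq_iff matrix_matrix_mult_def sum_distrib_left mult_ac)

lemma matrix_mult_diff:
  fixes A B C :: "real^'m^'m::finite"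
  shows "A ** (B - C) = A ** B - A ** C" "(B - C) ** A = B ** A - C ** A"
  by (simp_all add: vec_eq_iff matrix_matrix_mult_def sum_subtractf algebra_simps)

lemma newton_tr_similar:
  fixes P Pi B C :: "real^'m^'m::finite"
  assumes P: "P ** B = C ** P" "P ** Pi = mat 1" "Pi ** P = mat 1"
  shows "P ** newton_tr r B = newton_tr r C ** P"
proof (induction r)
  case (Suc r)
  have 1: "P ** (B ** newton_tr r B) = (C ** newton_tr r C) ** P"
    by (metis P(1) Suc matrix_mul_assoc)
  then have "trace (B ** newton_tr r B) = trace (C ** newton_tr r C)" by (rule trace_similar[OF _ P(2,3)])
  then show ?case using 1
    by (simp add: matrix_mult_diff matrix_scaleR_mult)
qed simp

context hypersurface begin

abbreviation "S x u \<equiv> frechet_derivative (N \<circ> x) (at u)"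

lemma S: "(V, x) \<in> \<A> \<Longrightarrow> u \<in> V \<Longrightarrow> ((N \<circ> x) has_derivative S x u) (at u)"
  by (rule C1_onD(1)[OF smooth_on_C1[OF smooth(2)]])

lemma linear_S: "(V, x) \<in> \<A> \<Longrightarrow> u \<in> V \<Longrightarrow> linear (S x u)"
  using S has_derivative_linear by blast

abbreviation "e \<equiv> \<lambda>p. radial c (f p)"

lemma radial_derivative:
  assumes x: "(V, x) \<in> \<A>" and u: "u \<in> V"
  shows "((\<lambda>u. e (x u)) has_derivative (\<lambda>h. (if c = 0 then 0 else 1) *\<^sub>R T x u h)) (at u)"
  using T[OF x u] by (cases "c = 0") (simp_all add: radial_def o_def)

lemma lorentz_ee: "lorentz (e p) (e p) < 0"
  by (rule lorentz_radial[OF c0 f_space])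

lemma S_normal:
  assumes x: "(V, x) \<in> \<A>" and u: "u \<in> V"
  shows "lorentz (N (x u)) (S x u v) = 0" "lorentz (e (x u)) (S x u v) = 0"
proof -
  have "((\<lambda>u. lorentz ((N \<circ> x) u) ((N \<circ> x) u)) has_derivative (\<lambda>v. lorentz ((N \<circ> x) u) (S x u v) + lorentz (S x u v) ((N \<circ> x) u))) (at u)"
    by (rule lorentz.FDERIV[OF S[OF x u] S[OF x u]])
  then have "lorentz ((N \<circ> x) u) (S x u v) + lorentz (S x u v) ((N \<circ> x) u) = 0"
    by (rule derivative_of_constant[where k = 1]) (simp add: N_normal)
  then show "lorentz (N (x u)) (S x u v) = 0" by (simp add: lorentz_commute[of "S x u v"])
  have "((\<lambda>u. lorentz (e (x u)) ((N \<circ> x) u)) has_derivative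
      (\<lambda>v. lorentz (e (x u)) (S x u v) + lorentz ((if c = 0 then 0 else 1) *\<^sub>R T x u v) ((N \<circ> x) u))) (at u)"
    by (rule lorentz.FDERIV[OF radial_derivative[OF x u] S[OF x u]])
  then have "lorentz (e (x u)) (S x u v) + lorentz ((if c = 0 then 0 else 1) *\<^sub>R T x u v) ((N \<circ> x) u) = 0"
    by (rule derivative_of_constant[where k = 0]) (simp add: N_normal)
  then show "lorentz (e (x u)) (S x u v) = 0"
    using NT[OF x u, of v] by (simp add: lorentz.scaleR_left lorentz_commute[of "T x u v"])
qed

text \<open>A dimension count: the ambient space has dimension CARD('m) + 2, the normals N and e are
  independent, and the differential is injective. The sign change J turns \<open>lorentz\<close>
  into the Euclidean product, so that orthogonal complements can be counted.\<close>

lemma tangent_complement: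
  assumes x: "(V, x) \<in> \<A>" and u: "u \<in> V" and w: "lorentz (N (x u)) w = 0" "lorentz (e (x u)) w = 0"
  shows "\<exists>v. T x u v = w"
proof -
  define J where "J y = (fst y, - snd y)" for y :: "(real^'n) \<times> real"
  have LJ: "lorentz y z = J y \<bullet> z" for y z by (simp add: lorentz_def J_def inner_prod_def)
  have J_scale: "J y = k *\<^sub>R J z \<Longrightarrow> y = k *\<^sub>R z" for y z k by (auto simp: J_def prod_eq_iff)
  let ?n = "J (N (x u))" and ?e = "J (e (x u))"
  have ne: "?n \<notin> span {?e}"
  proof
    assume "?n \<in> span {?e}"
    then obtain k where "?n = k *\<^sub>R ?e" by (auto simp: span_singleton)
    then have "N (x u) = k *\<^sub>R e (x u)" by (rule J_scale)
    then have "lorentz (N (x u)) (N (x u)) = k * lorentz (e (x u)) (N (x u))" by (metis lorentz.scaleR_left real_scaleR_def)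
    then show False by (simp add: N_normal)
  qed
  have e0: "?e \<noteq> 0"
  proof
    assume "?e = 0"
    then have "lorentz (e (x u)) (e (x u)) = 0" by (simp add: LJ)
    then show False using lorentz_ee[of "x u"] by simp
  qed
  have "independent {?n, ?e}" using ne e0 by (simp add: independent_insert)
  moreover have "?n \<noteq> ?e" using ne span_base by force
  ultimately have d2: "dim (span {?n, ?e}) = 2" by (simp add: dim_eq_card_independent)
  define W where "W = {y \<in> UNIV. \<forall>z\<in>span {?n, ?e}. orthogonal z y}"
  have W: "y \<in> W \<longleftrightarrow> lorentz (N (x u)) y = 0 \<and> lorentz (e (x u)) y = 0" for y
  proof
    assume "y \<in> W"
    then have "orthogonal ?n y" "orthogonal ?e y" unfolding W_def by (auto intro: span_base)
    then show "lorentz (N (x u)) y = 0 \<and> lorentz (e (x u)) y = 0" by (simp add: LJ orthogonal_def)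
  next
    assume a: "lorentz (N (x u)) y = 0 \<and> lorentz (e (x u)) y = 0"
    have "orthogonal y z" if "z \<in> span {?n, ?e}" for z
      by (rule orthogonal_to_span[OF that]) (use a in \<open>auto simp: LJ orthogonal_def inner_commute\<close>)
    then show "y \<in> W" by (simp add: W_def orthogonal_commute)
  qed
  have "dim W + dim (span {?n, ?e}) = dim (UNIV :: ((real^'n) \<times> real) set)"
    unfolding W_def by (rule dim_subspace_orthogonal_to_vectors) auto
  then have "dim W + 2 = CARD('n) + 1" using d2 by simp
  moreover have "CARD('n) = CARD('m) + 1" using hyp by (simp add: oriented_hypersurface_def)
  ultimately have dW: "dim W = CARD('m)" by simp
  have sW: "subspace W" unfolding subspace_def by (auto simp: W lorentz.zero_right lorentz.add_right lorentz.scaleR_right)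
  have rW: "range (T x u) \<subseteq> W" using NT[OF x u] radial_T[OF x u] by (auto simp: W)
  have dr: "dim (range (T x u)) = CARD('m)"
    using dim_image_eq[OF linear_T[OF x u], of UNIV] immersion[OF x u] by simp
  have "range (T x u) = W"
    by (rule subspace_dim_equal[OF _ sW rW]) (use linear_T[OF x u] dr dW in \<open>auto intro: linear_subspace_image\<close>)
  moreover have "w \<in> W" using w by (simp add: W)
  ultimately show ?thesis by (metis imageE)
qed

lemma T_inj: "(V, x) \<in> \<A> \<Longrightarrow> u \<in> V \<Longrightarrow> T x u v = T x u w \<longleftrightarrow> v = w"
  using immersion by (auto simp: inj_def)

text \<open>The shape operator in the coordinates of x; injectivity of the differential makes the
  choice unique.\<close>

definition Amat :: "(real^'m \<Rightarrow> 'p) \<Rightarrow> real^'m \<Rightarrow> real^'m^'m" where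
  "Amat x u = matrix (\<lambda>v. SOME w. T x u w = - S x u v)"

lemma Amat:
  assumes x: "(V, x) \<in> \<A>" and u: "u \<in> V" shows "T x u (Amat x u *v v) = - S x u v"
proof -
  define A0 where "A0 = (\<lambda>v. SOME w. T x u w = - S x u v)"
  have A0: "T x u (A0 v) = - S x u v" for v unfolding A0_def
    by (rule someI_ex, rule tangent_complement[OF x u]) (simp_all add: lorentz.minus_right S_normal[OF x u])
  have "linear A0"
  proof (rule linearI)
    show "A0 (v + w) = A0 v + A0 w" for v w
      by (subst T_inj[OF x u, symmetric]) (simp add: A0 linear_add[OF linear_T[OF x u]] linear_add[OF linear_S[OF x u]])
    show "A0 (k *\<^sub>R v) = k *\<^sub>R A0 v" for k v
      by (subst T_inj[OF x u, symmetric]) (simp add: A0 linear_cmul[OF linear_T[OF x u]] linear_cmul[OF linear_S[OF x u]])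
  qed
  then have "Amat x u *v v = A0 v" unfolding Amat_def A0_def[symmetric] using fun_cong[OF matrix_vector_mul(2)] by metis
  then show ?thesis by (simp add: A0)
qed

lemma patch:
  assumes x: "(V, x) \<in> \<A>" shows "immersed_patch V (f \<circ> x) (N \<circ> x) (Amat x)"
  by unfold_locales (use x chart(1) smooth T_pos NT Amat in auto)

lemma chart_rep:
  obtains V x u where "chart_at \<A> p = (V, x)" "(V, x) \<in> \<A>" "u \<in> V" "x u = p" "inv_into V x p = u"
proof -
  obtain V x where x: "chart_at \<A> p = (V, x)" "(V, x) \<in> \<A>" "p \<in> x ` V" by (rule chart_at)
  show ?thesis by (rule that[OF x(1,2), of "inv_into V x p"]) (use x(3) in \<open>auto intro: inv_into_into simp: f_inv_into_f\<close>)
qed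

text \<open>The same operator in the chart selected at p, that is, under the identification of the
  tangent space used by \<open>shape_operator\<close>.\<close>

definition AM :: "'p \<Rightarrow> real^'m^'m" where
  "AM p = (case chart_at \<A> p of (V, x) \<Rightarrow> Amat x (inv_into V x p))"

lemma mdiff_AM: "mdiff \<A> f p (AM p *v v) = - mdiff \<A> N p v"
proof -
  obtain V x u where x: "chart_at \<A> p = (V, x)" "(V, x) \<in> \<A>" "u \<in> V" "x u = p" "inv_into V x p = u" by (rule chart_rep)
  then show ?thesis using Amat[OF x(2,3)] by (simp add: mdiff_def AM_def)
qed

lemma mdiff_f: "mdiff \<A> f p v = mdiff \<A> f p w \<longleftrightarrow> v = w" "linear (mdiff \<A> f p)"
proof -
  obtain V x u where x: "chart_at \<A> p = (V, x)" "(V, x) \<in> \<A>" "u \<in> V" "x u = p" "inv_into V x p = u" by (rule chart_rep)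
  then show "mdiff \<A> f p v = mdiff \<A> f p w \<longleftrightarrow> v = w" "linear (mdiff \<A> f p)"
    using T_inj[OF x(2,3)] linear_T[OF x(2,3)] by (auto simp: mdiff_def)
qed

text \<open>Differentiating <f, N> = 0 for c < 0 shows that the derivative of N has no component
  along the position vector, so the correction in the covariant derivative vanishes.\<close>

lemma shape_operator_AM: "shape_operator c \<A> f N p = (*v) (AM p)"
proof
  fix v
  obtain V x u where x: "chart_at \<A> p = (V, x)" "(V, x) \<in> \<A>" "u \<in> V" "x u = p" "inv_into V x p = u" by (rule chart_rep)
  have "c * lorentz (mdiff \<A> N p v) (f p) = 0"
  proof (cases "c = 0")
    case False
    then show ?thesis using S_normal(2)[OF x(2,3), of v] x(1,4,5) lorentz_commute[of "f p"]
      by (simp add: mdiff_def radial_def)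
  qed simp
  then have "space_form_covd c \<A> f N p v = mdiff \<A> N p v" by (simp add: space_form_covd_def)
  then show "shape_operator c \<A> f N p v = AM p *v v"
    unfolding shape_operator_def
  proof (intro the_equality)
    show "mdiff \<A> f p (AM p *v v) = - space_form_covd c \<A> f N p v" if "space_form_covd c \<A> f N p v = mdiff \<A> N p v"
      by (simp add: that mdiff_AM)
    fix w assume "space_form_covd c \<A> f N p v = mdiff \<A> N p v" "mdiff \<A> f p w = - space_form_covd c \<A> f N p v"
    then have "mdiff \<A> f p w = mdiff \<A> f p (AM p *v v)" by (simp add: mdiff_AM)
    then show "w = AM p *v v" by (simp only: mdiff_f(1))
  qed
qed

lemma tr_Amat:
  assumes x: "(V, x) \<in> \<A>" and u: "u \<in> V"
  shows "tr x u (Amat x u *v v) = AM (x u) *v tr x u v"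
  by (subst mdiff_f(1)[where p = "x u", symmetric]) (simp add: mdiff_AM T_tr[OF x u, symmetric] S_tr[OF x u, symmetric] Amat[OF x u])

text \<open>The transition differential conjugates \<open>Amat\<close> into \<open>AM\<close>, and
  the Newton recursion consists of products and traces. Quantities computed in different charts
  therefore agree.\<close>

lemma newton_chart:
  assumes x: "(V, x) \<in> \<A>" and u: "u \<in> V"
  shows "tr x u (newton_tr r (Amat x u) *v v) = newton_tr r (AM (x u)) *v tr x u v"
    "trace (newton_tr r (Amat x u)) = trace (newton_tr r (AM (x u)))"
    "trace (Amat x u ** newton_tr r (Amat x u)) = trace (AM (x u) ** newton_tr r (AM (x u)))"
proof -
  define P where "P = matrix (tr x u)"
  have P: "P *v v = tr x u v" for v unfolding P_def using fun_cong[OF matrix_vector_mul(2)[OF linear_tr[OF x u]]] by metis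
  have "inj ((*v) P)" using inj_tr[OF x u] by (simp add: P inj_def)
  then obtain Pi where Pi: "Pi ** P = mat 1" using matrix_left_invertible_injective by blast
  then have Pi': "P ** Pi = mat 1" using matrix_left_right_inverse by blast
  have PA: "P ** Amat x u = AM (x u) ** P"
    by (simp add: matrix_eq matrix_vector_mul_assoc[symmetric] P tr_Amat[OF x u])
  note n = newton_tr_similar[OF PA Pi' Pi]
  show "tr x u (newton_tr r (Amat x u) *v v) = newton_tr r (AM (x u)) *v tr x u v"
    by (simp add: P[symmetric] matrix_vector_mul_assoc n)
  show "trace (newton_tr r (Amat x u)) = trace (newton_tr r (AM (x u)))"
    by (rule trace_similar[OF n Pi' Pi])
  show "trace (Amat x u ** newton_tr r (Amat x u)) = trace (AM (x u) ** newton_tr r (AM (x u)))"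
    by (rule trace_similar[OF _ Pi' Pi]) (metis PA n matrix_mul_assoc)
qed

lemma eigenbasis_AM:
  obtains b l where "eigenbasis (\<lambda>v w. lorentz (mdiff \<A> f p v) (mdiff \<A> f p w)) (AM p) b l"
proof -
  obtain V x u where x: "chart_at \<A> p = (V, x)" "(V, x) \<in> \<A>" "u \<in> V" "x u = p" "inv_into V x p = u" by (rule chart_rep)
  interpret P: immersed_patch V "f \<circ> x" "N \<circ> x" "Amat x" "\<lambda>u. T x u" "\<lambda>u. S x u" by (rule patch[OF x(2)])
  obtain b l where "eigenbasis (P.g u) (Amat x u) b l" by (rule P.eigenbasis_at[OF x(3)])
  moreover have "P.g u = (\<lambda>v w. lorentz (mdiff \<A> f p v) (mdiff \<A> f p w))"
    using x by (simp add: P.g_def fun_eq_iff mdiff_def)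
  moreover have "Amat x u = AM p" using x by (simp add: AM_def)
  ultimately show ?thesis using that by metis
qed

lemma trace_newton_elem_sym:
  "trace (newton_tr r (AM p)) = (real CARD('m) - real r) * elem_sym r (shape_operator c \<A> f N p)"
  "trace (AM p ** newton_tr r (AM p)) = real (Suc r) * elem_sym (Suc r) (shape_operator c \<A> f N p)"
proof -
  obtain b l where "eigenbasis (\<lambda>v w. lorentz (mdiff \<A> f p v) (mdiff \<A> f p w)) (AM p) b l" by (rule eigenbasis_AM)
  then interpret eigenbasis "\<lambda>v w. lorentz (mdiff \<A> f p v) (mdiff \<A> f p w)" "AM p" b l .
  show "trace (newton_tr r (AM p)) = (real CARD('m) - real r) * elem_sym r (shape_operator c \<A> f N p)"
    "trace (AM p ** newton_tr r (AM p)) = real (Suc r) * elem_sym (Suc r) (shape_operator c \<A> f N p)"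
    by (simp_all add: trace_newton_tr trace_newton elem_sym_eq shape_operator_AM)
qed

lemma rank_bound:
  assumes "j \<ge> 1" "elem_sym j (shape_operator c \<A> f N p) = 0" "elem_sym (Suc j) (shape_operator c \<A> f N p) = 0"
  shows "dim (range (shape_operator c \<A> f N p)) \<le> j - 1"
proof -
  obtain b l where "eigenbasis (\<lambda>v w. lorentz (mdiff \<A> f p v) (mdiff \<A> f p w)) (AM p) b l" by (rule eigenbasis_AM)
  then interpret eigenbasis "\<lambda>v w. lorentz (mdiff \<A> f p v) (mdiff \<A> f p w)" "AM p" b l .
  have "card {i\<in>UNIV. l i \<noteq> 0} < j"
    by (rule lsym_consecutive_zeros) (use assms in \<open>simp_all add: elem_sym_eq shape_operator_AM\<close>)
  then show ?thesis using rank_le by (simp add: shape_operator_AM)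
qed

end

section \<open>The position field\<close>

lemma trace_matrix_eq: "trace (matrix F) = (\<Sum>i\<in>UNIV. F (axis i 1) $ i)" for F :: "real^'m::finite \<Rightarrow> real^'m"
  by (simp add: trace_def matrix_def)

lemma trace_matrix_product_rule:
  fixes F :: "real^'m::finite \<Rightarrow> real^'m" and L :: "real^'m \<Rightarrow> real"
  assumes L: "linear L"
  shows "trace (matrix (\<lambda>h. a *\<^sub>R F h + L h *\<^sub>R y)) = a * trace (matrix F) + L y"
proof -
  have "(\<Sum>i\<in>UNIV. L (axis i 1) * y $ i) = L (\<Sum>i\<in>UNIV. y $ i *\<^sub>R axis i 1)"
    by (simp add: linear_sum[OF L] linear_cmul[OF L] mult.commute)
  also have "\<dots> = L y" using basis_expansion[of y] by (simp add: scalar_mult_eq_scaleR)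
  finally have "(\<Sum>i\<in>UNIV. L (axis i 1) * y $ i) = L y" .
  then show ?thesis by (simp add: trace_matrix_eq sum.distrib sum_distrib_left)
qed

text \<open>\<open>Z\<close> is the position vector relative to the base point for \<open>c = 0\<close>, and minus the base point
  itself, as a constant ambient vector, for \<open>c < 0\<close>; \<open>tau\<close> is its part tangent to the hypersurface, and
  \<open>wt *\<^sub>R tau\<close> is the gradient of the function \<open>r\<close> of the introduction.\<close>

locale position_field = hypersurface c \<A> f N
  for c :: real and \<A> :: "('m::finite, 'p::t2_space) param set" and f N :: "'p \<Rightarrow> (real^'n::finite) \<times> real" +
  fixes q :: 'p and j :: nat
  assumes Sj1: "\<And>p. elem_sym (Suc j) (shape_operator c \<A> f N p) = 0"
begin

definition flat :: bool where "flat \<longleftrightarrow> c = 0"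

lemma flat_snd: "flat \<Longrightarrow> snd (f p) = 0"
  using f_space[of p] by (simp add: flat_def space_form_def)

lemma flat_radial: "flat \<Longrightarrow> radial c y = (0, 1)" and nonflat_radial: "\<not> flat \<Longrightarrow> radial c y = y"
  by (simp_all add: flat_def radial_def)

lemma nonflat: "\<not> flat \<Longrightarrow> c \<noteq> 0"
  by (simp add: flat_def)

definition Z :: "'p \<Rightarrow> (real^'n) \<times> real" where "Z p = (if flat then f p - f q else - f q)"
definition zeta :: "'p \<Rightarrow> real" where "zeta p = lorentz (Z p) (e p) / lorentz (e p) (e p)"
definition tau :: "'p \<Rightarrow> (real^'n) \<times> real" where "tau p = Z p - lorentz (Z p) (N p) *\<^sub>R N p - zeta p *\<^sub>R e p"
definition wt :: "'p \<Rightarrow> real" where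
  "wt p = (if flat then inverse (sqrt (1 + lorentz (Z p) (Z p))) else inverse (lorentz (Z p) (f p)))"
text \<open>Chosen so that the derivative of \<open>wt\<close> along a tangent vector w is - kap
  times the product of Z and w.\<close>

definition kap :: "'p \<Rightarrow> real" where "kap p = (if flat then wt p ^ 3 else wt p ^ 2)"
text \<open>The coefficient a - \<zeta> \<beta> of \<open>newton_divergence\<close>, with a = 1,
  \<beta> = 0 in the flat model and a = 0, \<beta> = 1 otherwise.\<close>

definition lam :: "'p \<Rightarrow> real" where "lam p = (if flat then 1 else 0) - zeta p * (if flat then 0 else 1)"
definition trP :: "'p \<Rightarrow> real" where "trP p = trace (newton_tr j (AM p))"
definition zc :: "(real^'m \<Rightarrow> 'p) \<Rightarrow> real^'m \<Rightarrow> real^'m" where "zc x u = (SOME v. T x u v = tau (x u))"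
definition zM :: "'p \<Rightarrow> real^'m" where "zM p = (SOME v. mdiff \<A> f p v = tau p)"
definition vf :: "'p \<Rightarrow> real^'m" where "vf p = newton_tr j (AM p) *v zM p"
text \<open>The divergence of the field wt P_j tau: the product rule adds the derivative of
  \<open>wt\<close> to the Newton divergence. The next definition is the length of this
  field.\<close>

definition dv :: "'p \<Rightarrow> real" where "dv p = wt p * lam p * trP p - kap p * lorentz (tau p) (mdiff \<A> f p (vf p))"
definition xn :: "'p \<Rightarrow> real" where "xn p = wt p * sqrt (lorentz (mdiff \<A> f p (vf p)) (mdiff \<A> f p (vf p)))"

lemma T_zc: assumes x: "(V, x) \<in> \<A>" and u: "u \<in> V" shows "T x u (zc x u) = tau (x u)"
  unfolding zc_def
proof (rule someI_ex, rule tangent_complement[OF x u])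
  show "lorentz (N (x u)) (tau (x u)) = 0"
    using N_normal[of "x u"] by (simp add: tau_def lorentz.diff_right lorentz.scaleR_right lorentz_commute[of "N (x u)" "Z (x u)"] lorentz_commute[of "N (x u)" "e (x u)"])
  show "lorentz (e (x u)) (tau (x u)) = 0"
    using N_normal(3)[of "x u"] lorentz_ee[of "x u"]
    by (simp add: tau_def lorentz.diff_right lorentz.scaleR_right zeta_def lorentz_commute[of "e (x u)" "Z (x u)"])
qed

lemma mdiff_zM: "mdiff \<A> f p (zM p) = tau p"
  unfolding zM_def
proof (rule someI_ex)
  obtain V x u where x: "chart_at \<A> p = (V, x)" "(V, x) \<in> \<A>" "u \<in> V" "x u = p" "inv_into V x p = u" by (rule chart_rep)
  then show "\<exists>v. mdiff \<A> f p v = tau p" using T_zc[OF x(2,3)] by (auto simp: mdiff_def)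
qed

lemma tr_zc: "(V, x) \<in> \<A> \<Longrightarrow> u \<in> V \<Longrightarrow> tr x u (zc x u) = zM (x u)"
  by (subst mdiff_f(1)[where p = "x u", symmetric]) (simp add: mdiff_zM T_tr[symmetric] T_zc)

lemma tr_vf: "(V, x) \<in> \<A> \<Longrightarrow> u \<in> V \<Longrightarrow> tr x u (newton_tr j (Amat x u) *v zc x u) = vf (x u)"
  by (simp add: newton_chart(1) tr_zc vf_def)

lemma T_vf: "(V, x) \<in> \<A> \<Longrightarrow> u \<in> V \<Longrightarrow> T x u (newton_tr j (Amat x u) *v zc x u) = mdiff \<A> f (x u) (vf (x u))"
  by (simp add: T_tr tr_vf)

text \<open>For c < 0 this is the reverse Cauchy-Schwarz inequality for two timelike vectors in the
  same half cone.\<close>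

lemma wt_base_pos: "(if flat then 1 + lorentz (Z p) (Z p) else lorentz (Z p) (f p)) > 0"
proof (cases "flat")
  case True
  then have "snd (Z p) = 0" using flat_snd by (simp add: Z_def)
  then show ?thesis using True by (simp add: lorentz_def add_pos_nonneg)
next
  case False
  note cnz = nonflat[OF False]
  obtain a s b r where y: "f p = (a, s)" "f q = (b, r)" by force
  have "1 / c < 0" using c0 False cnz by (simp add: divide_less_0_iff)
  moreover have "a \<bullet> a - s * s = 1 / c" "s > 0" "b \<bullet> b - r * r = 1 / c" "r > 0"
    using f_space[of p] f_space[of q] cnz by (auto simp: space_form_def lorentz_def y)
  ultimately have "a \<bullet> a < s * s" "s > 0" "b \<bullet> b < r * r" "r > 0" by linarith+
  then have "norm a < s" "norm b < r"
    by (metis abs_of_pos norm_eq_sqrt_inner real_sqrt_abs2 real_sqrt_less_iff)+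
  have "a \<bullet> b \<le> norm a * norm b" by (rule norm_cauchy_schwarz)
  also have "\<dots> < s * r" using \<open>norm a < s\<close> \<open>norm b < r\<close> by (intro mult_strict_mono') auto
  finally show ?thesis using False cnz by (simp add: Z_def lorentz.minus_left lorentz_def y inner_commute mult.commute)
qed

lemma wt_pos: "wt p > 0"
  using wt_base_pos[of p] by (auto simp: wt_def split: if_splits)

lemma tau_tau: "lorentz (tau p) (tau p) = lorentz (Z p) (Z p) - (lorentz (Z p) (N p))\<^sup>2 - (zeta p)\<^sup>2 * lorentz (e p) (e p)"
proof -
  have "lorentz (Z p) (e p) = zeta p * lorentz (e p) (e p)" using lorentz_ee[of p] by (simp add: zeta_def)
  moreover have "lorentz (tau p) (tau p) = lorentz (Z p) (Z p) - lorentz (Z p) (N p) * lorentz (N p) (Z p) - zeta p * lorentz (e p) (Z p)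
      - (lorentz (Z p) (N p) * (lorentz (Z p) (N p) - lorentz (Z p) (N p) * lorentz (N p) (N p) - zeta p * lorentz (e p) (N p)))
      - zeta p * (lorentz (Z p) (e p) - lorentz (Z p) (N p) * lorentz (N p) (e p) - zeta p * lorentz (e p) (e p))"
    by (simp only: tau_def lorentz.diff_left lorentz.diff_right lorentz.scaleR_left lorentz.scaleR_right real_scaleR_def)
  ultimately show ?thesis
    using N_normal(1,3)[of p] lorentz_commute[of "N p" "Z p"] lorentz_commute[of "N p" "e p"] lorentz_commute[of "e p" "Z p"]
    by (simp add: power2_eq_square algebra_simps)
qed

lemma zeta_eq: "zeta p = (if flat then 0 else c * lorentz (Z p) (f p))"
proof (cases "flat")
  case True
  then have "snd (Z p) = 0" using flat_snd by (simp add: Z_def)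
  then show ?thesis using True by (simp add: zeta_def flat_radial lorentz_def)
next
  case False
  note cnz = nonflat[OF False]
  then have "lorentz (f p) (f p) = 1 / c" using f_space[of p] by (simp add: space_form_def)
  then show ?thesis using False cnz by (simp add: zeta_def radial_def)
qed

text \<open>What enters of the Hessian of r is the form wt lam g - kap tau (x) tau; the quantity
  bounds it below on unit vectors, with equality in direction tau. For c = 0 the bound |tau|^2 \<le>
  |Z|^2 leaves wt^3; for c < 0 the expression equals wt^2 (<Z, N>^2 - 1 / c).\<close>

lemma hessian_pos: "wt p * lam p - kap p * lorentz (tau p) (tau p) > 0"
proof (cases "flat")
  case True
  define Q where "Q = lorentz (Z p) (Z p)"
  have Q: "1 + Q > 0" using wt_base_pos[of p] True by (simp add: Q_def)
  have w2: "wt p * wt p * (1 + Q) = 1"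
    using Q True by (simp add: wt_def Q_def[symmetric] inverse_eq_divide)
  have "lorentz (tau p) (tau p) \<le> Q" using True by (simp add: tau_tau zeta_eq Q_def)
  then have "wt p ^ 3 * lorentz (tau p) (tau p) \<le> wt p ^ 3 * Q" using wt_pos[of p] by (intro mult_left_mono) auto
  moreover have "wt p ^ 3 * 1 + wt p ^ 3 * Q = wt p"
    unfolding distrib_left[symmetric] using w2 by (simp add: power3_eq_cube mult.assoc)
  moreover have "wt p ^ 3 > 0" using wt_pos[of p] by simp
  ultimately have "wt p * 1 - wt p ^ 3 * lorentz (tau p) (tau p) > 0" by linarith
  then show ?thesis using True by (simp add: lam_def kap_def)
next
  case False
  note cnz = nonflat[OF False]
  define L where "L = lorentz (Z p) (f p)"
  have L: "L > 0" using wt_base_pos[of p] False cnz by (simp add: L_def)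
  have ci: "1 / c < 0" using c0 False cnz by (simp add: divide_less_0_iff)
  have w: "wt p = inverse L" using False cnz by (simp add: wt_def L_def)
  have ee: "lorentz (e p) (e p) = 1 / c" using f_space[of p] False cnz by (simp add: space_form_def radial_def)
  have ZZ: "lorentz (Z p) (Z p) = 1 / c" using f_space[of q] False cnz
    by (simp add: Z_def space_form_def lorentz.minus_left lorentz.minus_right)
  have "wt p * lam p - kap p * lorentz (tau p) (tau p)
      = - c - (inverse L)^2 * (1 / c - (lorentz (Z p) (N p))\<^sup>2 - (c * L)^2 * (1 / c))"
    using False cnz L unfolding tau_tau zeta_eq[of p] ee ZZ by (simp add: lam_def zeta_eq kap_def w L_def[symmetric])
  also have "\<dots> = (inverse L)^2 * ((lorentz (Z p) (N p))\<^sup>2 - 1 / c)"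
    using L cnz by (simp add: field_simps power2_eq_square)
  also have "\<dots> > 0" proof (rule mult_pos_pos)
    show "0 < (inverse L)^2" using L by simp
    have "1 / c < (lorentz (Z p) (N p))^2" by (rule less_le_trans[OF ci zero_le_power2])
    then show "0 < (lorentz (Z p) (N p))\<^sup>2 - 1 / c" by (simp only: diff_gt_0_iff_gt)
  qed
  finally show ?thesis .
qed

text \<open>One constant serves both models: the squared length of the gradient is at most 1 for c =
  0 and at most -c for c < 0.\<close>

lemma gradient_bound: "wt p * sqrt (lorentz (tau p) (tau p)) \<le> sqrt (1 - c)"
proof -
  have "(wt p)^2 * lorentz (tau p) (tau p) \<le> 1 - c"
  proof (cases "flat")
    case True
    define Q where "Q = lorentz (Z p) (Z p)"
    have Q: "1 + Q > 0" using wt_base_pos[of p] True by (simp add: Q_def)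
    have w2: "wt p ^ 2 * (1 + Q) = 1"
      using Q True by (simp add: wt_def Q_def[symmetric] inverse_eq_divide power2_eq_square)
    have "lorentz (tau p) (tau p) \<le> 1 + Q" using True by (simp add: tau_tau zeta_eq Q_def add_increasing)
    then have "wt p ^ 2 * lorentz (tau p) (tau p) \<le> wt p ^ 2 * (1 + Q)" by (intro mult_left_mono) auto
    then show ?thesis using True w2 c0 by simp
  next
    case False
    note cnz = nonflat[OF False]
    define L where "L = lorentz (Z p) (f p)"
    have L: "L > 0" using wt_base_pos[of p] False cnz by (simp add: L_def)
    have ci: "1 / c < 0" using c0 False cnz by (simp add: divide_less_0_iff)
    have w: "wt p = inverse L" using False cnz by (simp add: wt_def L_def)
    have ee: "lorentz (e p) (e p) = 1 / c" using f_space[of p] False cnz by (simp add: space_form_def radial_def)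
    have ZZ: "lorentz (Z p) (Z p) = 1 / c" using f_space[of q] False cnz
      by (simp add: Z_def space_form_def lorentz.minus_left lorentz.minus_right)
    have "lorentz (tau p) (tau p) = 1 / c - (lorentz (Z p) (N p))\<^sup>2 - c * L\<^sup>2"
      using False cnz unfolding tau_tau zeta_eq[of p] ee ZZ by (simp add: L_def[symmetric] power2_eq_square)
    then have "lorentz (tau p) (tau p) \<le> - c * L\<^sup>2" using ci zero_le_power2[of "lorentz (Z p) (N p)"] by linarith
    then have "(wt p)^2 * lorentz (tau p) (tau p) \<le> (wt p)^2 * (- c * L\<^sup>2)" by (intro mult_left_mono) auto
    also have "\<dots> = - c" using L by (simp add: w field_simps)
    finally show ?thesis by simp
  qed
  then have "sqrt ((wt p)^2 * lorentz (tau p) (tau p)) \<le> sqrt (1 - c)" by simp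
  then show ?thesis using wt_pos[of p] by (simp add: real_sqrt_mult)
qed

text \<open>P_j is compared with its trace: the term containing tau costs at most kap |tau|^2 times
  the trace, and P_j tau is at most the trace times |tau| in length.\<close>

lemma newton_estimates:
  assumes j: "j \<ge> 1" and s: "\<sigma> * elem_sym j (shape_operator c \<A> f N p) \<ge> 0" "\<bar>\<sigma>\<bar> = 1"
  shows "\<sigma> * trP p \<ge> 0" "\<sigma> * dv p \<ge> (wt p * lam p - kap p * lorentz (tau p) (tau p)) * (\<sigma> * trP p)"
    "xn p \<le> sqrt (1 - c) * (\<sigma> * trP p)"
proof -
  obtain b l where "eigenbasis (\<lambda>v w. lorentz (mdiff \<A> f p v) (mdiff \<A> f p w)) (AM p) b l" by (rule eigenbasis_AM)
  then interpret E: eigenbasis "\<lambda>v w. lorentz (mdiff \<A> f p v) (mdiff \<A> f p w)" "AM p" b l .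
  have es: "lsym (Suc j) UNIV l = 0" "\<sigma> * lsym j UNIV l \<ge> 0"
    using Sj1[of p] s(1) by (simp_all add: E.elem_sym_eq shape_operator_AM)
  note sd = E.newton_tr_semidefinite[OF es(1) j es(2) s(2), folded trP_def]
  show t: "\<sigma> * trP p \<ge> 0" by (rule sd(1))
  have k: "kap p \<ge> 0" using wt_pos[of p] by (simp add: kap_def less_imp_le)
  have "\<sigma> * lorentz (tau p) (mdiff \<A> f p (vf p)) \<le> \<sigma> * trP p * lorentz (tau p) (tau p)"
    using sd(2)[of "zM p"] by (simp add: mdiff_zM vf_def lorentz_commute[of "tau p" "mdiff \<A> f p _"])
  then have "kap p * (\<sigma> * lorentz (tau p) (mdiff \<A> f p (vf p))) \<le> kap p * (\<sigma> * trP p * lorentz (tau p) (tau p))"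
    by (rule mult_left_mono[OF _ k])
  then show "\<sigma> * dv p \<ge> (wt p * lam p - kap p * lorentz (tau p) (tau p)) * (\<sigma> * trP p)"
    by (simp add: dv_def algebra_simps)
  have "sqrt (lorentz (mdiff \<A> f p (vf p)) (mdiff \<A> f p (vf p))) \<le> sqrt ((\<sigma> * trP p)^2 * lorentz (tau p) (tau p))"
    using sd(3)[of "zM p"] by (simp add: mdiff_zM vf_def)
  also have "\<dots> = (\<sigma> * trP p) * sqrt (lorentz (tau p) (tau p))" using t by (simp add: real_sqrt_mult)
  finally have "xn p \<le> wt p * ((\<sigma> * trP p) * sqrt (lorentz (tau p) (tau p)))"
    unfolding xn_def by (rule mult_left_mono) (use wt_pos[of p] in simp)
  also have "\<dots> = (wt p * sqrt (lorentz (tau p) (tau p))) * (\<sigma> * trP p)" by simp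
  also have "\<dots> \<le> sqrt (1 - c) * (\<sigma> * trP p)" by (rule mult_right_mono[OF gradient_bound t])
  finally show "xn p \<le> sqrt (1 - c) * (\<sigma> * trP p)" .
qed

section \<open>The gradient field and its divergence in charts\<close>

definition vol_density :: "(real^'m \<Rightarrow> 'p) \<Rightarrow> real^'m \<Rightarrow> real" where
  "vol_density x u = sqrt (det (gram_matrix f x u))"

text \<open>The volume density is built in, so that the trace of the Jacobian is the density times
  the Riemannian divergence.\<close>

definition field :: "(real^'m \<Rightarrow> 'p) \<Rightarrow> real^'m \<Rightarrow> real^'m" where
  "field x u = wt (x u) *\<^sub>R (vol_density x u *\<^sub>R (newton_tr j (Amat x u) *v zc x u))"

lemma field_facts:
  assumes x: "(V, x) \<in> \<A>"
  shows vol_density_C1: "C1_on V (vol_density x)" and vol_density_pos: "u \<in> V \<Longrightarrow> vol_density x u > 0"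
    and field_C1: "C1_on V (field x)"
    and Pz_C1: "C1_on V (\<lambda>u. newton_tr j (Amat x u) *v zc x u)"
    and wt_C1: "C1_on V (\<lambda>u. wt (x u))"
    and trP_C1: "C1_on V (\<lambda>u. trP (x u))"
    and field_divergence: "u \<in> V \<Longrightarrow> trace (matrix (frechet_derivative (field x) (at u))) = vol_density x u * dv (x u)"
proof -
  interpret P: immersed_patch V "f \<circ> x" "N \<circ> x" "Amat x" "\<lambda>u. T x u" "\<lambda>u. S x u" by (rule patch[OF x])
  have G: "gram_matrix f x u = P.G u" for u by (simp add: gram_matrix_def P.G_def gram_def)
  have vd: "vol_density x = (\<lambda>u. sqrt (det (P.G u)))" by (simp add: vol_density_def fun_eq_iff G)
  have Vo: "open V" by (rule chart(1)[OF x])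
  show vC: "C1_on V (vol_density x)" unfolding vd by (intro C1_on_sqrt C1_on_det P.C1_G P.det_G)
  show vp: "vol_density x u > 0" if "u \<in> V" for u using P.det_G[OF that] by (simp add: vd)
  define a where "a = (if flat then 1 else 0 :: real)"
  define \<beta> where "\<beta> = (if flat then 0 else 1 :: real)"
  have Fx: "C1_on V (\<lambda>u. f (x u))" using smooth_on_C1[OF smooth(1)[OF x]] by (simp add: o_def)
  have dZ: "((\<lambda>u. Z (x u)) has_derivative (\<lambda>h. a *\<^sub>R T x u h)) (at u)" if u: "u \<in> V" for u
    using T[OF x u] by (cases "flat") (auto simp: Z_def a_def o_def intro!: derivative_eq_intros)
  have de: "((\<lambda>u. e (x u)) has_derivative (\<lambda>h. \<beta> *\<^sub>R T x u h)) (at u)" if u: "u \<in> V" for u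
    using radial_derivative[OF x u] by (simp add: \<beta>_def flat_def)
  have CZ: "C1_on V (\<lambda>u. Z (x u))"
    by (cases "flat") (auto simp: Z_def intro!: C1_on_diff C1_on_const Fx)
  have Ce: "C1_on V (\<lambda>u. e (x u))"
    by (cases "flat") (auto simp: flat_radial nonflat_radial intro!: C1_on_const Fx)
  have C\<zeta>: "C1_on V (\<lambda>u. zeta (x u))" unfolding zeta_def
    by (intro C1_on_divide C1_on_bounded_bilinear[OF bounded_bilinear_lorentz] CZ Ce) (use lorentz_ee in \<open>simp add: less_imp_neq\<close>)
  have ca: "continuous_on V (\<lambda>u. a)" by (intro continuous_intros)
  have z: "T x u (zc x u) = Z (x u) - lorentz (Z (x u)) ((N \<circ> x) u) *\<^sub>R (N \<circ> x) u - zeta (x u) *\<^sub>R e (x u)" if "u \<in> V" for u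
    using T_zc[OF x that] by (simp add: tau_def)
  note nd = P.newton_divergence[OF dZ ca de radial_T[OF x] C\<zeta> z]
  show CPz: "C1_on V (\<lambda>u. newton_tr j (Amat x u) *v zc x u)"
    by (intro C1_on_matrix_vector_mult P.C1_newton nd(2))
  show wC: "C1_on V (\<lambda>u. wt (x u))"
  proof (cases "flat")
    case True
    have p: "1 + lorentz (Z p) (Z p) > 0" for p using wt_base_pos[of p] True by simp
    have "C1_on V (\<lambda>u. inverse (sqrt (1 + lorentz (Z (x u)) (Z (x u)))))"
      by (intro C1_on_inverse C1_on_sqrt C1_on_add C1_on_const C1_on_bounded_bilinear[OF bounded_bilinear_lorentz] CZ)
         (use p in \<open>auto simp: less_imp_neq[symmetric]\<close>)
    then show ?thesis using True by (simp add: wt_def)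
  next
    case False
    note cnz = nonflat[OF False]
    have p: "lorentz (Z p) (f p) > 0" for p using wt_base_pos[of p] False by simp
    have "C1_on V (\<lambda>u. inverse (lorentz (Z (x u)) (f (x u))))"
      by (intro C1_on_inverse C1_on_bounded_bilinear[OF bounded_bilinear_lorentz] CZ Fx)
         (use p in \<open>auto simp: less_imp_neq[symmetric]\<close>)
    then show ?thesis using False cnz by (simp add: wt_def)
  qed
  have "C1_on V (\<lambda>u. trace (newton_tr j (Amat x u)))" by (intro C1_on_trace P.C1_newton)
  then show "C1_on V (\<lambda>u. trP (x u))"
    by (rule C1_on_cong[OF Vo, rotated]) (simp add: trP_def newton_chart(2)[OF x])
  show "C1_on V (field x)" unfolding field_def by (intro C1_on_scaleR wC vC CPz)
  assume u: "u \<in> V"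
  define Y where "Y u = vol_density x u *\<^sub>R (newton_tr j (Amat x u) *v zc x u)" for u
  define Y' where "Y' = frechet_derivative Y (at u)"
  have CY: "C1_on V Y" unfolding Y_def[abs_def] by (intro C1_on_scaleR vC CPz)
  have dY: "(Y has_derivative Y') (at u)" unfolding Y'_def by (rule C1_onD(1)[OF CY u])
  \<comment> \<open>Here S_{j+1} = 0 removes the contribution of the normal component of Z.\<close>
  have t0: "trace (Amat x u ** newton_tr j (Amat x u)) = 0"
    using trace_newton_elem_sym(2)[of "x u" j] Sj1[of "x u"] by (simp add: newton_chart(3)[OF x u])
  have trY: "trace (matrix Y') = vol_density x u * (lam (x u) * trP (x u))"
  proof -
    have "trace (matrix (frechet_derivative (\<lambda>u. sqrt (det (P.G u)) *\<^sub>R (newton_tr j (Amat x u) *v zc x u)) (at u)))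
      = sqrt (det (P.G u)) * ((a - zeta (x u) * \<beta>) * trace (newton_tr j (Amat x u)) +
        lorentz (Z (x u)) ((N \<circ> x) u) * trace (Amat x u ** newton_tr j (Amat x u)))"
      by (rule nd(3)) (use u in auto)
    then show ?thesis unfolding Y'_def Y_def[abs_def] vd
    by (simp add: t0 newton_chart(2)[OF x u] lam_def a_def \<beta>_def trP_def)
  qed
  have dw: "((\<lambda>u. wt (x u)) has_derivative (\<lambda>h. - kap (x u) * lorentz (Z (x u)) (T x u h))) (at u)"
  proof (cases "flat")
    case True
    define Q where "Q u = 1 + lorentz (Z (x u)) (Z (x u))" for u
    have Q: "Q u > 0" for u using wt_base_pos[of "x u"] True by (simp add: Q_def)
    have "(Q has_derivative (\<lambda>h. lorentz (Z (x u)) (a *\<^sub>R T x u h) + lorentz (a *\<^sub>R T x u h) (Z (x u)))) (at u)"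
      unfolding Q_def[abs_def] by (rule has_derivative_eq_rhs[OF has_derivative_add[OF has_derivative_const lorentz.FDERIV[OF dZ[OF u] dZ[OF u]]]]) simp
    then have dQ: "(Q has_derivative (\<lambda>h. 2 * lorentz (Z (x u)) (T x u h))) (at u)"
      using True by (simp add: a_def lorentz_commute[of "T x u _"])
    have "((\<lambda>t. inverse (sqrt t)) has_real_derivative (- (inverse (sqrt (Q u)) ^ 3) / 2)) (at (Q u))"
      using Q[of u] by (auto intro!: derivative_eq_intros simp: power3_eq_cube)
    from has_derivative_compose[OF dQ this[unfolded has_field_derivative_def]]
    have "((\<lambda>u. inverse (sqrt (Q u))) has_derivative (\<lambda>h. - (inverse (sqrt (Q u)) ^ 3) / 2 * (2 * lorentz (Z (x u)) (T x u h)))) (at u)" .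
    moreover have "(\<lambda>u. wt (x u)) = (\<lambda>u. inverse (sqrt (Q u)))" using True by (simp add: wt_def Q_def)
    moreover have "kap (x u) = inverse (sqrt (Q u)) ^ 3" using True by (simp add: kap_def wt_def Q_def)
    ultimately show ?thesis by simp
  next
    case False
    note cnz = nonflat[OF False]
    define Q where "Q u = lorentz (Z (x u)) (f (x u))" for u
    have Q: "Q u > 0" for u using wt_base_pos[of "x u"] False cnz by (simp add: Q_def)
    have "(Q has_derivative (\<lambda>h. lorentz (Z (x u)) (T x u h) + lorentz (a *\<^sub>R T x u h) ((f \<circ> x) u))) (at u)"
      unfolding Q_def[abs_def] using lorentz.FDERIV[OF dZ[OF u] T[OF x u]] by (simp add: o_def)
    then have dQ: "(Q has_derivative (\<lambda>h. lorentz (Z (x u)) (T x u h))) (at u)"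
      using False cnz by (simp add: a_def lorentz.zero_left)
    have "((\<lambda>t. inverse t) has_real_derivative (- (inverse (Q u) ^ 2))) (at (Q u))"
      using Q[of u] by (auto intro!: derivative_eq_intros simp: power2_eq_square)
    from has_derivative_compose[OF dQ this[unfolded has_field_derivative_def]]
    have "((\<lambda>u. inverse (Q u)) has_derivative (\<lambda>h. - (inverse (Q u) ^ 2) * lorentz (Z (x u)) (T x u h))) (at u)" .
    moreover have "(\<lambda>u. wt (x u)) = (\<lambda>u. inverse (Q u))" using False cnz by (simp add: wt_def Q_def)
    moreover have "kap (x u) = inverse (Q u) ^ 2" using False cnz by (simp add: kap_def wt_def Q_def)
    ultimately show ?thesis by simp
  qed
  define w' where "w' h = - kap (x u) * lorentz (Z (x u)) (T x u h)" for h
  have lw: "linear w'" unfolding w'_def[abs_def] by (rule has_derivative_linear[OF dw])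
  have "(field x has_derivative (\<lambda>h. wt (x u) *\<^sub>R Y' h + w' h *\<^sub>R Y u)) (at u)"
    unfolding field_def[abs_def] Y_def[symmetric] w'_def by (rule has_derivative_scaleR[OF dw dY])
  from frechet_derivative_at[OF this, symmetric]
  have tw: "trace (matrix (frechet_derivative (field x) (at u))) = wt (x u) * trace (matrix Y') + w' (Y u)"
    by (simp only: trace_matrix_product_rule[OF lw])
  have wY: "w' (Y u) = - kap (x u) * (vol_density x u * lorentz (tau (x u)) (mdiff \<A> f (x u) (vf (x u))))"
  proof -
    \<comment> \<open>Z and its tangential part have the same products with tangent vectors, so the
      derivative of \<open>wt\<close> can be expressed by tau.\<close>
    have "lorentz (tau (x u)) (T x u v) = lorentz (Z (x u)) (T x u v)" for v
      using NT[OF x u, of v] radial_T[OF x u, of v] by (simp add: tau_def lorentz.diff_left lorentz.scaleR_left)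
    then show ?thesis
      by (simp add: w'_def Y_def linear_cmul[OF linear_T[OF x u]] lorentz.scaleR_right T_vf[OF x u, symmetric])
  qed
  show "trace (matrix (frechet_derivative (field x) (at u))) = vol_density x u * dv (x u)"
    unfolding tw wY trY dv_def by (simp add: algebra_simps)
qed

end

section \<open>Localization\<close>

lemma C1_on_Un:
  assumes "open V" "open W" "C1_on V h" "C1_on W h" shows "C1_on (V \<union> W) h"
proof (rule C1_onI)
  show "(h has_derivative frechet_derivative h (at u)) (at u)" if u: "u \<in> V \<union> W" for u
    using u C1_onD(1)[OF assms(3)] C1_onD(1)[OF assms(4)] by blast
  show "continuous_on (V \<union> W) (\<lambda>u. frechet_derivative h (at u) v)" for v
    by (rule continuous_on_open_Un[OF assms(1,2) C1_onD(2)[OF assms(3)] C1_onD(2)[OF assms(4)]])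
qed

lemma C1_on_derivative_continuous:
  fixes h :: "'a::euclidean_space \<Rightarrow> 'b::real_normed_vector"
  assumes h: "C1_on V h" and k: "continuous_on V k"
  shows "continuous_on V (\<lambda>u. frechet_derivative h (at u) (k u))"
proof (rule continuous_on_eq)
  show "continuous_on V (\<lambda>u. \<Sum>b\<in>Basis. (k u \<bullet> b) *\<^sub>R frechet_derivative h (at u) b)"
    by (intro continuous_intros k C1_onD(2)[OF h])
  fix u assume u: "u \<in> V"
  have l: "linear (frechet_derivative h (at u))" using C1_onD(1)[OF h u] by (rule has_derivative_linear)
  have "frechet_derivative h (at u) (k u) = frechet_derivative h (at u) (\<Sum>b\<in>Basis. (k u \<bullet> b) *\<^sub>R b)"
    by (simp add: euclidean_representation)
  then show "(\<Sum>b\<in>Basis. (k u \<bullet> b) *\<^sub>R frechet_derivative h (at u) b) = frechet_derivative h (at u) (k u)"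
    by (simp add: linear_sum[OF l] linear_cmul[OF l])
qed

definition pos_square :: "real \<Rightarrow> real" where "pos_square t = (max 0 t)\<^sup>2"

lemma pos_square_derivative: "(pos_square has_real_derivative 2 * max 0 t) (at t)"
proof -
  consider "t > 0" | "t < 0" | "t = 0" by linarith
  then show ?thesis
  proof cases
    case 1
    have "((\<lambda>t. t\<^sup>2) has_real_derivative 2 * max 0 t) (at t)"
      using 1 by (auto intro!: derivative_eq_intros)
    then show ?thesis
      by (rule has_field_derivative_transform_within_open[where S = "{0<..}"]) (use 1 in \<open>auto simp: pos_square_def\<close>)
  next
    case 2
    have "((\<lambda>t. 0) has_real_derivative 2 * max 0 t) (at t)"
      using 2 by (auto intro!: derivative_eq_intros)
    then show ?thesis
      by (rule has_field_derivative_transform_within_open[where S = "{..<0}"]) (use 2 in \<open>auto simp: pos_square_def\<close>)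
  next
    case 3
    have "((\<lambda>h. pos_square h / h) \<longlongrightarrow> 0) (at 0)"
    proof (rule Lim_null_comparison)
      show "\<forall>\<^sub>F h in at 0. norm (pos_square h / h) \<le> \<bar>h\<bar>"
        by (rule always_eventually) (auto simp: pos_square_def power2_eq_square max_def)
      show "((\<lambda>h::real. \<bar>h\<bar>) \<longlongrightarrow> 0) (at 0)" by (intro tendsto_rabs_zero tendsto_ident_at)
    qed
    moreover have "pos_square 0 = 0" by (simp add: pos_square_def)
    ultimately show ?thesis using 3 by (simp add: DERIV_def)
  qed
qed

lemma C1_on_pos_square: "C1_on V h \<Longrightarrow> C1_on V (\<lambda>u. pos_square (h u))"
  by (rule C1_on_real_compose[where S = UNIV and F' = "\<lambda>t. 2 * max 0 t", OF _ UNIV_I pos_square_derivative])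
     (auto intro!: continuous_intros)

text \<open>The inner square starts at t = 1 and reaches 1 at t = 2, where the outer positive part
  cuts off. Squares of positive parts are continuously differentiable, and test functions are
  differentiated only once.\<close>

definition cutoff :: "real \<Rightarrow> real" where "cutoff t = pos_square (1 - pos_square (t - 1))"

lemma cutoff: "0 \<le> cutoff t" "cutoff t \<le> 1" "t \<le> 1 \<Longrightarrow> cutoff t = 1" "t \<ge> 2 \<Longrightarrow> cutoff t = 0"
proof -
  have p: "pos_square s \<ge> 0" for s by (simp add: pos_square_def)
  show "0 \<le> cutoff t" by (simp add: cutoff_def p)
  show "cutoff t \<le> 1" unfolding cutoff_def pos_square_def[of "1 - _"] using p[of "t - 1"] by (intro power_le_one) auto
  show "t \<le> 1 \<Longrightarrow> cutoff t = 1" by (simp add: cutoff_def pos_square_def)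
  assume "t \<ge> 2"
  then have "(t - 1)\<^sup>2 \<ge> 1" by (simp add: one_le_power)
  then have "pos_square (t - 1) \<ge> 1" using \<open>t \<ge> 2\<close> by (simp add: pos_square_def)
  then show "cutoff t = 0" by (simp add: cutoff_def pos_square_def[of "1 - _"])
qed

context hypersurface
begin

lemma continuous_from_charts:
  assumes "\<And>V x. (V, x) \<in> \<A> \<Longrightarrow> continuous_on V (\<lambda>u. h (x u))" shows "continuous_on UNIV h"
proof -
  have "continuous_on (\<Union>z\<in>\<A>. (case z of (V, x) \<Rightarrow> x ` V)) h"
  proof (rule continuous_on_open_UN)
    fix z assume "z \<in> \<A>"
    then obtain V x where z: "z = (V, x)" "(V, x) \<in> \<A>" by (cases z) auto
    show "open (case z of (V, x) \<Rightarrow> x ` V)" using chart(2)[OF z(2)] z(1) by simp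
    have "continuous_on (x ` V) (\<lambda>p. h (x (inv_into V x p)))"
      by (rule continuous_on_compose2[OF assms[OF z(2)] chart(5)[OF z(2)]]) (auto intro: inv_into_into)
    then show "continuous_on (case z of (V, x) \<Rightarrow> x ` V) h"
      unfolding z(1) prod.case by (rule continuous_on_eq) (simp add: f_inv_into_f)
  qed
  moreover have "(\<Union>z\<in>\<A>. (case z of (V, x) \<Rightarrow> x ` V)) = UNIV"
    using atlas unfolding smooth_atlas_def by (elim conjE)
  ultimately show ?thesis by simp
qed

definition C1_fun :: "('p \<Rightarrow> real) \<Rightarrow> bool" where
  "C1_fun h \<longleftrightarrow> (\<forall>(V, x)\<in>\<A>. C1_on V (\<lambda>u. h (x u)))"

lemma C1_fun: "C1_fun h \<Longrightarrow> (V, x) \<in> \<A> \<Longrightarrow> C1_on V (\<lambda>u. h (x u))"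
  by (auto simp: C1_fun_def)

lemma C1_fun_continuous: "C1_fun h \<Longrightarrow> continuous_on UNIV h"
  by (rule continuous_from_charts) (rule C1_on_continuous[OF C1_fun])

lemma C1_fun_const: "C1_fun (\<lambda>_. k)"
  and C1_fun_add: "C1_fun h \<Longrightarrow> C1_fun k' \<Longrightarrow> C1_fun (\<lambda>p. h p + k' p)"
  and C1_fun_diff: "C1_fun h \<Longrightarrow> C1_fun k' \<Longrightarrow> C1_fun (\<lambda>p. h p - k' p)"
  and C1_fun_mult: "C1_fun h \<Longrightarrow> C1_fun k' \<Longrightarrow> C1_fun (\<lambda>p. h p * k' p)"
  by (auto simp: C1_fun_def intro!: C1_on_const C1_on_add C1_on_diff C1_on_mult)

lemma mdiff_locally_const:
  fixes h :: "'p \<Rightarrow> real"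
  assumes U: "open U" "p \<in> U" and h: "\<And>p. p \<in> U \<Longrightarrow> h p = k"
  shows "mdiff \<A> h p v = 0"
proof -
  obtain V x u where x: "chart_at \<A> p = (V, x)" "(V, x) \<in> \<A>" "u \<in> V" "x u = p" "inv_into V x p = u" by (rule chart_rep)
  have o: "open (V \<inter> x -` U)" by (intro continuous_open_preimage chart[OF x(2)] U)
  have "(h \<circ> x has_derivative (\<lambda>_. 0)) (at u)"
    by (rule has_derivative_transform_within_open[OF has_derivative_const[of k] o]) (use x U h in auto)
  then have "frechet_derivative (h \<circ> x) (at u) = (\<lambda>_. 0)" by (rule frechet_derivative_at[symmetric])
  then show ?thesis by (simp add: mdiff_def x)
qed

lemma mdiff_add:
  assumes h: "C1_fun h" and k: "C1_fun k"
  shows "mdiff \<A> (\<lambda>p. h p + k p) p v = mdiff \<A> h p v + mdiff \<A> k p v"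
proof -
  obtain V x u where x: "chart_at \<A> p = (V, x)" "(V, x) \<in> \<A>" "u \<in> V" "x u = p" "inv_into V x p = u" by (rule chart_rep)
  note d = has_derivative_add[OF C1_onD(1)[OF C1_fun[OF h x(2)] x(3)] C1_onD(1)[OF C1_fun[OF k x(2)] x(3)]]
  show ?thesis
    using fun_cong[OF frechet_derivative_at[OF d], of v] by (simp add: mdiff_def x o_def)
qed

lemma mdiff_C1_fun:
  assumes h: "C1_fun h" and x: "(V, x) \<in> \<A>" "u \<in> V"
  shows "frechet_derivative (\<lambda>u. h (x u)) (at u) v = mdiff \<A> h (x u) (tr x u v)"
  using mdiff_tr(3)[OF x, of h v] C1_onD(3)[OF C1_fun[OF h]] by (simp add: o_def)

text \<open>A cutoff of the squared coordinate distance, extended by zero. In another chart its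
  domain is covered by the overlap with x and by the preimage of the complement of the support; the
  latter is open because compact sets are closed in a Hausdorff space.\<close>

lemma bump:
  assumes U: "open U" "p \<in> U"
  obtains \<psi> V x K B where "(V, x) \<in> \<A>" "compact K" "K \<subseteq> V" "x ` K \<subseteq> U" "C1_fun \<psi>"
    "\<And>p. 0 \<le> \<psi> p" "\<And>p. \<psi> p \<le> 1" "\<And>p. p \<notin> x ` K \<Longrightarrow> \<psi> p = 0" "open B" "p \<in> B" "\<And>p. p \<in> B \<Longrightarrow> \<psi> p = 1"
    "B \<subseteq> x ` K"
proof -
  obtain V x where x: "(V, x) \<in> \<A>" "p \<in> x ` V" by (rule chart_cover)
  then obtain u where u: "u \<in> V" "p = x u" by blast
  have "open (V \<inter> x -` U)" by (intro continuous_open_preimage chart[OF x(1)] U)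
  then obtain r where r: "r > 0" "cball u r \<subseteq> V \<inter> x -` U"
    unfolding open_contains_cball using u U by blast
  \<comment> \<open>The cutoff is 1 up to radius \<rho> and vanishes once |w - u|^2 \<ge> 2
    \<rho>^2, hence outside the ball of radius r = 2 \<rho>.\<close>
  define \<rho> where "\<rho> = r / 2"
  have \<rho>: "\<rho> > 0" "r = 2 * \<rho>" using r by (simp_all add: \<rho>_def)
  define b where "b w = cutoff ((w - u) \<bullet> (w - u) / \<rho>\<^sup>2)" for w
  have Cb: "C1_on S b" for S
    unfolding b_def[abs_def] cutoff_def
    by (intro C1_on_pos_square C1_on_diff C1_on_const C1_on_divide C1_on_inner C1_on_id) (use \<rho> in auto)
  have b0: "b w = 0" if w: "w \<notin> cball u r" for w
  proof -
    have "2 * \<rho> < norm (w - u)" using w \<rho> by (simp add: dist_norm norm_minus_commute)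
    then have "(2 * \<rho>)\<^sup>2 \<le> (norm (w - u))\<^sup>2" using \<rho> by (intro power_mono) auto
    then have "(w - u) \<bullet> (w - u) \<ge> 4 * \<rho>\<^sup>2" by (simp add: dot_square_norm power_mult_distrib)
    then have "(w - u) \<bullet> (w - u) \<ge> 2 * \<rho>\<^sup>2" using zero_le_power2[of \<rho>] by linarith
    then show ?thesis using \<rho> unfolding b_def by (intro cutoff(4)) (simp add: le_divide_eq)
  qed
  have b1: "b w = 1" if w: "w \<in> ball u \<rho>" for w
  proof -
    have "norm (w - u) \<le> \<rho>" using w by (simp add: dist_norm norm_minus_commute)
    then have "(norm (w - u))\<^sup>2 \<le> \<rho>\<^sup>2" by (intro power_mono) auto
    then show ?thesis using \<rho> unfolding b_def by (intro cutoff(3)) (simp add: divide_le_eq dot_square_norm)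
  qed
  define \<psi> where "\<psi> p = (if p \<in> x ` V then b (inv_into V x p) else 0)" for p
  have KV: "cball u r \<subseteq> V" using r by auto
  have Kc: "closed (x ` cball u r)"
    by (intro compact_imp_closed compact_continuous_image compact_cball continuous_on_subset[OF chart(4)[OF x(1)] KV])
  have p0: "\<psi> p = 0" if p: "p \<notin> x ` cball u r" for p
  proof (cases "p \<in> x ` V")
    case True
    then have "inv_into V x p \<notin> cball u r" using p by (metis f_inv_into_f imageI)
    then show ?thesis by (simp add: \<psi>_def b0)
  qed (simp add: \<psi>_def)
  have p1: "\<psi> p = 1" if p: "p \<in> x ` ball u \<rho>" for p
  proof -
    obtain w where w: "w \<in> ball u \<rho>" "p = x w" using p by blast
    then have "w \<in> V" using KV \<rho> by auto
    then show ?thesis using w b1[OF w(1)] chart(6)[OF x(1)] by (simp add: \<psi>_def)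
  qed
  have C: "C1_fun \<psi>"
    unfolding C1_fun_def
  proof safe
    fix W y assume y: "(W, y) \<in> \<A>"
    let ?O1 = "dom W y V x" and ?O2 = "W \<inter> y -` (- x ` cball u r)"
    have o1: "open ?O1" by (rule open_dom[OF y x(1)])
    have o2: "open ?O2" by (intro continuous_open_preimage chart[OF y] open_Compl Kc)
    have "C1_on ?O1 (\<lambda>w. b ((inv_into V x \<circ> y) w))"
      by (rule C1_on_compose[OF C1_transition[OF y x(1)] Cb subset_UNIV])
    then have 1: "C1_on ?O1 (\<lambda>w. \<psi> (y w))"
      by (rule C1_on_cong[OF o1, rotated]) (auto simp: \<psi>_def dom_def)
    have 2: "C1_on ?O2 (\<lambda>w. \<psi> (y w))"
      by (rule C1_on_cong[OF o2 _ C1_on_const[of _ 0]]) (auto intro: p0)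
    have "x ` cball u r \<subseteq> x ` V" using KV by (rule image_mono)
    then have "W \<subseteq> ?O1 \<union> ?O2" unfolding dom_def by blast
    then show "C1_on W (\<lambda>w. \<psi> (y w))" by (rule C1_on_subset[OF C1_on_Un[OF o1 o2 1 2]])
  qed
  show ?thesis
  proof (rule that[OF x(1) compact_cball KV _ C _ _ p0 _ _ p1])
    show "x ` cball u r \<subseteq> U" using r by auto
    show "0 \<le> \<psi> p" "\<psi> p \<le> 1" for p by (simp_all add: \<psi>_def b_def cutoff)
    show "open (x ` ball u \<rho>)" by (rule chart_open_image[OF x(1) open_ball]) (use KV \<rho> in auto)
    show "p \<in> x ` ball u \<rho>" using u \<rho> by auto
    show "x ` ball u \<rho> \<subseteq> x ` cball u r" using \<rho> by (intro image_mono) auto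
  qed
qed

end

section \<open>Integration on the hypersurface\<close>

locale measured_field = position_field c \<A> f N q j
  for c :: real and \<A> :: "('m::finite, 'p::t2_space) param set" and f N :: "'p \<Rightarrow> (real^'n::finite) \<times> real"
    and q :: 'p and j :: nat +
  fixes vol :: "'p measure"
  assumes vol: "is_riemannian_measure \<A> f vol"
begin

lemma sets_vol: "sets vol = sets borel" and space_vol: "space vol = UNIV"
  using vol sets_eq_imp_space_eq[of vol borel] by (auto simp: is_riemannian_measure_def)

lemma emeasure_chart:
  "(V, x) \<in> \<A> \<Longrightarrow> B \<in> sets borel \<Longrightarrow> B \<subseteq> x ` V \<Longrightarrow>
   emeasure vol B = (\<integral>\<^sup>+u\<in>V \<inter> x -` B. ennreal (vol_density x u) \<partial>lborel)"
  using vol unfolding is_riemannian_measure_def vol_density_def by blast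

text \<open>On one chart domain the measure is the image of Lebesgue measure weighted by the volume
  density, as the two agree on Borel sets; integrals of functions supported there can be computed in
  coordinates.\<close>

lemma chart_integral:
  assumes x: "(V, x) \<in> \<A>" and K: "compact K" "K \<subseteq> V" and h: "continuous_on UNIV h" "\<And>p. p \<notin> x ` K \<Longrightarrow> h p = (0::real)"
  shows "integrable vol h" "(\<integral>p. h p \<partial>vol) = (\<integral>u. indicator K u * (h (x u) * vol_density x u) \<partial>lborel)"
proof -
  note [measurable_cong] = sets_vol
  \<comment> \<open>Off V the values of x are arbitrary; a constant there gives a Borel map, and the
    weight w vanishes off V.\<close>
  define x' where "x' u = (if u \<in> V then x u else q)" for u
  define w where "w u = indicator V u * vol_density x u" for u
  have Vo: "open V" "open (x ` V)" using chart[OF x] by auto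
  have [measurable]: "V \<in> sets borel" "x ` V \<in> sets borel" using Vo by auto
  have mx[measurable]: "x' \<in> borel_measurable borel"
    unfolding x'_def[abs_def] by (intro borel_measurable_continuous_on_if chart(4)[OF x] continuous_on_const) simp
  have mw[measurable]: "w \<in> borel_measurable borel"
    using borel_measurable_continuous_on_indicator[OF _ C1_on_continuous[OF vol_density_C1[OF x]]]
    by (simp add: w_def[abs_def])
  have mh[measurable]: "h \<in> borel_measurable borel" by (rule borel_measurable_continuous_onI[OF h(1)])
  have w0: "w u \<ge> 0" for u using vol_density_pos[OF x, of u] by (simp add: w_def indicator_def less_imp_le)
  have eq: "density vol (\<lambda>p. ennreal (indicator (x ` V) p)) = distr (density lborel (\<lambda>u. ennreal (w u))) borel x'"
    (is "?L = ?R")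
  proof (rule measure_eqI)
    fix A assume A: "A \<in> sets ?L"
    then have [measurable]: "A \<in> sets borel" by (simp add: sets_vol)
    have "emeasure ?L A = (\<integral>\<^sup>+p. ennreal (indicator (x ` V) p) * indicator A p \<partial>vol)"
      by (subst emeasure_density) (auto simp: sets_vol)
    also have "\<dots> = (\<integral>\<^sup>+p. indicator (A \<inter> x ` V) p \<partial>vol)"
      by (rule nn_integral_cong) (auto simp: indicator_def)
    also have "\<dots> = emeasure vol (A \<inter> x ` V)" by (simp add: sets_vol)
    also have "\<dots> = (\<integral>\<^sup>+u\<in>V \<inter> x -` (A \<inter> x ` V). ennreal (vol_density x u) \<partial>lborel)"
      by (rule emeasure_chart[OF x]) auto
    also have "\<dots> = (\<integral>\<^sup>+u. ennreal (w u) * indicator (x' -` A \<inter> space lborel) u \<partial>lborel)"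
      by (intro nn_integral_cong) (auto simp: w_def x'_def indicator_def)
    also have "\<dots> = emeasure ?R A"
    proof -
      have [measurable]: "x' -` A \<in> sets borel" by (rule measurable_sets_borel[OF mx]) fact
      show ?thesis by (subst emeasure_distr) (auto simp: emeasure_density)
    qed
    finally show "emeasure ?L A = emeasure ?R A" .
  qed (simp add: sets_vol)
  have ih: "indicator (x ` V) p *\<^sub>R h p = h p" for p
    using h(2)[of p] K by (cases "h p = 0") (auto simp: indicator_def)
  have iu: "w u *\<^sub>R h (x' u) = indicator K u * (h (x u) * vol_density x u)" for u
  proof (cases "u \<in> V")
    case True
    have "h (x u) = 0" if "u \<notin> K"
      by (rule h(2)) (use that True K(2) chart(6)[OF x] in \<open>metis imageE subset_iff\<close>)
    then show ?thesis using True by (auto simp: w_def x'_def indicator_def)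
  qed (use K in \<open>auto simp: w_def indicator_def\<close>)
  have ck: "continuous_on K (\<lambda>u. h (x u) * vol_density x u)"
    by (intro continuous_intros continuous_on_compose2[OF h(1)] continuous_on_subset[OF chart(4)[OF x] K(2)]
        continuous_on_subset[OF C1_on_continuous[OF vol_density_C1[OF x]] K(2)]) auto
  have "integrable vol h \<longleftrightarrow> integrable ?L h"
    by (subst integrable_density) (auto simp: ih[unfolded real_scaleR_def])
  also have "\<dots> \<longleftrightarrow> integrable lborel (\<lambda>u. w u *\<^sub>R h (x' u))"
    unfolding eq using w0 by (subst integrable_distr_eq) (auto simp: integrable_density)
  finally show "integrable vol h" unfolding iu using integral_compact_lborel(1)[OF K(1) ck] by simp
  have "(\<integral>p. h p \<partial>vol) = (\<integral>p. h p \<partial>?L)"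
    by (subst integral_density) (auto simp: ih[unfolded real_scaleR_def])
  also have "\<dots> = (\<integral>u. w u *\<^sub>R h (x' u) \<partial>lborel)"
    unfolding eq using w0 by (subst integral_distr) (auto simp: integral_density)
  finally show "(\<integral>p. h p \<partial>vol) = (\<integral>u. indicator K u * (h (x u) * vol_density x u) \<partial>lborel)" unfolding iu .
qed

lemma continuous_coefficients:
  "continuous_on UNIV wt" "continuous_on UNIV trP" "continuous_on UNIV dv" "continuous_on UNIV xn"
  and continuous_mdiff: "C1_fun \<psi> \<Longrightarrow> continuous_on UNIV (\<lambda>p. mdiff \<A> \<psi> p (vf p))"
  and xn_chart: "(V, x) \<in> \<A> \<Longrightarrow> u \<in> V \<Longrightarrow> wt (x u) * gn x u (newton_tr j (Amat x u) *v zc x u) = xn (x u)"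
proof -
  show xc: "wt (x u) * gn x u (newton_tr j (Amat x u) *v zc x u) = xn (x u)" if "(V, x) \<in> \<A>" "u \<in> V" for V x u
    by (simp add: xn_def gn_def T_vf[OF that])
  show "continuous_on UNIV wt" by (rule continuous_from_charts) (rule C1_on_continuous[OF wt_C1])
  show "continuous_on UNIV trP" by (rule continuous_from_charts) (rule C1_on_continuous[OF trP_C1])
  show "continuous_on UNIV dv"
  proof (rule continuous_from_charts)
    fix V x assume x: "(V, x) \<in> \<A>"
    \<comment> \<open>Continuity of \<open>dv\<close> is read off from the divergence formula, whose
      left-hand side contains only first derivatives of a C1 field.\<close>
    have "continuous_on V (\<lambda>u. trace (matrix (frechet_derivative (field x) (at u))) / vol_density x u)"
      unfolding trace_matrix_eq
      by (intro continuous_intros C1_onD(2)[OF field_C1[OF x]] C1_on_continuous[OF vol_density_C1[OF x]])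
         (use vol_density_pos[OF x] in \<open>auto simp: less_imp_neq[symmetric]\<close>)
    then show "continuous_on V (\<lambda>u. dv (x u))"
    proof (rule continuous_on_eq)
      fix u assume u: "u \<in> V"
      show "trace (matrix (frechet_derivative (field x) (at u))) / vol_density x u = dv (x u)"
        using field_divergence[OF x u] vol_density_pos[OF x u] by simp
    qed
  qed
  show "continuous_on UNIV xn"
  proof (rule continuous_from_charts)
    fix V x assume x: "(V, x) \<in> \<A>"
    have "continuous_on V (\<lambda>u. case (u, newton_tr j (Amat x u) *v zc x u) of (u, v) \<Rightarrow> gn x u v)"
      by (rule continuous_on_compose2[OF continuous_gn[OF x]])
         (auto intro!: continuous_intros C1_on_continuous[OF Pz_C1[OF x]])
    then have "continuous_on V (\<lambda>u. wt (x u) * gn x u (newton_tr j (Amat x u) *v zc x u))"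
      by (intro continuous_intros C1_on_continuous[OF wt_C1[OF x]]) simp
    then show "continuous_on V (\<lambda>u. xn (x u))" by (rule continuous_on_eq) (rule xc[OF x])
  qed
  assume \<psi>: "C1_fun \<psi>"
  show "continuous_on UNIV (\<lambda>p. mdiff \<A> \<psi> p (vf p))"
  proof (rule continuous_from_charts)
    fix V x assume x: "(V, x) \<in> \<A>"
    have "continuous_on V (\<lambda>u. frechet_derivative (\<lambda>u. \<psi> (x u)) (at u) (newton_tr j (Amat x u) *v zc x u))"
      by (rule C1_on_derivative_continuous[OF C1_fun[OF \<psi> x] C1_on_continuous[OF Pz_C1[OF x]]])
    then show "continuous_on V (\<lambda>u. mdiff \<A> \<psi> (x u) (vf (x u)))"
      by (rule continuous_on_eq) (simp add: mdiff_C1_fun[OF \<psi> x] tr_vf[OF x])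
  qed
qed

definition height :: "real \<Rightarrow> 'p \<Rightarrow> real" where "height \<mu> p = max 0 (1 - dd q p / \<mu>)"

lemma continuous_height: "continuous_on UNIV (height \<mu>)"
  unfolding height_def[abs_def] divide_inverse by (intro continuous_intros dd_continuous)

definition div_mult :: "('p \<Rightarrow> real) \<Rightarrow> 'p \<Rightarrow> real" where
  "div_mult \<psi> p = \<psi> p * dv p + wt p * mdiff \<A> \<psi> p (vf p)"

lemma continuous_div_mult: "C1_fun \<psi> \<Longrightarrow> continuous_on UNIV (div_mult \<psi>)"
  unfolding div_mult_def[abs_def]
  by (intro continuous_intros continuous_coefficients continuous_mdiff C1_fun_continuous)

text \<open>In coordinates this is \<open>integral_lipschitz_mult_divergence\<close> for W equal to
  \<psi> times \<open>field\<close> and for the induced norm. The density inside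
  \<open>field\<close> turns Lebesgue integrals into volume integrals on both sides, and 1 / \<mu>
  is the Lipschitz constant of the height function.\<close>

lemma chart_estimate:
  assumes x: "(V, x) \<in> \<A>" and K: "compact K" "K \<subseteq> V" and \<mu>: "\<mu> > 0"
    and \<psi>: "C1_fun \<psi>" "\<And>p. \<psi> p \<ge> 0" "\<And>p. p \<notin> x ` K \<Longrightarrow> \<psi> p = 0"
  shows "integrable vol (\<lambda>p. height \<mu> p * div_mult \<psi> p)"
    "\<bar>\<integral>p. height \<mu> p * div_mult \<psi> p \<partial>vol\<bar> \<le> (1 / \<mu>) * (\<integral>p. \<psi> p * xn p \<partial>vol)"
proof -
  have Vo: "open V" using chart[OF x] by auto
  have Kc: "closed (x ` K)"
    by (intro compact_imp_closed compact_continuous_image K continuous_on_subset[OF chart(4)[OF x] K(2)])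
  have dm0: "height \<mu> p * div_mult \<psi> p = 0" if p: "p \<notin> x ` K" for p
    using mdiff_locally_const[of "- x ` K" p \<psi> 0 "vf p"] Kc p \<psi>(3) by (simp add: div_mult_def open_Compl)
  have inK: "\<psi> (x u) = 0" if "u \<in> V" "u \<notin> K" for u
    by (rule \<psi>(3)) (use that K(2) chart(6)[OF x] in \<open>metis imageE subset_iff\<close>)
  note I1 = chart_integral[OF x K continuous_on_mult[OF continuous_height continuous_div_mult[OF \<psi>(1)]] dm0]
  show "integrable vol (\<lambda>p. height \<mu> p * div_mult \<psi> p)" by (rule I1(1))
  have I1': "(\<integral>p. height \<mu> p * div_mult \<psi> p \<partial>vol) =
      (\<integral>u. indicator K u * (height \<mu> (x u) * div_mult \<psi> (x u) * vol_density x u) \<partial>lborel)" by (rule I1(2))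
  have I2: "(\<integral>p. \<psi> p * xn p \<partial>vol) = (\<integral>u. indicator K u * (\<psi> (x u) * xn (x u) * vol_density x u) \<partial>lborel)"
    by (rule chart_integral[OF x K continuous_on_mult[OF C1_fun_continuous[OF \<psi>(1)] continuous_coefficients(4)]])
       (simp add: \<psi>(3))
  define W where "W u = (if u \<in> V then \<psi> (x u) *\<^sub>R field x u else 0)" for u
  define n where "n u h = (if u \<in> V then gn x u h else 0)" for u h
  \<comment> \<open>\<psi> vanishes off K, so the zero extension is C1 on V and on the complement of
    K, which together cover the space.\<close>
  have CW: "C1_on UNIV W"
  proof -
    have 1: "C1_on V W"
      by (rule C1_on_cong[OF Vo _ C1_on_scaleR[OF C1_fun[OF \<psi>(1) x] field_C1[OF x]]]) (simp add: W_def)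
    have 2: "C1_on (- K) W"
      by (rule C1_on_cong[OF _ _ C1_on_const[of _ 0]]) (use K inK in \<open>auto simp: W_def compact_imp_closed open_Compl\<close>)
    have "V \<union> - K = UNIV" using K by auto
    then show ?thesis using C1_on_Un[OF Vo _ 1 2] K by (simp add: compact_imp_closed open_Compl)
  qed
  have nW: "n u (W u) = \<psi> (x u) * xn (x u) * vol_density x u" if u: "u \<in> V" for u
    using u \<psi>(2)[of "x u"] wt_pos[of "x u"] vol_density_pos[OF x u]
    by (simp add: n_def W_def field_def gn_scale[OF x u] xn_chart[OF x u, symmetric])
  have tr: "trace (matrix (frechet_derivative W (at u))) = div_mult \<psi> (x u) * vol_density x u" if u: "u \<in> V" for u
  proof -
    let ?D = "frechet_derivative (\<lambda>u. \<psi> (x u)) (at u)"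
    note dp = C1_onD(1)[OF C1_fun[OF \<psi>(1) x] u]
    have l: "linear ?D" using dp by (rule has_derivative_linear)
    have "((\<lambda>u. \<psi> (x u) *\<^sub>R field x u) has_derivative (\<lambda>h. \<psi> (x u) *\<^sub>R frechet_derivative (field x) (at u) h + ?D h *\<^sub>R field x u)) (at u)"
      by (rule has_derivative_scaleR[OF dp C1_onD(1)[OF field_C1[OF x] u]])
    then have "(W has_derivative (\<lambda>h. \<psi> (x u) *\<^sub>R frechet_derivative (field x) (at u) h + ?D h *\<^sub>R field x u)) (at u)"
      by (rule has_derivative_transform_within_open[OF _ Vo u]) (simp add: W_def)
    from frechet_derivative_at[OF this, symmetric]
    have "trace (matrix (frechet_derivative W (at u))) = \<psi> (x u) * (vol_density x u * dv (x u)) + ?D (field x u)"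
      by (simp only: trace_matrix_product_rule[OF l] field_divergence[OF x u])
    also have "?D (field x u) = wt (x u) * (vol_density x u * mdiff \<A> \<psi> (x u) (vf (x u)))"
      by (simp only: field_def linear_cmul[OF l]) (simp add: mdiff_C1_fun[OF \<psi>(1) x u] tr_vf[OF x u])
    finally show ?thesis by (simp add: div_mult_def algebra_simps)
  qed
  have "\<bar>\<integral>u. indicator K u * (height \<mu> (x u) * trace (matrix (frechet_derivative W (at u)))) \<partial>lborel\<bar>
      \<le> (1 / \<mu>) * (\<integral>u. indicator K u * n u (W u) \<partial>lborel)"
  proof (rule integral_lipschitz_mult_divergence[OF K(1)])
    show "W u = 0" if "u \<notin> K" for u using that inK by (auto simp: W_def)
    show "(W has_derivative frechet_derivative W (at u)) (at u)" for u by (rule C1_onD(1)[OF CW UNIV_I])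
    show "continuous_on UNIV (\<lambda>u. frechet_derivative W (at u) v)" for v by (rule C1_onD(2)[OF CW])
    show "continuous_on K (\<lambda>u. height \<mu> (x u))"
      by (rule continuous_on_compose2[OF continuous_height continuous_on_subset[OF chart(4)[OF x] K(2)]]) auto
    show "n u (s *\<^sub>R h) = s * n u h" if "s \<ge> 0" for u h s using that by (simp add: n_def gn_scale[OF x])
    show "n u h \<ge> 0" for u h by (simp add: n_def gn_nonneg[OF x])
    have "continuous_on K (\<lambda>u. \<psi> (x u) * xn (x u) * vol_density x u)"
      by (intro continuous_on_mult continuous_on_compose2[OF C1_fun_continuous[OF \<psi>(1)]]
          continuous_on_compose2[OF continuous_coefficients(4)] continuous_on_subset[OF chart(4)[OF x] K(2)]
          continuous_on_subset[OF C1_on_continuous[OF vol_density_C1[OF x]] K(2)]) auto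
    then show "continuous_on K (\<lambda>u. n u (W u))" by (rule continuous_on_eq) (use K nW in auto)
    show "0 \<le> 1 / \<mu>" using \<mu> by simp
    fix e :: real assume "e > 0"
    then obtain d where d: "d > 0" "\<And>u h. u \<in> K \<Longrightarrow> norm h < d \<Longrightarrow> u + h \<in> K \<Longrightarrow>
        \<bar>dd q (x (u + h)) - dd q (x u)\<bar> \<le> gn x u h + e * norm h"
      using dd_chart_lipschitz[OF x K(1,2)] by blast
    have "\<bar>height \<mu> (x (u + h)) - height \<mu> (x u)\<bar> \<le> 1 / \<mu> * (n u h + e * norm h)"
      if u: "u \<in> K" "norm h < d" "u + h \<in> K" for u h
    proof -
      have "\<bar>height \<mu> (x (u + h)) - height \<mu> (x u)\<bar> \<le> \<bar>dd q (x (u + h)) / \<mu> - dd q (x u) / \<mu>\<bar>"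
        by (auto simp: height_def max_def)
      also have "\<dots> = 1 / \<mu> * \<bar>dd q (x (u + h)) - dd q (x u)\<bar>"
        using \<mu> by (simp add: diff_divide_distrib[symmetric] abs_divide)
      also have "\<dots> \<le> 1 / \<mu> * (gn x u h + e * norm h)" using d(2)[OF u] \<mu> by (intro mult_left_mono) auto
      finally show ?thesis using u K by (auto simp: n_def)
    qed
    then show "\<exists>d>0. \<forall>u\<in>K. \<forall>h. norm h < d \<and> u + h \<in> K \<longrightarrow>
        \<bar>height \<mu> (x (u + h)) - height \<mu> (x u)\<bar> \<le> 1 / \<mu> * (n u h + e * norm h)" using d(1) by blast
  qed
  moreover have "indicator K u * (height \<mu> (x u) * trace (matrix (frechet_derivative W (at u))))
      = indicator K u * (height \<mu> (x u) * div_mult \<psi> (x u) * vol_density x u)" for u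
    using K(2) tr[of u] by (cases "u \<in> K") auto
  moreover have "indicator K u * n u (W u) = indicator K u * (\<psi> (x u) * xn (x u) * vol_density x u)" for u
    using K(2) nW[of u] by (cases "u \<in> K") auto
  ultimately show "\<bar>\<integral>p. height \<mu> p * div_mult \<psi> p \<partial>vol\<bar> \<le> (1 / \<mu>) * (\<integral>p. \<psi> p * xn p \<partial>vol)"
    unfolding I1' I2 by (simp only:)
qed

text \<open>The class of functions for which the divergence estimate holds is closed under sums, which replaces
  an explicit partition of unity.\<close>

definition estimated :: "real \<Rightarrow> 'p set \<Rightarrow> ('p \<Rightarrow> real) \<Rightarrow> bool" where
  "estimated \<mu> U \<psi> \<longleftrightarrow> C1_fun \<psi> \<and> (\<forall>p. 0 \<le> \<psi> p \<and> \<psi> p \<le> 1) \<and> (\<forall>p. p \<notin> U \<longrightarrow> \<psi> p = 0) \<and>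
    (\<forall>h. continuous_on UNIV h \<longrightarrow> integrable vol (\<lambda>p. \<psi> p * h p)) \<and>
    integrable vol (\<lambda>p. height \<mu> p * div_mult \<psi> p) \<and>
    \<bar>\<integral>p. height \<mu> p * div_mult \<psi> p \<partial>vol\<bar> \<le> (1 / \<mu>) * (\<integral>p. \<psi> p * xn p \<partial>vol)"

lemma estimated_0: "estimated \<mu> U (\<lambda>_. 0)"
  using mdiff_locally_const[of UNIV _ "\<lambda>_. 0" 0] by (simp add: estimated_def C1_fun_const div_mult_def)

text \<open>One minus the new function is (1 - \<Psi>) (1 - b), so values stay in [0, 1] and equal 1
  wherever \<Psi> or b does. The increment is supported in a single chart,
  \<open>chart_estimate\<close> applies to it, and the two bounds add.\<close>

lemma estimated_step:
  assumes \<mu>: "\<mu> > 0" and \<Psi>: "estimated \<mu> U \<Psi>" and x: "(V, x) \<in> \<A>" and K: "compact K" "K \<subseteq> V" "x ` K \<subseteq> U"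
    and b: "C1_fun b" "\<And>p. 0 \<le> b p" "\<And>p. b p \<le> 1" "\<And>p. p \<notin> x ` K \<Longrightarrow> b p = 0"
  shows "estimated \<mu> U (\<lambda>p. \<Psi> p + b p * (1 - \<Psi> p))"
proof -
  let ?\<psi> = "\<lambda>p. b p * (1 - \<Psi> p)"
  note G = \<Psi>[unfolded estimated_def]
  have CP: "C1_fun \<Psi>" and P: "\<And>p. 0 \<le> \<Psi> p" "\<And>p. \<Psi> p \<le> 1" "\<And>p. p \<notin> U \<Longrightarrow> \<Psi> p = 0"
    and IP: "\<And>h. continuous_on UNIV h \<Longrightarrow> integrable vol (\<lambda>p. \<Psi> p * h p)"
    and ID: "integrable vol (\<lambda>p. height \<mu> p * div_mult \<Psi> p)"
    and EP: "\<bar>\<integral>p. height \<mu> p * div_mult \<Psi> p \<partial>vol\<bar> \<le> (1 / \<mu>) * (\<integral>p. \<Psi> p * xn p \<partial>vol)" using G by auto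
  have C\<psi>: "C1_fun ?\<psi>" by (intro C1_fun_mult C1_fun_diff C1_fun_const b CP)
  have p\<psi>: "?\<psi> p \<ge> 0" for p using b(2) P(2) by simp
  have z\<psi>: "p \<notin> x ` K \<Longrightarrow> ?\<psi> p = 0" for p using b(4) by simp
  note E = chart_estimate[OF x K(1,2) \<mu> C\<psi> p\<psi> z\<psi>]
  have I: "integrable vol (\<lambda>p. ?\<psi> p * h p)" if "continuous_on UNIV h" for h
    by (rule chart_integral(1)[OF x K(1,2) continuous_on_mult[OF C1_fun_continuous[OF C\<psi>] that]]) (simp add: b(4))
  have s1: "height \<mu> p * div_mult (\<lambda>p. \<Psi> p + ?\<psi> p) p = height \<mu> p * div_mult \<Psi> p + height \<mu> p * div_mult ?\<psi> p" for p
    unfolding div_mult_def mdiff_add[OF CP C\<psi>] by (simp add: algebra_simps)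
  have s2: "(\<Psi> p + ?\<psi> p) * h p = \<Psi> p * h p + ?\<psi> p * h p" for h :: "'p \<Rightarrow> real" and p by (simp add: algebra_simps)
  have le1: "\<Psi> p + ?\<psi> p \<le> 1" for p
    using mult_right_mono[OF b(3)[of p], of "1 - \<Psi> p"] P(2)[of p] by simp
  have "\<bar>\<integral>p. height \<mu> p * div_mult (\<lambda>p. \<Psi> p + ?\<psi> p) p \<partial>vol\<bar>
      \<le> \<bar>\<integral>p. height \<mu> p * div_mult \<Psi> p \<partial>vol\<bar> + \<bar>\<integral>p. height \<mu> p * div_mult ?\<psi> p \<partial>vol\<bar>"
  proof -
    have "(\<integral>p. height \<mu> p * div_mult \<Psi> p + height \<mu> p * div_mult ?\<psi> p \<partial>vol)
        = (\<integral>p. height \<mu> p * div_mult \<Psi> p \<partial>vol) + (\<integral>p. height \<mu> p * div_mult ?\<psi> p \<partial>vol)"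
      by (rule Bochner_Integration.integral_add[OF ID E(1)])
    then show ?thesis unfolding s1 by (simp only: abs_triangle_ineq)
  qed
  also have "\<dots> \<le> (1 / \<mu>) * (\<integral>p. \<Psi> p * xn p \<partial>vol) + (1 / \<mu>) * (\<integral>p. ?\<psi> p * xn p \<partial>vol)"
    by (rule add_mono[OF EP E(2)])
  also have "\<dots> = (1 / \<mu>) * (\<integral>p. (\<Psi> p + ?\<psi> p) * xn p \<partial>vol)"
  proof -
    have "(\<integral>p. \<Psi> p * xn p + ?\<psi> p * xn p \<partial>vol) = (\<integral>p. \<Psi> p * xn p \<partial>vol) + (\<integral>p. ?\<psi> p * xn p \<partial>vol)"
      by (rule Bochner_Integration.integral_add[OF IP I, OF continuous_coefficients(4) continuous_coefficients(4)])
    then show ?thesis unfolding s2 by (simp only: distrib_left)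
  qed
  finally have "\<bar>\<integral>p. height \<mu> p * div_mult (\<lambda>p. \<Psi> p + ?\<psi> p) p \<partial>vol\<bar> \<le> (1 / \<mu>) * (\<integral>p. (\<Psi> p + ?\<psi> p) * xn p \<partial>vol)" .
  moreover have "integrable vol (\<lambda>p. height \<mu> p * div_mult (\<lambda>p. \<Psi> p + ?\<psi> p) p)"
    unfolding s1 by (rule Bochner_Integration.integrable_add[OF ID E(1)])
  moreover have "integrable vol (\<lambda>p. (\<Psi> p + ?\<psi> p) * h p)" if "continuous_on UNIV h" for h
    unfolding s2 by (rule Bochner_Integration.integrable_add[OF IP[OF that] I[OF that]])
  moreover have "\<Psi> p + ?\<psi> p = 0" if "p \<notin> U" for p using P(3)[OF that] b(4)[of p] K(3) that by auto
  moreover have "C1_fun (\<lambda>p. \<Psi> p + ?\<psi> p)" by (rule C1_fun_add[OF CP C\<psi>])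
  ultimately show ?thesis
    unfolding estimated_def using le1 P(1) p\<psi> by (auto intro: add_nonneg_nonneg)
qed

text \<open>Compactness raises the zero function to 1 in finitely many bump steps. The value 1 is
  attained on an open neighbourhood of K, so the derivative of \<Psi> vanishes at the points of
  K.\<close>

lemma estimated_cutoff:
  assumes \<mu>: "\<mu> > 0" and K: "compact K" "K \<subseteq> U" and U: "open U"
  obtains \<Psi> W where "estimated \<mu> U \<Psi>" "open W" "K \<subseteq> W" "\<And>p. p \<in> W \<Longrightarrow> \<Psi> p = 1"
proof -
  \<comment> \<open>A good set can be added to the region where an already constructed function
    equals 1, without losing any of that region.\<close>
  define good where "good B \<longleftrightarrow> open B \<and> (\<forall>\<Psi>. estimated \<mu> U \<Psi> \<longrightarrow> (\<exists>\<Phi>. estimated \<mu> U \<Phi> \<and> (\<forall>p\<in>B. \<Phi> p = 1) \<and> (\<forall>p. \<Psi> p = 1 \<longrightarrow> \<Phi> p = 1)))" for B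
  have "\<exists>B. good B \<and> p \<in> B" if p: "p \<in> K" for p
  proof -
    obtain b V x C B where b: "(V, x) \<in> \<A>" "compact C" "C \<subseteq> V" "x ` C \<subseteq> U" "C1_fun b"
      "\<And>p. 0 \<le> b p" "\<And>p. b p \<le> 1" "\<And>p. p \<notin> x ` C \<Longrightarrow> b p = 0" "open B" "p \<in> B" "\<And>p. p \<in> B \<Longrightarrow> b p = 1"
      by (rule bump[OF U subsetD[OF K(2) p]]) blast
    have "\<exists>\<Phi>. estimated \<mu> U \<Phi> \<and> (\<forall>p\<in>B. \<Phi> p = 1) \<and> (\<forall>p. \<Psi> p = 1 \<longrightarrow> \<Phi> p = 1)" if \<Psi>: "estimated \<mu> U \<Psi>" for \<Psi>
      by (rule exI[of _ "\<lambda>p. \<Psi> p + b p * (1 - \<Psi> p)"])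
         (use estimated_step[OF \<mu> \<Psi> b(1-8)] b(11) in simp)
    then show ?thesis using b(9,10) unfolding good_def by blast
  qed
  then obtain B where B: "\<And>p. p \<in> K \<Longrightarrow> good (B p)" "\<And>p. p \<in> K \<Longrightarrow> p \<in> B p" by metis
  obtain D where D: "D \<subseteq> K" "finite D" "K \<subseteq> (\<Union>p\<in>D. B p)"
    by (rule compactE_image[OF K(1), of K B]) (use B in \<open>auto simp: good_def\<close>)
  have "\<exists>\<Phi>. estimated \<mu> U \<Phi> \<and> (\<forall>p\<in>(\<Union>p\<in>D. B p). \<Phi> p = 1)"
    using D(2,1)
  proof (induction D rule: finite_induct)
    case empty
    then show ?case using estimated_0 by auto
  next
    case (insert r D)
    then obtain \<Psi> where \<Psi>: "estimated \<mu> U \<Psi>" "\<forall>p\<in>(\<Union>p\<in>D. B p). \<Psi> p = 1" by auto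
    have "good (B r)" using B(1) insert.prems by auto
    then obtain \<Phi> where "estimated \<mu> U \<Phi>" "\<forall>p\<in>B r. \<Phi> p = 1" "\<forall>p. \<Psi> p = 1 \<longrightarrow> \<Phi> p = 1"
      unfolding good_def using \<Psi>(1) by blast
    then show ?case using \<Psi>(2) by (intro exI[of _ \<Phi>]) auto
  qed
  then obtain \<Phi> where \<Phi>: "estimated \<mu> U \<Phi>" "\<forall>p\<in>(\<Union>p\<in>D. B p). \<Phi> p = 1" by blast
  have "open (\<Union>p\<in>D. B p)" using B(1) D(1) by (intro open_UN) (auto simp: good_def)
  then show ?thesis by (rule that[OF \<Phi>(1) _ D(3)]) (use \<Phi>(2) in blast)
qed

end

section \<open>The lower bound near q and linear growth\<close>

context measured_field
begin

lemma chart_integral_pos: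
  assumes x: "(V, x) \<in> \<A>" and K: "compact K" "K \<subseteq> V" and h: "continuous_on UNIV h" "\<And>p. p \<notin> x ` K \<Longrightarrow> h p = (0::real)"
    and pos: "\<And>p. h p \<ge> 0" "h p > 0"
  shows "(\<integral>p. h p \<partial>vol) > 0"
proof -
  have "p \<in> x ` K" using pos(2) h(2)[of p] by (cases "p \<in> x ` K") auto
  then obtain u where u: "u \<in> K" "p = x u" by blast
  have Vo: "open V" using chart[OF x] by auto
  define g where "g u = h (x u) * vol_density x u" for u
  have gK: "g w = indicator K w * g w" if "w \<in> V" for w
  proof (cases "w \<in> K")
    case False
    have "h (x w) = 0" by (rule h(2)) (use that False K(2) chart(6)[OF x] in \<open>metis imageE subset_iff\<close>)
    then show ?thesis by (simp add: g_def)
  qed simp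
  have gc: "continuous_on V g"
    unfolding g_def[abs_def]
    by (intro continuous_intros continuous_on_compose2[OF h(1)] chart(4)[OF x] C1_on_continuous[OF vol_density_C1[OF x]]) auto
  have g0: "g w \<ge> 0" if "w \<in> V" for w
    using pos(1)[of "x w"] vol_density_pos[OF x that] by (simp add: g_def)
  have gu: "g u > 0" using pos(2) u K vol_density_pos[OF x, of u] by (auto simp: g_def)
  have "open (V \<inter> g -` {g u / 2 <..})" by (rule continuous_open_preimage[OF gc Vo]) simp
  moreover have "u \<in> V \<inter> g -` {g u / 2 <..}" using u K gu by auto
  ultimately obtain r where r: "r > 0" "ball u r \<subseteq> V \<inter> g -` {g u / 2 <..}" by (metis open_contains_ball)
  note I = integral_compact_lborel(1)[OF K(1) continuous_on_subset[OF gc K(2)]]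
  have fin: "emeasure lborel (ball u r) < \<infinity>" by (rule emeasure_lborel_ball_finite)
  have i: "integrable lborel (\<lambda>w. indicator (ball u r) w * (g u / 2))"
    using fin by (intro integrable_mult_left integrable_real_indicator) auto
  have "0 < measure lborel (ball u r) * (g u / 2)"
    using content_ball_pos[OF r(1), of u] gu by simp
  also have "\<dots> = (\<integral>w. indicator (ball u r) w * (g u / 2) \<partial>lborel)" by simp
  also have "\<dots> \<le> (\<integral>w. indicator K w * g w \<partial>lborel)"
  proof (rule integral_mono[OF i I])
    fix w
    show "indicator (ball u r) w * (g u / 2) \<le> indicator K w * g w"
    proof (cases "w \<in> ball u r")
      case True
      then have "w \<in> V" "g u / 2 < g w" using r(2) by auto
      then show ?thesis unfolding gK[OF \<open>w \<in> V\<close>, symmetric] using True by simp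
    next
      case False
      then show ?thesis using g0[of w] K(2) by (auto simp: indicator_def)
    qed
  qed
  also have "\<dots> = (\<integral>p. h p \<partial>vol)" using chart_integral(2)[OF x K h] unfolding g_def by (rule sym)
  finally show ?thesis .
qed

text \<open>\<sigma> times the divergence is nonnegative, so keeping only a fixed neighbourhood of q
  decreases its integral against the height function to a positive number independent of the radius.
  From above the integral is at most 1 / \<mu> times a multiple of the integral of |S_j| over the
  support of the cutoff.\<close>

theorem linear_growth:
  assumes complete: "dd.mcomplete" and j: "1 \<le> j" "j \<le> CARD('m) - 1"
    and s: "\<And>p. \<sigma> * elem_sym j (shape_operator c \<A> f N p) \<ge> 0" "\<bar>\<sigma>\<bar> = 1"
    and q: "elem_sym j (shape_operator c \<A> f N q) \<noteq> 0"
  obtains k where "k > 0"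
    "\<And>\<nu>. \<nu> \<ge> 2 \<Longrightarrow> ennreal (k * \<nu>) \<le> (\<integral>\<^sup>+p\<in>{p. dd q p < \<nu>}. ennreal \<bar>elem_sym j (shape_operator c \<A> f N p)\<bar> \<partial>vol)"
proof -
  let ?S = "\<lambda>p. elem_sym j (shape_operator c \<A> f N p)"
  define a where "a = real CARD('m) - real j"
  have a: "a > 0" using j by (simp add: a_def)
  have trP: "trP p = a * ?S p" for p by (simp add: trP_def trace_newton_elem_sym a_def)
  have sS: "\<sigma> * ?S p = \<bar>?S p\<bar>" for p using s(1)[of p] s(2) by (cases "\<sigma> \<ge> 0") (auto simp: abs_if split: if_splits)
  have st: "\<sigma> * trP p = a * \<bar>?S p\<bar>" for p using sS[of p] by (simp add: trP mult.left_commute)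
  note ne = newton_estimates[OF j(1) s]
  define H where "H p = wt p * lam p - kap p * lorentz (tau p) (tau p)" for p
  have H: "H p > 0" for p unfolding H_def by (rule hessian_pos)
  have sdv: "\<sigma> * dv p \<ge> H p * (a * \<bar>?S p\<bar>)" for p using ne(2)[of p] by (simp add: H_def st)
  have sdv0: "\<sigma> * dv p \<ge> 0" for p
    by (rule order_trans[OF _ sdv]) (use H[of p] a in simp)
  have cS: "continuous_on UNIV (\<lambda>p. \<bar>?S p\<bar>)"
  proof -
    have "continuous_on UNIV (\<lambda>p. \<bar>trP p / a\<bar>)" using a by (intro continuous_intros continuous_coefficients) auto
    then show ?thesis using a by (simp add: trP)
  qed
  obtain b V x K where x: "(V, x) \<in> \<A>" and K: "compact K" "K \<subseteq> V"
    and b: "C1_fun b" "\<And>p. 0 \<le> b p" "\<And>p. b p \<le> 1" "\<And>p. p \<notin> x ` K \<Longrightarrow> b p = 0" "b q = 1"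
    by (rule bump[OF open_UNIV UNIV_I, of q]) metis
  \<comment> \<open>A lower bound for \<sigma> times the integrand that is independent of \<mu>:
    \<open>height 1\<close> lies below \<open>height \<mu>\<close> for \<mu> \<ge> 1, and the bump
    confines everything to one chart.\<close>
  define \<omega> where "\<omega> p = b p * (height 1 p * (\<sigma> * dv p))" for p
  have c\<omega>: "continuous_on UNIV \<omega>"
    unfolding \<omega>_def[abs_def] by (intro continuous_intros C1_fun_continuous[OF b(1)] continuous_height continuous_coefficients)
  have z\<omega>: "p \<notin> x ` K \<Longrightarrow> \<omega> p = 0" for p by (simp add: \<omega>_def b(4))
  have p\<omega>: "\<omega> p \<ge> 0" for p unfolding \<omega>_def by (intro mult_nonneg_nonneg[OF b(2)] mult_nonneg_nonneg[OF _ sdv0]) (simp add: height_def)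
  have q\<omega>: "\<omega> q > 0"
  proof -
    have "0 < H q * (a * \<bar>?S q\<bar>)" using H[of q] a q by simp
    then have "\<sigma> * dv q > 0" using sdv[of q] by linarith
    moreover have "dd q q = 0" using dd.mdist_zero by simp
    ultimately show ?thesis by (simp add: \<omega>_def b(5) height_def)
  qed
  note I\<omega> = chart_integral(1)[OF x K c\<omega> z\<omega>]
  define c0' where "c0' = (\<integral>p. \<omega> p \<partial>vol)"
  have c0': "c0' > 0" unfolding c0'_def by (rule chart_integral_pos[OF x K c\<omega> z\<omega> p\<omega> q\<omega>])
  \<comment> \<open>From the gradient bound sqrt (1 - c) and the trace (m - j) S_j of P_j.\<close>
  define g where "g = sqrt (1 - c) * a"
  have g: "g > 0" using c0 a by (simp add: g_def)
  show ?thesis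
  proof (rule that[of "c0' / (2 * g)"])
    show "c0' / (2 * g) > 0" using c0' g by simp
    fix \<nu> :: real assume \<nu>: "\<nu> \<ge> 2"
    \<comment> \<open>The height function lives on the closed ball of radius \<mu>, and the cutoff
      needs room around it, taken to be the ball of radius \<nu> = 2 \<mu>. This is the 2 in the
      constant, and \<nu> \<ge> 2 ensures \<mu> \<ge> 1.\<close>
    define \<mu> where "\<mu> = \<nu> / 2"
    have \<mu>: "\<mu> \<ge> 1" "\<nu> = 2 * \<mu>" using \<nu> by (simp_all add: \<mu>_def)
    have sub: "{p. dd q p \<le> \<mu>} \<subseteq> {p. dd q p < \<nu>}" using \<mu> by auto
    have \<mu>0: "\<mu> > 0" using \<mu> by simp
    obtain \<Psi> W where \<Psi>: "estimated \<mu> {p. dd q p < \<nu>} \<Psi>" and W: "open W" "{p. dd q p \<le> \<mu>} \<subseteq> W" "\<And>p. p \<in> W \<Longrightarrow> \<Psi> p = 1"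
      by (rule estimated_cutoff[OF \<mu>0 closed_ball_compact[OF complete] sub dd_open]) blast
    have P: "\<And>p. 0 \<le> \<Psi> p" "\<And>p. \<Psi> p \<le> 1" "\<And>p. p \<notin> {p. dd q p < \<nu>} \<Longrightarrow> \<Psi> p = 0"
      and IP: "\<And>h. continuous_on UNIV h \<Longrightarrow> integrable vol (\<lambda>p. \<Psi> p * h p)"
      and ID: "integrable vol (\<lambda>p. height \<mu> p * div_mult \<Psi> p)"
      and E: "\<bar>\<integral>p. height \<mu> p * div_mult \<Psi> p \<partial>vol\<bar> \<le> (1 / \<mu>) * (\<integral>p. \<Psi> p * xn p \<partial>vol)"
      using \<Psi> unfolding estimated_def by auto
    \<comment> \<open>On the closed ball \<Psi> is 1 near p and contributes no derivative; outside
      it both height functions vanish, because \<mu> \<ge> 1.\<close>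
    have hd: "\<sigma> * (height \<mu> p * div_mult \<Psi> p) \<ge> \<omega> p" for p
    proof (cases "dd q p \<le> \<mu>")
      case True
      then have pW: "p \<in> W" using W(2) by auto
      then have "div_mult \<Psi> p = dv p"
        using mdiff_locally_const[OF W(1) pW, of \<Psi> 1 "vf p"] W(3) by (simp add: div_mult_def)
      moreover have "b p * (height 1 p * (\<sigma> * dv p)) \<le> 1 * (height \<mu> p * (\<sigma> * dv p))"
      proof (rule mult_mono[OF b(3) mult_right_mono[OF _ sdv0]])
        have "dd q p / \<mu> \<le> dd q p / 1" using \<mu> dd_nonneg[of q p] by (intro divide_left_mono) auto
        then show "height 1 p \<le> height \<mu> p" by (simp add: height_def max_def)
        show "0 \<le> height 1 p * (\<sigma> * dv p)" by (rule mult_nonneg_nonneg[OF _ sdv0]) (simp add: height_def)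
      qed simp
      ultimately show ?thesis by (simp add: \<omega>_def mult.left_commute)
    next
      case False
      then have "height \<mu> p = 0" "height 1 p = 0" using \<mu> \<mu>0 by (simp_all add: height_def)
      then show ?thesis by (simp add: \<omega>_def)
    qed
    have "c0' \<le> (\<integral>p. \<sigma> * (height \<mu> p * div_mult \<Psi> p) \<partial>vol)"
      unfolding c0'_def using ID by (intro integral_mono I\<omega> hd) auto
    also have "\<dots> = \<sigma> * (\<integral>p. height \<mu> p * div_mult \<Psi> p \<partial>vol)" by simp
    also have "\<dots> \<le> \<bar>\<sigma> * (\<integral>p. height \<mu> p * div_mult \<Psi> p \<partial>vol)\<bar>" by (rule abs_ge_self)
    also have "\<dots> \<le> (1 / \<mu>) * (\<integral>p. \<Psi> p * xn p \<partial>vol)" using E by (simp add: abs_mult s(2))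
    also have "\<dots> \<le> (1 / \<mu>) * (\<integral>p. g * (\<Psi> p * \<bar>?S p\<bar>) \<partial>vol)"
    proof (rule mult_left_mono[OF integral_mono])
      show "integrable vol (\<lambda>p. \<Psi> p * xn p)" by (rule IP[OF continuous_coefficients(4)])
      show "integrable vol (\<lambda>p. g * (\<Psi> p * \<bar>?S p\<bar>))" by (intro integrable_mult_right IP[OF cS])
      fix p
      have "\<Psi> p * xn p \<le> \<Psi> p * (sqrt (1 - c) * (a * \<bar>?S p\<bar>))"
        by (rule mult_left_mono) (use ne(3)[of p] P(1) st in simp_all)
      then show "\<Psi> p * xn p \<le> g * (\<Psi> p * \<bar>?S p\<bar>)" by (simp add: g_def algebra_simps)
    qed (use \<mu>0 in simp)
    also have "\<dots> = g * (\<integral>p. \<Psi> p * \<bar>?S p\<bar> \<partial>vol) / \<mu>" by simp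
    finally have "c0' / (2 * g) * \<nu> \<le> (\<integral>p. \<Psi> p * \<bar>?S p\<bar> \<partial>vol)" using g \<mu>0 \<mu>(2) by (simp add: field_simps)
    then have "ennreal (c0' / (2 * g) * \<nu>) \<le> ennreal (\<integral>p. \<Psi> p * \<bar>?S p\<bar> \<partial>vol)" by (rule ennreal_leI)
    also have "\<dots> = (\<integral>\<^sup>+p. ennreal (\<Psi> p * \<bar>?S p\<bar>) \<partial>vol)"
      by (rule nn_integral_eq_integral[symmetric]) (use IP[OF cS] P(1) in auto)
    also have "\<dots> \<le> (\<integral>\<^sup>+p\<in>{p. dd q p < \<nu>}. ennreal \<bar>?S p\<bar> \<partial>vol)"
    proof (rule nn_integral_mono)
      fix p
      show "ennreal (\<Psi> p * \<bar>?S p\<bar>) \<le> ennreal \<bar>?S p\<bar> * indicator {p. dd q p < \<nu>} p"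
        using P(3)[of p] mult_right_mono[OF P(2)[of p], of "\<bar>?S p\<bar>"]
        by (cases "dd q p < \<nu>") (auto intro: ennreal_leI)
    qed
    finally show "ennreal (c0' / (2 * g) * \<nu>) \<le> (\<integral>\<^sup>+p\<in>{p. dd q p < \<nu>}. ennreal \<bar>?S p\<bar> \<partial>vol)" .
  qed
qed

end

theorem theorem1p4:
  fixes \<A> :: "('m::finite, 'p::{t2_space, second_countable_topology}) param set"
    and f N :: "'p \<Rightarrow> (real^'n::finite) \<times> real"
    and vol :: "'p measure"
    and c :: real
    and j :: nat
  assumes "c \<le> 0"
    and "smooth_atlas \<A>"
    and "connected (UNIV :: 'p set)"
    and "oriented_hypersurface c \<A> f N"
    and "Metric_space.mcomplete UNIV (riemannian_dist \<A> f)"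
    and "\<not> compact (UNIV :: 'p set)"
    and "is_riemannian_measure \<A> f vol"
    and "1 \<le> j" and "j \<le> CARD('m) - 1"
    and "\<forall>p. elem_sym (j + 1) (shape_operator c \<A> f N p) = 0"
    and "(\<forall>p. elem_sym j (shape_operator c \<A> f N p) \<ge> 0) \<or>
         (\<forall>p. elem_sym j (shape_operator c \<A> f N p) \<le> 0)"
  shows "\<forall>q. dim (range (shape_operator c \<A> f N q)) \<le> j - 1 \<or>
    Liminf at_top (\<lambda>\<mu>::real.
      (\<integral>\<^sup>+p\<in>geodesic_ball \<A> f q \<mu>. ennreal \<bar>elem_sym j (shape_operator c \<A> f N p)\<bar> \<partial>vol) / ennreal \<mu>) > 0"
proof
  fix q
  let ?S = "\<lambda>p. elem_sym j (shape_operator c \<A> f N p)"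
  let ?V = "\<lambda>\<mu>::real. \<integral>\<^sup>+p\<in>geodesic_ball \<A> f q \<mu>. ennreal \<bar>?S p\<bar> \<partial>vol"
  interpret measured_field c \<A> f N q j vol
    by unfold_locales (use assms in simp_all)
  obtain \<sigma> :: real where s: "\<bar>\<sigma>\<bar> = 1" "\<And>p. \<sigma> * ?S p \<ge> 0"
  proof (cases "\<forall>p. ?S p \<ge> 0")
    case True
    then show ?thesis by (intro that[of 1]) auto
  next
    case False
    then show ?thesis using assms(11) by (intro that[of "-1"]) auto
  qed
  show "dim (range (shape_operator c \<A> f N q)) \<le> j - 1 \<or> Liminf at_top (\<lambda>\<mu>. ?V \<mu> / ennreal \<mu>) > 0"
  \<comment> \<open>Two consecutive vanishing symmetric functions at q force the rank bound; a
    nonzero S_j at q supplies the positive integral that drives the growth.\<close>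
  proof (cases "?S q = 0")
    case True
    then show ?thesis using rank_bound[of j q] assms(8) Sj1[of q] by simp
  next
    case False
    obtain k where k: "k > 0" "\<And>\<nu>. \<nu> \<ge> 2 \<Longrightarrow> ennreal (k * \<nu>) \<le> (\<integral>\<^sup>+p\<in>{p. dd q p < \<nu>}. ennreal \<bar>?S p\<bar> \<partial>vol)"
      by (rule linear_growth[OF assms(5,8,9) s(2,1) False]) blast
    have ball: "geodesic_ball \<A> f q \<nu> = {p. dd q p < \<nu>}" for \<nu> by (auto simp: dd.in_mball)
    have "ennreal k \<le> ?V \<nu> / ennreal \<nu>" if \<nu>: "\<nu> \<ge> 2" for \<nu>
    proof -
      have "ennreal k = ennreal (k * \<nu>) / ennreal \<nu>" using k(1) \<nu> by (simp add: divide_ennreal)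
      also have "\<dots> \<le> ?V \<nu> / ennreal \<nu>" unfolding ball by (intro divide_right_mono_ennreal k(2) \<nu>)
      finally show ?thesis .
    qed
    then have "\<forall>\<^sub>F \<nu> in at_top. ennreal k \<le> ?V \<nu> / ennreal \<nu>"
      by (intro eventually_at_top_linorderI[of 2])
    then have "ennreal k \<le> Liminf at_top (\<lambda>\<mu>. ?V \<mu> / ennreal \<mu>)" by (rule Liminf_bounded)
    moreover have "0 < ennreal k" using k(1) by simp
    ultimately show ?thesis by (meson less_le_trans)
  qed
qed

end
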